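(* Let $p$ be a prime number and let $H=R\# A$ be a biproduct, where $A$ is a non-cocommutative semisimple Hopf algebra of dimension $p^3$ over $k$ and $R$ is a semisimple braided Hopf algebra in ${}^A_A\mathcal{YD}$. Suppose that $V\subseteq R$ is an irreducible $p$-dimensional left coideal of $H$ such that $\sum_{g\in G(A)}g.V$ generates $R$ as an algebra. Then $H$ contains a Hopf subalgebra of index $p$.
   Context: $k$ is an algebraically closed field of characteristic zero. ${}^A_A\mathcal{YD}$ is the braided category of (left-left) Yetter–Drinfeld modules over $A$: vector spaces with an $A$-action $.$ and an $A$-coaction $\rho(r)=r_{-1}\otimes r_0$ satisfying $\rho(h.r)=h_1r_{-1}\mathcal S(h_3)\otimes h_2.r_0$. For a braided Hopf algebra $R$ in this category, with comultiplication $\Delta_R(a)=a^1\otimes a^2$, the (Radford–Majid) biproduct $R\#A$ is the Hopf algebra on $R\otimes A$ with $(a\#g)(b\#h)=a(g_1.b)\#g_2h$ and $\Delta(a\#g)=a^1\#(a^2)_{-1}g_1\otimes(a^2)_0\#g_2$. With $\pi:R\#A\to A$, $\pi(r\#a)=\epsilon_R(r)a$, the algebra $R$ is identified with the left coideal subalgebra $H^{\mathrm{co}\,\pi}=\{h\in H:(\mathrm{id}\otimes\pi)\Delta(h)=h\otimes1\}$ of $H$, so it makes sense to speak of left coideals of $H$ contained in $R$; irreducible means irreducible as a left $H$-comodule. $G(A)$ is the group of group-like elements of $A$, and $g.V$ refers to the action of $A$ on $R$. The index of a Hopf subalgebra $K\subseteq H$ is $\dim H/\dim K$. *)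

theory Defs
  imports "HOL-Computational_Algebra.Computational_Algebra" "HOL-Library.Function_Algebras"
begin

section \<open>Tensor products of vector spaces\<close>

text \<open>
  A vector space is a type of class \<open>ab_group_add\<close> together with a scalar multiplication, as in
  the locale \<open>vector_space\<close>.  The functions \<open>'x \<Rightarrow> 'k\<close> form a vector space under the pointwise
  operations.
\<close>

definition fscale :: "'k::field \<Rightarrow> ('x \<Rightarrow> 'k) \<Rightarrow> ('x \<Rightarrow> 'k)" where
  "fscale c f = (\<lambda>x. c * f x)"

definition bilinear_map ::
  "('k::field \<Rightarrow> 'v::ab_group_add \<Rightarrow> 'v) \<Rightarrow> ('k \<Rightarrow> 'w::ab_group_add \<Rightarrow> 'w) \<Rightarrow>
   ('k \<Rightarrow> 'x::ab_group_add \<Rightarrow> 'x) \<Rightarrow> ('v \<Rightarrow> 'w \<Rightarrow> 'x) \<Rightarrow> bool" where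
  "bilinear_map s t u f \<longleftrightarrow>
     (\<forall>w. Vector_Spaces.linear s u (\<lambda>v. f v w)) \<and> (\<forall>v. Vector_Spaces.linear t u (f v))"

text \<open>
  A type cannot depend on a scalar multiplication, so the tensor product of \<open>V\<close> and \<open>W\<close> is realised
  inside the fixed vector space of all functions from \<open>'v \<Rightarrow> 'w \<Rightarrow> 'k\<close> to \<open>'k\<close>: the pure tensor of
  \<open>v\<close> and \<open>w\<close> is evaluation of bilinear forms at \<open>(v, w)\<close> (with the junk value \<open>0\<close> on arguments
  that are not bilinear), and the tensor product is the span of the pure tensors.  Over a field this
  is the usual tensor product; its universal property is proved below.
\<close>

type_synonym ('k, 'v, 'w) tensor = "('v \<Rightarrow> 'w \<Rightarrow> 'k) \<Rightarrow> 'k"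

definition tens ::
  "'v::ab_group_add \<Rightarrow> ('k::field \<Rightarrow> 'v \<Rightarrow> 'v) \<Rightarrow> ('k \<Rightarrow> 'w::ab_group_add \<Rightarrow> 'w) \<Rightarrow> 'w \<Rightarrow>
   ('k, 'v, 'w) tensor"  (\<open>_ \<otimes>[_,_] _\<close> [76, 0, 0, 75] 75) where
  "v \<otimes>[s,t] w = (\<lambda>\<beta>. if bilinear_map s t (*) \<beta> then \<beta> v w else 0)"

text \<open>For subspaces \<open>V\<close> and \<open>W\<close> this is the subspace \<open>V \<otimes> W\<close> of the full tensor product.\<close>

definition tensor_sub ::
  "('k::field \<Rightarrow> 'v::ab_group_add \<Rightarrow> 'v) \<Rightarrow> ('k \<Rightarrow> 'w::ab_group_add \<Rightarrow> 'w) \<Rightarrow> 'v set \<Rightarrow> 'w set \<Rightarrow>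
   ('k, 'v, 'w) tensor set" where
  "tensor_sub s t V W = module.span fscale {v \<otimes>[s,t] w | v w. v \<in> V \<and> w \<in> W}"

abbreviation tensor_space ::
  "('k::field \<Rightarrow> 'v::ab_group_add \<Rightarrow> 'v) \<Rightarrow> ('k \<Rightarrow> 'w::ab_group_add \<Rightarrow> 'w) \<Rightarrow>
   ('k, 'v, 'w) tensor set" where
  "tensor_space s t \<equiv> tensor_sub s t UNIV UNIV"

text \<open>
  Sweedler notation: if \<open>t = \<Sum>\<^sub>i v\<^sub>i \<otimes> w\<^sub>i\<close> then \<open>sweedler sV sW t f\<close> is \<open>\<Sum>\<^sub>i f v\<^sub>i w\<^sub>i\<close>,
  which for bilinear \<open>f\<close> does not depend on the representation (lemma \<open>sweedler_sum_list\<close>).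
  So \<open>sweedler s s (\<Delta> h) (\<lambda>h1 h2. F h1 h2)\<close> is what is usually written \<open>F(h\<^sub>1, h\<^sub>2)\<close>.
\<close>

definition sweedler ::
  "('k::field \<Rightarrow> 'v::ab_group_add \<Rightarrow> 'v) \<Rightarrow> ('k \<Rightarrow> 'w::ab_group_add \<Rightarrow> 'w) \<Rightarrow>
   ('k, 'v, 'w) tensor \<Rightarrow> ('v \<Rightarrow> 'w \<Rightarrow> 'x::ab_group_add) \<Rightarrow> 'x" where
  "sweedler sV sW t f =
     (THE y. \<exists>xs. t = (\<Sum>(v, w)\<leftarrow>xs. v \<otimes>[sV,sW] w) \<and> y = (\<Sum>(v, w)\<leftarrow>xs. f v w))"

lemma vector_space_fscale: "vector_space fscale"
  by unfold_locales (auto simp: fscale_def fun_eq_iff algebra_simps)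

lemma bilinear_map_tens:
  assumes "vector_space s" "vector_space t"
  shows "bilinear_map s t fscale (\<lambda>v w. v \<otimes>[s,t] w)"
  using assms vector_space_fscale
  by (auto simp: bilinear_map_def Vector_Spaces.linear_iff tens_def fscale_def fun_eq_iff)

lemma functionals_separate:
  assumes "vector_space u" and "\<And>g. Vector_Spaces.linear u (*) g \<Longrightarrow> g x = g y"
  shows "x = y"
proof -
  interpret vector_space u by fact
  obtain B where B: "independent B" "UNIV \<subseteq> span B"
    by (rule maximal_independent_subset[of UNIV])
  then have span: "span B = UNIV" by (simp add: top.extremum_unique)
  have "representation B x = representation B y"
    by (rule ext) (rule assms(2)[OF linear_representation[OF B(1) span]])
  moreover have "(\<Sum>b | representation B v b \<noteq> 0. u (representation B v b) b) = v" for v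
    by (rule sum_nonzero_representation_eq[OF B(1)]) (simp add: span)
  ultimately show ?thesis by metis
qed

lemma sum_list_tens_apply:
  "bilinear_map s t (*) \<beta> \<Longrightarrow> (\<Sum>(v, w)\<leftarrow>xs. v \<otimes>[s,t] w) \<beta> = (\<Sum>(v, w)\<leftarrow>xs. \<beta> v w)"
  by (induction xs) (auto simp: tens_def)

lemma sweedler_sum_list:
  assumes f: "bilinear_map sV sW sX f"
  shows "sweedler sV sW (\<Sum>(v, w)\<leftarrow>xs. v \<otimes>[sV,sW] w) f = (\<Sum>(v, w)\<leftarrow>xs. f v w)"
proof -
  have X: "vector_space sX"
    using f by (auto simp: bilinear_map_def Vector_Spaces.linear_iff)
  have eq: "(\<Sum>(v, w)\<leftarrow>xs. f v w) = (\<Sum>(v, w)\<leftarrow>ys. f v w)"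
    if e: "(\<Sum>(v, w)\<leftarrow>xs. v \<otimes>[sV,sW] w) = (\<Sum>(v, w)\<leftarrow>ys. v \<otimes>[sV,sW] w)" for ys
  proof (rule functionals_separate[OF X])
    fix g assume g: "Vector_Spaces.linear sX (*) g"
    have b: "bilinear_map sV sW (*) (\<lambda>v w. g (f v w))"
      using f g by (auto simp: bilinear_map_def Vector_Spaces.linear_iff)
    have g0: "g 0 = 0" and ga: "g (x + y) = g x + g y" for x y
      using g module_hom.zero[OF module_hom_linearI[OF g]] by (auto simp: Vector_Spaces.linear_iff)
    have "g (\<Sum>(v, w)\<leftarrow>zs. f v w) = (\<Sum>(v, w)\<leftarrow>zs. v \<otimes>[sV,sW] w) (\<lambda>v w. g (f v w))" for zs
      unfolding sum_list_tens_apply[OF b] by (induction zs) (auto simp: g0 ga)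
    then show "g (\<Sum>(v, w)\<leftarrow>xs. f v w) = g (\<Sum>(v, w)\<leftarrow>ys. f v w)"
      using e by simp
  qed
  show ?thesis unfolding sweedler_def
  proof (rule the_equality)
    fix y
    assume "\<exists>ys. (\<Sum>(v, w)\<leftarrow>xs. v \<otimes>[sV,sW] w) = (\<Sum>(v, w)\<leftarrow>ys. v \<otimes>[sV,sW] w) \<and>
                 y = (\<Sum>(v, w)\<leftarrow>ys. f v w)"
    then obtain ys where xs: "(\<Sum>(v, w)\<leftarrow>xs. v \<otimes>[sV,sW] w) = (\<Sum>(v, w)\<leftarrow>ys. v \<otimes>[sV,sW] w)"
      and y: "y = (\<Sum>(v, w)\<leftarrow>ys. f v w)" by blast
    show "y = (\<Sum>(v, w)\<leftarrow>xs. f v w)" unfolding y eq[OF xs] ..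
  qed blast
qed

lemma tensor_space_sum_list:
  fixes s :: "'k::field \<Rightarrow> 'v::ab_group_add \<Rightarrow> 'v" and t :: "'k \<Rightarrow> 'w::ab_group_add \<Rightarrow> 'w"
  assumes "vector_space s" "vector_space t" and z: "z \<in> tensor_space s t"
  obtains xs where "z = (\<Sum>(v, w)\<leftarrow>xs. v \<otimes>[s,t] w)"
proof -
  interpret F: vector_space "fscale :: 'k \<Rightarrow> ('k, 'v, 'w) tensor \<Rightarrow> _" by (rule vector_space_fscale)
  have "\<exists>xs. z = (\<Sum>(v, w)\<leftarrow>xs. v \<otimes>[s,t] w)"
    using z unfolding tensor_sub_def
  proof (induction rule: F.span_induct_alt)
    case base
    show ?case by (intro exI[of _ "[]"]) simp
  next
    case (step c x y)
    then obtain v w xs where *: "x = v \<otimes>[s,t] w" "y = (\<Sum>(v, w)\<leftarrow>xs. v \<otimes>[s,t] w)" by auto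
    have "fscale c x = s c v \<otimes>[s,t] w"
      using bilinear_map_tens[OF assms(1,2)] *(1)
      by (auto simp: bilinear_map_def Vector_Spaces.linear_iff)
    then show ?case using *(2) by (intro exI[of _ "(s c v, w) # xs"]) auto
  qed
  then show ?thesis using that by blast
qed

theorem tensor_universal_property:
  assumes f: "bilinear_map sV sW sX f"
  shows "sweedler sV sW (v \<otimes>[sV,sW] w) f = f v w"
    and "z \<in> tensor_space sV sW \<Longrightarrow> z' \<in> tensor_space sV sW \<Longrightarrow>
           sweedler sV sW (z + z') f = sweedler sV sW z f + sweedler sV sW z' f"
    and "z \<in> tensor_space sV sW \<Longrightarrow>
           sweedler sV sW (fscale c z) f = sX c (sweedler sV sW z f)"
proof -
  have V: "vector_space sV" and W: "vector_space sW" and X: "vector_space sX"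
    using f by (auto simp: bilinear_map_def Vector_Spaces.linear_iff)
  note rep = tensor_space_sum_list[OF V W] and sw = sweedler_sum_list[OF f]
  interpret X: vector_space sX by (rule X)
  show "sweedler sV sW (v \<otimes>[sV,sW] w) f = f v w"
    using sw[of "[(v, w)]"] by simp
  show "sweedler sV sW (z + z') f = sweedler sV sW z f + sweedler sV sW z' f"
    if z: "z \<in> tensor_space sV sW" and z': "z' \<in> tensor_space sV sW"
  proof -
    obtain xs where x: "z = (\<Sum>(v, w)\<leftarrow>xs. v \<otimes>[sV,sW] w)" by (rule rep[OF z])
    obtain ys where y: "z' = (\<Sum>(v, w)\<leftarrow>ys. v \<otimes>[sV,sW] w)" by (rule rep[OF z'])
    show ?thesis using sw[of "xs @ ys"] sw[of xs] sw[of ys] unfolding x y by simp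
  qed
  show "sweedler sV sW (fscale c z) f = sX c (sweedler sV sW z f)"
    if z: "z \<in> tensor_space sV sW"
  proof -
    obtain xs where *: "z = (\<Sum>(v, w)\<leftarrow>xs. v \<otimes>[sV,sW] w)" by (rule rep[OF z])
    have t: "fscale c (x \<otimes>[sV,sW] y) = sV c x \<otimes>[sV,sW] y" for x y
      using bilinear_map_tens[OF V W] by (auto simp: bilinear_map_def Vector_Spaces.linear_iff)
    have g: "f (sV c x) y = sX c (f x y)" for x y
      using f by (auto simp: bilinear_map_def Vector_Spaces.linear_iff)
    have t': "c * (x \<otimes>[sV,sW] y) \<beta> = (sV c x \<otimes>[sV,sW] y) \<beta>" for x y \<beta>
      using fun_cong[OF t, of x y \<beta>] by (simp add: fscale_def)
    have "fscale c z \<beta> = (\<Sum>(v, w)\<leftarrow>map (\<lambda>(v, w). (sV c v, w)) xs. v \<otimes>[sV,sW] w) \<beta>" for \<beta>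
      unfolding * by (induction xs) (auto simp: fscale_def distrib_left t')
    then have 1: "fscale c z = (\<Sum>(v, w)\<leftarrow>map (\<lambda>(v, w). (sV c v, w)) xs. v \<otimes>[sV,sW] w)"
      by (rule ext)
    have 2: "(\<Sum>(v, w)\<leftarrow>map (\<lambda>(v, w). (sV c v, w)) xs. f v w) = sX c (\<Sum>(v, w)\<leftarrow>xs. f v w)"
      by (induction xs) (auto simp: X.scale_right_distrib g)
    show ?thesis unfolding 1 sw 2 unfolding * sw ..
  qed
qed


section \<open>Algebras, coalgebras and Hopf algebras\<close>

text \<open>
  The underlying ring of an algebra is given by the class \<open>ring_1\<close>.  Its axiom \<open>0 \<noteq> 1\<close> is no
  restriction here: it follows from \<open>\<epsilon> 1 = 1\<close>.
\<close>

locale k_algebra = vector_space s for s :: "'k::field \<Rightarrow> 'a::ring_1 \<Rightarrow> 'a" +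
  assumes scale_mult_left: "s c x * y = s c (x * y)"
    and scale_mult_right: "x * s c y = s c (x * y)"

locale k_coalgebra = vector_space s for s :: "'k::field \<Rightarrow> 'c::ab_group_add \<Rightarrow> 'c" +
  fixes \<Delta> :: "'c \<Rightarrow> ('k, 'c, 'c) tensor" and \<epsilon> :: "'c \<Rightarrow> 'k"
  assumes comult_linear: "Vector_Spaces.linear s fscale \<Delta>"
    and comult_in: "\<Delta> x \<in> tensor_space s s"
    and counit_linear: "Vector_Spaces.linear s (*) \<epsilon>"
    and coassoc:
      "sweedler s s (\<Delta> x) (\<lambda>x1 x2. sweedler s s (\<Delta> x1) (\<lambda>y z. y \<otimes>[s,fscale] (z \<otimes>[s,s] x2))) =
       sweedler s s (\<Delta> x) (\<lambda>x1 x2. x1 \<otimes>[s,fscale] \<Delta> x2)"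
    and counit_left: "sweedler s s (\<Delta> x) (\<lambda>x1 x2. s (\<epsilon> x1) x2) = x"
    and counit_right: "sweedler s s (\<Delta> x) (\<lambda>x1 x2. s (\<epsilon> x2) x1) = x"

locale hopf_algebra = k_algebra s + k_coalgebra s \<Delta> \<epsilon>
  for s :: "'k::field \<Rightarrow> 'h::ring_1 \<Rightarrow> 'h" and \<Delta> \<epsilon> +
  fixes S :: "'h \<Rightarrow> 'h"
  assumes comult_mult:
      "\<Delta> (x * y) = sweedler s s (\<Delta> x) (\<lambda>x1 x2.
                     sweedler s s (\<Delta> y) (\<lambda>y1 y2. (x1 * y1) \<otimes>[s,s] (x2 * y2)))"
    and comult_one: "\<Delta> 1 = 1 \<otimes>[s,s] 1"
    and counit_mult: "\<epsilon> (x * y) = \<epsilon> x * \<epsilon> y"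
    and counit_one: "\<epsilon> 1 = 1"
    and antipode_linear: "Vector_Spaces.linear s s S"
    and antipode_left: "sweedler s s (\<Delta> x) (\<lambda>x1 x2. S x1 * x2) = s (\<epsilon> x) 1"
    and antipode_right: "sweedler s s (\<Delta> x) (\<lambda>x1 x2. x1 * S x2) = s (\<epsilon> x) 1"

definition cocommutative ::
  "('k::field \<Rightarrow> 'c::ab_group_add \<Rightarrow> 'c) \<Rightarrow> ('c \<Rightarrow> ('k, 'c, 'c) tensor) \<Rightarrow> bool" where
  "cocommutative s \<Delta> \<longleftrightarrow> (\<forall>x. sweedler s s (\<Delta> x) (\<lambda>x1 x2. x2 \<otimes>[s,s] x1) = \<Delta> x)"

definition group_likes ::
  "('k::field \<Rightarrow> 'c::ab_group_add \<Rightarrow> 'c) \<Rightarrow> ('c \<Rightarrow> ('k, 'c, 'c) tensor) \<Rightarrow> 'c set" where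
  "group_likes s \<Delta> = {g. g \<noteq> 0 \<and> \<Delta> g = g \<otimes>[s,s] g}"

definition left_ideal :: "('k::field \<Rightarrow> 'a::ring_1 \<Rightarrow> 'a) \<Rightarrow> 'a set \<Rightarrow> bool" where
  "left_ideal s I \<longleftrightarrow> module.subspace s I \<and> (\<forall>a. \<forall>x\<in>I. a * x \<in> I)"

definition simple_left_ideal :: "('k::field \<Rightarrow> 'a::ring_1 \<Rightarrow> 'a) \<Rightarrow> 'a set \<Rightarrow> bool" where
  "simple_left_ideal s I \<longleftrightarrow>
     left_ideal s I \<and> I \<noteq> {0} \<and> (\<forall>J. left_ideal s J \<and> J \<subseteq> I \<longrightarrow> J = {0} \<or> J = I)"

text \<open>The left regular module is the sum of its simple submodules.\<close>

definition semisimple_algebra :: "('k::field \<Rightarrow> 'a::ring_1 \<Rightarrow> 'a) \<Rightarrow> bool" where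
  "semisimple_algebra s \<longleftrightarrow> module.span s (\<Union>{I. simple_left_ideal s I}) = UNIV"

definition subalgebra :: "('k::field \<Rightarrow> 'a::ring_1 \<Rightarrow> 'a) \<Rightarrow> 'a set \<Rightarrow> bool" where
  "subalgebra s B \<longleftrightarrow> module.subspace s B \<and> 1 \<in> B \<and> (\<forall>x\<in>B. \<forall>y\<in>B. x * y \<in> B)"

definition generates_algebra :: "('k::field \<Rightarrow> 'a::ring_1 \<Rightarrow> 'a) \<Rightarrow> 'a set \<Rightarrow> bool" where
  "generates_algebra s X \<longleftrightarrow> subalgebra s hull X = UNIV"

definition hopf_subalgebra ::
  "('k::field \<Rightarrow> 'h::ring_1 \<Rightarrow> 'h) \<Rightarrow> ('h \<Rightarrow> ('k, 'h, 'h) tensor) \<Rightarrow> ('h \<Rightarrow> 'h) \<Rightarrow> 'h set \<Rightarrow> bool"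
  where
  "hopf_subalgebra s \<Delta> S K \<longleftrightarrow>
     subalgebra s K \<and> (\<forall>x\<in>K. \<Delta> x \<in> tensor_sub s s K K) \<and> (\<forall>x\<in>K. S x \<in> K)"

text \<open>
  Since \<open>dim\<close> is \<open>0\<close> in the infinite-dimensional case and \<open>x / 0 = 0\<close>, a nonzero index entails that
  both dimensions are finite and positive.
\<close>

definition hopf_index :: "('k::field \<Rightarrow> 'h::ring_1 \<Rightarrow> 'h) \<Rightarrow> 'h set \<Rightarrow> rat" where
  "hopf_index s K = of_nat (vector_space.dim s UNIV) / of_nat (vector_space.dim s K)"

definition left_coideal ::
  "('k::field \<Rightarrow> 'c::ab_group_add \<Rightarrow> 'c) \<Rightarrow> ('c \<Rightarrow> ('k, 'c, 'c) tensor) \<Rightarrow> 'c set \<Rightarrow> bool" where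
  "left_coideal s \<Delta> V \<longleftrightarrow> module.subspace s V \<and> (\<forall>x\<in>V. \<Delta> x \<in> tensor_sub s s UNIV V)"

text \<open>
  The subcomodules of a left coideal \<open>V\<close>, with coaction the restriction of \<open>\<Delta>\<close>, are the left
  coideals contained in \<open>V\<close>.
\<close>

definition irreducible_left_coideal ::
  "('k::field \<Rightarrow> 'c::ab_group_add \<Rightarrow> 'c) \<Rightarrow> ('c \<Rightarrow> ('k, 'c, 'c) tensor) \<Rightarrow> 'c set \<Rightarrow> bool" where
  "irreducible_left_coideal s \<Delta> V \<longleftrightarrow>
     left_coideal s \<Delta> V \<and> V \<noteq> {0} \<and> (\<forall>W. left_coideal s \<Delta> W \<and> W \<subseteq> V \<longrightarrow> W = {0} \<or> W = V)"


section \<open>Yetter--Drinfeld modules, braided Hopf algebras and biproducts\<close>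

locale yetter_drinfeld_module =
  A: hopf_algebra sA \<Delta>A \<epsilon>A SA + R: vector_space sR
  for sA :: "'k::field \<Rightarrow> 'a::ring_1 \<Rightarrow> 'a" and \<Delta>A \<epsilon>A SA
    and sR :: "'k \<Rightarrow> 'r::ab_group_add \<Rightarrow> 'r" +
  fixes act :: "'a \<Rightarrow> 'r \<Rightarrow> 'r" (infixr \<open>\<cdot>\<close> 80)
    and \<rho> :: "'r \<Rightarrow> ('k, 'a, 'r) tensor"
  assumes act_bilinear: "bilinear_map sA sR sR act"
    and act_one: "1 \<cdot> r = r"
    and act_mult: "(g * h) \<cdot> r = g \<cdot> (h \<cdot> r)"
    and coact_linear: "Vector_Spaces.linear sR fscale \<rho>"
    and coact_in: "\<rho> r \<in> tensor_space sA sR"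
    and coact_coassoc:
      "sweedler sA sR (\<rho> r) (\<lambda>m n. sweedler sA sA (\<Delta>A m)
         (\<lambda>m1 m2. m1 \<otimes>[sA,fscale] (m2 \<otimes>[sA,sR] n))) =
       sweedler sA sR (\<rho> r) (\<lambda>m n. m \<otimes>[sA,fscale] \<rho> n)"
    and coact_counit: "sweedler sA sR (\<rho> r) (\<lambda>m n. sR (\<epsilon>A m) n) = r"
    and coact_act:
      "\<rho> (h \<cdot> r) = sweedler sA sA (\<Delta>A h) (\<lambda>h1 h'. sweedler sA sA (\<Delta>A h') (\<lambda>h2 h3.
         sweedler sA sR (\<rho> r) (\<lambda>m n. (h1 * m * SA h3) \<otimes>[sA,sR] (h2 \<cdot> n))))"

text \<open>
  A Hopf algebra in the category of Yetter--Drinfeld modules: unit, multiplication, counit,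
  comultiplication and antipode are \<open>A\<close>-linear and \<open>A\<close>-colinear, and the comultiplication is
  multiplicative with respect to the braiding \<open>x \<otimes> y \<mapsto> x\<^sub>-\<^sub>1 \<cdot> y \<otimes> x\<^sub>0\<close>.
\<close>

locale braided_hopf_algebra =
  yetter_drinfeld_module sA \<Delta>A \<epsilon>A SA sR act \<rho> + R: k_algebra sR + R: k_coalgebra sR \<Delta>R \<epsilon>R
  for sA :: "'k::field \<Rightarrow> 'a::ring_1 \<Rightarrow> 'a" and \<Delta>A \<epsilon>A SA
    and sR :: "'k \<Rightarrow> 'r::ring_1 \<Rightarrow> 'r" and act (infixr \<open>\<cdot>\<close> 80) and \<rho> \<Delta>R \<epsilon>R +
  fixes SR :: "'r \<Rightarrow> 'r"
  assumes act_mult_distrib: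
      "h \<cdot> (x * y) = sweedler sA sA (\<Delta>A h) (\<lambda>h1 h2. (h1 \<cdot> x) * (h2 \<cdot> y))"
    and act_unit: "h \<cdot> 1 = sR (\<epsilon>A h) 1"
    and coact_mult:
      "\<rho> (x * y) = sweedler sA sR (\<rho> x) (\<lambda>m x0.
         sweedler sA sR (\<rho> y) (\<lambda>n y0. (m * n) \<otimes>[sA,sR] (x0 * y0)))"
    and coact_unit: "\<rho> 1 = 1 \<otimes>[sA,sR] 1"
    and comult_act:
      "\<Delta>R (h \<cdot> x) = sweedler sA sA (\<Delta>A h) (\<lambda>h1 h2.
         sweedler sR sR (\<Delta>R x) (\<lambda>x1 x2. (h1 \<cdot> x1) \<otimes>[sR,sR] (h2 \<cdot> x2)))"
    and counit_act: "\<epsilon>R (h \<cdot> x) = \<epsilon>A h * \<epsilon>R x"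
    and comult_coact:
      "sweedler sA sR (\<rho> x) (\<lambda>m x0. m \<otimes>[sA,fscale] \<Delta>R x0) =
       sweedler sR sR (\<Delta>R x) (\<lambda>x1 x2. sweedler sA sR (\<rho> x1) (\<lambda>m y.
         sweedler sA sR (\<rho> x2) (\<lambda>n z. (m * n) \<otimes>[sA,fscale] (y \<otimes>[sR,sR] z))))"
    and counit_coact: "sweedler sA sR (\<rho> x) (\<lambda>m x0. sA (\<epsilon>R x0) m) = sA (\<epsilon>R x) 1"
    and comult_braided_mult:
      "\<Delta>R (x * y) = sweedler sR sR (\<Delta>R x) (\<lambda>x1 x2. sweedler sR sR (\<Delta>R y) (\<lambda>y1 y2.
         sweedler sA sR (\<rho> x2) (\<lambda>m z. (x1 * (m \<cdot> y1)) \<otimes>[sR,sR] (z * y2))))"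
    and comult_unit: "\<Delta>R 1 = 1 \<otimes>[sR,sR] 1"
    and counit_mult: "\<epsilon>R (x * y) = \<epsilon>R x * \<epsilon>R y"
    and counit_unit: "\<epsilon>R 1 = 1"
    and antipode_linear: "Vector_Spaces.linear sR sR SR"
    and antipode_left: "sweedler sR sR (\<Delta>R x) (\<lambda>x1 x2. SR x1 * x2) = sR (\<epsilon>R x) 1"
    and antipode_right: "sweedler sR sR (\<Delta>R x) (\<lambda>x1 x2. x1 * SR x2) = sR (\<epsilon>R x) 1"
    and antipode_act: "SR (h \<cdot> x) = h \<cdot> SR x"
    and antipode_coact: "\<rho> (SR x) = sweedler sA sR (\<rho> x) (\<lambda>m x0. m \<otimes>[sA,sR] SR x0)"

text \<open>
  The biproduct is a Hopf algebra structure on the vector space \<open>R \<otimes> A\<close>.  As the concrete tensor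
  product is not a whole type, \<open>H\<close> is any vector space with a bilinear map \<open>\<sharp>\<close> that induces a
  bijection from \<open>R \<otimes> A\<close> onto \<open>H\<close>.  The algebra \<open>R\<close> is identified with its image under
  \<open>r \<mapsto> r \<sharp> 1\<close>.
\<close>

locale biproduct =
  braided_hopf_algebra sA \<Delta>A \<epsilon>A SA sR act \<rho> \<Delta>R \<epsilon>R SR + H: hopf_algebra sH \<Delta>H \<epsilon>H SH
  for sA :: "'k::field \<Rightarrow> 'a::ring_1 \<Rightarrow> 'a" and \<Delta>A \<epsilon>A SA
    and sR :: "'k \<Rightarrow> 'r::ring_1 \<Rightarrow> 'r" and act (infixr \<open>\<cdot>\<close> 80) and \<rho> \<Delta>R \<epsilon>R SR
    and sH :: "'k \<Rightarrow> 'h::ring_1 \<Rightarrow> 'h" and \<Delta>H \<epsilon>H SH +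
  fixes smash :: "'r \<Rightarrow> 'a \<Rightarrow> 'h" (infix \<open>\<sharp>\<close> 70)
  assumes smash_bilinear: "bilinear_map sR sA sH smash"
    and smash_bij: "bij_betw (\<lambda>t. sweedler sR sA t smash) (tensor_space sR sA) UNIV"
    and smash_mult:
      "(a \<sharp> g) * (b \<sharp> h) = sweedler sA sA (\<Delta>A g) (\<lambda>g1 g2. (a * (g1 \<cdot> b)) \<sharp> (g2 * h))"
    and smash_one: "1 = 1 \<sharp> 1"
    and smash_comult:
      "\<Delta>H (a \<sharp> g) = sweedler sR sR (\<Delta>R a) (\<lambda>a1 a2. sweedler sA sA (\<Delta>A g) (\<lambda>g1 g2.
         sweedler sA sR (\<rho> a2) (\<lambda>m n. (a1 \<sharp> (m * g1)) \<otimes>[sH,sH] (n \<sharp> g2))))"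
    and smash_counit: "\<epsilon>H (a \<sharp> g) = \<epsilon>R a * \<epsilon>A g"

end

theory Submission
  imports Defs
begin

text \<open>
  The antipode of \<open>A\<close> is an involution (Larson--Radford), so \<open>A\<close> has a basis of matrix coefficients
  with the usual orthogonality relations for the Haar functional, and \<open>n / dim (A e)\<close> is an integer
  for every primitive idempotent \<open>e\<close> of the character ring.  On a Hopf subalgebra of dimension
  \<open>p\<^sup>a\<close>, counting dimensions modulo powers of \<open>p\<close> yields a nontrivial such \<open>e\<close> spanning a
  one-dimensional left ideal, that is, a nontrivial grading of the fusion ring by roots of unity, whose
  components all have the same dimension.  If \<open>A\<close> is not cocommutative of dimension \<open>p\<^sup>3\<close>, it
  follows that the trivial component is the group algebra of \<open>G(A)\<close>, of order \<open>p\<^sup>2\<close>, and that every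
  other simple subcoalgebra consists of \<open>p \<times> p\<close> matrix coefficients.

  If such a matrix coalgebra occurred in the coaction on \<open>V\<close>, its rows would give \<open>p\<close> independent
  vectors in the kernel of the counit on \<open>V\<close>, which has dimension \<open>p - 1\<close>.  So the coaction maps \<open>V\<close>
  to \<open>k G(A) \<otimes> V\<close>.  The elements of \<open>R\<close> on which \<open>A\<close> coacts through \<open>k G(A)\<close> form a
  \<open>G(A)\<close>-stable subalgebra, hence are all of \<open>R\<close>, and \<open>R # k G(A)\<close> is a Hopf subalgebra of
  index \<open>p\<close>.  Finiteness of the dimensions holds because integrals of \<open>R\<close> and \<open>A\<close> combine to an integral
  of \<open>H\<close> with counit \<open>1\<close>, which makes \<open>H\<close> a separable algebra.
\<close>

section \<open>Traces\<close>

text \<open>The field is an arbitrary algebraically closed field of characteristic zero, so no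
  complex conjugation makes traces positive; that the trace of the squared antipode is nonzero is
  obtained by moving one sum of roots of unity to the complex numbers. Integrality of
  \<open>n / dim (A e)\<close> rests on a Casimir element: the sum of \<open>chi H\<close> tensor
  \<open>S (chi H)\<close> acts on \<open>e\<close> tensor \<open>e\<close> by the scalar
  \<open>1 / haar e\<close>, while its matrix in the basis of pairs of characters has integer
  entries. The count works because the dimensions of the ideals are powers of \<open>p\<close> with
  sum \<open>p ^ k\<close>, and the one belonging to the Haar integral has too few factors
  \<open>p\<close> to be strictly the smallest. A one-dimensional ideal spanned by a class function
  gives an algebra map that is scalar on every simple subcoalgebra, and these scalars are the
  grading. Hopf subalgebras never become types of their own: they are spans of the coefficients in a
  closed set of classes, and traces on such subspaces are taken with dual systems.\<close>

locale vspace = vector_space scale for scale :: "'a::field \<Rightarrow> 'b::ab_group_add \<Rightarrow> 'b"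
begin

definition functional :: "('b \<Rightarrow> 'a) \<Rightarrow> bool" where
  "functional f \<longleftrightarrow> (\<forall>x y. f (x + y) = f x + f y) \<and> (\<forall>c x. f (scale c x) = c * f x)"

definition operator :: "('b \<Rightarrow> 'b) \<Rightarrow> bool" where
  "operator F \<longleftrightarrow> (\<forall>x y. F (x + y) = F x + F y) \<and> (\<forall>c x. F (scale c x) = scale c (F x))"

lemma functional_iff: "functional f \<longleftrightarrow> Vector_Spaces.linear scale (*) f"
  unfolding functional_def Vector_Spaces.linear_iff using vector_space_assms
  by (auto simp: vector_space_def algebra_simps)

lemma operator_iff: "operator F \<longleftrightarrow> Vector_Spaces.linear scale scale F"
  unfolding operator_def Vector_Spaces.linear_iff using vector_space_axioms by auto

lemma functional_add: "functional f \<Longrightarrow> f (x + y) = f x + f y"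
  and functional_scale: "functional f \<Longrightarrow> f (scale c x) = c * f x"
  and functional_0: "functional f \<Longrightarrow> f 0 = 0"
  and operator_add: "operator F \<Longrightarrow> F (x + y) = F x + F y"
  and operator_scale: "operator F \<Longrightarrow> F (scale c x) = scale c (F x)"
  and operator_0: "operator F \<Longrightarrow> F 0 = 0"
proof -
  show "functional f \<Longrightarrow> f 0 = 0"
    unfolding functional_def by (metis add_cancel_right_right)
  show "operator F \<Longrightarrow> F 0 = 0"
    unfolding operator_def by (metis add_cancel_right_right)
qed (auto simp: functional_def operator_def)

lemma functional_sum: "functional f \<Longrightarrow> f (sum g A) = (\<Sum>x\<in>A. f (g x))"
  by (induction A rule: infinite_finite_induct) (auto simp: functional_add functional_0)

lemma operator_sum: "operator F \<Longrightarrow> F (sum g A) = (\<Sum>x\<in>A. F (g x))"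
  by (induction A rule: infinite_finite_induct) (auto simp: operator_add operator_0)

lemma functional_diff: "functional f \<Longrightarrow> f (x - y) = f x - f y"
  by (metis functional_add add_diff_cancel diff_add_cancel)

lemma operator_diff: "operator F \<Longrightarrow> F (x - y) = F x - F y"
  by (metis operator_add add_diff_cancel diff_add_cancel)

lemma operator_comp: "operator F \<Longrightarrow> operator G \<Longrightarrow> operator (F \<circ> G)"
  by (auto simp: operator_def)

lemma functional_comp: "functional f \<Longrightarrow> operator G \<Longrightarrow> functional (\<lambda>x. f (G x))"
  by (auto simp: functional_def operator_def)

lemma subspace_image_operator: "operator F \<Longrightarrow> subspace W \<Longrightarrow> subspace (F ` W)"
  using module_hom.subspace_image[OF module_hom_linearI] operator_iff by blast

lemma functional_separate: "(\<And>f. functional f \<Longrightarrow> f x = f y) \<Longrightarrow> x = y"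
  using functionals_separate[OF vector_space_axioms, of x y] functional_iff by blast

text \<open>A dual system generalises a finite basis together with its dual basis; it computes
  traces on \<open>W\<close> without linear independence.\<close>

definition dual_system :: "'b set \<Rightarrow> 'i set \<Rightarrow> ('i \<Rightarrow> 'b \<Rightarrow> 'a) \<Rightarrow> ('i \<Rightarrow> 'b) \<Rightarrow> bool" where
  "dual_system W X \<phi> a \<longleftrightarrow> finite X \<and> (\<forall>i\<in>X. functional (\<phi> i) \<and> a i \<in> W) \<and>
     (\<forall>x\<in>W. x = (\<Sum>i\<in>X. scale (\<phi> i x) (a i)))"

definition dtrace :: "'i set \<Rightarrow> ('i \<Rightarrow> 'b \<Rightarrow> 'a) \<Rightarrow> ('i \<Rightarrow> 'b) \<Rightarrow> ('b \<Rightarrow> 'b) \<Rightarrow> 'a" where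
  "dtrace X \<phi> a F = (\<Sum>i\<in>X. \<phi> i (F (a i)))"

text \<open>Expanding \<open>F (a i)\<close> in the second system and contracting the first at
  \<open>b j\<close> turns one sum into the other; \<open>W' \<subseteq> W\<close> is what allows
  the contraction at \<open>b j\<close>. With \<open>W' = W\<close> the trace does not depend on the
  system, with \<open>W'\<close> the image of \<open>F\<close> it may be computed there.\<close>

lemma dtrace_eq_dtrace:
  assumes 1: "dual_system W X \<phi> a" and 2: "dual_system W' Y \<psi> b"
    and F: "operator F" "F ` W \<subseteq> W'" and W: "W' \<subseteq> W"
  shows "dtrace X \<phi> a F = dtrace Y \<psi> b F"
proof -
  note d1 = 1[unfolded dual_system_def] and d2 = 2[unfolded dual_system_def]
  have "dtrace X \<phi> a F = (\<Sum>i\<in>X. \<phi> i (\<Sum>j\<in>Y. scale (\<psi> j (F (a i))) (b j)))"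
    unfolding dtrace_def
  proof (rule sum.cong[OF refl])
    fix i assume "i \<in> X"
    then have "F (a i) \<in> W'" using d1 F(2) by blast
    then show "\<phi> i (F (a i)) = \<phi> i (\<Sum>j\<in>Y. scale (\<psi> j (F (a i))) (b j))"
      using d2 by metis
  qed
  also have "\<dots> = (\<Sum>i\<in>X. \<Sum>j\<in>Y. \<psi> j (F (a i)) * \<phi> i (b j))"
    using d1 by (intro sum.cong refl) (simp add: functional_sum functional_scale)
  also have "\<dots> = (\<Sum>j\<in>Y. \<Sum>i\<in>X. \<psi> j (F (a i)) * \<phi> i (b j))"
    by (rule sum.swap)
  also have "\<dots> = (\<Sum>j\<in>Y. \<psi> j (F (\<Sum>i\<in>X. scale (\<phi> i (b j)) (a i))))"
    using d2 F(1)
    by (intro sum.cong refl)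
       (simp add: functional_sum functional_scale operator_sum operator_scale mult.commute)
  also have "\<dots> = dtrace Y \<psi> b F"
    unfolding dtrace_def
  proof (rule sum.cong[OF refl])
    fix j assume "j \<in> Y"
    then have "b j \<in> W" using d2 W by blast
    then show "\<psi> j (F (\<Sum>i\<in>X. scale (\<phi> i (b j)) (a i))) = \<psi> j (F (b j))"
      using d1 by metis
  qed
  finally show ?thesis .
qed

text \<open>Coordinates are taken in a basis extending \<open>C\<close>, because
  \<open>representation C\<close> vanishes outside \<open>span C\<close> and so is not linear on the
  whole space.\<close>

lemma dual_system_basis:
  assumes C: "independent C" "finite C"
  shows "dual_system (span C) C (\<lambda>c x. representation (extend_basis C) x c) (\<lambda>c. c)"
    and "c \<in> C \<Longrightarrow> c' \<in> C \<Longrightarrow>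
           representation (extend_basis C) c c' = (if c = c' then 1 else 0)"
proof -
  let ?E = "extend_basis C"
  have E: "independent ?E" "span ?E = UNIV" "C \<subseteq> ?E"
    using independent_extend_basis[OF C(1)] span_extend_basis[OF C(1)] extend_basis_superset[OF C(1)]
    by auto
  have r: "representation ?E c c' = (if c = c' then 1 else 0)" if "c \<in> C" for c c'
    using representation_basis[OF E(1), of c] that E(3) by auto
  then show "c \<in> C \<Longrightarrow> c' \<in> C \<Longrightarrow> representation ?E c c' = (if c = c' then 1 else 0)" .
  have f: "functional (\<lambda>x. representation ?E x c)" for c
    using linear_representation[OF E(1,2)] by (simp add: functional_iff)
  have "x = (\<Sum>c\<in>C. scale (representation ?E x c) c)" if "x \<in> span C" for x
  proof -
    obtain u where x: "x = (\<Sum>c\<in>C. scale (u c) c)"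
      using \<open>x \<in> span C\<close> span_finite[OF C(2)] by auto
    have "representation ?E x c' = u c'" if c': "c' \<in> C" for c'
    proof -
      have "representation ?E x c' = (\<Sum>c\<in>C. u c * (if c = c' then 1 else 0))"
        unfolding x by (simp add: functional_sum[OF f] functional_scale[OF f] r)
      also have "\<dots> = (\<Sum>c\<in>C. if c = c' then u c else 0)"
        by (intro sum.cong) auto
      finally show ?thesis using C(2) c' by simp
    qed
    then show ?thesis by (subst x) simp
  qed
  then show "dual_system (span C) C (\<lambda>c x. representation ?E x c) (\<lambda>c. c)"
    using C(2) f span_base by (auto simp: dual_system_def)
qed

lemma subspace_basis:
  assumes "subspace W" "W \<subseteq> span S" "finite S"
  obtains C where "independent C" "finite C" "span C = W" "card C = dim W"
proof -
  obtain C where C: "C \<subseteq> W" "independent C" "W \<subseteq> span C" "card C = dim W"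
    using basis_exists[of W] by blast
  have "finite C"
    using independent_span_bound[OF assms(3) C(2)] C(1) assms(2) by auto
  moreover have "span C = W"
    using C(1,3) assms(1) span_minimal by (intro equalityI) auto
  ultimately show ?thesis using C(2,4) that by simp
qed

lemma dual_system_subspace_span:
  "dual_system W X \<phi> a \<Longrightarrow> W \<subseteq> span (a ` X)"
proof
  fix x assume 1: "dual_system W X \<phi> a" and "x \<in> W"
  then have "x = (\<Sum>i\<in>X. scale (\<phi> i x) (a i))" by (simp add: dual_system_def)
  also have "\<dots> \<in> span (a ` X)" by (intro span_sum span_scale span_base) auto
  finally show "x \<in> span (a ` X)" .
qed

text \<open>\<open>P\<close> is the identity on its image, so every vector of a basis of the image
  contributes \<open>1\<close>.\<close>

lemma dtrace_idempotent:
  assumes W: "subspace W" and 1: "dual_system W X \<phi> a"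
    and P: "operator P" "P ` W \<subseteq> W" "\<And>x. x \<in> W \<Longrightarrow> P (P x) = P x"
  shows "dtrace X \<phi> a P = of_nat (dim (P ` W))"
proof -
  have "finite (a ` X)" "P ` W \<subseteq> span (a ` X)"
    using 1 P(2) dual_system_subspace_span[OF 1] by (auto simp: dual_system_def)
  from this(2,1) obtain C
    where C: "independent C" "finite C" "span C = P ` W" "card C = dim (P ` W)"
    by (rule subspace_basis[OF subspace_image_operator[OF P(1) W]])
  note s = dual_system_basis[OF C(1,2)]
  have "dtrace X \<phi> a P = dtrace C (\<lambda>c x. representation (extend_basis C) x c) (\<lambda>c. c) P"
    using dtrace_eq_dtrace[OF 1 s(1)] P C(3) by simp
  also have "\<dots> = (\<Sum>c\<in>C. representation (extend_basis C) c c)"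
    unfolding dtrace_def
  proof (rule sum.cong[OF refl])
    fix c assume "c \<in> C"
    then have "c \<in> P ` W" using C(3) span_base by blast
    then have "P c = c" using P(3) by auto
    then show "representation (extend_basis C) (P c) c = representation (extend_basis C) c c" by simp
  qed
  also have "\<dots> = of_nat (card C)" using s(2) by simp
  finally show ?thesis using C(4) by simp
qed

text \<open>The trace on \<open>W\<close> equals the trace on the image of \<open>W\<close> under
  \<open>F\<close>, where one power fewer already annihilates; the induction on \<open>k\<close>
  ends at the zero space.\<close>

lemma dtrace_nilpotent:
  assumes "subspace W" "dual_system W X \<phi> a" "operator F" "F ` W \<subseteq> W"
    "\<And>x. x \<in> W \<Longrightarrow> (F ^^ k) x = 0"
  shows "dtrace X \<phi> a F = 0"
proof -
  have *: "dtrace C (\<lambda>c x. representation (extend_basis C) x c) (\<lambda>c. c) F = 0"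
    if "independent C" "finite C" "F ` span C \<subseteq> span C" "\<And>x. x \<in> span C \<Longrightarrow> (F ^^ k) x = 0" for C
    using that
  proof (induction k arbitrary: C)
    case 0
    then have "span C \<subseteq> {0}" by auto
    then have "C = {}"
      using "0.prems"(1) dependent_zero span_base by blast
    then show ?case by (simp add: dtrace_def)
  next
    case (Suc k)
    have sub: "subspace (F ` span C)" by (rule subspace_image_operator[OF assms(3) subspace_span])
    obtain D where D: "independent D" "finite D" "span D = F ` span C" "card D = dim (F ` span C)"
      by (rule subspace_basis[OF sub Suc.prems(3,2)])
    have "(F ^^ k) x = 0" if x: "x \<in> span D" for x
    proof -
      obtain y where "y \<in> span C" "x = F y" using x D(3) by auto
      then show ?thesis using Suc.prems(4)[of y] by (simp add: funpow_swap1)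
    qed
    moreover have "F ` span D \<subseteq> span D" unfolding D(3) using Suc.prems(3) by blast
    ultimately have "dtrace D (\<lambda>c x. representation (extend_basis D) x c) (\<lambda>c. c) F = 0"
      using Suc.IH D by blast
    moreover have "dtrace C (\<lambda>c x. representation (extend_basis C) x c) (\<lambda>c. c) F =
        dtrace D (\<lambda>c x. representation (extend_basis D) x c) (\<lambda>c. c) F"
      using D Suc.prems
      by (intro dtrace_eq_dtrace[OF dual_system_basis(1) dual_system_basis(1) assms(3)]) auto
    ultimately show ?case by simp
  qed
  have "finite (a ` X)" using assms(2) by (simp add: dual_system_def)
  then obtain C where C: "independent C" "finite C" "span C = W" "card C = dim W"
    by (rule subspace_basis[OF assms(1) dual_system_subspace_span[OF assms(2)]])
  have "dtrace X \<phi> a F = dtrace C (\<lambda>c x. representation (extend_basis C) x c) (\<lambda>c. c) F"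
    using dtrace_eq_dtrace[OF assms(2), of W C _ _ F] dual_system_basis(1)[OF C(1,2)] C(3) assms(3,4)
    by auto
  also have "\<dots> = 0"
    by (rule *[OF C(1,2)]) (use C(3) assms(4,5) in auto)
  finally show ?thesis .
qed

end

section \<open>Operator algebras\<close>

locale fd_space = vspace scale
  for scale :: "'a::{alg_closed_field,field_char_0} \<Rightarrow> 'b::ab_group_add \<Rightarrow> 'b" +
  fixes B :: "'b set"
  assumes B_finite: "finite B" and B_indep: "independent B" and B_span: "span B = UNIV"
begin

abbreviation coord :: "'b \<Rightarrow> 'b \<Rightarrow> 'a" where "coord b x \<equiv> representation B x b"

lemma functional_coord: "functional (coord b)"
  using linear_representation[OF B_indep B_span] by (simp add: functional_iff)

lemma sum_coord: "(\<Sum>b\<in>B. scale (coord b x) b) = x"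
  using sum_representation_eq[OF B_indep _ B_finite, of x] B_span by auto

lemma coord_basis: "b \<in> B \<Longrightarrow> coord c b = (if c = b then 1 else 0)"
  using representation_basis[OF B_indep] by auto

lemma functional_expand: "functional f \<Longrightarrow> f x = (\<Sum>b\<in>B. coord b x * f b)"
  by (subst sum_coord[symmetric]) (simp add: functional_sum functional_scale)

lemma operator_expand: "operator F \<Longrightarrow> F x = (\<Sum>b\<in>B. scale (coord b x) (F b))"
  by (subst sum_coord[symmetric]) (simp add: operator_sum operator_scale)

lemma dual_system_B: "dual_system UNIV B coord (\<lambda>b. b)"
  using B_finite functional_coord sum_coord by (auto simp: dual_system_def)

definition tr :: "('b \<Rightarrow> 'b) \<Rightarrow> 'a" where "tr F = (\<Sum>b\<in>B. coord b (F b))"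

lemma tr_eq_dtrace: "tr F = dtrace B coord (\<lambda>b. b) F"
  by (simp add: tr_def dtrace_def)

lemma tr_dual_system:
  "dual_system UNIV X \<phi> a \<Longrightarrow> operator F \<Longrightarrow> tr F = (\<Sum>i\<in>X. \<phi> i (F (a i)))"
  unfolding tr_eq_dtrace using dtrace_eq_dtrace[OF dual_system_B, of UNIV X \<phi> a F]
  by (simp add: dtrace_def)

lemma tr_add: "tr (\<lambda>x. F x + G x) = tr F + tr G"
  by (simp add: tr_def functional_add[OF functional_coord] sum.distrib)

lemma tr_diff: "tr (\<lambda>x. F x - G x) = tr F - tr G"
  by (simp add: tr_def functional_diff[OF functional_coord] sum_subtractf)

lemma tr_scale: "tr (\<lambda>x. scale c (F x)) = c * tr F"
  by (simp add: tr_def functional_scale[OF functional_coord] sum_distrib_left)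

lemma tr_0: "tr (\<lambda>x. 0) = 0"
  by (simp add: tr_def functional_0[OF functional_coord])

lemma tr_sum: "tr (\<lambda>x. \<Sum>i\<in>I. F i x) = (\<Sum>i\<in>I. tr (F i))"
  by (simp add: tr_def functional_sum[OF functional_coord]) (rule sum.swap)

lemma tr_id: "tr (\<lambda>x. x) = of_nat (card B)"
  by (simp add: tr_def coord_basis)

lemma tr_commute:
  assumes "operator F" "operator G"
  shows "tr (\<lambda>x. F (G x)) = tr (\<lambda>x. G (F x))"
proof -
  have *: "tr (\<lambda>x. F (G x)) = (\<Sum>b\<in>B. \<Sum>c\<in>B. coord c (G b) * coord b (F c))"
    if "operator F" for F G
    unfolding tr_def
    by (subst operator_expand[OF that])
       (simp add: functional_sum[OF functional_coord] functional_scale[OF functional_coord])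
  show ?thesis
    unfolding *[OF assms(1)] *[OF assms(2)] by (subst sum.swap) (simp add: mult.commute)
qed

lemma tr_idempotent:
  "operator P \<Longrightarrow> (\<And>x. P (P x) = P x) \<Longrightarrow> tr P = of_nat (dim (range P))"
  unfolding tr_eq_dtrace by (rule dtrace_idempotent[OF subspace_UNIV dual_system_B]) auto

lemma tr_nilpotent: "operator F \<Longrightarrow> (\<And>x. (F ^^ k) x = 0) \<Longrightarrow> tr F = 0"
  unfolding tr_eq_dtrace by (rule dtrace_nilpotent[OF subspace_UNIV dual_system_B]) auto

lemma dim_pos:
  assumes "subspace W" "x \<in> W" "x \<noteq> 0"
  shows "dim W > 0"
proof -
  obtain C where "independent C" "finite C" "span C = W" "card C = dim W"
    by (rule subspace_basis[OF assms(1) _ B_finite]) (simp add: B_span)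
  then show ?thesis using assms by (metis card_gt_0_iff empty_iff singletonD span_empty)
qed

text \<open>In characteristic zero a vanishing trace forces a vanishing rank.\<close>

lemma tr_idempotent_eq_0:
  assumes "operator P" "\<And>x. P (P x) = P x" "tr P = 0"
  shows "P x = 0"
proof (rule ccontr)
  assume "P x \<noteq> 0"
  then have "dim (range P) > 0"
    using dim_pos[OF subspace_image_operator[OF assms(1) subspace_UNIV], of "P x"] by auto
  then show False using assms tr_idempotent[of P] by auto
qed

lemma injective_imp_surjective:
  assumes F: "operator F" and inj: "\<And>x. F x = 0 \<Longrightarrow> x = 0"
  shows "\<exists>x. F x = y"
proof -
  have F': "Vector_Spaces.linear scale scale F" using F operator_iff by blast
  have inj': "inj F"
    using inj F operator_diff[OF F] by (intro injI) (metis eq_iff_diff_eq_0)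
  have ind: "independent (F ` B)"
    using module_hom.independent_injective_image[OF module_hom_linearI[OF F'] B_indep] inj'
    by (metis inj_on_subset subset_UNIV)
  have c: "card (F ` B) = card B"
    using inj' by (metis card_image inj_on_subset subset_UNIV)
  have "UNIV \<subseteq> span (F ` B)"
  proof (rule ccontr)
    assume "\<not> UNIV \<subseteq> span (F ` B)"
    then obtain y where y: "y \<notin> span (F ` B)" by auto
    then have "independent (insert y (F ` B))" using ind independent_insertI by blast
    then have "card (insert y (F ` B)) \<le> card B"
      using independent_span_bound[OF B_finite] B_span by blast
    moreover have "y \<notin> F ` B" using y span_base by blast
    ultimately show False using c B_finite by simp
  qed
  then have "y \<in> range F"
    using module_hom.span_image[OF module_hom_linearI[OF F'], of B] B_span by auto
  then show ?thesis by auto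
qed

text \<open>The vector \<open>p(z) v\<close> in Horner form, computed at one vector at a time so
  that operators need not form a ring type.\<close>

definition pev :: "'a poly \<Rightarrow> ('b \<Rightarrow> 'b) \<Rightarrow> 'b \<Rightarrow> 'b" where
  "pev p z v = fold_coeffs (\<lambda>a w. scale a v + z w) p 0"

context
  fixes z :: "'b \<Rightarrow> 'b"
  assumes z: "operator z"
begin

lemma pev_0 [simp]: "pev 0 z v = 0"
  by (simp add: pev_def)

lemma pev_pCons [simp]: "pev (pCons a p) z v = scale a v + z (pev p z v)"
  using operator_0[OF z] by (cases "a = 0 \<and> p = 0") (auto simp: pev_def)

lemma pev_1 [simp]: "pev 1 z v = v"
  using operator_0[OF z] by (simp flip: pCons_one)

lemma operator_pev: "operator (pev p z)"
proof (induction p)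
  case (pCons a p)
  then show ?case
    using operator_add[OF z] operator_scale[OF z]
    by (auto simp: operator_def algebra_simps scale_left_commute)
qed (auto simp: operator_def)

lemma pev_add: "pev (p + q) z v = pev p z v + pev q z v"
proof (induction p arbitrary: q)
  case (pCons a p)
  obtain b q' where "q = pCons b q'" by (cases q)
  then show ?case
    by (auto simp: pCons.IH operator_add[OF z] algebra_simps)
qed auto

lemma pev_smult: "pev (smult c p) z v = scale c (pev p z v)"
  by (induction p) (auto simp: operator_scale[OF z] algebra_simps)

lemma pev_mult: "pev (p * q) z v = pev p z (pev q z v)"
  by (induction p) (auto simp: pev_add pev_smult operator_0[OF z])

lemma pev_monom: "pev (monom c k) z v = scale c ((z ^^ k) v)"
  by (induction k) (auto simp: monom_0 monom_Suc operator_0[OF z] operator_scale[OF z])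

lemma pev_sum: "pev (\<Sum>i\<in>I. p i) z v = (\<Sum>i\<in>I. pev (p i) z v)"
  by (induction I rule: infinite_finite_induct) (auto simp: pev_add)

lemma pev_commute: "pev p z (pev q z v) = pev q z (pev p z v)"
  by (metis pev_mult mult.commute)

lemma pev_z: "pev p z (z v) = z (pev p z v)"
  using pev_commute[of p "[:0, 1:]" v] operator_0[OF z] by (simp del: pev_1)

text \<open>The \<open>card B + 1\<close> vectors obtained by iterating \<open>z\<close> on
  \<open>v\<close> cannot be independent. Repetitions are treated apart, because independence is a
  property of the set and not of the family.\<close>

lemma annihilator_vector: "\<exists>p. p \<noteq> 0 \<and> pev p z v = 0"
proof (cases "inj_on (\<lambda>i. (z ^^ i) v) {..card B}")
  case True
  let ?S = "(\<lambda>i. (z ^^ i) v) ` {..card B}"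
  have "card ?S = Suc (card B)" using card_image[OF True] by simp
  then have "dependent ?S"
    using independent_span_bound[OF B_finite, of ?S] B_span by force
  then obtain u x where u: "x \<in> ?S" "u x \<noteq> 0" "(\<Sum>w\<in>?S. scale (u w) w) = 0"
    using dependent_finite[of ?S] by auto
  then obtain j where j: "j \<le> card B" "u ((z ^^ j) v) \<noteq> 0" by auto
  define p where "p = (\<Sum>i\<le>card B. monom (u ((z ^^ i) v)) i)"
  have "coeff p j \<noteq> 0"
    using j by (simp add: p_def coeff_sum)
  moreover have "pev p z v = 0"
    using u(3) True by (simp add: p_def pev_sum pev_monom sum.reindex)
  ultimately show ?thesis by (metis coeff_0)
next
  case False
  then obtain i j where ij: "i \<noteq> j" "(z ^^ i) v = (z ^^ j) v" by (auto simp: inj_on_def)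
  have "coeff (monom 1 i - monom (1::'a) j) i \<noteq> 0" using ij by simp
  then have "monom 1 i - monom (1::'a) j \<noteq> 0" by (metis coeff_0)
  moreover have "pev (monom 1 i + monom (- 1) j) z v = 0"
    using ij(2) by (simp add: pev_add pev_monom)
  ultimately show ?thesis by (metis diff_conv_add_uminus minus_monom)
qed

text \<open>The product of annihilators of the basis vectors kills every basis vector, since
  polynomials in \<open>z\<close> commute.\<close>

lemma annihilator: "\<exists>p. p \<noteq> 0 \<and> (\<forall>v. pev p z v = 0)"
proof -
  obtain p where p: "\<And>v. p v \<noteq> 0 \<and> pev (p v) z v = 0"
    using annihilator_vector by metis
  let ?q = "\<Prod>b\<in>B. p b"
  have "pev ?q z b = 0" if "b \<in> B" for b
  proof -
    have "?q = (\<Prod>c\<in>B - {b}. p c) * p b"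
      using that B_finite by (simp add: prod.remove mult.commute)
    then show ?thesis using p[of b] operator_0[OF operator_pev] by (simp add: pev_mult)
  qed
  then have "pev ?q z v = 0" for v
    by (subst operator_expand[OF operator_pev]) simp
  moreover have "?q \<noteq> 0" using p B_finite by simp
  ultimately show ?thesis by blast
qed

text \<open>An annihilating polynomial is a power of \<open>X\<close> times some \<open>q\<close>
  with nonzero constant term. Bezout gives \<open>a X^k + b q = 1\<close>, and \<open>a X^k\<close>
  evaluated at \<open>z\<close> is an idempotent; if it vanishes, \<open>z\<close> is
  nilpotent.\<close>

lemma fitting:
  "(\<exists>k. \<forall>v. (z ^^ k) v = 0) \<or>
   (\<exists>r. (\<forall>v. z (pev r z (z (pev r z v))) = z (pev r z v)) \<and> (\<exists>v. z (pev r z v) \<noteq> 0))"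
proof -
  obtain p where p: "p \<noteq> 0" "\<And>v. pev p z v = 0" using annihilator by blast
  \<comment> \<open>The successor guarantees \<open>k > 0\<close>, so that \<open>a X^k\<close> is
    divisible by \<open>X\<close> even when \<open>p\<close> has nonzero constant term;
    \<open>r\<close> below is the quotient.\<close>
  define k where "k = Suc (order 0 p)"
  obtain q where q: "p = [:0, 1:] ^ order 0 p * q" "\<not> [:0, 1:] dvd q"
    using order_decomp[OF p(1), of 0] by auto
  have X: "[:0, 1:] ^ j = monom (1::'a) j" for j
    by (simp add: monom_altdef)
  have kill: "pev (monom 1 k * q) z v = 0" for v
  proof -
    have "monom 1 k * q = [:0, 1:] * p"
      using q(1) by (simp add: k_def flip: X)
    then show ?thesis using p(2) operator_0[OF operator_pev] by (simp add: pev_mult operator_0[OF z])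
  qed
  obtain q0 q' where q': "q = pCons q0 q'" by (cases q)
  have "q0 \<noteq> 0"
    using q(2) unfolding q' by (metis dvd_iff_poly_eq_0 minus_zero poly_pCons mult_zero_left add_0_right)
  \<comment> \<open>From \<open>j\<close> to \<open>j + 1\<close>: a multiple of \<open>q\<close>
    removes the constant term of \<open>a\<close>, and what remains of \<open>a\<close> supplies one
    more factor \<open>X\<close>.\<close>
  have "\<exists>a b. a * monom 1 j + b * q = 1" for j
  proof (induction j)
    case 0
    show ?case by (intro exI[of _ 1] exI[of _ 0]) (simp add: monom_0 one_pCons)
  next
    case (Suc j)
    then obtain a b where ab: "a * monom 1 j + b * q = 1" by blast
    obtain a0 a' where a: "a = pCons a0 a'" by (cases a)
    let ?c = "[:a0 / q0:]"
    have X': "monom 1 (Suc j) = [:0, 1:] * monom (1::'a) j"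
      by (simp flip: X)
    have e: "a = ?c * q + [:0, 1:] * (a' - ?c * q')"
      using \<open>q0 \<noteq> 0\<close> by (simp add: a q' smult_diff_right)
    have "1 = (?c * q + [:0, 1:] * (a' - ?c * q')) * monom 1 j + b * q"
      using ab e by simp
    also have "\<dots> = (a' - ?c * q') * monom 1 (Suc j) + (b + ?c * monom 1 j) * q"
      unfolding X' by algebra
    finally show ?case by metis
  qed
  then obtain a b where ab: "a * monom 1 k + b * q = 1" by blast
  define r where "r = a * monom 1 (k - 1)"
  have rk: "a * monom 1 k = [:0, 1:] * r"
    by (simp add: r_def k_def monom_Suc)
  have f: "z (pev r z v) = pev (a * monom 1 k) z v" for v
    unfolding rk by (simp add: pev_mult operator_0[OF z])
  have split: "v = pev (a * monom 1 k) z v + pev (b * q) z v" for v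
    using ab pev_1[of v] by (metis pev_add)
  have idem: "pev (a * monom 1 k) z (pev (a * monom 1 k) z v) = pev (a * monom 1 k) z v" for v
  proof -
    have "pev (a * monom 1 k) z (pev (b * q) z v) = pev (a * b * (monom 1 k * q)) z v"
      by (simp flip: pev_mult add: algebra_simps)
    also have "\<dots> = 0" by (subst pev_mult) (simp add: kill operator_0[OF operator_pev])
    finally show ?thesis
      using split[of v] operator_add[OF operator_pev] by (metis add.right_neutral)
  qed
  show ?thesis
  proof (cases "\<exists>v. z (pev r z v) \<noteq> 0")
    case True
    then show ?thesis using f idem by metis
  next
    case False
    have "(z ^^ k) v = 0" for v
    proof -
      have "v = pev (b * q) z v" using split[of v] False f by simp
      then have "(z ^^ k) v = pev (monom 1 k) z (pev (b * q) z v)"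
        by (simp add: pev_monom)
      also have "\<dots> = pev (b * (monom 1 k * q)) z v"
        by (simp flip: pev_mult add: algebra_simps)
      also have "\<dots> = 0" by (subst pev_mult) (simp add: kill operator_0[OF operator_pev])
      finally show ?thesis .
    qed
    then show ?thesis by blast
  qed
qed

text \<open>Linear factors are stripped off a polynomial annihilating \<open>v\<close>: either the
  cofactor already kills \<open>v\<close> and the degree drops, or the cofactor sends
  \<open>v\<close> to an eigenvector, which lies in \<open>W\<close> because \<open>W\<close> is
  \<open>z\<close>-stable.\<close>

lemma eigenvector:
  assumes W: "\<And>x. x \<in> W \<Longrightarrow> z x \<in> W" "subspace W" and v: "v \<in> W" "v \<noteq> 0"
  obtains c w where "w \<in> W" "w \<noteq> 0" "z w = scale c w"
proof -
  have pevW: "pev p z w \<in> W" if "w \<in> W" for p w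
    using that by (induction p) (auto intro: subspace_0 subspace_add subspace_scale W)
  obtain p where p: "p \<noteq> 0" "pev p z v = 0" using annihilator_vector by blast
  have "\<exists>c w. w \<in> W \<and> w \<noteq> 0 \<and> z w = scale c w"
    using p v
  proof (induction "degree p" arbitrary: p v rule: less_induct)
    case less
    have "degree p > 0"
    proof (rule ccontr)
      assume "\<not> degree p > 0"
      then obtain a where a: "p = [:a:]" by (metis degree_eq_zeroE neq0_conv)
      then show False using less.prems operator_0[OF z] by simp
    qed
    then obtain c where c: "poly p c = 0" using alg_closed_imp_poly_has_root by blast
    then obtain q where q: "p = [:- c, 1:] * q" by (metis dvdE poly_eq_0_iff_dvd)
    then have q0: "q \<noteq> 0" and dq: "degree q < degree p"
      using less.prems(1) by (auto simp: degree_mult_eq simp del: mult_pCons_left)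
    have e: "pev p z v = z (pev q z v) - scale c (pev q z v)"
      unfolding q pev_mult by (simp add: operator_0[OF z])
    show ?case
    proof (cases "pev q z v = 0")
      case True
      then show ?thesis using less.hyps[OF dq q0] less.prems by blast
    next
      case False
      then show ?thesis using e less.prems pevW by (metis eq_iff_diff_eq_0)
    qed
  qed
  then show ?thesis using that by blast
qed

end

end

text \<open>Nondegeneracy of the trace form plays the part of semisimplicity: traces of nilpotents
  vanish, so an element all of whose multiples are nilpotent is zero.\<close>

locale op_algebra = fd_space scale B
  for scale :: "'a::{alg_closed_field,field_char_0} \<Rightarrow> 'b::ab_group_add \<Rightarrow> 'b" and B +
  fixes \<B> :: "('b \<Rightarrow> 'b) set"
  assumes op: "F \<in> \<B> \<Longrightarrow> operator F"
    and one_mem: "(\<lambda>x. x) \<in> \<B>"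
    and add_mem: "F \<in> \<B> \<Longrightarrow> G \<in> \<B> \<Longrightarrow> (\<lambda>x. F x + G x) \<in> \<B>"
    and scale_mem: "F \<in> \<B> \<Longrightarrow> (\<lambda>x. scale c (F x)) \<in> \<B>"
    and comp_mem: "F \<in> \<B> \<Longrightarrow> G \<in> \<B> \<Longrightarrow> (\<lambda>x. F (G x)) \<in> \<B>"
    and nondegenerate: "F \<in> \<B> \<Longrightarrow> (\<And>G. G \<in> \<B> \<Longrightarrow> tr (\<lambda>x. F (G x)) = 0) \<Longrightarrow> F = (\<lambda>x. 0)"
begin

lemma zero_mem: "(\<lambda>x. 0) \<in> \<B>"
  using scale_mem[OF one_mem, of 0] by simp

lemma diff_mem: "F \<in> \<B> \<Longrightarrow> G \<in> \<B> \<Longrightarrow> (\<lambda>x. F x - G x) \<in> \<B>"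
  using add_mem[of F, OF _ scale_mem[of G "-1"]] by simp

lemma pev_mem: "z \<in> \<B> \<Longrightarrow> pev p z \<in> \<B>"
proof (induction p)
  case 0
  have "pev 0 z = (\<lambda>x. 0)" by (rule ext) (simp add: pev_def)
  then show ?case using zero_mem by simp
next
  case (pCons a p)
  have "pev (pCons a p) z = (\<lambda>v. scale a v + z (pev p z v))"
    using pev_pCons[OF op[OF pCons.prems]] by (intro ext) simp
  then show ?case using pCons comp_mem add_mem scale_mem[OF one_mem] by simp
qed

definition decomposition :: "('b \<Rightarrow> 'b) set \<Rightarrow> bool" where
  "decomposition E \<longleftrightarrow> finite E \<and> E \<subseteq> \<B> \<and> (\<forall>e\<in>E. e \<noteq> (\<lambda>x. 0) \<and> (\<forall>x. e (e x) = e x)) \<and>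
     (\<forall>e\<in>E. \<forall>f\<in>E. e \<noteq> f \<longrightarrow> (\<forall>x. e (f x) = 0)) \<and> (\<forall>x. (\<Sum>e\<in>E. e x) = x)"

text \<open>Each idempotent has its rank as trace and the ranks add up to \<open>card B\<close>. The
  bound guarantees a decomposition with the largest number of members.\<close>

lemma decomposition_card: "decomposition E \<Longrightarrow> card E \<le> card B"
proof -
  assume E: "decomposition E"
  have "card E = (\<Sum>e\<in>E. 1)" by simp
  also have "\<dots> \<le> (\<Sum>e\<in>E. dim (range e))"
  proof (rule sum_mono)
    fix e assume "e \<in> E"
    then obtain x where "e x \<noteq> 0" "operator e"
      using E op unfolding decomposition_def by fastforce
    then show "1 \<le> dim (range e)"
      using dim_pos[OF subspace_image_operator[OF _ subspace_UNIV], of e "e x"] by (simp add: Suc_leI)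
  qed
  also have "\<dots> = card B"
  proof -
    have "of_nat (\<Sum>e\<in>E. dim (range e)) = (\<Sum>e\<in>E. tr e)"
      using E op by (auto simp: decomposition_def tr_idempotent intro!: sum.cong)
    also have "\<dots> = of_nat (card B)"
      using E by (simp add: tr_sum[symmetric] tr_id decomposition_def)
    finally show ?thesis using of_nat_eq_iff by blast
  qed
  finally show ?thesis .
qed

lemma decomposition_refine:
  assumes E: "decomposition E" "e \<in> E"
    and f: "f \<in> \<B>" "\<And>x. f (f x) = f x" "\<And>x. e (f x) = f x" "\<And>x. f (e x) = f x"
      "f \<noteq> (\<lambda>x. 0)" "f \<noteq> e"
  shows "\<exists>E'. decomposition E' \<and> card E' > card E"
proof -
  note d = E(1)[unfolded decomposition_def]
  have fin: "finite E" and Esum: "(\<Sum>h\<in>E. h x) = x" for x using d by auto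
  define g where "g = (\<lambda>x. e x - f x)"
  have fo: "operator f" and eo: "operator e" using f(1) op E d by auto
  have ee: "e (e x) = e x" for x using E d by blast
  have g: "g (g x) = g x" "e (g x) = g x" "g (e x) = g x" "f (g x) = 0" "g (f x) = 0" for x
    by (simp_all add: g_def operator_diff[OF fo] operator_diff[OF eo] f ee)
  have g0: "g \<noteq> (\<lambda>x. 0)" using f(6) by (auto simp: g_def fun_eq_iff) metis
  have gB: "g \<in> \<B>" using diff_mem[of e f] E d f(1) by (auto simp: g_def)
  have orth: "h (k x) = 0" "k (h x) = 0"
    if "h \<in> E - {e}" "k = f \<or> k = g" for h k x
  proof -
    have he: "h (e y) = 0" "e (h y) = 0" for y using that E d by auto
    have "operator k" using that(2) fo op[OF gB] by auto
    moreover have "e (k x) = k x" "k (e y) = k y" for y using that(2) f g by auto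
    ultimately show "h (k x) = 0" "k (h x) = 0"
      using he operator_0[of k] by metis+
  qed
  have nf: "f \<notin> E - {e}" and ng: "g \<notin> E - {e}"
    using orth(1)[of f f] orth(1)[of g g] f(2,5) g(1) g0 by (auto simp: fun_eq_iff)
  have fg: "f \<noteq> g" using f(2,5) g(4) by (auto simp: fun_eq_iff) metis
  let ?E = "insert f (insert g (E - {e}))"
  have "(\<Sum>h\<in>?E. h x) = x" for x
  proof -
    have "(\<Sum>h\<in>?E. h x) = f x + (g x + (\<Sum>h\<in>E - {e}. h x))"
      using fin nf ng fg by simp
    also have "\<dots> = (\<Sum>h\<in>E. h x)"
      using fin E(2) by (simp add: g_def sum.remove)
    finally show ?thesis using Esum by simp
  qed
  moreover have "\<forall>h\<in>?E. \<forall>k\<in>?E. h \<noteq> k \<longrightarrow> (\<forall>x. h (k x) = 0)"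
  proof (intro ballI impI allI)
    fix h k x assume hk: "h \<in> ?E" "k \<in> ?E" "h \<noteq> k"
    then consider "h \<in> E - {e}" "k \<in> E - {e}" | "h \<in> E - {e}" "k = f \<or> k = g"
      | "k \<in> E - {e}" "h = f \<or> h = g" | "h = f" "k = g" | "h = g" "k = f" by blast
    then show "h (k x) = 0"
    proof cases
      case 1 then show ?thesis using d hk(3) by blast
    qed (use orth g(4,5) in auto)
  qed
  moreover have "\<forall>h\<in>?E. h \<noteq> (\<lambda>x. 0) \<and> (\<forall>x. h (h x) = h x)"
    using f(2,5) g(1) g0 d by blast
  ultimately have "decomposition ?E"
    using fin d f(1) gB unfolding decomposition_def by blast
  moreover have "card ?E > card E"
    using fin nf ng fg E(2) card_Suc_Diff1[OF fin E(2)] by simp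
  ultimately show ?thesis by blast
qed

text \<open>In a largest decomposition a corner \<open>e F e\<close> contains no idempotents besides
  \<open>0\<close> and \<open>e\<close>. Subtracting an eigenvalue from a corner element gives
  \<open>y\<close> with a kernel vector in the range of \<open>e\<close>; by \<open>fitting\<close>
  every \<open>e G y\<close> is then nilpotent, and the trace form forces
  \<open>y = 0\<close>.\<close>

lemma primitive_decomposition:
  obtains E where "decomposition E"
    "\<And>e F. e \<in> E \<Longrightarrow> F \<in> \<B> \<Longrightarrow> \<exists>c. \<forall>x. e (F (e x)) = scale c (e x)"
proof -
  have "\<exists>E. decomposition E"
  proof (cases "(\<lambda>x. x) = (\<lambda>x::'b. 0)")
    case True
    then have "decomposition {}" by (auto simp: decomposition_def fun_eq_iff)
    then show ?thesis by blast
  next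
    case False
    then have "decomposition {\<lambda>x. x}" using one_mem by (auto simp: decomposition_def)
    then show ?thesis by blast
  qed
  then obtain E where E: "decomposition E" "\<And>E'. decomposition E' \<Longrightarrow> card E' \<le> card E"
    using ex_has_greatest_nat[of decomposition _ card] decomposition_card by (metis le_SucI less_Suc_eq_le)
  note d = E(1)[unfolded decomposition_def]
  have min: "f = e" if "e \<in> E" "f \<in> \<B>" "\<And>x. f (f x) = f x" "\<And>x. e (f x) = f x" "\<And>x. f (e x) = f x"
      "f \<noteq> (\<lambda>x. 0)" for e f
    using decomposition_refine[OF E(1) that] E(2) by (meson not_le)
  \<comment> \<open>The idempotent that \<open>fitting\<close> would produce from \<open>z\<close>
    has to be all of \<open>e\<close>, yet it kills \<open>v = e v\<close>.\<close>
  have nil: "\<exists>k. \<forall>x. (z ^^ k) x = 0"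
    if e: "e \<in> E" and z: "z \<in> \<B>" "\<And>x. e (z x) = z x" "\<And>x. z (e x) = z x"
      and v: "e v = v" "v \<noteq> 0" "z v = 0" for e z v
  proof (rule ccontr)
    assume "\<nexists>k. \<forall>x. (z ^^ k) x = 0"
    then obtain r where r: "\<And>v. z (pev r z (z (pev r z v))) = z (pev r z v)" "\<exists>v. z (pev r z v) \<noteq> 0"
      using fitting[OF op[OF z(1)]] by blast
    let ?f = "\<lambda>v. z (pev r z v)"
    have comm: "pev r z (z x) = z (pev r z x)" for x by (rule pev_z[OF op[OF z(1)]])
    have "?f = e"
    proof (rule min[OF e])
      show "?f \<in> \<B>" by (rule comp_mem[OF z(1) pev_mem[OF z(1)]])
      show "?f (e x) = ?f x" for x using comm z(3) by metis
    qed (use r z in \<open>auto dest: fun_cong\<close>)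
    moreover have "?f v = 0"
      using comm v(3) operator_0[OF operator_pev[OF op[OF z(1)]]] by metis
    ultimately show False using v by (metis (mono_tags, lifting))
  qed
  have "\<exists>c. \<forall>x. e (F (e x)) = scale c (e x)" if e: "e \<in> E" and F: "F \<in> \<B>" for e F
  proof -
    have eB: "e \<in> \<B>" and ee: "e (e x) = e x" for x using e d by auto
    have eo: "operator e" and Fo: "operator F" using eB F op by auto
    obtain w where w: "e w \<noteq> 0" using e d by fastforce
    let ?z = "\<lambda>x. e (F (e x))"
    have zB: "?z \<in> \<B>" by (rule comp_mem[OF eB comp_mem[OF F eB]])
    obtain c v where v: "v \<in> range e" "v \<noteq> 0" "?z v = scale c v"
    proof (rule eigenvector[OF op[OF zB], of "range e" "e w"])
      show "subspace (range e)" by (rule subspace_image_operator[OF eo subspace_UNIV])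
    qed (use w in auto)
    have ev: "e v = v" using v(1) ee by auto
    define y where "y = (\<lambda>x. ?z x - scale c (e x))"
    have yB: "y \<in> \<B>" unfolding y_def by (rule diff_mem[OF zB scale_mem[OF eB]])
    have y: "e (y x) = y x" "y (e x) = y x" "y v = 0" for x
      using v(3) ev by (auto simp: y_def operator_diff[OF eo] operator_scale[OF eo] ee)
    have "tr (\<lambda>x. y (G x)) = 0" if G: "G \<in> \<B>" for G
    proof -
      let ?h = "\<lambda>x. e (G (y x))"
      have hB: "?h \<in> \<B>" by (rule comp_mem[OF eB comp_mem[OF G yB]])
      have "tr (\<lambda>x. y (G x)) = tr (\<lambda>x. y (e (G x)))" by (simp add: y)
      also have "\<dots> = tr ?h"
        using tr_commute[OF op[OF yB] op[OF comp_mem[OF eB G]]] .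
      also have "\<exists>k. \<forall>x. (?h ^^ k) x = 0"
        by (rule nil[OF e hB _ _ ev v(2)])
          (use y ee operator_0[OF op[OF G]] operator_0[OF eo] in auto)
      then have "tr ?h = 0" using tr_nilpotent[OF op[OF hB]] by blast
      finally show ?thesis .
    qed
    then have "y = (\<lambda>x. 0)" using nondegenerate[OF yB] by blast
    then show ?thesis unfolding y_def by (metis eq_iff_diff_eq_0)
  qed
  then show ?thesis using that E(1) by blast
qed

end

section \<open>Matrix units of an operator algebra with nondegenerate trace form\<close>

locale primitive_op_algebra = op_algebra scale B \<B>
  for scale :: "'a::{alg_closed_field,field_char_0} \<Rightarrow> 'b::ab_group_add \<Rightarrow> 'b" and B \<B> +
  fixes E
  assumes decomp: "decomposition E"
    and primitive: "e \<in> E \<Longrightarrow> F \<in> \<B> \<Longrightarrow> \<exists>c. \<forall>x. e (F (e x)) = scale c (e x)"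
begin

lemma E_finite: "finite E"
  and E_mem: "e \<in> E \<Longrightarrow> e \<in> \<B>"
  and E_nonzero: "e \<in> E \<Longrightarrow> e \<noteq> (\<lambda>x. 0)"
  and E_idem: "e \<in> E \<Longrightarrow> e (e x) = e x"
  and E_orth: "e \<in> E \<Longrightarrow> f \<in> E \<Longrightarrow> e \<noteq> f \<Longrightarrow> e (f x) = 0"
  and E_sum: "(\<Sum>e\<in>E. e x) = x"
  using decomp by (auto simp: decomposition_def)

lemma E_op: "e \<in> E \<Longrightarrow> operator e"
  using E_mem op by blast

text \<open>Linked idempotents are those in the same block; equivalently, the simple modules they
  generate are isomorphic.\<close>

definition linked :: "('b \<Rightarrow> 'b) \<Rightarrow> ('b \<Rightarrow> 'b) \<Rightarrow> bool" where
  "linked i j \<longleftrightarrow> (\<exists>F\<in>\<B>. (\<lambda>x. i (F (j x))) \<noteq> (\<lambda>x. 0))"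

text \<open>The trace form supplies \<open>G\<close> with nonzero trace against
  \<open>i F j\<close>. Both corners being scalar, \<open>j G i\<close> is an inverse up to the
  factor \<open>c\<close>, and the scalar on the other side must agree because \<open>i F j\<close>
  is not zero.\<close>

lemma linked_inverse:
  assumes i: "i \<in> E" and j: "j \<in> E" and F: "F \<in> \<B>" "(\<lambda>x. i (F (j x))) \<noteq> (\<lambda>x. 0)"
  shows "\<exists>y\<in>\<B>. (\<forall>v. j (y v) = y v) \<and> (\<forall>v. y (i v) = y v) \<and>
           (\<forall>v. i (F (j (y v))) = i v) \<and> (\<forall>v. y (i (F (j v))) = j v)"
proof -
  let ?x = "\<lambda>v. i (F (j v))"
  have xB: "?x \<in> \<B>" by (rule comp_mem[OF E_mem[OF i] comp_mem[OF F(1) E_mem[OF j]]])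
  obtain G where G: "G \<in> \<B>" "tr (\<lambda>v. ?x (G v)) \<noteq> 0"
    using nondegenerate[OF xB] F(2) by blast
  obtain c where c: "\<And>v. i (F (j (G (i v)))) = scale c (i v)"
    using primitive[OF i comp_mem[OF F(1) comp_mem[OF E_mem[OF j] G(1)]]] by blast
  obtain c' where c': "\<And>v. j (G (i (F (j v)))) = scale c' (j v)"
    using primitive[OF j comp_mem[OF G(1) comp_mem[OF E_mem[OF i] F(1)]]] by blast
  have "c \<noteq> 0"
  proof
    assume "c = 0"
    have "tr (\<lambda>v. ?x (G v)) = tr (\<lambda>v. i (?x (G v)))" using E_idem[OF i] by simp
    also have "\<dots> = tr (\<lambda>v. ?x (G (i v)))"
      by (rule tr_commute[OF E_op[OF i] op[OF comp_mem[OF xB G(1)]]])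
    also have "\<dots> = 0" using c \<open>c = 0\<close> tr_0 by simp
    finally show False using G(2) by simp
  qed
  let ?y = "\<lambda>v. scale (inverse c) (j (G (i v)))"
  have xo: "operator ?x" by (rule op[OF xB])
  have xy: "i (F (j (?y v))) = i v" for v
    using operator_scale[OF xo] c E_idem[OF j] \<open>c \<noteq> 0\<close> by simp
  have yx: "?y (i (F (j v))) = scale (inverse c * c') (j v)" for v
    using c' E_idem[OF i] by simp
  have "inverse c * c' = 1"
  proof -
    obtain v where v: "?x v \<noteq> 0" using F(2) by auto
    have "?x v = ?x (?y (?x v))" using xy[of "?x v"] E_idem[OF i] by simp
    also have "\<dots> = scale (inverse c * c') (?x v)"
      unfolding yx using operator_scale[OF xo] E_idem[OF j] by simp
    finally show ?thesis using v by (metis scale_cancel_right scale_one)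
  qed
  then have "\<forall>v. ?y (i (F (j v))) = j v" using yx by simp
  moreover have "?y \<in> \<B>" by (rule scale_mem[OF comp_mem[OF E_mem[OF j] comp_mem[OF G(1) E_mem[OF i]]]])
  moreover have "j (?y v) = ?y v" "?y (i v) = ?y v" for v
    using operator_scale[OF E_op[OF j]] E_idem[OF j] E_idem[OF i] by auto
  ultimately show ?thesis using xy E_idem[OF i] by (intro bexI[of _ ?y]) auto
qed

lemma linked_refl: "i \<in> E \<Longrightarrow> linked i i"
  unfolding linked_def using E_nonzero[of i] E_idem[of i] one_mem by (intro bexI[of _ "\<lambda>x. x"]) auto

lemma linked_sym: "i \<in> E \<Longrightarrow> j \<in> E \<Longrightarrow> linked i j \<Longrightarrow> linked j i"
proof -
  assume i: "i \<in> E" and j: "j \<in> E" and "linked i j"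
  then obtain F where F: "F \<in> \<B>" "(\<lambda>x. i (F (j x))) \<noteq> (\<lambda>x. 0)" by (auto simp: linked_def)
  obtain y where y: "y \<in> \<B>" "\<And>v. j (y v) = y v" "\<And>v. y (i v) = y v" "\<And>v. y (i (F (j v))) = j v"
    using linked_inverse[OF i j F] by blast
  obtain v where "j v \<noteq> 0" using E_nonzero[OF j] by auto
  then have "j (y (i (i (F (j v))))) \<noteq> 0" using y E_idem[OF j] by simp
  then have "(\<lambda>x. j (y (i x))) \<noteq> (\<lambda>x. 0)" by (metis (mono_tags))
  then show ?thesis unfolding linked_def using y(1) by blast
qed

lemma linked_trans:
  assumes i: "i \<in> E" and j: "j \<in> E" and "k \<in> E" "linked i j" "linked j k"
  shows "linked i k"
proof -
  obtain F where F: "F \<in> \<B>" "(\<lambda>x. i (F (j x))) \<noteq> (\<lambda>x. 0)" using assms by (auto simp: linked_def)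
  obtain G v where G: "G \<in> \<B>" "j (G (k v)) \<noteq> 0" using assms by (auto simp: linked_def fun_eq_iff)
  obtain y where y: "y \<in> \<B>" "\<And>v. y (i (F (j v))) = j v"
    using linked_inverse[OF i j F] by blast
  have "i (F (j (G (k v)))) \<noteq> 0"
    using y(2)[of "G (k v)"] G(2) operator_0[OF op[OF y(1)]] by metis
  moreover have "(\<lambda>x. F (j (G x))) \<in> \<B>" by (rule comp_mem[OF F(1) comp_mem[OF E_mem[OF j] G(1)]])
  ultimately show ?thesis unfolding linked_def by (metis (no_types, lifting))
qed

text \<open>\<open>cl\<close> labels the blocks, and \<open>u i j\<close> counts as a matrix unit
  only when \<open>cl i = cl j\<close>. By the last two clauses the corners between idempotents are
  lines inside a block and zero between blocks, so the algebra is a product of full matrix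
  algebras.\<close>

definition matrix_unit_system ::
  "(('b \<Rightarrow> 'b) \<Rightarrow> ('b \<Rightarrow> 'b)) \<Rightarrow> (('b \<Rightarrow> 'b) \<Rightarrow> ('b \<Rightarrow> 'b) \<Rightarrow> ('b \<Rightarrow> 'b)) \<Rightarrow> bool" where
  "matrix_unit_system cl u \<longleftrightarrow>
     (\<forall>i\<in>E. \<forall>j\<in>E. u i j \<in> \<B>) \<and> (\<forall>i\<in>E. u i i = i) \<and>
     (\<forall>i\<in>E. \<forall>j\<in>E. \<forall>k\<in>E. \<forall>l\<in>E. cl i = cl j \<longrightarrow> cl k = cl l \<longrightarrow>
        (\<forall>x. u i j (u k l x) = (if j = k then u i l x else 0))) \<and>
     (\<forall>i\<in>E. \<forall>j\<in>E. \<forall>F\<in>\<B>. cl i = cl j \<longrightarrow> (\<exists>c. \<forall>x. i (F (j x)) = scale c (u i j x))) \<and>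
     (\<forall>i\<in>E. \<forall>j\<in>E. \<forall>F\<in>\<B>. cl i \<noteq> cl j \<longrightarrow> (\<forall>x. i (F (j x)) = 0))"

lemma matrix_unit_systemD:
  assumes "matrix_unit_system cl u"
  shows "\<And>i j. i \<in> E \<Longrightarrow> j \<in> E \<Longrightarrow> u i j \<in> \<B>"
    and "\<And>i. i \<in> E \<Longrightarrow> u i i = i"
    and "\<And>i j k l x. i \<in> E \<Longrightarrow> j \<in> E \<Longrightarrow> k \<in> E \<Longrightarrow> l \<in> E \<Longrightarrow> cl i = cl j \<Longrightarrow> cl k = cl l \<Longrightarrow>
           u i j (u k l x) = (if j = k then u i l x else 0)"
    and "\<And>i j F. i \<in> E \<Longrightarrow> j \<in> E \<Longrightarrow> F \<in> \<B> \<Longrightarrow> cl i = cl j \<Longrightarrow>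
           \<exists>c. \<forall>x. i (F (j x)) = scale c (u i j x)"
    and "\<And>i j F x. i \<in> E \<Longrightarrow> j \<in> E \<Longrightarrow> F \<in> \<B> \<Longrightarrow> cl i \<noteq> cl j \<Longrightarrow> i (F (j x)) = 0"
  using assms unfolding matrix_unit_system_def by blast+

text \<open>One representative is chosen per block, with mutually inverse connections
  \<open>X i\<close> and \<open>Y i\<close> to it; \<open>u i j\<close> passes through the
  representative.\<close>

lemma matrix_units: "\<exists>cl u. matrix_unit_system cl u"
proof -
  \<comment> \<open>The predicate depends only on the block of \<open>i\<close>, so linked
    idempotents choose the same representative.\<close>
  define cl where "cl i = (SOME r. r \<in> E \<and> linked i r)" for i
  have cl: "cl i \<in> E \<and> linked i (cl i)" if "i \<in> E" for i
    unfolding cl_def by (rule someI[of _ i]) (use that linked_refl in auto)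
  have cl_eq: "cl i = cl j \<longleftrightarrow> linked i j" if "i \<in> E" "j \<in> E" for i j
  proof
    assume "cl i = cl j"
    then show "linked i j" using cl[OF that(1)] cl[OF that(2)] that linked_sym linked_trans by metis
  next
    assume "linked i j"
    then have "linked i r \<longleftrightarrow> linked j r" if "r \<in> E" for r
      using \<open>i \<in> E\<close> \<open>j \<in> E\<close> that linked_sym linked_trans by metis
    then show "cl i = cl j" unfolding cl_def by (metis (no_types, lifting))
  qed
  define Q where "Q i x y \<longleftrightarrow> x \<in> \<B> \<and> y \<in> \<B> \<and> (\<forall>v. i (x v) = x v) \<and> (\<forall>v. x (cl i v) = x v) \<and>
      (\<forall>v. cl i (y v) = y v) \<and> (\<forall>v. y (i v) = y v) \<and> (\<forall>v. x (y v) = i v) \<and> (\<forall>v. y (x v) = cl i v)"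
    for i x y
  have "\<exists>x y. Q i x y"
    if i: "i \<in> E" for i
  proof -
    have c: "cl i \<in> E" and "linked i (cl i)" using cl i by auto
    then obtain F where F: "F \<in> \<B>" "(\<lambda>x. i (F (cl i x))) \<noteq> (\<lambda>x. 0)" by (auto simp: linked_def)
    from linked_inverse[OF i c F] obtain y where "y \<in> \<B>" "\<forall>v. cl i (y v) = y v" "\<forall>v. y (i v) = y v"
      "\<forall>v. i (F (cl i (y v))) = i v" "\<forall>v. y (i (F (cl i v))) = cl i v" by blast
    then show ?thesis
      unfolding Q_def using E_idem[OF i] E_idem[OF c] comp_mem[OF E_mem[OF i] comp_mem[OF F(1) E_mem[OF c]]]
      by (intro exI[of _ "\<lambda>v. i (F (cl i v))"] exI[of _ y]) auto
  qed
  then obtain X Y where "\<And>i. i \<in> E \<Longrightarrow> Q i (X i) (Y i)" by metis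
  then have XY: "\<And>i. i \<in> E \<Longrightarrow> X i \<in> \<B> \<and> Y i \<in> \<B>"
    "\<And>i v. i \<in> E \<Longrightarrow> i (X i v) = X i v" "\<And>i v. i \<in> E \<Longrightarrow> X i (cl i v) = X i v"
    "\<And>i v. i \<in> E \<Longrightarrow> cl i (Y i v) = Y i v" "\<And>i v. i \<in> E \<Longrightarrow> Y i (i v) = Y i v"
    "\<And>i v. i \<in> E \<Longrightarrow> X i (Y i v) = i v" "\<And>i v. i \<in> E \<Longrightarrow> Y i (X i v) = cl i v"
    by (auto simp: Q_def)
  define u where "u i j = (\<lambda>x. X i (Y j x))" for i j
  have "matrix_unit_system cl u"
    unfolding matrix_unit_system_def
  proof (intro conjI ballI impI allI)
    show "u i j \<in> \<B>" if "i \<in> E" "j \<in> E" for i j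
      unfolding u_def using XY(1) that comp_mem by blast
    show "u i i = i" if "i \<in> E" for i
      unfolding u_def using XY that by auto
    show "u i j (u k l x) = (if j = k then u i l x else 0)"
      if "i \<in> E" "j \<in> E" "k \<in> E" "l \<in> E" "cl i = cl j" "cl k = cl l" for i j k l x
    proof (cases "j = k")
      case True
      then show ?thesis using that XY by (simp add: u_def)
    next
      case False
      have "Y j (X k (Y l x)) = Y j (j (k (X k (Y l x))))"
        by (simp only: XY(5)[OF that(2)] XY(2)[OF that(3)])
      also have "\<dots> = 0"
        using E_orth[OF that(2,3) False] operator_0[OF op] XY(1) that by simp
      finally show ?thesis using False operator_0[OF op] XY(1) that by (simp add: u_def)
    qed
    show "\<exists>c. \<forall>x. i (F (j x)) = scale c (u i j x)"
      if ij: "i \<in> E" "j \<in> E" "F \<in> \<B>" "cl i = cl j" for i j F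
    proof -
      have "(\<lambda>x. Y i (F (X j x))) \<in> \<B>" using XY(1) ij comp_mem[of "Y i" "\<lambda>x. F (X j x)"] comp_mem[of F "X j"] by blast
      then obtain c where c: "\<And>x. cl i (Y i (F (X j (cl i x)))) = scale c (cl i x)"
        using primitive[of "cl i"] cl[OF ij(1)] by blast
      have "i (F (j x)) = scale c (u i j x)" for x
      proof -
        have "X j (cl i v) = X j v" for v using XY(3)[OF ij(2)] ij(4) by simp
        then have "i (F (j x)) = X i (cl i (Y i (F (X j (cl i (Y j x))))))"
          by (simp add: XY(4)[OF ij(1)] XY(6)[OF ij(1)] XY(6)[OF ij(2)])
        also have "\<dots> = scale c (X i (cl i (Y j x)))"
          unfolding c using operator_scale[OF op] XY(1)[OF ij(1)] by simp
        finally show ?thesis by (simp add: u_def XY(3)[OF ij(1)])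
      qed
      then show ?thesis by blast
    qed
    show "i (F (j x)) = 0" if "i \<in> E" "j \<in> E" "F \<in> \<B>" "cl i \<noteq> cl j" for i j F x
      using that cl_eq unfolding linked_def by (metis (no_types, lifting))
  qed
  then show ?thesis by blast
qed

end

section \<open>Calculus of Sweedler notation\<close>

lemma bilinear_mapD:
  assumes "bilinear_map s t u f"
  shows "f (v + v') w = f v w + f v' w" "f v (w + w') = f v w + f v w'"
    "f (s c v) w = u c (f v w)" "f v (t c w) = u c (f v w)"
    "vector_space s" "vector_space t" "vector_space u"
  using assms by (auto simp: bilinear_map_def Vector_Spaces.linear_iff)

lemma bilinear_mapI:
  assumes "vector_space s" "vector_space t" "vector_space u"
    "\<And>v v' w. f (v + v') w = f v w + f v' w" "\<And>v w w'. f v (w + w') = f v w + f v w'"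
    "\<And>c v w. f (s c v) w = u c (f v w)" "\<And>c v w. f v (t c w) = u c (f v w)"
  shows "bilinear_map s t u f"
  using assms by (auto simp: bilinear_map_def Vector_Spaces.linear_iff)

lemma vector_space_mult: "vector_space ((*) :: 'k::field \<Rightarrow> 'k \<Rightarrow> 'k)"
  by unfold_locales (auto simp: algebra_simps)

lemma linear_sum_list:
  assumes "Vector_Spaces.linear s t g"
  shows "g (\<Sum>x\<leftarrow>xs. f x) = (\<Sum>x\<leftarrow>xs. g (f x))"
proof -
  have "g 0 = 0" using assms by (metis add_cancel_right_right Vector_Spaces.linear_iff)
  then show ?thesis using assms by (induction xs) (auto simp: Vector_Spaces.linear_iff)
qed

lemma sweedler_push:
  assumes f: "bilinear_map s t u f" and g: "Vector_Spaces.linear u w g" and z: "z \<in> tensor_space s t"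
  shows "g (sweedler s t z f) = sweedler s t z (\<lambda>x y. g (f x y))"
proof -
  obtain xs where xs: "z = (\<Sum>(v, w)\<leftarrow>xs. v \<otimes>[s,t] w)"
    by (rule tensor_space_sum_list[OF bilinear_mapD(5,6)[OF f] z])
  have b: "bilinear_map s t w (\<lambda>x y. g (f x y))"
    using f g by (auto simp: bilinear_map_def Vector_Spaces.linear_iff)
  show ?thesis
    unfolding xs sweedler_sum_list[OF f] sweedler_sum_list[OF b]
    by (simp add: linear_sum_list[OF g] case_prod_unfold)
qed

lemma sweedler_linear:
  assumes D: "Vector_Spaces.linear r fscale D" "\<And>x. D x \<in> tensor_space s t"
    and f: "bilinear_map s t u f"
  shows "Vector_Spaces.linear r u (\<lambda>x. sweedler s t (D x) f)"
  using D(1) tensor_universal_property(2,3)[OF f D(2)] D(2) bilinear_mapD(7)[OF f]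
  by (auto simp: Vector_Spaces.linear_iff)

text \<open>One list representing \<open>z\<close> serves for all values of the parameter.\<close>

lemma sweedler_linear_parameter:
  assumes z: "z \<in> tensor_space s t" and f: "\<And>p. bilinear_map s t u (f p)"
    and lin: "\<And>v w. Vector_Spaces.linear r u (\<lambda>p. f p v w)"
  shows "Vector_Spaces.linear r u (\<lambda>p. sweedler s t z (f p))"
proof -
  obtain xs where xs: "z = (\<Sum>(v, w)\<leftarrow>xs. v \<otimes>[s,t] w)"
    by (rule tensor_space_sum_list[OF bilinear_mapD(5,6)[OF f] z])
  have vu: "vector_space u" and vr: "vector_space r"
    using lin by (auto simp: Vector_Spaces.linear_iff)
  interpret u: vector_space u by (rule vu)
  have 1: "f (p + q) v w = f p v w + f q v w" and 2: "f (r c p) v w = u c (f p v w)" for p q c v w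
    using lin by (auto simp: Vector_Spaces.linear_iff)
  have "(\<Sum>(v, w)\<leftarrow>xs. f (p + q) v w) = (\<Sum>(v, w)\<leftarrow>xs. f p v w) + (\<Sum>(v, w)\<leftarrow>xs. f q v w)"
    and "(\<Sum>(v, w)\<leftarrow>xs. f (r c p) v w) = u c (\<Sum>(v, w)\<leftarrow>xs. f p v w)" for p q c
    by (induction xs) (auto simp: 1 2 u.scale_right_distrib)
  then show ?thesis
    unfolding xs sweedler_sum_list[OF f] using vu vr by (auto simp: Vector_Spaces.linear_iff)
qed

text \<open>A tensor is a function on bilinear forms, so a scalar-valued Sweedler sum is plain
  application.\<close>

lemma sweedler_eval:
  assumes f: "bilinear_map s t (*) f" and z: "z \<in> tensor_space s t"
  shows "sweedler s t z f = z f"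
proof -
  obtain xs where xs: "z = (\<Sum>(v, w)\<leftarrow>xs. v \<otimes>[s,t] w)"
    by (rule tensor_space_sum_list[OF bilinear_mapD(5,6)[OF f] z])
  show ?thesis unfolding xs sweedler_sum_list[OF f] sum_list_tens_apply[OF f] ..
qed

lemma linear_eval: "Vector_Spaces.linear fscale (*) (\<lambda>z. z \<beta>)"
  using vector_space_fscale vector_space_mult by (auto simp: Vector_Spaces.linear_iff fscale_def)

lemma bilinear_eval_inner:
  "Vector_Spaces.linear s (*) f \<Longrightarrow> bilinear_map s fscale (*) (\<lambda>y z. f y * z \<gamma>)"
  using vector_space_fscale
  by (auto simp: bilinear_map_def Vector_Spaces.linear_iff fscale_def algebra_simps
      vector_space_mult)

lemma tens_in_tensor_sub: "v \<in> V \<Longrightarrow> w \<in> W \<Longrightarrow> v \<otimes>[s,t] w \<in> tensor_sub s t V W"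
proof -
  assume vw: "v \<in> V" "w \<in> W"
  interpret F: vector_space "fscale :: 'k::field \<Rightarrow> ('x \<Rightarrow> 'k) \<Rightarrow> _" by (rule vector_space_fscale)
  show ?thesis unfolding tensor_sub_def by (rule F.span_base) (use vw in blast)
qed

lemma subspace_tensor_sub: "module.subspace fscale (tensor_sub s t V W)"
proof -
  interpret F: vector_space "fscale :: 'k::field \<Rightarrow> ('x \<Rightarrow> 'k) \<Rightarrow> _" by (rule vector_space_fscale)
  show ?thesis unfolding tensor_sub_def by (rule F.subspace_span)
qed

lemma tens_in_tensor_space: "v \<otimes>[s,t] w \<in> tensor_space s t"
  by (simp add: tens_in_tensor_sub)

section \<open>Hopf algebras\<close>

locale hopf_vspace = hopf_algebra s \<Delta> \<epsilon> S + vspace s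
  for s :: "'k::field \<Rightarrow> 'h::ring_1 \<Rightarrow> 'h" and \<Delta> \<epsilon> S
begin

lemma vs: "vector_space s"
  by (rule vector_space_axioms)

abbreviation bifunctional :: "('h \<Rightarrow> 'h \<Rightarrow> 'k) \<Rightarrow> bool" where
  "bifunctional \<equiv> bilinear_map s s (*)"

lemma bifunctional_iff:
  "bifunctional F \<longleftrightarrow> (\<forall>y. functional (\<lambda>x. F x y)) \<and> (\<forall>x. functional (F x))"
  by (simp add: bilinear_map_def functional_iff)

lemma bifunctionalI:
  "(\<And>y. functional (\<lambda>x. F x y)) \<Longrightarrow> (\<And>x. functional (\<lambda>y. F x y)) \<Longrightarrow> bifunctional F"
  by (simp add: bifunctional_iff)

lemma functional_bif_left: "bifunctional F \<Longrightarrow> operator G \<Longrightarrow> functional (\<lambda>x. F (G x) y)"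
  and functional_bif_right: "bifunctional F \<Longrightarrow> operator G \<Longrightarrow> functional (\<lambda>x. F y (G x))"
  by (auto simp: bifunctional_iff functional_def operator_def)

lemma linear_functional: "functional f \<Longrightarrow> Vector_Spaces.linear s (*) f"
  by (simp add: functional_iff)

lemma functional_times: "functional F \<Longrightarrow> functional (\<lambda>x. c * F x)"
  and functional_times_right: "functional F \<Longrightarrow> functional (\<lambda>x. F x * c)"
  by (auto simp: functional_def algebra_simps)

lemma functional_plus: "functional F \<Longrightarrow> functional G \<Longrightarrow> functional (\<lambda>x. F x + G x)"
  by (auto simp: functional_def algebra_simps)

lemma functional_minus: "functional F \<Longrightarrow> functional G \<Longrightarrow> functional (\<lambda>x. F x - G x)"
  by (auto simp: functional_def algebra_simps)

lemma functional_counit: "functional \<epsilon>"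
  using counit_linear functional_iff by blast

lemma operator_antipode: "operator S"
  using antipode_linear operator_iff by blast

lemma operator_id: "operator (\<lambda>x. x)"
  and operator_mult_left: "operator G \<Longrightarrow> operator (\<lambda>x. c * G x)"
  and operator_mult_right: "operator G \<Longrightarrow> operator (\<lambda>x. G x * c)"
  and operator_antipode_comp: "operator G \<Longrightarrow> operator (\<lambda>x. S (G x))"
  and operator_scale_comp: "operator G \<Longrightarrow> operator (\<lambda>x. s k (G x))"
  using operator_antipode
  by (auto simp: operator_def distrib_left distrib_right scale_mult_left scale_mult_right
      scale_right_distrib mult.commute)

lemma counit_add: "\<epsilon> (x + y) = \<epsilon> x + \<epsilon> y"
  and counit_scale: "\<epsilon> (s c x) = c * \<epsilon> x"
  using functional_counit by (auto simp: functional_def)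

lemma antipode_add: "S (x + y) = S x + S y"
  and antipode_scale: "S (s c x) = s c (S x)"
  using operator_antipode by (auto simp: operator_def)

lemma functional_comult: "functional (\<lambda>x. \<Delta> x F)"
  using comult_linear unfolding functional_def by (auto simp: Vector_Spaces.linear_iff fscale_def)

lemma comult_eval_list:
  obtains xs where "\<Delta> x = (\<Sum>(v, w)\<leftarrow>xs. v \<otimes>[s,s] w)" "\<And>F. bifunctional F \<Longrightarrow> \<Delta> x F = (\<Sum>(v, w)\<leftarrow>xs. F v w)"
proof -
  obtain xs where xs: "\<Delta> x = (\<Sum>(v, w)\<leftarrow>xs. v \<otimes>[s,s] w)"
    by (rule tensor_space_sum_list[OF vs vs comult_in])
  show ?thesis by (rule that[OF xs]) (unfold xs, rule sum_list_tens_apply)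
qed

lemma functional_comult_body:
  assumes F: "\<And>p. bifunctional (F p)" and lin: "\<And>a b. functional (\<lambda>p. F p a b)"
  shows "functional (\<lambda>p. \<Delta> x (F p))"
proof -
  have "functional (\<lambda>p. sweedler s s (\<Delta> x) (F p))"
    unfolding functional_iff
    by (rule sweedler_linear_parameter[OF comult_in F]) (use lin in \<open>simp add: functional_iff\<close>)
  then show ?thesis by (simp add: sweedler_eval[OF F comult_in])
qed

lemmas fnh = operator_id operator_mult_left operator_mult_right operator_antipode_comp
  functional_times functional_times_right functional_comp[OF functional_counit]

lemma comult_cong: "(\<And>a b. F a b = G a b) \<Longrightarrow> \<Delta> x F = \<Delta> x G"
  by presburger

lemma comult_scale:
  assumes "bifunctional F"
  shows "\<Delta> x (\<lambda>a b. c * F a b) = c * \<Delta> x F" "\<Delta> x (\<lambda>a b. F a b * c) = \<Delta> x F * c"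
proof -
  obtain xs where xs: "\<And>F. bifunctional F \<Longrightarrow> \<Delta> x F = (\<Sum>(v, w)\<leftarrow>xs. F v w)" by (rule comult_eval_list[of x]) (rule that)
  have b: "bifunctional (\<lambda>a b. c * F a b)" "bifunctional (\<lambda>a b. F a b * c)"
    using bilinear_mapD[OF assms] vs
    by (auto intro!: bilinear_mapI vector_space_mult simp: algebra_simps)
  show "\<Delta> x (\<lambda>a b. c * F a b) = c * \<Delta> x F" "\<Delta> x (\<lambda>a b. F a b * c) = \<Delta> x F * c"
    unfolding xs[OF b(1)] xs[OF b(2)] xs[OF assms]
    by (simp_all add: case_prod_unfold sum_list_const_mult sum_list_mult_const)
qed

lemma comult_swap:
  assumes "\<And>b c d. functional (\<lambda>a. F a b c d)" "\<And>a c d. functional (\<lambda>b. F a b c d)"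
    "\<And>a b d. functional (\<lambda>c. F a b c d)" "\<And>a b c. functional (\<lambda>d. F a b c d)"
  shows "\<Delta> x (\<lambda>a b. \<Delta> y (\<lambda>c d. F a b c d)) = \<Delta> y (\<lambda>c d. \<Delta> x (\<lambda>a b. F a b c d))"
proof -
  obtain xs where xs: "\<And>F. bifunctional F \<Longrightarrow> \<Delta> x F = (\<Sum>(v, w)\<leftarrow>xs. F v w)" by (rule comult_eval_list[of x]) (rule that)
  obtain ys where ys: "\<And>F. bifunctional F \<Longrightarrow> \<Delta> y F = (\<Sum>(v, w)\<leftarrow>ys. F v w)" by (rule comult_eval_list[of y]) (rule that)
  have b: "bifunctional (F a b)" "bifunctional (\<lambda>a b. F a b c d)" for a b c d
    using assms by (auto intro!: bifunctionalI)
  have b': "bifunctional (\<lambda>a b. \<Delta> y (F a b))" "bifunctional (\<lambda>c d. \<Delta> x (\<lambda>a b. F a b c d))"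
    by (intro bifunctionalI functional_comult_body b assms)+
  have "(\<Sum>x\<leftarrow>xs. \<Sum>y\<leftarrow>ys. g x y) = (\<Sum>y\<leftarrow>ys. \<Sum>x\<leftarrow>xs. g x y)" for g :: "'h \<times> 'h \<Rightarrow> 'h \<times> 'h \<Rightarrow> 'k"
    by (induction xs) (simp_all add: sum_list_addf)
  then show ?thesis
    unfolding xs[OF b'(1)] ys[OF b'(2)] unfolding ys[OF b(1)] xs[OF b(2)]
    by (simp add: case_prod_unfold)
qed

text \<open>The axiom is an equation in the nested tensor space. To test it against a trilinear
  \<open>F\<close>, a bilinear form on pairs of a vector and a tensor has to be built from
  \<open>F\<close>; this is \<open>\<Psi>\<close>.\<close>

lemma comult_coassoc:
  assumes F: "\<And>b c. functional (\<lambda>a. F a b c)" "\<And>a c. functional (\<lambda>b. F a b c)" "\<And>a b. functional (F a b)"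
  shows "\<Delta> x (\<lambda>a b. \<Delta> a (\<lambda>c d. F c d b)) = \<Delta> x (\<lambda>a b. \<Delta> b (\<lambda>c d. F a c d))"
proof -
  interpret T: vector_space "fscale :: 'k \<Rightarrow> ('k, 'h, 'h) tensor \<Rightarrow> _" by (rule vector_space_fscale)
  interpret TT: vector_space_pair "fscale :: 'k \<Rightarrow> ('k, 'h, 'h) tensor \<Rightarrow> _" "fscale :: 'k \<Rightarrow> ('k, 'h, 'h) tensor \<Rightarrow> _"
    by unfold_locales
  let ?T = "tensor_space s s"
  \<comment> \<open>On elements of the type of \<open>?T\<close> outside \<open>?T\<close>, evaluation at \<open>F y\<close> need not be linear in
    \<open>y\<close>; the projection \<open>P\<close> removes this junk.\<close>
  have "\<exists>P. range P \<subseteq> ?T \<and> Vector_Spaces.linear fscale fscale P \<and> (\<forall>z\<in>?T. P (id z) = z)"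
    by (rule TT.linear_exists_left_inverse_on[OF T.linear_id])
      (simp_all add: tensor_sub_def T.subspace_span)
  then obtain P :: "('k, 'h, 'h) tensor \<Rightarrow> ('k, 'h, 'h) tensor"
    where P: "\<And>z. P z \<in> ?T" "Vector_Spaces.linear fscale fscale P" "\<And>z. z \<in> ?T \<Longrightarrow> P z = z"
    by auto
  have bF: "bifunctional (F a)" "bifunctional (\<lambda>c d. F c d b)" for a b using F by (auto intro!: bifunctionalI)
  define \<Psi> where "\<Psi> y z = P z (F y)" for y z
  have b\<Psi>: "bilinear_map s fscale (*) \<Psi>"
  proof (intro bilinear_mapI vs vector_space_fscale vector_space_mult)
    have lin: "functional (\<lambda>y. P z (F y))" for z
    proof -
      have "functional (\<lambda>y. sweedler s s (P z) (F y))"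
        unfolding functional_iff
        by (rule sweedler_linear_parameter[OF P(1) bF(1)]) (use F(1) in \<open>simp add: functional_iff\<close>)
      then show ?thesis by (simp add: sweedler_eval[OF bF(1) P(1)])
    qed
    show "\<Psi> (v + v') w = \<Psi> v w + \<Psi> v' w" "\<Psi> (s c v) w = c * \<Psi> v w" for v v' w c
      unfolding \<Psi>_def by (rule functional_add[OF lin], rule functional_scale[OF lin])
    show "\<Psi> v (w + w') = \<Psi> v w + \<Psi> v w'" "\<Psi> v (fscale c w) = c * \<Psi> v w" for v w w' c
      using P(2) by (simp_all add: \<Psi>_def Vector_Spaces.linear_iff fscale_def)
  qed
  define ev where "ev = (\<lambda>z :: ('k, 'h, ('k, 'h, 'h) tensor) tensor. z \<Psi>)"
  have lin_ev: "Vector_Spaces.linear fscale (*) ev" unfolding ev_def by (rule linear_eval)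
  have pure: "ev (y \<otimes>[s,fscale] z) = z (F y)" if "z \<in> ?T" for y z
    using b\<Psi> P(3)[OF that] by (simp add: ev_def tens_def \<Psi>_def)
  have pure2: "ev (y \<otimes>[s,fscale] (z \<otimes>[s,s] w)) = F y z w" for y z w
    using bF(1)[of y] by (simp add: pure tens_in_tensor_space) (simp add: tens_def)
  have tt: "bilinear_map s s fscale (\<lambda>v w. v \<otimes>[s,s] w)"
    by (rule bilinear_map_tens[OF vs vs])
  have tf: "bilinear_map s fscale fscale (\<lambda>v w. v \<otimes>[s,fscale] (w :: ('k, 'h, 'h) tensor))"
    by (rule bilinear_map_tens[OF vs vector_space_fscale])
  have b1: "bilinear_map s s fscale (\<lambda>y z. y \<otimes>[s,fscale] (z \<otimes>[s,s] x2))" for x2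
    using bilinear_mapD[OF tt] bilinear_mapD[OF tf] by (intro bilinear_mapI) auto
  have b1': "bilinear_map s s fscale (\<lambda>x1 x2. sweedler s s (\<Delta> x1) (\<lambda>y z. y \<otimes>[s,fscale] (z \<otimes>[s,s] x2)))"
    unfolding bilinear_map_def
  proof (intro conjI allI)
    show "Vector_Spaces.linear s fscale
        (\<lambda>x1. sweedler s s (\<Delta> x1) (\<lambda>y z. y \<otimes>[s,fscale] (z \<otimes>[s,s] x2)))" for x2
      by (rule sweedler_linear[OF comult_linear comult_in b1])
    show "Vector_Spaces.linear s fscale
        (\<lambda>x2. sweedler s s (\<Delta> x1) (\<lambda>y z. y \<otimes>[s,fscale] (z \<otimes>[s,s] x2)))" for x1
      using bilinear_mapD[OF tt] bilinear_mapD[OF tf]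
      by (intro sweedler_linear_parameter[OF comult_in b1]) (auto simp: Vector_Spaces.linear_iff)
  qed
  have b2: "bilinear_map s s fscale (\<lambda>x1 x2. x1 \<otimes>[s,fscale] \<Delta> x2)"
    using bilinear_mapD[OF tf] comult_linear
    by (intro bilinear_mapI) (auto simp: Vector_Spaces.linear_iff)
  have "\<Delta> x (\<lambda>a b. \<Delta> a (\<lambda>c d. F c d b)) = sweedler s s (\<Delta> x) (\<lambda>a b. \<Delta> a (\<lambda>c d. F c d b))"
    by (rule sweedler_eval[symmetric, OF _ comult_in])
      (intro bifunctionalI functional_comult functional_comult_body bF F)
  also have "\<dots> = sweedler s s (\<Delta> x) (\<lambda>x1 x2. sweedler s s (\<Delta> x1) (\<lambda>y z. F y z x2))"
    unfolding sweedler_eval[OF bF(2) comult_in] ..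
  also have "\<dots> = ev (sweedler s s (\<Delta> x) (\<lambda>x1 x2. sweedler s s (\<Delta> x1) (\<lambda>y z. y \<otimes>[s,fscale] (z \<otimes>[s,s] x2))))"
    unfolding sweedler_push[OF b1' lin_ev comult_in] sweedler_push[OF b1 lin_ev comult_in] pure2 ..
  also have "\<dots> = ev (sweedler s s (\<Delta> x) (\<lambda>x1 x2. x1 \<otimes>[s,fscale] \<Delta> x2))"
    unfolding coassoc ..
  also have "\<dots> = sweedler s s (\<Delta> x) (\<lambda>x1 x2. \<Delta> x2 (F x1))"
    unfolding sweedler_push[OF b2 lin_ev comult_in] pure[OF comult_in] ..
  also have "\<dots> = \<Delta> x (\<lambda>a b. \<Delta> b (\<lambda>c d. F a c d))"
    by (rule sweedler_eval[OF _ comult_in]) (intro bifunctionalI functional_comult functional_comult_body bF F)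
  finally show ?thesis .
qed

lemma comult_mult_eval:
  assumes F: "bifunctional F"
  shows "\<Delta> (x * y) F = \<Delta> x (\<lambda>a b. \<Delta> y (\<lambda>c d. F (a * c) (b * d)))"
proof -
  have tt: "bilinear_map s s fscale (\<lambda>v w. v \<otimes>[s,s] w)" by (rule bilinear_map_tens[OF vs vs])
  have b1: "bilinear_map s s fscale (\<lambda>c d. (a * c) \<otimes>[s,s] (b * d))" for a b
    using bilinear_mapD[OF tt] by (intro bilinear_mapI) (auto simp: distrib_left scale_mult_right)
  have b1': "bilinear_map s s fscale (\<lambda>a b. (a * c) \<otimes>[s,s] (b * d))" for c d
    using bilinear_mapD[OF tt] by (intro bilinear_mapI) (auto simp: distrib_right scale_mult_left)
  have b2: "bilinear_map s s fscale (\<lambda>a b. sweedler s s (\<Delta> y) (\<lambda>c d. (a * c) \<otimes>[s,s] (b * d)))"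
    unfolding bilinear_map_def
    by (intro conjI allI sweedler_linear_parameter[OF comult_in b1])
      (use b1' in \<open>auto simp: bilinear_map_def\<close>)
  have fF: "functional (\<lambda>u. F (G u) v)" "functional (\<lambda>u. F v (G u))" if "operator G" for G v
    using F that unfolding bilinear_map_def functional_iff[symmetric] by (auto intro: functional_comp)
  have bF: "bifunctional (\<lambda>c d. F (a * c) (b * d))" for a b by (intro bifunctionalI fF fnh)
  have bF': "bifunctional (\<lambda>a b. \<Delta> y (\<lambda>c d. F (a * c) (b * d)))"
    by (intro bifunctionalI functional_comult_body bF) (intro fF fnh)+
  have "\<Delta> (x * y) F = sweedler s s (\<Delta> x) (\<lambda>a b. sweedler s s (\<Delta> y) (\<lambda>c d. ((a * c) \<otimes>[s,s] (b * d)) F))"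
    unfolding comult_mult sweedler_push[OF b2 linear_eval comult_in] sweedler_push[OF b1 linear_eval comult_in] ..
  also have "\<dots> = sweedler s s (\<Delta> x) (\<lambda>a b. sweedler s s (\<Delta> y) (\<lambda>c d. F (a * c) (b * d)))"
    using F by (simp add: tens_def)
  also have "\<dots> = \<Delta> x (\<lambda>a b. \<Delta> y (\<lambda>c d. F (a * c) (b * d)))"
    unfolding sweedler_eval[OF bF comult_in] sweedler_eval[OF bF' comult_in] ..
  finally show ?thesis .
qed

lemma counit_eval:
  assumes f: "functional f"
  shows "\<Delta> x (\<lambda>a b. \<epsilon> a * f b) = f x" "\<Delta> x (\<lambda>a b. \<epsilon> b * f a) = f x"
proof -
  have lf: "Vector_Spaces.linear s (*) f" using f by (simp add: functional_iff)
  have b: "bilinear_map s s s (\<lambda>a b. s (\<epsilon> a) b)" "bilinear_map s s s (\<lambda>a b. s (\<epsilon> b) a)"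
    using functional_add[OF functional_counit] functional_scale[OF functional_counit] vs
    by (auto intro!: bilinear_mapI simp: scale_left_distrib scale_right_distrib mult.commute)
  have e: "bifunctional (\<lambda>a b. \<epsilon> a * f b)" "bifunctional (\<lambda>a b. \<epsilon> b * f a)"
    using f by (auto intro!: bifunctionalI functional_times functional_times_right functional_counit)
  show "\<Delta> x (\<lambda>a b. \<epsilon> a * f b) = f x"
    using arg_cong[OF counit_left, of f x] sweedler_push[OF b(1) lf comult_in, of x] sweedler_eval[OF e(1) comult_in, of x]
    by (simp add: functional_scale[OF f])
  show "\<Delta> x (\<lambda>a b. \<epsilon> b * f a) = f x"
    using arg_cong[OF counit_right, of f x] sweedler_push[OF b(2) lf comult_in, of x] sweedler_eval[OF e(2) comult_in, of x]
    by (simp add: functional_scale[OF f])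
qed

lemma antipode_eval:
  assumes f: "functional f"
  shows "\<Delta> x (\<lambda>a b. f (S a * b)) = \<epsilon> x * f 1" "\<Delta> x (\<lambda>a b. f (a * S b)) = \<epsilon> x * f 1"
proof -
  have lf: "Vector_Spaces.linear s (*) f" using f by (simp add: functional_iff)
  have b: "bilinear_map s s s (\<lambda>a b. S a * b)" "bilinear_map s s s (\<lambda>a b. a * S b)"
    using antipode_linear vs
    by (auto intro!: bilinear_mapI simp: Vector_Spaces.linear_iff distrib_left distrib_right
        scale_mult_left scale_mult_right)
  have e: "bifunctional (\<lambda>a b. f (S a * b))" "bifunctional (\<lambda>a b. f (a * S b))"
    by (intro bifunctionalI functional_comp[OF f] fnh)+
  show "\<Delta> x (\<lambda>a b. f (S a * b)) = \<epsilon> x * f 1"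
    using arg_cong[OF antipode_left, of f x] sweedler_push[OF b(1) lf comult_in, of x] sweedler_eval[OF e(1) comult_in, of x]
    by (simp add: functional_scale[OF f])
  show "\<Delta> x (\<lambda>a b. f (a * S b)) = \<epsilon> x * f 1"
    using arg_cong[OF antipode_right, of f x] sweedler_push[OF b(2) lf comult_in, of x] sweedler_eval[OF e(2) comult_in, of x]
    by (simp add: functional_scale[OF f])
qed

end

section \<open>Finite-dimensional Hopf algebras\<close>

locale fd_hopf = hopf_vspace s \<Delta> \<epsilon> S + fd_space s B
  for s :: "'k::{alg_closed_field,field_char_0} \<Rightarrow> 'h::ring_1 \<Rightarrow> 'h" and \<Delta> \<epsilon> S B
begin

text \<open>Structure constants: the coefficient of \<open>b \<otimes> c\<close> in
  \<open>\<Delta> x\<close>.\<close>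

definition delta :: "'h \<Rightarrow> 'h \<Rightarrow> 'h \<Rightarrow> 'k" where
  "delta b c x = \<Delta> x (\<lambda>v w. coord b v * coord c w)"

text \<open>Sweedler sums in coordinates: linear in \<open>x\<close>, and subject to coassociativity and Fubini, for
  arbitrary \<open>F\<close>, because \<open>F\<close> is only evaluated at basis vectors.\<close>

definition sw :: "'h \<Rightarrow> ('h \<Rightarrow> 'h \<Rightarrow> 'k) \<Rightarrow> 'k" where
  "sw x F = (\<Sum>b\<in>B. \<Sum>c\<in>B. delta b c x * F b c)"

lemma bifunctional_coord: "bifunctional (\<lambda>v w. coord b v * coord c w)"
  by (auto simp: bifunctional_iff functional_def functional_add[OF functional_coord]
      functional_scale[OF functional_coord] algebra_simps)

lemma bifunctional_expand:
  "bifunctional F \<Longrightarrow> F x y = (\<Sum>b\<in>B. \<Sum>c\<in>B. coord b x * coord c y * F b c)"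
proof -
  assume F: "bifunctional F"
  have "F x y = (\<Sum>b\<in>B. coord b x * F b y)"
    using F functional_expand[of "\<lambda>x. F x y" x] by (simp add: bifunctional_iff)
  also have "\<dots> = (\<Sum>b\<in>B. coord b x * (\<Sum>c\<in>B. coord c y * F b c))"
    using F functional_expand[of "F _" y] by (simp add: bifunctional_iff)
  finally show ?thesis by (simp add: sum_distrib_left mult.assoc)
qed

lemma sw_eval:
  assumes F: "bifunctional F"
  shows "sw x F = \<Delta> x F"
proof -
  obtain xs where xs: "\<And>F. bifunctional F \<Longrightarrow> \<Delta> x F = (\<Sum>(v, w)\<leftarrow>xs. F v w)"
    by (rule comult_eval_list[of x]) (rule that)
  have cc: "(\<Sum>b\<in>B. \<Sum>c\<in>B. (\<Sum>(v, w)\<leftarrow>xs. coord b v * coord c w) * F b c) =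
      (\<Sum>(v, w)\<leftarrow>xs. \<Sum>b\<in>B. \<Sum>c\<in>B. coord b v * coord c w * F b c)"
    by (induction xs) (auto simp: sum.distrib algebra_simps)
  have e: "(\<Sum>b\<in>B. \<Sum>c\<in>B. coord b v * coord c w * F b c) = F v w" for v w
    by (rule bifunctional_expand[OF F, symmetric])
  show ?thesis
    unfolding sw_def delta_def xs[OF bifunctional_coord] xs[OF F] cc e ..
qed

lemma sw_sweedler: "bifunctional F \<Longrightarrow> sweedler s s (\<Delta> x) F = sw x F"
  by (simp add: sweedler_eval comult_in sw_eval)

lemma delta_add: "delta b c (x + y) = delta b c x + delta b c y"
  and delta_scale: "delta b c (s a x) = a * delta b c x"
  using comult_linear by (auto simp: Vector_Spaces.linear_iff delta_def fscale_def)

lemma sw_add: "sw (x + y) F = sw x F + sw y F"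
  by (simp add: sw_def delta_add algebra_simps sum.distrib)

lemma sw_scale: "sw (s c x) F = c * sw x F"
  by (simp add: sw_def delta_scale sum_distrib_left algebra_simps)

lemma functional_sw: "functional (\<lambda>x. sw x F)"
  by (simp add: functional_def sw_add sw_scale)

lemma sw_plus: "sw x (\<lambda>a b. F a b + G a b) = sw x F + sw x G"
  by (simp add: sw_def algebra_simps sum.distrib)

lemma sw_times: "sw x (\<lambda>a b. c * F a b) = c * sw x F"
  unfolding sw_def sum_distrib_left by (intro sum.cong refl) (rule mult.left_commute)

lemma sw_times_right: "sw x (\<lambda>a b. F a b * c) = sw x F * c"
  unfolding sw_def sum_distrib_right by (intro sum.cong refl) (rule mult.assoc[symmetric])

lemma sw_sum: "sw x (\<lambda>a b. \<Sum>i\<in>I. F i a b) = (\<Sum>i\<in>I. sw x (F i))"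
  by (induction I rule: infinite_finite_induct) (auto simp: sw_plus, auto simp: sw_def)

lemma sw_swap: "sw x (\<lambda>a b. sw y (\<lambda>c d. F a b c d)) = sw y (\<lambda>c d. sw x (\<lambda>a b. F a b c d))"
proof -
  have 1: "sw x F = (\<Sum>p\<in>B \<times> B. delta (fst p) (snd p) x * F (fst p) (snd p))" for x F
    unfolding sw_def sum.cartesian_product by (simp add: case_prod_unfold)
  show ?thesis
    unfolding 1 sum_distrib_left
    by (subst sum.swap) (simp add: algebra_simps)
qed

lemma functional_big_sum: "(\<And>i. i \<in> I \<Longrightarrow> functional (F i)) \<Longrightarrow> functional (\<lambda>x. \<Sum>i\<in>I. F i x)"
  by (auto simp: functional_def sum.distrib sum_distrib_left)

lemma functional_sw_body: "(\<And>a b. functional (\<lambda>x. F x a b)) \<Longrightarrow> functional (\<lambda>x. sw y (F x))"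
  unfolding sw_def by (intro functional_big_sum functional_times)

lemma functional_sw_arg: "operator G \<Longrightarrow> functional (\<lambda>x. sw (G x) F)"
  using functional_comp[OF functional_sw] .

lemmas fn_intros = functional_times functional_times_right functional_plus functional_minus
  functional_sw_body functional_sw_arg
  functional_comp[OF functional_coord] functional_comp[OF functional_counit]
  operator_id operator_mult_left operator_mult_right operator_antipode_comp operator_scale_comp

text \<open>Since \<open>F\<close> is evaluated at basis vectors, only an identity between structure
  constants is at stake (\<open>key\<close>), and that is coassociativity tested on products of
  coordinate functions.\<close>

lemma sw_coassoc:
  "sw x (\<lambda>a b. sw a (\<lambda>c d. F c d b)) = sw x (\<lambda>a b. sw b (\<lambda>c d. F a c d))"
proof -
  have rot: "(\<Sum>a\<in>B. \<Sum>b\<in>B. \<Sum>c\<in>B. \<Sum>d\<in>B. f a b c d) =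
      (\<Sum>b\<in>B. \<Sum>c\<in>B. \<Sum>d\<in>B. \<Sum>a\<in>B. f a b c d)" for f :: "'h \<Rightarrow> 'h \<Rightarrow> 'h \<Rightarrow> 'h \<Rightarrow> 'k"
    by (subst sum.swap, rule sum.cong[OF refl], subst sum.swap, rule sum.cong[OF refl], rule sum.swap)
  have key: "(\<Sum>a\<in>B. delta a b x * delta c d a) = (\<Sum>a\<in>B. delta c a x * delta d b a)"
    if b: "b \<in> B" and c': "c \<in> B" for b c d
  proof -
    have delta_sw: "sw y (\<lambda>v w. coord p v * coord q w) = delta p q y" for p q y
      by (simp add: delta_def sw_eval[OF bifunctional_coord])
    have eq: "sw x (\<lambda>x1 x2. sw x1 (\<lambda>y z. coord c y * (coord d z * coord b x2))) =
        sw x (\<lambda>x1 x2. sw x2 (\<lambda>y z. coord c x1 * (coord d y * coord b z)))"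
    proof -
      let ?F = "\<lambda>y z w. coord c y * (coord d z * coord b w)"
      note fi = bifunctionalI fn_intros
      have "sw x1 (\<lambda>y z. ?F y z w) = \<Delta> x1 (\<lambda>y z. ?F y z w)" "sw x1 (?F w) = \<Delta> x1 (?F w)" for x1 w
        by (rule sw_eval; intro fi)+
      moreover have "sw x (\<lambda>x1 x2. sw x1 (\<lambda>y z. ?F y z x2)) = \<Delta> x (\<lambda>x1 x2. sw x1 (\<lambda>y z. ?F y z x2))"
        "sw x (\<lambda>x1 x2. sw x2 (?F x1)) = \<Delta> x (\<lambda>x1 x2. sw x2 (?F x1))"
        by (rule sw_eval; intro fi)+
      moreover have "\<Delta> x (\<lambda>a b. \<Delta> a (\<lambda>c d. ?F c d b)) = \<Delta> x (\<lambda>a b. \<Delta> b (?F a))"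
        by (rule comult_coassoc[of ?F]) (intro fi)+
      ultimately show ?thesis by simp
    qed
    have "sw x (\<lambda>x1 x2. sw x1 (\<lambda>y z. coord c y * (coord d z * coord b x2))) =
        sw x (\<lambda>x1 x2. delta c d x1 * coord b x2)"
      by (simp flip: mult.assoc add: sw_times_right delta_sw)
    also have "\<dots> = (\<Sum>a\<in>B. delta a b x * delta c d a)"
      using b by (simp add: sw_def coord_basis mult.assoc if_distrib[of "(*) _"] sum.delta B_finite
          cong: if_cong)
    finally have 3: "sw x (\<lambda>x1 x2. sw x1 (\<lambda>y z. coord c y * (coord d z * coord b x2))) =
        (\<Sum>a\<in>B. delta a b x * delta c d a)" .
    have "sw x (\<lambda>x1 x2. sw x2 (\<lambda>y z. coord c x1 * (coord d y * coord b z))) = sw x (\<lambda>x1 x2. coord c x1 * delta d b x2)"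
      by (simp add: sw_times delta_sw)
    also have "\<dots> = (\<Sum>a\<in>B. delta c a x * delta d b a)"
      unfolding sw_def
      using c' by (subst sum.swap) (simp add: coord_basis if_distrib[of "(*) _"] if_distrib[of "\<lambda>x. x * _"]
          sum.delta B_finite cong: if_cong)
    finally show ?thesis using 3 eq by simp
  qed
  have "sw x (\<lambda>a b. sw a (\<lambda>c d. F c d b)) =
      (\<Sum>a\<in>B. \<Sum>b\<in>B. \<Sum>c\<in>B. \<Sum>d\<in>B. delta a b x * delta c d a * F c d b)"
    by (simp add: sw_def sum_distrib_left mult.assoc)
  also have "\<dots> = (\<Sum>b\<in>B. \<Sum>c\<in>B. \<Sum>d\<in>B. \<Sum>a\<in>B. delta a b x * delta c d a * F c d b)"
    by (rule rot)
  also have "\<dots> = (\<Sum>b\<in>B. \<Sum>c\<in>B. \<Sum>d\<in>B. \<Sum>a\<in>B. delta c a x * delta d b a * F c d b)"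
    unfolding sum_distrib_right[symmetric] by (intro sum.cong refl) (simp add: key)
  also have "\<dots> = (\<Sum>c\<in>B. \<Sum>d\<in>B. \<Sum>a\<in>B. \<Sum>b\<in>B. delta c a x * delta d b a * F c d b)"
    by (rule rot)
  also have "\<dots> = (\<Sum>c\<in>B. \<Sum>a\<in>B. \<Sum>d\<in>B. \<Sum>b\<in>B. delta c a x * delta d b a * F c d b)"
    by (rule sum.cong[OF refl], rule sum.swap)
  also have "\<dots> = sw x (\<lambda>a b. sw b (\<lambda>c d. F a c d))"
    by (simp add: sw_def sum_distrib_left mult.assoc)
  finally show ?thesis .
qed

end

context fd_hopf
begin

lemma sw_counit_left:
  assumes f: "functional f"
  shows "sw x (\<lambda>a b. \<epsilon> a * f b) = f x"
  by (subst sw_eval) (intro bifunctionalI fn_intros functional_comp[OF f] counit_eval(1)[OF f])+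

lemma sw_counit_right:
  assumes f: "functional f"
  shows "sw x (\<lambda>a b. f a * \<epsilon> b) = f x"
  unfolding mult.commute[of _ "\<epsilon> _"]
  by (subst sw_eval) (intro bifunctionalI fn_intros functional_comp[OF f] counit_eval(2)[OF f])+

lemma sw_antipode_left:
  assumes f: "functional f"
  shows "sw x (\<lambda>a b. f (S a * b)) = \<epsilon> x * f 1"
  by (subst sw_eval) (intro bifunctionalI fn_intros functional_comp[OF f] antipode_eval(1)[OF f])+

lemma sw_antipode_right:
  assumes f: "functional f"
  shows "sw x (\<lambda>a b. f (a * S b)) = \<epsilon> x * f 1"
  by (subst sw_eval) (intro bifunctionalI fn_intros functional_comp[OF f] antipode_eval(2)[OF f])+

lemma sw_one: "bifunctional F \<Longrightarrow> sw 1 F = F 1 1"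
  by (simp add: sw_eval comult_one tens_def)

lemma sw_mult:
  assumes F: "bifunctional F"
  shows "sw (x * y) F = sw x (\<lambda>a b. sw y (\<lambda>c d. F (a * c) (b * d)))"
proof -
  note fi = bifunctionalI fn_intros functional_bif_left[OF F] functional_bif_right[OF F]
  have "sw y (\<lambda>c d. F (a * c) (b * d)) = \<Delta> y (\<lambda>c d. F (a * c) (b * d))" for a b
    by (rule sw_eval) (intro fi)
  moreover have "sw x (\<lambda>a b. sw y (\<lambda>c d. F (a * c) (b * d))) = \<Delta> x (\<lambda>a b. sw y (\<lambda>c d. F (a * c) (b * d)))"
    by (rule sw_eval) (intro fi)
  ultimately show ?thesis by (simp add: sw_eval[OF F] comult_mult_eval[OF F])
qed

section \<open>The antipode\<close>

text \<open>The two sides are a left and a right convolution inverse of the multiplication: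
  \<open>?T\<close> is \<open>f\<close> at \<open>S (x1 y1) x2 y2 S y3 S x3\<close>, which can be
  collapsed from either end.\<close>

lemma antipode_mult: "S (x * y) = S y * S x"
proof (rule functional_separate)
  fix f assume f: "functional f"
  note fi = fn_intros functional_comp[OF f]
  let ?T = "sw x (\<lambda>a b. sw y (\<lambda>c d. sw b (\<lambda>p q. sw d (\<lambda>u w.
      f (S (a * c) * (p * u * (S w * S q)))))))"
  have 1: "sw b (\<lambda>p q. sw d (\<lambda>u w. f (S (a * c) * (p * u * (S w * S q))))) =
      \<epsilon> b * (\<epsilon> d * f (S (a * c)))" for a b c d
  proof -
    have "sw b (\<lambda>p q. sw d (\<lambda>u w. f (S (a * c) * (p * u * (S w * S q))))) =
        sw b (\<lambda>p q. sw d (\<lambda>u w. (\<lambda>z. f (S (a * c) * (p * z * S q))) (u * S w)))"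
      by (simp add: mult.assoc)
    also have "\<dots> = sw b (\<lambda>p q. \<epsilon> d * (\<lambda>z. f (S (a * c) * z)) (p * S q))"
      by (subst sw_antipode_right) (intro fi, simp)
    also have "\<dots> = \<epsilon> d * sw b (\<lambda>p q. (\<lambda>z. f (S (a * c) * z)) (p * S q))"
      by (rule sw_times)
    also have "\<dots> = \<epsilon> d * (\<epsilon> b * f (S (a * c)))"
      by (subst sw_antipode_right) (intro fi, simp)
    finally show ?thesis by simp
  qed
  have "?T = sw x (\<lambda>a b. sw y (\<lambda>c d. \<epsilon> b * (\<epsilon> d * f (S (a * c)))))"
    unfolding 1 ..
  also have "\<dots> = sw x (\<lambda>a b. sw y (\<lambda>c d. f (S (a * c)) * \<epsilon> d) * \<epsilon> b)"
    by (simp add: sw_times mult.commute)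
  also have "\<dots> = sw x (\<lambda>a b. f (S (a * y)) * \<epsilon> b)"
    by (subst sw_counit_right) (intro fi, simp)
  also have "\<dots> = f (S (x * y))"
    by (rule sw_counit_right) (intro fi)
  finally have A: "?T = f (S (x * y))" .
  have 2: "sw x (\<lambda>a p. sw y (\<lambda>c u. f (S (a * c) * (p * u * z)))) = \<epsilon> x * (\<epsilon> y * f z)" for x y z
  proof -
    have "sw x (\<lambda>a p. sw y (\<lambda>c u. f (S (a * c) * (p * u * z)))) =
        sw (x * y) (\<lambda>a b. f (S a * (b * z)))"
      by (subst sw_mult) (intro bifunctionalI fi, simp)
    also have "\<dots> = sw (x * y) (\<lambda>a b. (\<lambda>v. f (v * z)) (S a * b))"
      by (simp add: mult.assoc)
    also have "\<dots> = \<epsilon> (x * y) * f z"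
      by (subst sw_antipode_left) (intro fi, simp)
    finally show ?thesis by (simp add: counit_mult)
  qed
  have "?T = sw x (\<lambda>a b. sw b (\<lambda>p q. sw y (\<lambda>c d. sw d (\<lambda>u w.
      f (S (a * c) * (p * u * (S w * S q)))))))"
    by (subst sw_swap) (rule refl)
  also have "\<dots> = sw x (\<lambda>b q. sw b (\<lambda>a p. sw y (\<lambda>d w. sw d (\<lambda>c u.
      f (S (a * c) * (p * u * (S w * S q)))))))"
    by (simp only: sw_coassoc[of x "\<lambda>a p q. sw y (\<lambda>c d. sw d (\<lambda>u w. f (S (a * c) * (p * u * (S w * S q)))))"]
       sw_coassoc[of y "\<lambda>c u w. f (S (_ * c) * (_ * u * (S w * S _)))"])
  also have "\<dots> = sw x (\<lambda>b q. sw y (\<lambda>d w. sw b (\<lambda>a p. sw d (\<lambda>c u.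
      f (S (a * c) * (p * u * (S w * S q)))))))"
    by (subst sw_swap) (rule refl)
  also have "\<dots> = sw x (\<lambda>b q. sw y (\<lambda>d w. \<epsilon> b * (\<epsilon> d * f (S w * S q))))"
    unfolding 2 ..
  also have "\<dots> = sw x (\<lambda>b q. \<epsilon> b * sw y (\<lambda>d w. \<epsilon> d * f (S w * S q)))"
    by (simp add: sw_times)
  also have "\<dots> = sw x (\<lambda>b q. \<epsilon> b * f (S y * S q))"
    by (subst sw_counit_left) (intro fi, simp)
  also have "\<dots> = f (S y * S x)"
    by (rule sw_counit_left) (intro fi)
  finally show "f (S (x * y)) = f (S y * S x)" using A by simp
qed

lemma antipode_one: "S 1 = 1"
proof (rule functional_separate)
  fix f assume f: "functional f"
  have "sw 1 (\<lambda>a b. f (S a * b)) = f (S 1 * 1)"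
    by (rule sw_one) (intro bifunctionalI fn_intros functional_comp[OF f])
  then show "f (S 1) = f 1" using sw_antipode_left[OF f, of 1] by (simp add: counit_one)
qed

lemma counit_antipode: "\<epsilon> (S x) = \<epsilon> x"
proof -
  have "\<epsilon> (S x) = sw x (\<lambda>a b. \<epsilon> (S a) * \<epsilon> b)"
    by (rule sw_counit_right[symmetric]) (intro fn_intros)
  also have "\<dots> = \<epsilon> x"
    using sw_antipode_left[OF functional_counit, of x] by (simp add: counit_mult counit_one)
  finally show ?thesis .
qed

text \<open>The same device for the comultiplication: \<open>?T\<close> multiplies
  \<open>\<Delta> (S x1)\<close>, \<open>\<Delta> x2\<close> and the flipped image of
  \<open>\<Delta> x3\<close> under \<open>S\<close>, and collapses from either end.\<close>

lemma sw_antipode: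
  assumes F: "bifunctional F"
  shows "sw (S x) F = sw x (\<lambda>a b. F (S b) (S a))"
proof -
  note fi = fn_intros functional_bif_left[OF F] functional_bif_right[OF F]
  let ?T = "sw x (\<lambda>a b. sw b (\<lambda>m q. sw (S a) (\<lambda>p p'. sw m (\<lambda>r t. sw q (\<lambda>u w.
      F (p * (r * S w)) (p' * (t * S u)))))))"
  have inner: "sw b (\<lambda>m q. sw m (\<lambda>r t. sw q (\<lambda>u w. F (p * (r * S w)) (p' * (t * S u))))) = \<epsilon> b * F p p'"
    for b p p'
  proof -
    have "sw b (\<lambda>m q. sw m (\<lambda>r t. sw q (\<lambda>u w. F (p * (r * S w)) (p' * (t * S u))))) =
        sw b (\<lambda>r b'. sw b' (\<lambda>t q. sw q (\<lambda>u w. F (p * (r * S w)) (p' * (t * S u)))))"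
      by (rule sw_coassoc)
    also have "\<dots> = sw b (\<lambda>r b'. sw b' (\<lambda>m w. sw m (\<lambda>t u. F (p * (r * S w)) (p' * (t * S u)))))"
      by (simp only: sw_coassoc)
    also have "\<dots> = sw b (\<lambda>r b'. sw b' (\<lambda>m w. \<epsilon> m * F (p * (r * S w)) p'))"
      by (subst sw_antipode_right) (intro fi, simp)
    also have "\<dots> = sw b (\<lambda>r b'. F (p * (r * S b')) p')"
      by (subst sw_counit_left) (intro fi, simp)
    also have "\<dots> = \<epsilon> b * F p p'"
      by (subst sw_antipode_right) (intro fi, simp)
    finally show ?thesis .
  qed
  have "?T = sw x (\<lambda>a b. sw (S a) (\<lambda>p p'. sw b (\<lambda>m q. sw m (\<lambda>r t. sw q (\<lambda>u w.
      F (p * (r * S w)) (p' * (t * S u)))))))"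
    by (subst sw_swap) (rule refl)
  also have "\<dots> = sw x (\<lambda>a b. sw (S a) F * \<epsilon> b)"
    unfolding inner by (simp add: sw_times mult.commute)
  also have "\<dots> = sw (S x) F"
    by (rule sw_counit_right) (intro fi)
  finally have A: "?T = sw (S x) F" .
  have "?T = sw x (\<lambda>c q. sw c (\<lambda>a m. sw (S a) (\<lambda>p p'. sw m (\<lambda>r t. sw q (\<lambda>u w.
      F (p * (r * S w)) (p' * (t * S u)))))))"
    by (rule sw_coassoc[symmetric])
  also have "\<dots> = sw x (\<lambda>c q. sw c (\<lambda>a m. sw (S a * m) (\<lambda>y z. sw q (\<lambda>u w. F (y * S w) (z * S u)))))"
    by (subst sw_mult) (intro bifunctionalI fi, simp add: mult.assoc)
  also have "\<dots> = sw x (\<lambda>c q. \<epsilon> c * sw 1 (\<lambda>y z. sw q (\<lambda>u w. F (y * S w) (z * S u))))"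
    by (subst sw_antipode_left) (intro fi, simp)
  also have "\<dots> = sw x (\<lambda>c q. \<epsilon> c * sw q (\<lambda>u w. F (S w) (S u)))"
    by (subst sw_one) (intro bifunctionalI fi, simp)
  also have "\<dots> = sw x (\<lambda>u w. F (S w) (S u))"
    by (rule sw_counit_left) (intro fi)
  finally show ?thesis using A by simp
qed

end

section \<open>Integrals\<close>

text \<open>Some simple left ideal \<open>I\<close> is not contained in the kernel of
  \<open>e\<close>. Its intersection with the kernel is a smaller left ideal, hence zero, so
  \<open>I\<close> is a line on which the algebra acts through \<open>e\<close>.\<close>

lemma semisimple_left_integral:
  fixes s :: "'k::field \<Rightarrow> 'a::ring_1 \<Rightarrow> 'a"
  assumes A: "k_algebra s" "semisimple_algebra s"
    and e: "Vector_Spaces.linear s (*) e" "\<And>x y. e (x * y) = e x * e y" "e 1 = 1"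
  shows "\<exists>l. e l = 1 \<and> (\<forall>x. x * l = s (e x) l)"
proof -
  interpret k_algebra s by (rule A)
  have e_add: "e (x + y) = e x + e y" and e_scale: "e (s c x) = c * e x" for x y c
    using e(1) by (auto simp: Vector_Spaces.linear_iff)
  have e_0: "e 0 = 0" using e_scale[of 0 0] by simp
  have e_diff: "e (x - y) = e x - e y" for x y
    using e_add[of "x - y" y] by simp
  have sub: "subspace {x. e x = 0}"
    by (auto simp: subspace_def e_0 e_add e_scale)
  obtain I where I: "simple_left_ideal s I" "\<not> I \<subseteq> {x. e x = 0}"
  proof (rule ccontr)
    assume "\<not> thesis"
    then have "\<Union>{I. simple_left_ideal s I} \<subseteq> {x. e x = 0}" using that by blast
    then have "span (\<Union>{I. simple_left_ideal s I}) \<subseteq> {x. e x = 0}" by (rule span_minimal[OF _ sub])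
    then have "1 \<in> {x. e x = 0}" using A(2) by (auto simp: semisimple_algebra_def)
    then show False using e(3) by simp
  qed
  then obtain y where y: "y \<in> I" "e y \<noteq> 0" by auto
  have lI: "subspace I" "\<And>a x. x \<in> I \<Longrightarrow> a * x \<in> I"
    using I(1) by (auto simp: simple_left_ideal_def left_ideal_def)
  let ?J = "I \<inter> {x. e x = 0}"
  have "left_ideal s ?J"
    using lI sub by (auto simp: left_ideal_def e(2) intro: subspace_inter)
  then have "?J = {0} \<or> ?J = I" using I(1) unfolding simple_left_ideal_def by blast
  then have J: "?J = {0}" using y by auto
  define l where "l = s (inverse (e y)) y"
  have l: "l \<in> I" "e l = 1" using y lI by (auto simp: l_def e_scale intro: subspace_scale)
  have "x * l - s (e x) l \<in> ?J" for x
    using l lI by (auto simp: e_diff e_scale e(2) intro: subspace_diff subspace_scale)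
  then have "x * l = s (e x) l" for x using J by auto
  then show ?thesis using l by blast
qed

locale ss_hopf = fd_hopf s \<Delta> \<epsilon> S B
  for s :: "'k::{alg_closed_field,field_char_0} \<Rightarrow> 'h::ring_1 \<Rightarrow> 'h" and \<Delta> \<epsilon> S B +
  assumes semisimple: "semisimple_algebra s"
begin

definition Lam :: 'h where "Lam = (SOME l. \<epsilon> l = 1 \<and> (\<forall>x. x * l = s (\<epsilon> x) l))"

lemma counit_Lam: "\<epsilon> Lam = 1" and mult_Lam: "x * Lam = s (\<epsilon> x) Lam"
proof -
  have "\<epsilon> Lam = 1 \<and> (\<forall>x. x * Lam = s (\<epsilon> x) Lam)"
    unfolding Lam_def using semisimple_left_integral[OF k_algebra_axioms semisimple counit_linear]
    by (rule someI_ex) (simp_all add: counit_mult counit_one)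
  then show "\<epsilon> Lam = 1" "x * Lam = s (\<epsilon> x) Lam" by auto
qed

definition swv :: "'h \<Rightarrow> ('h \<Rightarrow> 'h \<Rightarrow> 'h) \<Rightarrow> 'h" where
  "swv x F = (\<Sum>b\<in>B. \<Sum>c\<in>B. s (delta b c x) (F b c))"

lemma functional_swv: "functional f \<Longrightarrow> f (swv x F) = sw x (\<lambda>a b. f (F a b))"
  by (simp add: swv_def sw_def functional_sum functional_scale)

lemma operator_swv: "operator (\<lambda>x. swv x F)"
  by (auto simp: operator_def swv_def delta_add delta_scale algebra_simps sum.distrib scale_sum_right)

lemma functional_mult_left: "functional f \<Longrightarrow> functional (\<lambda>x. f (c * x))"
  and functional_mult_right: "functional f \<Longrightarrow> functional (\<lambda>x. f (x * c))"
  by ((rule functional_comp, assumption, intro fn_intros)+)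

text \<open>\<open>Lam\<close> absorbs a factor through the counit and \<open>S h1 h2\<close>
  cancels; hence a left factor moves from one leg of \<open>\<Delta> Lam\<close> to the other at the
  cost of one \<open>S\<close>.\<close>

lemma Lam_shift:
  assumes F: "bifunctional F"
  shows "sw Lam (\<lambda>a b. F a (h * b)) = sw Lam (\<lambda>a b. F (S h * a) b)"
proof -
  note fi = fn_intros functional_bif_left[OF F] functional_bif_right[OF F]
  have "sw Lam (\<lambda>a b. F (S h * a) b) = sw h (\<lambda>p q. sw Lam (\<lambda>a b. F (S p * a) b) * \<epsilon> q)"
    by (rule sw_counit_right[symmetric]) (intro fi)
  also have "\<dots> = sw h (\<lambda>p q. sw (q * Lam) (\<lambda>a b. F (S p * a) b))"
    by (simp add: mult_Lam sw_scale mult.commute)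
  also have "\<dots> = sw h (\<lambda>p q. sw q (\<lambda>u v. sw Lam (\<lambda>a b. F (S p * u * a) (v * b))))"
    by (subst sw_mult) (intro bifunctionalI fi, simp add: mult.assoc)
  also have "\<dots> = sw h (\<lambda>m v. sw m (\<lambda>p u. sw Lam (\<lambda>a b. F (S p * u * a) (v * b))))"
    by (rule sw_coassoc[symmetric])
  also have "\<dots> = sw h (\<lambda>m v. \<epsilon> m * sw Lam (\<lambda>a b. F a (v * b)))"
    by (subst sw_antipode_left) (intro fi, simp)
  also have "\<dots> = sw Lam (\<lambda>a b. F a (h * b))"
    by (rule sw_counit_left) (intro fi)
  finally show ?thesis by simp
qed

text \<open>This trace is the integral of the dual Hopf algebra normalised by \<open>lam Lam = 1\<close>; its value
  at \<open>1\<close> is the trace of the square of the antipode.\<close>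

definition lam :: "'h \<Rightarrow> 'k" where "lam x = tr (\<lambda>a. S (S a) * x)"

lemma functional_lam: "functional lam"
  by (simp add: functional_def lam_def distrib_left scale_mult_right tr_add tr_scale)

lemmas fnl = fn_intros functional_comp[OF functional_lam]

lemma lam_1: "lam 1 = tr (\<lambda>a. S (S a))"
  by (simp add: lam_def)

text \<open>In \<open>f (S Lam1 * Lam2)\<close> the first leg is expanded in the basis and
  \<open>S c\<close> is moved to the other leg by \<open>Lam_shift\<close>, where it becomes
  \<open>S (S c)\<close>; the sum over the basis is then the trace that defines
  \<open>lam\<close>.\<close>

lemma lam_Lam_left:
  assumes f: "functional f"
  shows "sw Lam (\<lambda>a b. lam a * f b) = f 1"
proof -
  note fi = fn_intros functional_comp[OF f]
  have "f 1 = sw Lam (\<lambda>a b. f (S a * b))"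
    using sw_antipode_left[OF f, of Lam] by (simp add: counit_Lam)
  also have "\<dots> = sw Lam (\<lambda>a b. \<Sum>c\<in>B. coord c a * f (S c * b))"
    by (intro arg_cong[of _ _ "sw Lam"] ext functional_expand[of "\<lambda>a. f (S a * _)"] fi)
  also have "\<dots> = (\<Sum>c\<in>B. sw Lam (\<lambda>a b. coord c (S (S c) * a) * f b))"
    unfolding sw_sum
    by (intro sum.cong refl Lam_shift[of "\<lambda>a b. coord _ a * f b"] bifunctionalI fi)
  also have "\<dots> = sw Lam (\<lambda>a b. lam a * f b)"
    unfolding sw_sum[symmetric] by (simp add: lam_def tr_def sum_distrib_right)
  finally show ?thesis by simp
qed

lemma lam_Lam: "lam Lam = 1"
  using lam_Lam_left[OF functional_counit] sw_counit_right[OF functional_lam, of Lam]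
  by (simp add: counit_one)

text \<open>Up to \<open>S\<close>, the legs of \<open>\<Delta> Lam\<close> are dual bases for the
  form \<open>lam (x * y)\<close>; bijectivity of \<open>S\<close> and nondegeneracy of the form
  follow from this.\<close>

lemma lam_antipode_dual:
  assumes f: "functional f"
  shows "sw Lam (\<lambda>a b. lam (S h * a) * f b) = f h"
proof -
  have "sw Lam (\<lambda>a b. lam (S h * a) * f b) = sw Lam (\<lambda>a b. lam a * f (h * b))"
    by (rule Lam_shift[of "\<lambda>a b. lam a * f b", symmetric])
      (intro bifunctionalI fnl functional_comp[OF f])
  also have "\<dots> = f (h * 1)"
    by (rule lam_Lam_left) (intro functional_mult_left f)
  finally show ?thesis by simp
qed

lemma antipode_eq_0: "S h = 0 \<Longrightarrow> h = 0"
proof (rule functional_separate)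
  fix f assume f: "functional f" and "S h = 0"
  then show "f h = f 0"
    using lam_antipode_dual[OF f, of h] by (simp add: functional_0[OF functional_lam] functional_0[OF f] sw_def)
qed

lemma antipode_inj: "S x = S y \<Longrightarrow> x = y"
  using antipode_eq_0[of "x - y"] by (simp add: operator_diff[OF operator_antipode])

lemma antipode_surj: "\<exists>x. S x = y"
  using injective_imp_surjective[OF operator_antipode antipode_eq_0] .

definition Si :: "'h \<Rightarrow> 'h" where "Si y = (THE x. S x = y)"

lemma S_Si [simp]: "S (Si y) = y" and Si_S [simp]: "Si (S x) = x"
proof -
  have *: "\<exists>!x. S x = y" for y using antipode_surj antipode_inj by blast
  show "S (Si y) = y" unfolding Si_def using theI'[OF *] .
  show "Si (S x) = x" unfolding Si_def using antipode_inj by blast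
qed

lemma operator_Si: "operator Si"
  unfolding operator_def
  by (intro conjI allI; rule antipode_inj) (simp_all add: antipode_add antipode_scale)

lemma lam_dual:
  assumes f: "functional f"
  shows "sw Lam (\<lambda>a b. lam (y * a) * f (S b)) = f y"
  using lam_antipode_dual[of "\<lambda>x. f (S x)" "Si y"] functional_comp[OF f operator_antipode] by simp

lemma lam_nondegenerate_left: "(\<And>x. lam (y * x) = 0) \<Longrightarrow> y = 0"
proof (rule functional_separate)
  fix f assume f: "functional f" and "\<And>x. lam (y * x) = 0"
  then show "f y = f 0" using lam_dual[OF f, of y] by (simp add: functional_0[OF f] sw_def)
qed

text \<open>\<open>S Lam\<close> is a right integral and \<open>Lam\<close> a left one, both of
  counit \<open>1\<close>; their product equals each of them.\<close>

lemma antipode_Lam: "S Lam = Lam"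
  and Lam_mult: "Lam * x = s (\<epsilon> x) Lam"
proof -
  have r: "S Lam * x = s (\<epsilon> x) (S Lam)" for x
    using antipode_mult[of "Si x" Lam] counit_antipode[of "Si x"] by (simp add: mult_Lam antipode_scale)
  have "S Lam * Lam = S Lam" using r[of Lam] by (simp add: counit_Lam)
  moreover have "S Lam * Lam = Lam" using mult_Lam[of "S Lam"] by (simp add: counit_antipode counit_Lam)
  ultimately show 1: "S Lam = Lam" by simp
  show "Lam * x = s (\<epsilon> x) Lam" using r[of x] 1 by simp
qed

lemma Lam_shift_right:
  assumes F: "bifunctional F"
  shows "sw Lam (\<lambda>a b. F (a * h) b) = sw Lam (\<lambda>a b. F a (b * S h))"
proof -
  note fi = fn_intros functional_bif_left[OF F] functional_bif_right[OF F]
  have "sw Lam (\<lambda>a b. F a (b * S h)) = sw h (\<lambda>p q. \<epsilon> p * sw Lam (\<lambda>a b. F a (b * S q)))"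
    by (rule sw_counit_left[symmetric]) (intro fi)
  also have "\<dots> = sw h (\<lambda>p q. sw (Lam * p) (\<lambda>a b. F a (b * S q)))"
    by (simp add: Lam_mult sw_scale)
  also have "\<dots> = sw h (\<lambda>p q. sw p (\<lambda>u v. sw Lam (\<lambda>a b. F (a * u) (b * (v * S q)))))"
    by (subst sw_mult) (intro bifunctionalI fi, subst sw_swap, simp add: mult.assoc)
  also have "\<dots> = sw h (\<lambda>u m. sw m (\<lambda>v q. sw Lam (\<lambda>a b. F (a * u) (b * (v * S q)))))"
    by (rule sw_coassoc)
  also have "\<dots> = sw h (\<lambda>u m. sw Lam (\<lambda>a b. F (a * u) b) * \<epsilon> m)"
    by (subst sw_antipode_right) (intro fi, simp add: mult.commute)
  also have "\<dots> = sw Lam (\<lambda>a b. F (a * h) b)"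
    by (rule sw_counit_right) (intro fi)
  finally show ?thesis by simp
qed

lemma lam_Lam_right:
  assumes f: "functional f"
  shows "sw Lam (\<lambda>a b. lam (a * h) * f b) = f (S h)"
proof -
  have "sw Lam (\<lambda>a b. lam (a * h) * f b) = sw Lam (\<lambda>a b. lam a * f (b * S h))"
    by (rule Lam_shift_right[of "\<lambda>a b. lam a * f b"])
      (intro bifunctionalI fnl functional_comp[OF f])
  also have "\<dots> = f (1 * S h)"
    by (rule lam_Lam_left) (intro functional_mult_right f)
  finally show ?thesis by simp
qed

lemma lam_nondegenerate_right: "(\<And>x. lam (x * y) = 0) \<Longrightarrow> y = 0"
proof (rule antipode_eq_0, rule functional_separate)
  fix f assume f: "functional f" and "\<And>x. lam (x * y) = 0"
  then show "f (S y) = f 0" using lam_Lam_right[OF f, of y] by (simp add: functional_0[OF f] sw_def)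
qed

text \<open>The element \<open>y'\<close> assembled from the left side has the same pairings under
  \<open>lam\<close> as \<open>y\<close>, by \<open>lam_dual\<close>.\<close>

lemma lam_dual_right:
  assumes f: "functional f"
  shows "sw Lam (\<lambda>a b. f a * lam (S b * y)) = f y"
proof -
  define y' where "y' = swv Lam (\<lambda>a b. s (lam (S b * y)) a)"
  have "lam (z * (y' - y)) = 0" for z
  proof -
    have "lam (z * y') = sw Lam (\<lambda>a b. lam (z * a) * lam (S b * y))"
    proof -
      have "functional (\<lambda>x. lam (z * x))" by (intro fnl)
      from functional_swv[OF this] show ?thesis
        by (simp add: y'_def scale_mult_right functional_scale[OF functional_lam] mult.commute)
    qed
    also have "\<dots> = lam (z * y)"
      by (rule lam_dual[of "\<lambda>x. lam (x * y)"]) (intro fnl)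
    finally show ?thesis by (simp add: right_diff_distrib functional_diff[OF functional_lam])
  qed
  then have "y' = y" using lam_nondegenerate_right[of "y' - y"] by simp
  then have "f y = f y'" by simp
  then show ?thesis
    by (simp add: y'_def functional_swv[OF f] functional_scale[OF f] mult.commute)
qed

text \<open>Because of this, identities between functionals may be tested by contraction with
  \<open>\<Delta> Lam\<close>; the test functional that recovers \<open>f y\<close> comes from
  \<open>lam_dual_right\<close>.\<close>

lemma Lam_injective:
  assumes f: "functional f" and 0: "\<And>g. functional g \<Longrightarrow> sw Lam (\<lambda>a b. f a * g b) = 0"
  shows "f y = 0"
proof -
  have "functional (\<lambda>b. lam (S b * y))" by (intro fnl)
  from 0[OF this] show ?thesis using lam_dual_right[OF f, of y] by simp
qed

lemma Lam_injective_eq: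
  assumes f: "functional f" "functional f'"
    and eq: "\<And>g. functional g \<Longrightarrow> sw Lam (\<lambda>a b. f a * g b) = sw Lam (\<lambda>a b. f' a * g b)"
  shows "f y = f' y"
proof -
  have "(\<lambda>x. f x - f' x) y = 0"
  proof (rule Lam_injective)
    show "functional (\<lambda>x. f x - f' x)" using f by (rule functional_minus)
    fix g assume "functional g"
    then show "sw Lam (\<lambda>a b. (f a - f' a) * g b) = 0"
      using eq[of g] by (simp add: sw_def algebra_simps sum_subtractf)
  qed
  then show ?thesis by simp
qed

text \<open>Contracted with \<open>\<Delta> Lam\<close>, both sides become \<open>f 1 * g 1\<close>,
  by coassociativity and \<open>lam_Lam_left\<close>.\<close>

lemma lam_integral:
  assumes f: "functional f"
  shows "sw x (\<lambda>a b. lam a * f b) = lam x * f 1"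
proof (rule Lam_injective_eq[of "\<lambda>x. sw x (\<lambda>a b. lam a * f b)" "\<lambda>x. lam x * f 1"])
  fix g assume g: "functional g"
  have "sw Lam (\<lambda>x b. sw x (\<lambda>c d. lam c * f d) * g b) =
      sw Lam (\<lambda>x b. sw x (\<lambda>c d. lam c * (f d * g b)))"
    by (simp add: sw_times_right[symmetric] mult.assoc)
  also have "\<dots> = sw Lam (\<lambda>c b. sw b (\<lambda>d e. lam c * (f d * g e)))"
    by (rule sw_coassoc)
  also have "\<dots> = sw Lam (\<lambda>c b. lam c * sw b (\<lambda>d e. f d * g e))"
    by (simp add: sw_times)
  also have "\<dots> = sw 1 (\<lambda>d e. f d * g e)"
    by (rule lam_Lam_left[OF functional_sw])
  also have "\<dots> = f 1 * g 1"
    by (rule sw_one) (intro bifunctionalI fn_intros functional_comp[OF f] functional_comp[OF g])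
  also have "\<dots> = sw Lam (\<lambda>a b. lam a * f 1 * g b)"
    using lam_Lam_left[OF g] by (simp add: mult.assoc sw_times mult.left_commute[of _ "f 1"])
  finally show "sw Lam (\<lambda>x b. sw x (\<lambda>c d. lam c * f d) * g b) = sw Lam (\<lambda>a b. lam a * f 1 * g b)" .
qed (rule functional_sw, rule functional_times_right[OF functional_lam])

text \<open>Both functionals contract with \<open>\<Delta> Lam\<close> to \<open>g (S h)\<close>.
  Thus the square of \<open>S\<close> is the Nakayama automorphism of \<open>lam\<close>.\<close>

lemma lam_nakayama: "lam (x * h) = lam (S (S h) * x)"
proof (rule Lam_injective_eq[of "\<lambda>x. lam (x * h)" "\<lambda>x. lam (S (S h) * x)"])
  fix g assume g: "functional g"
  show "sw Lam (\<lambda>a b. lam (a * h) * g b) = sw Lam (\<lambda>a b. lam (S (S h) * a) * g b)"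
    unfolding lam_Lam_right[OF g] lam_antipode_dual[OF g] ..
qed (intro fnl)+

lemma integral_unique:
  assumes f: "functional f" and "\<And>g x. functional g \<Longrightarrow> sw x (\<lambda>a b. f a * g b) = f x * g 1"
  shows "f x = f Lam * lam x"
proof (rule Lam_injective_eq[OF f, of "\<lambda>x. f Lam * lam x"])
  show "functional (\<lambda>x. f Lam * lam x)" by (rule functional_times[OF functional_lam])
  fix g assume g: "functional g"
  show "sw Lam (\<lambda>a b. f a * g b) = sw Lam (\<lambda>a b. f Lam * lam a * g b)"
    using assms(2)[OF g] lam_Lam_left[OF g] by (simp add: mult.assoc sw_times)
qed

section \<open>The fourth power of the antipode\<close>

text \<open>The distinguished group-like element: \<open>x1 lam (x2)\<close> is \<open>lam x\<close>
  times \<open>gd\<close>, so \<open>gd\<close> measures the failure of \<open>lam\<close> to be a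
  two-sided integral.\<close>

definition gd :: 'h where "gd = swv Lam (\<lambda>a b. s (lam b) a)"

lemma functional_gd: "functional f \<Longrightarrow> f gd = sw Lam (\<lambda>a b. f a * lam b)"
  by (simp add: gd_def functional_swv functional_scale mult.commute)

text \<open>For fixed \<open>f\<close> the left side is again an integral as a function of
  \<open>x\<close>, hence a multiple of \<open>lam\<close>, with its value at \<open>Lam\<close> as
  factor.\<close>

lemma lam_integral_left:
  assumes f: "functional f"
  shows "sw x (\<lambda>a b. f a * lam b) = f gd * lam x"
proof -
  have "sw x (\<lambda>a b. f a * lam b) = sw Lam (\<lambda>a b. f a * lam b) * lam x"
  proof (rule integral_unique[OF functional_sw])
    fix g x assume g: "functional g"
    have "sw x (\<lambda>a b. sw a (\<lambda>c d. f c * lam d) * g b) =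
        sw x (\<lambda>a b. sw a (\<lambda>c d. f c * (lam d * g b)))"
      by (simp add: sw_times_right[symmetric] mult.assoc)
    also have "\<dots> = sw x (\<lambda>c b. sw b (\<lambda>d e. f c * (lam d * g e)))"
      by (rule sw_coassoc)
    also have "\<dots> = sw x (\<lambda>a b. f a * lam b * g 1)"
      by (simp add: sw_times lam_integral[OF g] mult.assoc)
    finally show "sw x (\<lambda>a b. sw a (\<lambda>c d. f c * lam d) * g b) = sw x (\<lambda>a b. f a * lam b) * g 1"
      by (simp add: sw_times_right)
  qed
  then show ?thesis by (simp add: functional_gd[OF f])
qed

definition grp :: "'h \<Rightarrow> bool" where
  "grp x \<longleftrightarrow> \<epsilon> x = 1 \<and> (\<forall>F. bifunctional F \<longrightarrow> sw x F = F x x)"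

lemma delta_sw: "delta b c x = sw x (\<lambda>v w. coord b v * coord c w)"
  by (simp add: sw_eval[OF bifunctional_coord] delta_def)

lemma sw_pureI:
  assumes "\<And>f g. functional f \<Longrightarrow> functional g \<Longrightarrow> sw x (\<lambda>a b. f a * g b) = f y * g z"
    and F: "bifunctional F"
  shows "sw x F = F y z"
  by (subst sw_def, subst bifunctional_expand[OF F])
    (simp add: delta_sw assms(1)[OF functional_coord functional_coord])

text \<open>The coproduct of \<open>gd\<close> is read off by applying
  \<open>lam_integral_left\<close> before and after coassociativity.\<close>

lemma grp_gd: "grp gd"
proof -
  have "sw gd (\<lambda>a b. f a * g b) = f gd * g gd" if f: "functional f" and g: "functional g" for f g
  proof -
    have "sw gd (\<lambda>a b. f a * g b) * lam Lam = sw Lam (\<lambda>a b. sw a (\<lambda>c d. f c * g d) * lam b)"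
      by (rule lam_integral_left[OF functional_sw, symmetric])
    also have "\<dots> = sw Lam (\<lambda>a b. sw a (\<lambda>c d. f c * (g d * lam b)))"
      by (simp add: sw_times_right[symmetric] mult.assoc)
    also have "\<dots> = sw Lam (\<lambda>c b. sw b (\<lambda>d e. f c * (g d * lam e)))"
      by (rule sw_coassoc)
    also have "\<dots> = sw Lam (\<lambda>c b. g gd * (f c * lam b))"
      by (simp add: sw_times lam_integral_left[OF g] algebra_simps)
    also have "\<dots> = g gd * (f gd * lam Lam)"
      by (simp add: sw_times lam_integral_left[OF f])
    finally show ?thesis by (simp add: lam_Lam mult.commute)
  qed
  moreover have "\<epsilon> gd = 1"
    using functional_gd[OF functional_counit] sw_counit_left[OF functional_lam, of Lam]
    by (simp add: lam_Lam)
  ultimately show ?thesis unfolding grp_def using sw_pureI by blast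
qed

lemma grp_one: "grp 1"
  by (simp add: grp_def sw_one counit_one)

lemma grp_mult:
  assumes "grp x" "grp y"
  shows "grp (x * y)"
proof -
  have "sw (x * y) F = F (x * y) (x * y)" if F: "bifunctional F" for F
  proof -
    note fi = fn_intros functional_bif_left[OF F] functional_bif_right[OF F]
    have "bifunctional (\<lambda>c d. F (a * c) (b * d))" "bifunctional (\<lambda>a b. F (a * y) (b * y))" for a b
      by (intro bifunctionalI fi)+
    then show ?thesis using assms by (simp add: sw_mult[OF F] grp_def)
  qed
  then show ?thesis using assms by (simp add: grp_def counit_mult)
qed

lemma grp_power: "grp x \<Longrightarrow> grp (x ^ n)"
  by (induction n) (auto intro: grp_one grp_mult)

lemma grp_antipode: "grp x \<Longrightarrow> S x * x = 1" "grp x \<Longrightarrow> x * S x = 1"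
proof -
  assume x: "grp x"
  show "S x * x = 1"
  proof (rule functional_separate)
    fix f assume f: "functional f"
    have "bifunctional (\<lambda>a b. f (S a * b))" by (intro bifunctionalI fn_intros functional_comp[OF f])
    then show "f (S x * x) = f 1" using x sw_antipode_left[OF f, of x] by (simp add: grp_def)
  qed
  show "x * S x = 1"
  proof (rule functional_separate)
    fix f assume f: "functional f"
    have "bifunctional (\<lambda>a b. f (a * S b))" by (intro bifunctionalI fn_intros functional_comp[OF f])
    then show "f (x * S x) = f 1" using x sw_antipode_right[OF f, of x] by (simp add: grp_def)
  qed
qed

text \<open>Dedekind's argument: applying the comultiplication to a relation and comparing with the
  relation multiplied by \<open>h x\<close> leaves a relation among the other elements, for any
  \<open>h\<close> separating \<open>x\<close> from \<open>y\<close>.\<close>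

lemma grp_independent:
  assumes "finite X" "\<And>x. x \<in> X \<Longrightarrow> grp x"
  shows "independent X"
  using assms
proof (induction X rule: finite_induct)
  case empty
  show ?case by (rule independent_empty)
next
  case (insert x X)
  have ind: "independent X" using insert by simp
  have "x \<notin> span X"
  proof
    assume "x \<in> span X"
    then obtain c where x: "x = (\<Sum>y\<in>X. s (c y) y)"
      using span_finite[OF insert(1)] by auto
    have "c y = 0" if y: "y \<in> X" for y
    proof -
      obtain h where h: "functional h" "h x \<noteq> h y"
        using functional_separate[of x y] insert(2) y by blast
      have "(\<Sum>y\<in>X. s (c y * (h x - h y)) y) = 0"
      proof (rule functional_separate)
        fix f assume f: "functional f"
        have bif: "bifunctional (\<lambda>a b. f a * h b)"
          by (intro bifunctionalI fn_intros functional_comp[OF f] functional_comp[OF h(1)])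
        have "f x * h x = sw x (\<lambda>a b. f a * h b)" using insert.prems bif by (simp add: grp_def)
        also have "\<dots> = (\<Sum>y\<in>X. c y * sw y (\<lambda>a b. f a * h b))"
          by (subst x) (simp add: functional_sum[OF functional_sw] functional_scale[OF functional_sw])
        also have "\<dots> = (\<Sum>y\<in>X. c y * (f y * h y))"
          using insert.prems bif by (intro sum.cong refl) (simp add: grp_def)
        finally have "(\<Sum>y\<in>X. c y * (f y * h y)) = (\<Sum>y\<in>X. c y * f y) * h x"
          by (subst (asm) x) (simp add: functional_sum[OF f] functional_scale[OF f])
        then show "f (\<Sum>y\<in>X. s (c y * (h x - h y)) y) = f 0"
          by (simp add: functional_sum[OF f] functional_scale[OF f] functional_0[OF f]
              functional_diff[OF f] algebra_simps sum_subtractf sum_distrib_left)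
      qed
      then have "c y * (h x - h y) = 0"
        using independentD[OF ind insert(1) subset_refl _ y, of "\<lambda>y. c y * (h x - h y)"] by blast
      then show ?thesis using h by simp
    qed
    then have "x = 0" using x by simp
    then show False using insert.prems[of x] counit_scale[of 0 0] by (auto simp: grp_def)
  qed
  then show ?case using ind independent_insertI by blast
qed

lemma grp_finite_order:
  assumes x: "grp x"
  shows "\<exists>n>0. x ^ n = 1"
proof -
  have "\<not> inj_on (\<lambda>i. x ^ i) {..card B}"
  proof
    assume inj: "inj_on (\<lambda>i. x ^ i) {..card B}"
    have "independent ((\<lambda>i. x ^ i) ` {..card B})"
      by (rule grp_independent) (auto intro: grp_power x)
    then have "card ((\<lambda>i. x ^ i) ` {..card B}) \<le> card B"
      using independent_span_bound[OF B_finite] B_span by blast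
    then show False using card_image[OF inj] by simp
  qed
  then obtain i j where ij: "i \<noteq> j" "x ^ i = x ^ j" by (auto simp: inj_on_def)
  have *: "x ^ (j - i) = 1" if "i < j" "x ^ i = x ^ j" for i j
  proof -
    have "S (x ^ i) * x ^ i * x ^ (j - i) = S (x ^ i) * x ^ i"
    proof -
      have "x ^ i * x ^ (j - i) = x ^ j" using that(1) by (simp flip: power_add)
      then have "x ^ i * x ^ (j - i) = x ^ i" using that(2) by simp
      then show ?thesis by (simp add: mult.assoc)
    qed
    then show ?thesis using grp_antipode(1)[OF grp_power[OF x]] by simp
  qed
  show ?thesis
  proof (cases "i < j")
    case True
    then show ?thesis using *[OF True ij(2)] by (intro exI[of _ "j - i"]) auto
  next
    case False
    then have "j < i" using ij by simp
    then show ?thesis using *[of j i] ij by (intro exI[of _ "i - j"]) auto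
  qed
qed

lemma antipode_antipode_gd: "S (S gd) = gd"
  using grp_antipode[OF grp_gd] antipode_mult[of gd "S gd"] antipode_mult[of "S gd" gd] antipode_one
  by (metis mult.assoc mult_1_left mult_1_right)

text \<open>By uniqueness of integrals it suffices that \<open>lam (S x * gd)\<close> is again an
  integral in \<open>x\<close>.\<close>

lemma lam_antipode: "lam (S x * gd) = lam x"
proof -
  have "lam (S x * gd) = lam (S Lam * gd) * lam x"
  proof (rule integral_unique)
    show "functional (\<lambda>x. lam (S x * gd))" by (intro fnl)
    fix f x assume f: "functional f"
    \<comment> \<open>Chosen so that \<open>?f (S b * gd) = f b\<close> and
      \<open>?f gd = f 1\<close>.\<close>
    let ?f = "\<lambda>p. f (Si (p * S gd))"
    have f': "functional ?f"
      using operator_Si by (intro functional_comp[OF functional_comp[OF f operator_Si]] fn_intros)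
    have "?f gd * lam (S x * gd) = sw (S x * gd) (\<lambda>p q. ?f p * lam q)"
      by (rule lam_integral_left[OF f', symmetric])
    also have "\<dots> = sw (S x) (\<lambda>p q. sw gd (\<lambda>c d. ?f (p * c) * lam (q * d)))"
      by (rule sw_mult) (intro bifunctionalI fnl functional_comp[OF f'])
    also have "\<dots> = sw (S x) (\<lambda>p q. ?f (p * gd) * lam (q * gd))"
    proof -
      have "bifunctional (\<lambda>c d. ?f (p * c) * lam (q * d))" for p q
        by (intro bifunctionalI fnl functional_comp[OF f'])
      then show ?thesis using grp_gd by (simp add: grp_def)
    qed
    also have "\<dots> = sw x (\<lambda>a b. ?f (S b * gd) * lam (S a * gd))"
      by (rule sw_antipode) (intro bifunctionalI fnl functional_comp[OF f'])
    finally show "sw x (\<lambda>a b. lam (S a * gd) * f b) = lam (S x * gd) * f 1"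
      using grp_antipode(2)[OF grp_gd] Si_S[of 1]
      by (simp add: mult.assoc antipode_one mult.commute)
  qed
  moreover have "lam (S Lam * gd) = 1"
    using grp_gd by (simp add: antipode_Lam Lam_mult grp_def lam_Lam functional_scale[OF functional_lam])
  ultimately show ?thesis by simp
qed

text \<open>Radford's formula in the case of a two-sided integral \<open>Lam\<close>. Under
  \<open>lam\<close>, an element is traded for its antipode by \<open>lam_antipode\<close> and
  factors are rotated by \<open>lam_nakayama\<close>; nondegeneracy removes the test element
  \<open>y\<close>.\<close>

lemma antipode_4: "S (S (S (S x))) = gd * x * S gd"
proof -
  note g = grp_antipode[OF grp_gd] antipode_antipode_gd
  have g1: "S gd * (gd * z) = z" "gd * (S gd * z) = z" for z
    using g by (simp_all flip: mult.assoc)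
  have "lam ((x - S gd * S (S (S (S x))) * gd) * y) = 0" for y
  proof -
    let ?w = "gd * y * S gd * S (S x)"
    have "lam (x * y) = lam (S y * (S x * gd))"
      by (subst lam_antipode[symmetric]) (simp add: antipode_mult mult.assoc)
    also have "\<dots> = lam (S (S (S x * gd)) * S y)"
      by (rule lam_nakayama)
    also have "S (S (S x * gd)) * S y = S ?w * gd"
      by (simp add: antipode_mult g g1 mult.assoc)
    also have "lam (S ?w * gd) = lam ?w"
      by (rule lam_antipode)
    also have "\<dots> = lam (S (S (S (S x))) * (gd * y) * S gd)"
      using lam_nakayama[of "gd * y * S gd" "S (S x)"] by (simp add: mult.assoc)
    also have "\<dots> = lam (S gd * (S (S (S (S x))) * (gd * y)))"
      using lam_nakayama[of "S (S (S (S x))) * (gd * y)" "S gd"] by (simp add: g)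
    finally show ?thesis
      by (simp add: left_diff_distrib functional_diff[OF functional_lam] mult.assoc)
  qed
  then have "x = S gd * S (S (S (S x))) * gd"
    using lam_nondegenerate_left by (metis eq_iff_diff_eq_0)
  then have "gd * x * S gd = gd * (S gd * S (S (S (S x))) * gd) * S gd" by simp
  then show ?thesis by (simp add: mult.assoc g g1)
qed

end

section \<open>Sums of roots of unity\<close>

definition rat_eval :: "rat poly \<Rightarrow> 'c::field_char_0 \<Rightarrow> 'c" where
  "rat_eval p x = poly (map_poly of_rat p) x"

lemma rat_eval_0 [simp]: "rat_eval 0 x = 0"
  by (simp add: rat_eval_def)

lemma rat_eval_pCons [simp]: "rat_eval (pCons a p) x = of_rat a + x * rat_eval p x"
  by (simp add: rat_eval_def map_poly_pCons)

lemma rat_eval_1 [simp]: "rat_eval 1 x = 1"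
  by (simp add: one_pCons)

lemma rat_eval_add: "rat_eval (p + q) x = rat_eval p x + rat_eval q x"
proof (induction p arbitrary: q)
  case (pCons a p)
  obtain b q' where "q = pCons b q'" by (cases q)
  then show ?case by (simp add: pCons.IH of_rat_add algebra_simps)
qed simp

lemma rat_eval_smult: "rat_eval (smult c p) x = of_rat c * rat_eval p x"
  by (induction p) (auto simp: of_rat_mult algebra_simps)

lemma rat_eval_mult: "rat_eval (p * q) x = rat_eval p x * rat_eval q x"
  by (induction p) (auto simp: rat_eval_add rat_eval_smult algebra_simps)

lemma rat_eval_sum: "rat_eval (\<Sum>i\<in>I. p i) x = (\<Sum>i\<in>I. rat_eval (p i) x)"
  by (induction I rule: infinite_finite_induct) (auto simp: rat_eval_add)

lemma rat_eval_monom: "rat_eval (monom 1 k) x = x ^ k"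
  by (induction k) (auto simp: monom_0 monom_Suc)

lemma rat_eval_diff: "rat_eval (p - q) x = rat_eval p x - rat_eval q x"
  using rat_eval_add[of "p - q" q x] by (simp add: eq_diff_eq)

lemma rational_minimal_polynomial:
  assumes "rat_eval q x = 0" "q \<noteq> 0"
  obtains m where "m \<noteq> 0" "rat_eval m x = 0" "degree m > 0" "\<And>P. rat_eval P x = 0 \<Longrightarrow> m dvd P"
proof -
  have "\<exists>m. (m \<noteq> 0 \<and> rat_eval m x = 0) \<and> (\<forall>y. y \<noteq> 0 \<and> rat_eval y x = 0 \<longrightarrow> degree m \<le> degree y)"
    using ex_has_least_nat[of "\<lambda>m. m \<noteq> 0 \<and> rat_eval m x = 0" q degree] assms by blast
  then obtain m where m: "m \<noteq> 0" "rat_eval m x = 0" "\<And>y. y \<noteq> 0 \<Longrightarrow> rat_eval y x = 0 \<Longrightarrow> degree m \<le> degree y"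
    by blast
  have "degree m > 0"
  proof (rule ccontr)
    assume "\<not> degree m > 0"
    then obtain a where "m = [:a:]" by (metis degree_eq_zeroE neq0_conv)
    then show False using m by simp
  qed
  moreover have "m dvd P" if P: "rat_eval P x = 0" for P
  proof -
    have "P mod m = P - P div m * m" by (simp add: minus_div_mult_eq_mod)
    then have "rat_eval (P mod m) x = 0" using P m(2) by (simp only: rat_eval_diff rat_eval_mult) simp
    then have "P mod m = 0"
      using m(3)[of "P mod m"] degree_mod_less'[of m P] m(1) by fastforce
    then show ?thesis by (simp add: dvd_eq_mod_eq_0)
  qed
  ultimately show ?thesis using that m by blast
qed

text \<open>\<open>\<zeta>\<close> is a root in the given field of the minimal polynomial of \<open>z\<close> over the rationals.\<close>

lemma conjugate_root:
  fixes z :: complex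
  assumes z: "rat_eval q z = 0" "q \<noteq> 0"
  obtains \<zeta> :: "'k::{alg_closed_field,field_char_0}"
  where "\<And>P. rat_eval P \<zeta> = 0 \<longleftrightarrow> rat_eval P z = 0"
proof -
  obtain m where m: "m \<noteq> 0" "rat_eval m z = 0" "degree m > 0" "\<And>P. rat_eval P z = 0 \<Longrightarrow> m dvd P"
    using rational_minimal_polynomial[OF z] by blast
  have "degree (map_poly of_rat m :: 'k poly) > 0"
    using m(3) by (simp add: degree_map_poly)
  then obtain \<zeta> :: 'k where \<zeta>: "rat_eval m \<zeta> = 0"
    using alg_closed_imp_poly_has_root unfolding rat_eval_def by blast
  \<comment> \<open>Irreducibility of \<open>m\<close> in disguise: were \<open>g\<close> nonzero at
    \<open>z\<close>, the cofactor \<open>h\<close> would vanish there and be divisible by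
    \<open>m\<close>, against the degrees.\<close>
  obtain g where g: "g \<noteq> 0" "rat_eval g \<zeta> = 0" "degree g > 0" "\<And>P. rat_eval P \<zeta> = 0 \<Longrightarrow> g dvd P"
    using rational_minimal_polynomial[OF \<zeta> m(1)] by blast
  obtain h where h: "m = g * h" using g(4)[OF \<zeta>] by (auto elim: dvdE)
  have gz: "rat_eval g z = 0"
  proof (rule ccontr)
    assume "rat_eval g z \<noteq> 0"
    then have "m dvd h" using m(2,4) h by (simp add: rat_eval_mult)
    moreover have "h \<noteq> 0" using m(1) h by auto
    ultimately have "degree m \<le> degree h" by (rule dvd_imp_degree_le)
    then show False using g(1,3) \<open>h \<noteq> 0\<close> h by (simp add: degree_mult_eq)
  qed
  have "rat_eval P \<zeta> = 0 \<longleftrightarrow> rat_eval P z = 0" for P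
    using m(4)[of P] g(4)[of P] \<zeta> gz by (auto simp: rat_eval_mult elim!: dvdE)
  then show ?thesis using that by blast
qed

text \<open>Transported to the complex numbers, the sum over each class becomes a squared modulus.\<close>

lemma root_sums_nonzero:
  fixes \<alpha> :: "'i \<Rightarrow> 'k::{alg_closed_field,field_char_0}" and cl :: "'i \<Rightarrow> 'j"
  assumes I: "finite I" and M: "M > 0" and nz: "\<And>i. i \<in> I \<Longrightarrow> \<alpha> i \<noteq> 0"
    and root: "\<And>i j. i \<in> I \<Longrightarrow> j \<in> I \<Longrightarrow> cl i = cl j \<Longrightarrow> (\<alpha> i / \<alpha> j) ^ M = 1"
    and i0: "i0 \<in> I" "\<And>i. i \<in> I \<Longrightarrow> cl i = cl i0 \<Longrightarrow> i = i0"
  shows "(\<Sum>i\<in>I. \<Sum>j\<in>{j\<in>I. cl j = cl i}. \<alpha> i / \<alpha> j) \<noteq> 0"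
proof
  assume 0: "(\<Sum>i\<in>I. \<Sum>j\<in>{j\<in>I. cl j = cl i}. \<alpha> i / \<alpha> j) = 0"
  define z where "z = cis (2 * pi / real M)"
  have zM: "z ^ M = 1" using M by (simp add: z_def DeMoivre)
  have zprim: "z ^ j \<noteq> 1" if j: "0 < j" "j < M" for j
  proof
    assume "z ^ j = 1"
    moreover have "(\<lambda>k. cis (2 * pi * real k / real M)) j = z ^ j" "z ^ 0 = (\<lambda>k. cis (2 * pi * real k / real M)) 0"
      by (simp_all add: z_def DeMoivre mult.commute)
    ultimately show False
      using bij_betw_roots_unity[OF M] j
        inj_onD[of "\<lambda>k. cis (2 * pi * real k / real M)" "{..<M}" j 0]
      by (auto simp: bij_betw_def)
  qed
  have "rat_eval (monom 1 M - 1) z = 0" "monom 1 M - 1 \<noteq> (0 :: rat poly)"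
  proof -
    show "rat_eval (monom 1 M - 1) z = 0" by (simp add: rat_eval_diff rat_eval_monom zM)
    have "coeff (monom 1 M - 1 :: rat poly) M = 1" using M by simp
    then show "monom 1 M - 1 \<noteq> (0 :: rat poly)" by (metis coeff_0 zero_neq_one)
  qed
  then obtain \<zeta> :: 'k where \<zeta>: "\<And>P. rat_eval P \<zeta> = 0 \<longleftrightarrow> rat_eval P z = 0"
    by (rule conjugate_root) (rule that)
  have pow: "\<zeta> ^ j = 1 \<longleftrightarrow> z ^ j = 1" for j
    using \<zeta>[of "monom 1 j - 1"] by (simp add: rat_eval_diff rat_eval_monom)
  have \<zeta>M: "\<zeta> ^ M = 1" using pow zM by simp
  have \<zeta>0: "\<zeta> \<noteq> 0" using \<zeta>M M by (auto simp: power_0_left)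
  have inj: "inj_on (\<lambda>k. \<zeta> ^ k) {..<M}"
  proof (rule inj_onI)
    have *: False if "i < j" "j < M" "\<zeta> ^ i = \<zeta> ^ j" for i j
    proof -
      have "\<zeta> ^ i * \<zeta> ^ (j - i) = \<zeta> ^ j" using that(1) by (simp flip: power_add)
      then have "\<zeta> ^ i * \<zeta> ^ (j - i) = \<zeta> ^ i * 1" using that(3) by simp
      then have "\<zeta> ^ (j - i) = 1" using \<zeta>0 by simp
      then show False using pow zprim[of "j - i"] that by simp
    qed
    fix i j assume "i \<in> {..<M}" "j \<in> {..<M}" "\<zeta> ^ i = \<zeta> ^ j"
    then show "i = j" using *[of i j] *[of j i] by (cases i j rule: linorder_cases) auto
  qed
  \<comment> \<open>\<open>?U\<close> has at most \<open>M\<close> elements and contains the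
    \<open>M\<close> distinct powers of \<open>\<zeta>\<close>, so every ratio occurring in the sum
    is such a power.\<close>
  let ?U = "{x::'k. x ^ M = 1}"
  define p where "p = monom 1 M - (1 :: 'k poly)"
  have p0: "p \<noteq> 0"
  proof -
    have "coeff p M = 1" using M by (simp add: p_def)
    then show ?thesis by (metis coeff_0 zero_neq_one)
  qed
  have U: "?U = {x. poly p x = 0}" by (simp add: p_def poly_monom)
  have fU: "finite ?U" unfolding U by (rule poly_roots_finite[OF p0])
  have "card ?U \<le> M"
    unfolding U using card_poly_roots_bound[OF p0] by (simp add: p_def order_trans[OF _ degree_diff_le] degree_monom_eq)
  moreover have sub: "(\<lambda>k. \<zeta> ^ k) ` {..<M} \<subseteq> ?U"
    using \<zeta>M by (auto simp flip: power_mult simp: mult.commute[of _ M]) (simp add: power_mult)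
  ultimately have "(\<lambda>k. \<zeta> ^ k) ` {..<M} = ?U"
    using card_image[OF inj] fU by (intro card_seteq) auto
  then have ex: "\<exists>k<M. x = \<zeta> ^ k" if "x ^ M = 1" for x using that by blast
  define r where "r i = (SOME j. j \<in> I \<and> cl j = cl i)" for i
  have r: "r i \<in> I \<and> cl (r i) = cl i" if "i \<in> I" for i
    unfolding r_def by (rule someI[of _ i]) (use that in auto)
  have req: "r i = r j" if "cl i = cl j" for i j unfolding r_def that ..
  have "\<exists>k<M. \<alpha> i / \<alpha> (r i) = \<zeta> ^ k" if "i \<in> I" for i
    using ex root[of i "r i"] r that by simp
  then obtain k where k: "\<And>i. i \<in> I \<Longrightarrow> k i < M \<and> \<alpha> i / \<alpha> (r i) = \<zeta> ^ k i" by metis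
  \<comment> \<open>The exponent \<open>M - k j\<close> stands for division by the
    \<open>k j\<close>-th power, and the reference \<open>r i\<close> of a class cancels in ratios.
    So \<open>P\<close> is the given sum at \<open>\<zeta>\<close> and a sum of squared moduli at
    \<open>z\<close>.\<close>
  define P where "P = (\<Sum>i\<in>I. \<Sum>j\<in>{j\<in>I. cl j = cl i}. monom (1::rat) (k i + (M - k j)))"
  have inv: "x ^ (M - l) = inverse (x ^ l)" if "x ^ M = 1" "l < M" for x :: "'c::field" and l
  proof -
    have "x ^ l * x ^ (M - l) = 1" using that by (simp flip: power_add)
    then show ?thesis by (metis inverse_unique)
  qed
  have "rat_eval P \<zeta> = (\<Sum>i\<in>I. \<Sum>j\<in>{j\<in>I. cl j = cl i}. \<alpha> i / \<alpha> j)"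
    unfolding P_def rat_eval_sum
  proof (intro sum.cong refl)
    fix i j assume i: "i \<in> I" and j: "j \<in> {j\<in>I. cl j = cl i}"
    have rj: "r j = r i" using j by (intro req) simp
    have kj: "k j < M" using k[of j] j by simp
    have "rat_eval (monom 1 (k i + (M - k j))) \<zeta> = \<zeta> ^ k i / \<zeta> ^ k j"
      unfolding rat_eval_monom power_add divide_inverse inv[OF \<zeta>M kj] ..
    also have "\<dots> = \<alpha> i / \<alpha> j"
    proof -
      have "\<zeta> ^ k i = \<alpha> i / \<alpha> (r i)" "\<zeta> ^ k j = \<alpha> j / \<alpha> (r i)"
        using k[OF i] k[of j] j rj by auto
      then show ?thesis using nz[of "r i"] r[OF i] by simp
    qed
    finally show "rat_eval (monom 1 (k i + (M - k j))) \<zeta> = \<alpha> i / \<alpha> j" .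
  qed
  then have "rat_eval P z = 0" using 0 \<zeta> by simp
  moreover have "rat_eval P z = (\<Sum>D\<in>cl ` I. of_real ((cmod (\<Sum>i | i \<in> I \<and> cl i = D. z ^ k i))\<^sup>2))"
  proof -
    have "rat_eval P z = (\<Sum>i\<in>I. \<Sum>j\<in>{j\<in>I. cl j = cl i}. z ^ k i * cnj (z ^ k j))"
      unfolding P_def rat_eval_sum
    proof (intro sum.cong refl)
      fix i j assume "i \<in> I" and j: "j \<in> {j\<in>I. cl j = cl i}"
      have kj: "k j < M" using k[of j] j by simp
      have "inverse (z ^ k j) = cnj (z ^ k j)" by (simp add: z_def DeMoivre cis_cnj cis_inverse)
      then show "rat_eval (monom 1 (k i + (M - k j))) z = z ^ k i * cnj (z ^ k j)"
        unfolding rat_eval_monom power_add inv[OF zM kj] by simp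
    qed
    also have "\<dots> = (\<Sum>D\<in>cl ` I. \<Sum>i | i \<in> I \<and> cl i = D. \<Sum>j\<in>{j\<in>I. cl j = cl i}. z ^ k i * cnj (z ^ k j))"
      by (rule sum.image_gen[OF I])
    also have "\<dots> = (\<Sum>D\<in>cl ` I. of_real ((cmod (\<Sum>i | i \<in> I \<and> cl i = D. z ^ k i))\<^sup>2))"
      unfolding complex_norm_square cnj_sum sum_product
      by (intro sum.cong refl) auto
    finally show ?thesis .
  qed
  ultimately have "complex_of_real (\<Sum>D\<in>cl ` I. (cmod (\<Sum>i | i \<in> I \<and> cl i = D. z ^ k i))\<^sup>2) = 0"
    unfolding of_real_sum by simp
  then have "(\<Sum>D\<in>cl ` I. (cmod (\<Sum>i | i \<in> I \<and> cl i = D. z ^ k i))\<^sup>2) = 0"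
    unfolding of_real_eq_0_iff .
  \<comment> \<open>All squared moduli vanish, but the class of \<open>i0\<close> is a singleton and
    contributes a power of \<open>z\<close>.\<close>
  then have "(cmod (\<Sum>i | i \<in> I \<and> cl i = cl i0. z ^ k i))\<^sup>2 = 0"
    using I i0(1) by (subst (asm) sum_nonneg_eq_0_iff) auto
  moreover have "{i \<in> I. cl i = cl i0} = {i0}" using i0 by auto
  ultimately have "z ^ k i0 = 0" by simp
  then show False using zM M by (auto simp: z_def)
qed

section \<open>The antipode is an involution\<close>

context ss_hopf
begin

definition t :: "'h \<Rightarrow> 'k" where "t x = tr (\<lambda>a. x * a)"

lemma operator_L: "operator (\<lambda>a. x * a)"
  by (intro fn_intros)

lemma functional_t: "functional t"
  by (simp add: functional_def t_def distrib_right scale_mult_left tr_add tr_scale)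

lemma t_commute: "t (x * y) = t (y * x)"
  using tr_commute[OF operator_L operator_L, of x y] by (simp add: t_def mult.assoc)

lemma pev_L: "pev p (\<lambda>a. z * a) v = pev p (\<lambda>a. z * a) 1 * v"
  by (induction p) (simp_all add: operator_L distrib_right scale_mult_left mult.assoc)

text \<open>If \<open>x * y\<close> is nonzero for some \<open>y\<close> in a simple left ideal, the
  ideal is generated by \<open>x * y\<close>, so some \<open>z = a * x\<close> fixes
  \<open>y\<close> and is not nilpotent. The nonzero idempotent that \<open>fitting\<close> makes
  from \<open>z\<close> has trace zero, because \<open>t\<close> vanishes on all
  \<open>z * b\<close>.\<close>

lemma t_nondegenerate:
  assumes x: "\<And>y. t (x * y) = 0"
  shows "x = 0"
proof (rule ccontr)
  assume "x \<noteq> 0"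
  have "\<exists>J y. simple_left_ideal s J \<and> y \<in> J \<and> x * y \<noteq> 0"
  proof (rule ccontr)
    assume *: "\<not> ?thesis"
    have "subspace {y. x * y = 0}"
      by (auto simp: subspace_def distrib_left scale_mult_right)
    moreover have "\<Union>{I. simple_left_ideal s I} \<subseteq> {y. x * y = 0}" using * by blast
    ultimately have "span (\<Union>{I. simple_left_ideal s I}) \<subseteq> {y. x * y = 0}" by (intro span_minimal)
    then have "1 \<in> {y. x * y = 0}" using semisimple unfolding semisimple_algebra_def by blast
    then show False using \<open>x \<noteq> 0\<close> by simp
  qed
  then obtain J y where J: "simple_left_ideal s J" "y \<in> J" "x * y \<noteq> 0" by blast
  let ?K = "range (\<lambda>a. a * (x * y))"
  have "left_ideal s ?K"
    unfolding left_ideal_def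
  proof (intro conjI ballI allI)
    show "subspace ?K"
      by (rule subspace_image_operator[OF _ subspace_UNIV]) (intro fn_intros)
  qed (auto simp flip: mult.assoc)
  moreover have "?K \<subseteq> J"
    using J by (auto simp: simple_left_ideal_def left_ideal_def)
  moreover have "?K \<noteq> {0}" using J(3) by (metis UNIV_I image_eqI mult_1_left singletonD)
  ultimately have "y \<in> ?K" using J by (auto simp: simple_left_ideal_def)
  then obtain a where y: "y = a * x * y" by (auto simp: mult.assoc)
  define z where "z = a * x"
  have tz: "t (z * b) = 0" for b
    using x[of "b * a"] t_commute[of a "x * b"] by (simp add: z_def mult.assoc)
  from fitting[OF operator_L, of z] show False
  proof
    assume "\<exists>k. \<forall>v. ((\<lambda>a. z * a) ^^ k) v = 0"
    then obtain k where "((\<lambda>a. z * a) ^^ k) y = 0" by blast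
    moreover have "((\<lambda>a. z * a) ^^ k) y = y" by (induction k) (auto simp: z_def y[symmetric])
    ultimately show False using J(3) by simp
  next
    assume "\<exists>r. (\<forall>v. z * pev r ((*) z) (z * pev r ((*) z) v) = z * pev r ((*) z) v) \<and>
        (\<exists>v. z * pev r ((*) z) v \<noteq> 0)"
    then obtain r v where r: "\<And>v. z * pev r ((*) z) (z * pev r ((*) z) v) = z * pev r ((*) z) v"
      "z * pev r ((*) z) v \<noteq> 0" by blast
    define w where "w = z * pev r ((*) z) 1"
    have w: "z * pev r ((*) z) v = w * v" for v
      by (subst pev_L) (simp add: w_def mult.assoc)
    have "w * v = 0"
      by (rule tr_idempotent_eq_0[of "\<lambda>v. w * v"])
        (use r(1) tz operator_L in \<open>auto simp: w t_def[symmetric]\<close>, simp add: w_def tz)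
    then show False using r(2) w by simp
  qed
qed

text \<open>\<open>t\<close> is symmetric, \<open>lam\<close> only up to the square of
  \<open>S\<close>. The element \<open>v\<close> with \<open>t x = lam (v * x)\<close> therefore
  satisfies \<open>v * x = S (S x) * v\<close>, and nondegeneracy of \<open>t\<close> makes it
  invertible.\<close>

lemma antipode_square_inner:
  obtains v w where "v * w = 1" "w * v = 1" "\<And>x. S (S x) = v * x * w" "\<And>x. t x = lam (v * x)"
proof -
  define v where "v = swv Lam (\<lambda>a b. s (t a) (S b))"
  have tv: "t x = lam (v * x)" for x
  proof -
    have "functional (\<lambda>z. lam (z * x))" by (intro fnl)
    then have "lam (v * x) = sw Lam (\<lambda>a b. t a * lam (S b * x))"
      unfolding v_def
      by (subst functional_swv[where f = "\<lambda>z. lam (z * x)"])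
        (auto simp: scale_mult_left functional_scale[OF functional_lam])
    then show ?thesis using lam_dual_right[OF functional_t] by simp
  qed
  have comm: "v * x = S (S x) * v" for x
  proof -
    have "lam ((v * x - S (S x) * v) * y) = 0" for y
      using t_commute[of x y] lam_nakayama[of "v * y" x]
      by (simp add: tv left_diff_distrib functional_diff[OF functional_lam] mult.assoc)
    then show ?thesis using lam_nondegenerate_left[of "v * x - S (S x) * v"] by simp
  qed
  have inj: "v * x = 0 \<Longrightarrow> x = 0" for x
    by (rule t_nondegenerate) (simp add: tv functional_0[OF functional_lam] flip: mult.assoc)
  obtain w where w: "v * w = 1"
    using injective_imp_surjective[OF operator_L[of v] inj, of 1] by blast
  have "v * (w * v - 1) = 0" using w by (simp add: right_diff_distrib flip: mult.assoc)
  then have "w * v = 1" using inj by fastforce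
  moreover have "S (S x) = v * x * w" for x
    using comm[of x] w by (simp add: mult.assoc)
  ultimately show ?thesis using that w tv by blast
qed

lemma L_op_algebra:
  assumes "1 \<in> X" "subspace X" "\<And>x y. x \<in> X \<Longrightarrow> y \<in> X \<Longrightarrow> x * y \<in> X"
    and nd: "\<And>x. x \<in> X \<Longrightarrow> (\<And>y. y \<in> X \<Longrightarrow> t (x * y) = 0) \<Longrightarrow> x = 0"
  shows "op_algebra s B ((\<lambda>x. (\<lambda>a. x * a)) ` X)"
proof unfold_locales
  fix F G c
  assume F: "F \<in> (\<lambda>x a. x * a) ` X"
  then obtain x where x: "x \<in> X" "F = (\<lambda>a. x * a)" by blast
  show "operator F" using x operator_L by simp
  show "(\<lambda>v. s c (F v)) \<in> (\<lambda>x a. x * a) ` X"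
    using x assms(2) by (intro image_eqI[of _ _ "s c x"]) (auto simp: scale_mult_left subspace_scale)
  show "F = (\<lambda>x. 0)" if 0: "\<And>G. G \<in> (\<lambda>x a. x * a) ` X \<Longrightarrow> tr (\<lambda>x. F (G x)) = 0"
  proof -
    have "t (x * y) = 0" if "y \<in> X" for y
      using 0[of "\<lambda>a. y * a"] that x(2) by (simp add: t_def mult.assoc)
    then have "x = 0" using nd[OF x(1)] by blast
    then show ?thesis using x(2) by simp
  qed
  assume "G \<in> (\<lambda>x a. x * a) ` X"
  then obtain y where y: "y \<in> X" "G = (\<lambda>a. y * a)" by blast
  show "(\<lambda>v. F v + G v) \<in> (\<lambda>x a. x * a) ` X"
    using x y assms(2) by (intro image_eqI[of _ _ "x + y"]) (auto simp: distrib_right subspace_add)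
  show "(\<lambda>v. F (G v)) \<in> (\<lambda>x a. x * a) ` X"
    using x y assms(3) by (intro image_eqI[of _ _ "x * y"]) (auto simp: mult.assoc)
next
  show "(\<lambda>x. x) \<in> (\<lambda>x a. x * a) ` X"
    using assms(1) by (intro image_eqI[of _ _ 1]) auto
qed

lemma power_inverse_cancel:
  assumes "v * w = (1::'h)"
  shows "v ^ n * w ^ n = 1"
proof (induction n)
  case (Suc n)
  have "v ^ Suc n * w ^ Suc n = v ^ n * (v * w) * w ^ n"
    unfolding power_Suc2[of v] power_Suc[of w] by (simp add: mult.assoc)
  then show ?case using Suc assms by simp
qed simp

text \<open>The square of \<open>S\<close> is conjugation by \<open>v\<close>. With primitive
  idempotents chosen in the centraliser of \<open>v\<close>, the matrix units are eigenvectors with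
  eigenvalues \<open>\<alpha> i / \<alpha> j\<close>, so the trace \<open>lam 1\<close> is a sum of
  the kind treated in \<open>root_sums_nonzero\<close>.\<close>

lemma lam_1_nonzero: "lam 1 \<noteq> 0"
proof -
  obtain v w where vw: "v * w = 1" "w * v = 1" and inner: "\<And>x. S (S x) = v * x * w"
    by (rule antipode_square_inner) blast
  obtain N where N: "N > 0" "gd ^ N = 1" using grp_finite_order[OF grp_gd] by blast
  \<comment> \<open>The fourth power of \<open>S\<close> is conjugation by \<open>gd\<close> and
    \<open>gd ^ N = 1\<close>; so \<open>2 * N\<close> iterations of the square of \<open>S\<close>
    give the identity.\<close>
  define M where "M = 2 * N"
  have M: "M > 0" using N by (simp add: M_def)
  have iter: "((\<lambda>x. S (S x)) ^^ k) x = v ^ k * x * w ^ k" for k x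
  proof (induction k)
    case (Suc k)
    then show ?case by (simp add: inner mult.assoc power_commutes)
  qed simp
  have "((\<lambda>x. S (S x)) ^^ (2 * k)) x = gd ^ k * x * S gd ^ k" for k x
  proof (induction k)
    case (Suc k)
    then show ?case by (simp add: antipode_4 mult.assoc power_commutes)
  qed simp
  moreover have "S gd ^ N = 1"
    using power_inverse_cancel[OF grp_antipode(1)[OF grp_gd], of N] N(2) by simp
  ultimately have vM: "v ^ M * x * w ^ M = x" for x
    using iter[of M x] N(2) by (simp add: M_def)
  define X where "X = {x. x * v = v * x}"
  have Xw: "x * w = w * x" if "x \<in> X" for x
    using that vw unfolding X_def by (metis (mono_tags, lifting) mem_Collect_eq mult.assoc mult_1_left mult_1_right)
  have nd: "x = 0" if x: "x \<in> X" and 0: "\<And>y. y \<in> X \<Longrightarrow> t (x * y) = 0" for x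
  proof (rule t_nondegenerate)
    fix y
    \<comment> \<open>The sum of the conjugates of \<open>y\<close> under powers of \<open>v\<close>
      lies in \<open>X\<close> and pairs with \<open>x\<close> like \<open>M\<close> copies of
      \<open>y\<close>; thus the trace form stays nondegenerate on the centraliser.\<close>
    define y' where "y' = (\<Sum>j<M. v ^ j * y * w ^ j)"
    have "v * y' * w = (\<Sum>j<M. v ^ Suc j * y * w ^ Suc j)"
      by (simp add: y'_def sum_distrib_left sum_distrib_right mult.assoc power_commutes)
    also have "\<dots> = (\<Sum>j\<in>{1..<Suc M}. v ^ j * y * w ^ j)"
      unfolding sum.atLeast_Suc_lessThan_Suc_shift One_nat_def by (simp add: lessThan_atLeast0)
    also have "\<dots> = y'"
      using vM[of y] M sum.atLeast_Suc_lessThan[of 0 M "\<lambda>j. v ^ j * y * w ^ j"]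
      by (simp add: y'_def lessThan_atLeast0 add.commute)
    finally have "v * y' * w * v = y' * v" by simp
    then have "y' \<in> X" using vw by (simp add: X_def mult.assoc)
    then have "t (x * y') = 0" by (rule 0)
    moreover have "t (x * (v ^ j * y * w ^ j)) = t (x * y)" for j
    proof -
      have "x * v ^ j = v ^ j * x" using x by (simp add: X_def power_commuting_commutes)
      then have "t (x * (v ^ j * y * w ^ j)) = t (w ^ j * v ^ j * (x * y))"
        by (metis t_commute mult.assoc)
      then show ?thesis using power_inverse_cancel[OF vw(2)] by simp
    qed
    ultimately have "of_nat M * t (x * y) = 0"
      by (simp add: y'_def sum_distrib_left functional_sum[OF functional_t])
    then show "t (x * y) = 0" using M by simp
  qed
  have X: "1 \<in> X" "subspace X" "\<And>x y. x \<in> X \<Longrightarrow> y \<in> X \<Longrightarrow> x * y \<in> X"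
    by (auto simp: X_def subspace_def algebra_simps scale_mult_left scale_mult_right)
      (metis mult.assoc)
  interpret O0: op_algebra s B "(\<lambda>x a. x * a) ` X"
    by (rule L_op_algebra[OF X nd])
  interpret O1: op_algebra s B "(\<lambda>x a. x * a) ` UNIV"
    by (rule L_op_algebra) (auto intro: t_nondegenerate)
  obtain E where E: "O0.decomposition E"
    "\<And>e F. e \<in> E \<Longrightarrow> F \<in> (\<lambda>x a. x * a) ` X \<Longrightarrow> \<exists>c. \<forall>x. e (F (e x)) = s c (e x)"
    by (rule O0.primitive_decomposition) (rule that)
  note Ed = E(1)[unfolded O0.decomposition_def]
  define el where "el e = e (1::'h)" for e :: "'h \<Rightarrow> 'h"
  have el: "e y = el e * y" "el e \<in> X" if "e \<in> E" for e y
    using Ed that by (auto simp: el_def)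
  have el_idem: "el e * el e = el e" if "e \<in> E" for e
    using Ed that el(1) by (metis el_def)
  \<comment> \<open>\<open>v\<close> is central in \<open>X\<close>, so on a primitive idempotent of
    \<open>X\<close> it acts by a scalar, called \<open>\<alpha> e\<close> below.\<close>
  have "\<exists>c. \<forall>x. v * (el e * x) = s c (el e * x)" if e: "e \<in> E" for e
  proof -
    obtain c where "\<And>x. e (v * e x) = s c (e x)"
      using E(2)[OF e, of "\<lambda>a. v * a"] by (auto simp: X_def)
    then have "el e * (v * (el e * x)) = s c (el e * x)" for x using el(1)[OF e] by metis
    moreover have "el e * (v * (el e * x)) = v * (el e * el e * x)" for x
      using el(2)[OF e] by (simp add: X_def flip: mult.assoc)
    ultimately show ?thesis using el_idem[OF e] by auto
  qed
  then obtain \<alpha> where \<alpha>: "\<And>e x. e \<in> E \<Longrightarrow> v * (el e * x) = s (\<alpha> e) (el e * x)" by metis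
  have \<alpha>0: "\<alpha> e \<noteq> 0" if e: "e \<in> E" for e
  proof
    assume "\<alpha> e = 0"
    then have "w * (v * el e) = 0" using \<alpha>[OF e, of 1] by simp
    then have "el e = 0" using vw(2) by (simp flip: mult.assoc)
    then have "e = (\<lambda>x. 0)" using el(1)[OF e] by auto
    then show False using Ed e by blast
  qed
  \<comment> \<open>\<open>v\<close> acts by the same scalar on both sides of a corner, so corner
    elements of the full algebra already lie in \<open>X\<close>: idempotents primitive in
    \<open>X\<close> remain primitive.\<close>
  have prim: "\<exists>c. \<forall>x. e (F (e x)) = s c (e x)" if e: "e \<in> E" and F: "F \<in> (\<lambda>x a. x * a) ` UNIV" for e F
  proof -
    obtain y where y: "F = (\<lambda>a. y * a)" using F by blast
    have "v * (el e * y * el e) = s (\<alpha> e) (el e * y * el e)"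
      using \<alpha>[OF e] by (simp add: mult.assoc)
    moreover have "el e * v = s (\<alpha> e) (el e)"
      using \<alpha>[OF e, of 1] el(2)[OF e] by (simp add: X_def)
    ultimately have "el e * y * el e \<in> X" by (simp add: X_def mult.assoc scale_mult_right)
    then obtain c where "\<And>x. e (el e * y * el e * e x) = s c (e x)" using E(2)[OF e] by blast
    then have "e (F (e x)) = s c (e x)" for x
      unfolding y using el(1)[OF e] el_idem[OF e] by (metis mult.assoc)
    then show ?thesis by blast
  qed
  interpret O: primitive_op_algebra s B "(\<lambda>x a. x * a) ` UNIV" E
    by unfold_locales (use Ed prim in \<open>auto simp: O1.decomposition_def\<close>)
  obtain cl u where "O.matrix_unit_system cl u" using O.matrix_units by blast
  note u = O.matrix_unit_systemD[OF this]
  have uu: "u i j (u j l x) = u i l x" if "i \<in> E" "j \<in> E" "l \<in> E" "cl i = cl j" "cl j = cl l" for i j l x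
    using u(3)[OF that(1,2,2,3,4,5), of x] by simp
  have ui: "i (u i j x) = u i j x" "u i j (j x) = u i j x" "u i j (u j i x) = i x"
    if "i \<in> E" "j \<in> E" "cl i = cl j" for i j x
    using uu[OF that(1,1,2) refl that(3), of x] uu[OF that(1,2,2,3) refl, of x]
      uu[OF that(1,2,1,3) that(3)[symmetric], of x] u(2)[OF that(1)] u(2)[OF that(2)] by simp_all
  have um: "u i j y = u i j 1 * y" if "i \<in> E" "j \<in> E" for i j y
    using u(1)[OF that] by auto
  have tr0: "tr i \<noteq> 0" if i: "i \<in> E" for i
    using O.E_nonzero[OF i] tr_idempotent_eq_0[OF O.E_op[OF i] O.E_idem[OF i]] by auto
  \<comment> \<open>The coefficient of \<open>x\<close> at a matrix unit, recovered as a
    trace.\<close>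
  define \<phi> where "\<phi> p x = tr (\<lambda>a. fst p (x * u (snd p) (fst p) a)) / tr (fst p)" for p x
  define Y where "Y = {p \<in> E \<times> E. cl (fst p) = cl (snd p)}"
  have \<phi>: "i (x * j y) = s (\<phi> (i, j) x) (u i j y)" if ij: "i \<in> E" "j \<in> E" "cl i = cl j" for i j x y
  proof -
    obtain c where c: "\<And>y. i (x * j y) = s c (u i j y)"
      using u(4)[OF ij(1,2) _ ij(3), of "\<lambda>a. x * a"] by auto
    have "i (x * u j i a) = s c (i a)" for a
    proof -
      show ?thesis using c[of "u j i a"]
        by (simp only: ui(1)[OF ij(2,1) ij(3)[symmetric]] ui(3)[OF ij])
    qed
    then have "\<phi> (i, j) x = c" using tr0[OF ij(1)] by (simp add: \<phi>_def tr_scale)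
    then show ?thesis using c by simp
  qed
  have ds: "dual_system UNIV Y \<phi> (\<lambda>p. u (fst p) (snd p) 1)"
    unfolding dual_system_def
  proof (intro conjI ballI)
    show "finite Y" using O.E_finite by (simp add: Y_def)
    fix p assume p: "p \<in> Y"
    show "functional (\<phi> p)"
    proof -
      have "operator (fst p)" using p O.E_op by (auto simp: Y_def)
      then show ?thesis
        unfolding functional_def \<phi>_def
        by (simp add: distrib_right scale_mult_left operator_add operator_scale tr_add tr_scale
            add_divide_distrib)
    qed
  next
    fix x
    have "x = (\<Sum>i\<in>E. i (x * (\<Sum>j\<in>E. j 1)))" using O.E_sum by simp
    also have "\<dots> = (\<Sum>i\<in>E. \<Sum>j\<in>E. i (x * j 1))"
      by (intro sum.cong refl) (simp add: sum_distrib_left operator_sum[OF O.E_op])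
    also have "\<dots> = (\<Sum>p\<in>E \<times> E. fst p (x * snd p 1))"
      by (simp add: sum.cartesian_product case_prod_unfold)
    also have "\<dots> = (\<Sum>p\<in>Y. fst p (x * snd p 1))"
    proof (rule sum.mono_neutral_right)
      show "\<forall>p\<in>E \<times> E - Y. fst p (x * snd p 1) = 0"
      proof
        fix p assume "p \<in> E \<times> E - Y"
        then have "fst p \<in> E" "snd p \<in> E" "cl (fst p) \<noteq> cl (snd p)" by (auto simp: Y_def)
        then show "fst p (x * snd p 1) = 0" using u(5)[of "fst p" "snd p" "\<lambda>a. x * a" 1] by simp
      qed
    qed (use O.E_finite in \<open>auto simp: Y_def\<close>)
    also have "\<dots> = (\<Sum>p\<in>Y. s (\<phi> p x) (u (fst p) (snd p) 1))"
      using \<phi> by (intro sum.cong refl) (auto simp: Y_def)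
    finally show "x = (\<Sum>p\<in>Y. s (\<phi> p x) (u (fst p) (snd p) 1))" .
  qed auto
  have uel: "el i * u i j 1 = u i j 1" "u i j 1 * el j = u i j 1" "u i j 1 \<noteq> 0" "\<phi> (i, j) (u i j 1) = 1"
    if ij: "i \<in> E" "j \<in> E" "cl i = cl j" for i j
  proof -
    show 1: "el i * u i j 1 = u i j 1"
      using ui(1)[OF ij, of 1] el(1)[OF ij(1)] by simp
    show 2: "u i j 1 * el j = u i j 1"
      using ui(2)[OF ij, of 1] um[OF ij(1,2), of "j 1"] by (simp add: el_def)
    obtain y where "i y \<noteq> 0" using O.E_nonzero[OF ij(1)] by auto
    then have "u i j 1 * u j i y \<noteq> 0"
      using ui(3)[OF ij, of y] um[OF ij(1,2), of "u j i y"] by simp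
    then show 3: "u i j 1 \<noteq> 0" by auto
    have "s (\<phi> (i, j) (u i j 1)) (u i j 1) = i (u i j 1 * j 1)" using \<phi>[OF ij] by simp
    also have "\<dots> = s 1 (u i j 1)" using 1 2 el(1)[OF ij(1)] el_def[of j] by (simp flip: mult.assoc)
    finally show "\<phi> (i, j) (u i j 1) = 1" using 3 by (metis scale_cancel_right)
  qed
  have S2: "S (S (u i j 1)) = s (\<alpha> i / \<alpha> j) (u i j 1)" if ij: "i \<in> E" "j \<in> E" "cl i = cl j" for i j
  proof -
    have "v * u i j 1 = s (\<alpha> i) (u i j 1)"
      using \<alpha>[OF ij(1), of "u i j 1"] uel[OF ij] by simp
    moreover have "el j * w = s (inverse (\<alpha> j)) (el j)"
    proof -
      have "el j = w * (v * el j)" using vw(2) by (simp flip: mult.assoc)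
      also have "\<dots> = s (\<alpha> j) (el j * w)"
        using \<alpha>[OF ij(2), of 1] Xw[OF el(2)[OF ij(2)]] by (simp add: scale_mult_right)
      finally show ?thesis using \<alpha>0[OF ij(2)] by (metis inverse_nonzero_iff_nonzero left_inverse scale_one scale_scale)
    qed
    ultimately have "v * (u i j 1 * el j) * w = s (\<alpha> i * inverse (\<alpha> j)) (u i j 1)"
      using uel(2)[OF ij] by (metis (no_types, lifting) mult.assoc scale_mult_left scale_mult_right scale_scale)
    then show ?thesis using uel(2)[OF ij] inner by (simp add: divide_inverse)
  qed
  have "lam 1 = (\<Sum>p\<in>Y. \<phi> p (S (S (u (fst p) (snd p) 1))))"
    unfolding lam_1 by (rule tr_dual_system[OF ds]) (intro fn_intros)
  also have "\<dots> = (\<Sum>p\<in>Y. \<alpha> (fst p) / \<alpha> (snd p))"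
    using ds S2 uel(4) by (intro sum.cong refl) (auto simp: Y_def dual_system_def functional_scale)
  also have "\<dots> = (\<Sum>i\<in>E. \<Sum>j\<in>{j\<in>E. cl j = cl i}. \<alpha> i / \<alpha> j)"
  proof -
    have "Y = Sigma E (\<lambda>i. {j \<in> E. cl j = cl i})" by (auto simp: Y_def)
    then show ?thesis using O.E_finite by (simp add: sum.Sigma case_prod_unfold)
  qed
  finally have lam1: "lam 1 = (\<Sum>i\<in>E. \<Sum>j\<in>{j\<in>E. cl j = cl i}. \<alpha> i / \<alpha> j)" .
  \<comment> \<open>An idempotent not killed by the counit is a multiple of \<open>Lam\<close>. Its
    block is the trivial representation, of dimension one, and this is the singleton class required
    by \<open>root_sums_nonzero\<close>.\<close>
  have "(\<Sum>e\<in>E. \<epsilon> (el e)) = 1"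
    using O.E_sum[of 1] functional_sum[OF functional_counit, of el E] counit_one by (simp add: el_def)
  then obtain i0 where i0: "i0 \<in> E" "\<epsilon> (el i0) \<noteq> 0" by (metis sum.neutral zero_neq_one)
  obtain c where c: "\<And>x. i0 (Lam * i0 x) = s c (i0 x)"
    using prim[OF i0(1), of "\<lambda>a. Lam * a"] by blast
  have "el i0 * (Lam * el i0) = s c (el i0)"
    using c[of 1] by (simp only: el(1)[OF i0(1)] mult_1_right)
  moreover have "el i0 * (Lam * el i0) = s (\<epsilon> (el i0) * \<epsilon> (el i0)) Lam"
    by (simp add: mult_Lam Lam_mult scale_mult_right mult.commute)
  ultimately have eL: "s (\<epsilon> (el i0) * \<epsilon> (el i0)) Lam = s c (el i0)" by simp
  have "c \<noteq> 0"
  proof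
    assume "c = 0"
    then have "\<epsilon> (el i0) = 0 \<or> Lam = 0" using eL by simp
    then show False using i0 counit_Lam counit_scale[of 0 0] by auto
  qed
  then obtain d where d: "el i0 = s d Lam"
    using eL by (metis left_inverse scale_one scale_scale)
  have "d \<noteq> 0" using d i0(2) counit_scale[of 0 0] by auto
  have singleton: "j = i0" if j: "j \<in> E" "cl j = cl i0" for j
  proof (rule ccontr)
    assume "j \<noteq> i0"
    then have "el i0 * el j = 0"
      using O.E_orth[OF i0(1) j(1), of 1] el(1)[OF i0(1), of "j 1"] el_def[of j] by metis
    then have "\<epsilon> (el j) = 0"
      using \<open>d \<noteq> 0\<close> counit_Lam counit_scale[of 0 0]
      by (simp add: d scale_mult_left Lam_mult) (metis zero_neq_one)
    moreover have "u i0 j 1 = s (d * \<epsilon> (u i0 j 1) * \<epsilon> (el j)) Lam"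
    proof -
      have "u i0 j 1 = el i0 * (u i0 j 1 * el j)" using uel[OF i0(1) j(1)] j(2) by simp
      also have "\<dots> = s d (Lam * (u i0 j 1 * el j))" unfolding d by (rule scale_mult_left)
      finally show ?thesis by (simp add: Lam_mult counit_mult mult.assoc)
    qed
    ultimately show False using uel(3)[OF i0(1) j(1)] j(2) by simp
  qed
  show ?thesis
    unfolding lam1
  proof (rule root_sums_nonzero[OF O.E_finite M \<alpha>0 _ i0(1) singleton])
    fix i j assume ij: "i \<in> E" "j \<in> E" "cl i = cl j"
    have "((\<lambda>x. S (S x)) ^^ k) (u i j 1) = s ((\<alpha> i / \<alpha> j) ^ k) (u i j 1)" for k
      by (induction k) (auto simp: S2[OF ij] antipode_scale mult.commute)
    then have "s ((\<alpha> i / \<alpha> j) ^ M) (u i j 1) = s 1 (u i j 1)"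
      using iter[of M "u i j 1"] vM by simp
    then show "(\<alpha> i / \<alpha> j) ^ M = 1"
      using uel(3)[OF ij] by (metis scale_cancel_right)
  qed
qed

text \<open>The convolution of \<open>lam\<close> with itself at \<open>Lam\<close>, computed with
  either integral property, gives \<open>lam gd = lam 1\<close>. The integral property at
  \<open>gd\<close> then yields \<open>f gd = f 1\<close> after division by
  \<open>lam 1\<close>.\<close>

lemma gd_eq_1: "gd = 1"
proof (rule functional_separate)
  fix f assume f: "functional f"
  have "lam gd = lam 1"
    using lam_integral_left[OF functional_lam, of Lam] lam_integral[OF functional_lam, of Lam]
    by (simp add: lam_Lam)
  moreover have "sw gd (\<lambda>a b. lam a * f b) = lam gd * f gd"
    using grp_gd unfolding grp_def by (simp add: bifunctionalI fnl functional_comp[OF f])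
  ultimately show "f gd = f 1"
    using lam_integral[OF f, of gd] lam_1_nonzero by simp
qed

lemma antipode_4_id: "S (S (S (S x))) = x"
  by (simp add: antipode_4 gd_eq_1 antipode_one)

text \<open>As the fourth power of \<open>S\<close> is the identity, the third power is the inverse
  of \<open>S\<close>, which satisfies the antipode axiom with the legs exchanged.\<close>

lemma sw_antipode_3_left:
  assumes h: "functional h"
  shows "sw x (\<lambda>a b. h (S (S (S b)) * a)) = \<epsilon> x * h 1"
proof -
  have e: "h (S (S (S b)) * a) = h (Si (S a * b))" for a b
    using Si_S[of "S (S (S b)) * a"] by (simp add: antipode_mult antipode_4_id)
  show ?thesis
    unfolding e using sw_antipode_left[OF functional_comp[OF h operator_Si], of x] Si_S[of 1]
    by (simp add: antipode_one)
qed

text \<open>By \<open>lam_dual\<close> the coproduct of \<open>Lam\<close> gives a dual system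
  indexed by pairs of basis vectors; it is too large to be a basis, but it computes traces.\<close>

lemma tr_lam:
  assumes F: "operator F"
  shows "tr F = sw Lam (\<lambda>a b. lam (F (S b) * a))"
proof -
  have "dual_system UNIV (B \<times> B) (\<lambda>p y. delta (fst p) (snd p) Lam * lam (y * fst p)) (\<lambda>p. S (snd p))"
    unfolding dual_system_def
  proof (intro conjI ballI)
    fix y
    show "y = (\<Sum>p\<in>B \<times> B. s (delta (fst p) (snd p) Lam * lam (y * fst p)) (S (snd p)))"
    proof (rule functional_separate)
      fix f assume f: "functional f"
      show "f y = f (\<Sum>p\<in>B \<times> B. s (delta (fst p) (snd p) Lam * lam (y * fst p)) (S (snd p)))"
        using lam_dual[OF f, of y] unfolding sw_def
        by (simp add: functional_sum[OF f] functional_scale[OF f] sum.cartesian_product case_prod_unfold mult.assoc)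
    qed
  qed (auto intro!: fnl B_finite)
  from tr_dual_system[OF this F] show ?thesis
    by (simp add: sw_def sum.cartesian_product case_prod_unfold)
qed

text \<open>The action of the dual algebra on the Hopf algebra; it reverses convolution, see
  \<open>hit_hit\<close>.\<close>

definition hit :: "('h \<Rightarrow> 'k) \<Rightarrow> 'h \<Rightarrow> 'h" where
  "hit f a = swv a (\<lambda>p q. s (f p) q)"

lemma operator_hit: "operator (hit f)"
  unfolding hit_def by (rule operator_swv)

lemma functional_hit: "functional g \<Longrightarrow> g (hit f a) = sw a (\<lambda>p q. f p * g q)"
  by (simp add: hit_def functional_swv functional_scale)

lemma tr_hit_antipode_square:
  assumes f: "functional f"
  shows "tr (\<lambda>a. S (S (hit f a))) = lam 1 * f Lam"
proof -
  note fi = fnl functional_comp[OF f]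
  have "tr (\<lambda>a. S (S (hit f a))) = sw Lam (\<lambda>a b. lam (S (S (hit f (S b))) * a))"
    by (rule tr_lam) (intro fn_intros operator_hit)
  also have "\<dots> = sw Lam (\<lambda>a b. sw (S b) (\<lambda>p q. f p * lam (S (S q) * a)))"
    by (subst functional_hit[of "\<lambda>z. lam (S (S z) * _)"]) (intro fi, simp)
  also have "\<dots> = sw Lam (\<lambda>a b. sw b (\<lambda>c d. f (S d) * lam (S (S (S c)) * a)))"
    by (subst sw_antipode) (intro bifunctionalI fi, simp)
  also have "\<dots> = sw Lam (\<lambda>m d. sw m (\<lambda>a c. f (S d) * lam (S (S (S c)) * a)))"
    by (rule sw_coassoc[symmetric])
  also have "\<dots> = sw Lam (\<lambda>m d. \<epsilon> m * (f (S d) * lam 1))"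
    by (simp add: sw_times sw_antipode_3_left[OF functional_lam] mult.left_commute)
  also have "\<dots> = f (S Lam) * lam 1"
    by (rule sw_counit_left) (intro fi)
  finally show ?thesis by (simp add: antipode_Lam mult.commute)
qed

text \<open>The map from \<open>x \<otimes> y\<close> to \<open>x1 \<otimes> x2 y\<close> has the
  inverse \<open>x1 \<otimes> S x2 y\<close>; the composite of the two is written out in
  coordinates.\<close>

lemma pure_expand:
  assumes f: "functional f" and g: "functional g"
  shows "(\<Sum>b\<in>B. \<Sum>c\<in>B. sw x (\<lambda>u v. coord b u * coord c (S v * y)) * sw b (\<lambda>u v. f u * g (v * c)))
    = f x * g y"
proof -
  note fi = fn_intros functional_comp[OF f] functional_comp[OF g]
  have p: "(\<Sum>b\<in>B. \<Sum>c\<in>B. coord b u * coord c z * sw b (\<lambda>p q. f p * g (q * c))) =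
      sw u (\<lambda>p q. f p * g (q * z))" for u z
  proof -
    have "(\<Sum>c\<in>B. coord c z * sw b (\<lambda>p q. f p * g (q * c))) = sw b (\<lambda>p q. f p * g (q * z))" for b
      by (rule functional_expand[of "\<lambda>z. sw b (\<lambda>p q. f p * g (q * z))", symmetric]) (intro fi)
    then have "(\<Sum>b\<in>B. \<Sum>c\<in>B. coord b u * coord c z * sw b (\<lambda>p q. f p * g (q * c))) =
        (\<Sum>b\<in>B. coord b u * sw b (\<lambda>p q. f p * g (q * z)))"
      by (simp add: mult.assoc sum_distrib_left[symmetric])
    also have "\<dots> = sw u (\<lambda>p q. f p * g (q * z))"
      by (rule functional_expand[OF functional_sw, symmetric])
    finally show ?thesis .
  qed
  have "(\<Sum>b\<in>B. \<Sum>c\<in>B. sw x (\<lambda>u v. coord b u * coord c (S v * y)) * sw b (\<lambda>u v. f u * g (v * c)))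
    = sw x (\<lambda>u v. \<Sum>b\<in>B. \<Sum>c\<in>B. coord b u * coord c (S v * y) * sw b (\<lambda>p q. f p * g (q * c)))"
    unfolding sw_sum sw_times_right ..
  also have "\<dots> = sw x (\<lambda>u v. sw u (\<lambda>p q. f p * g (q * (S v * y))))"
    unfolding p ..
  also have "\<dots> = sw x (\<lambda>p m. sw m (\<lambda>q v. f p * g (q * (S v * y))))"
    by (rule sw_coassoc)
  also have "\<dots> = sw x (\<lambda>p m. f p * g y * \<epsilon> m)"
  proof -
    have "functional (\<lambda>z. g (z * y))" by (intro fi)
    from sw_antipode_right[OF this] show ?thesis
      by (simp add: sw_times mult.assoc mult.commute mult.left_commute)
  qed
  also have "\<dots> = f x * g y"
    by (rule sw_counit_right) (intro functional_times_right f)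
  finally show ?thesis .
qed

text \<open>The bijection behind \<open>pure_expand\<close> turns the tensor square of the regular
  representation into \<open>card B\<close> copies of the regular representation; the proof compares
  the traces.\<close>

lemma t_convolution: "sw a (\<lambda>p q. t p * t q) = of_nat (card B) * t a"
proof -
  note fi = fn_intros
  have t_def': "t x = (\<Sum>b\<in>B. coord b (x * b))" for x by (simp add: t_def tr_def)
  have swap4: "(\<Sum>a\<in>B. \<Sum>b\<in>B. \<Sum>c\<in>B. \<Sum>d\<in>B. G a b c d) =
      (\<Sum>c\<in>B. \<Sum>d\<in>B. \<Sum>a\<in>B. \<Sum>b\<in>B. G a b c d)" for G :: "'h \<Rightarrow> 'h \<Rightarrow> 'h \<Rightarrow> 'h \<Rightarrow> 'k"
  proof -
    have "(\<Sum>a\<in>B. \<Sum>b\<in>B. \<Sum>c\<in>B. \<Sum>d\<in>B. G a b c d) =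
        (\<Sum>a\<in>B. \<Sum>c\<in>B. \<Sum>b\<in>B. \<Sum>d\<in>B. G a b c d)"
      by (rule sum.cong[OF refl], rule sum.swap)
    also have "\<dots> = (\<Sum>c\<in>B. \<Sum>a\<in>B. \<Sum>b\<in>B. \<Sum>d\<in>B. G a b c d)"
      by (rule sum.swap)
    also have "\<dots> = (\<Sum>c\<in>B. \<Sum>a\<in>B. \<Sum>d\<in>B. \<Sum>b\<in>B. G a b c d)"
      by (rule sum.cong[OF refl], rule sum.cong[OF refl], rule sum.swap)
    also have "\<dots> = (\<Sum>c\<in>B. \<Sum>d\<in>B. \<Sum>a\<in>B. \<Sum>b\<in>B. G a b c d)"
      by (rule sum.cong[OF refl], rule sum.swap)
    finally show ?thesis .
  qed
  let ?K = "\<lambda>b c b' c'. sw b' (\<lambda>u v. coord b u * coord c (S v * c'))"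
  have 1: "t p * t q = (\<Sum>b\<in>B. \<Sum>c\<in>B. sw b (\<lambda>u v. sw (p * u) (\<lambda>x y. coord b x * coord c (S y * (q * v * c)))))"
    for p q
  proof -
    have "t p * t q = (\<Sum>b'\<in>B. \<Sum>c'\<in>B. coord b' (p * b') * coord c' (q * c'))"
      by (simp add: t_def' sum_product)
    also have "\<dots> = (\<Sum>b'\<in>B. \<Sum>c'\<in>B. \<Sum>b\<in>B. \<Sum>c\<in>B. ?K b c b' c' * sw b (\<lambda>u v. coord b' (p * u) * coord c' (q * (v * c))))"
      by (intro sum.cong refl pure_expand[of "\<lambda>z. coord _ (p * z)" "\<lambda>z. coord _ (q * z)", symmetric] fi)
    also have "\<dots> = (\<Sum>b\<in>B. \<Sum>c\<in>B. \<Sum>b'\<in>B. \<Sum>c'\<in>B. ?K b c b' c' * sw b (\<lambda>u v. coord b' (p * u) * coord c' (q * (v * c))))"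
      by (rule swap4)
    also have "\<dots> = (\<Sum>b\<in>B. \<Sum>c\<in>B. sw b (\<lambda>u v. sw (p * u) (\<lambda>x y. coord b x * coord c (S y * (q * v * c)))))"
    proof (intro sum.cong refl)
      fix b c
      have e: "(\<Sum>b'\<in>B. \<Sum>c'\<in>B. coord b' x * coord c' y * ?K b c b' c') =
          sw x (\<lambda>u v. coord b u * coord c (S v * y))" for x y
      proof -
        have "bifunctional (\<lambda>x y. sw x (\<lambda>u v. coord b u * coord c (S v * y)))"
          by (intro bifunctionalI fi)
        then show ?thesis by (rule bifunctional_expand[symmetric])
      qed
      have "(\<Sum>b'\<in>B. \<Sum>c'\<in>B. ?K b c b' c' * sw b (\<lambda>u v. coord b' (p * u) * coord c' (q * (v * c)))) =
          sw b (\<lambda>u v. \<Sum>b'\<in>B. \<Sum>c'\<in>B. coord b' (p * u) * coord c' (q * (v * c)) * ?K b c b' c')"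
        unfolding sw_sum sw_times_right by (intro sum.cong refl) (rule mult.commute)
      then show "(\<Sum>b'\<in>B. \<Sum>c'\<in>B. ?K b c b' c' * sw b (\<lambda>u v. coord b' (p * u) * coord c' (q * (v * c)))) =
          sw b (\<lambda>u v. sw (p * u) (\<lambda>x y. coord b x * coord c (S y * (q * v * c))))"
        unfolding e by (simp add: mult.assoc)
    qed
    finally show ?thesis .
  qed
  have 2: "sw a (\<lambda>p q. sw b (\<lambda>u v. sw (p * u) (\<lambda>x y. coord b x * coord c (S y * (q * v * c))))) =
      coord b (a * b) * coord c c" for b c
  proof -
    have "sw a (\<lambda>p q. sw b (\<lambda>u v. sw (p * u) (\<lambda>x y. coord b x * coord c (S y * (q * v * c))))) =
        sw (a * b) (\<lambda>m z. sw m (\<lambda>x y. coord b x * coord c (S y * (z * c))))"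
      by (subst sw_mult) (intro bifunctionalI fi, simp)
    also have "\<dots> = sw (a * b) (\<lambda>x m. sw m (\<lambda>y z. coord b x * coord c (S y * (z * c))))"
      by (rule sw_coassoc)
    also have "\<dots> = sw (a * b) (\<lambda>x m. coord b x * coord c c * \<epsilon> m)"
    proof -
      have "functional (\<lambda>z. coord c (z * c))" by (intro fi)
      from sw_antipode_left[OF this] show ?thesis
        by (simp add: sw_times mult.assoc mult.commute mult.left_commute)
    qed
    also have "\<dots> = coord b (a * b) * coord c c"
      by (rule sw_counit_right) (intro functional_times_right functional_coord)
    finally show ?thesis .
  qed
  have "sw a (\<lambda>p q. t p * t q) = (\<Sum>b\<in>B. \<Sum>c\<in>B. coord b (a * b) * coord c c)"
    unfolding 1 sw_sum 2 ..
  also have "\<dots> = (\<Sum>b\<in>B. coord b (a * b)) * (\<Sum>c\<in>B. coord c c)"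
    by (simp add: sum_product)
  also have "(\<Sum>c\<in>B. coord c c) = of_nat (card B)" by (simp add: coord_basis)
  finally show ?thesis by (simp add: t_def')
qed

lemma t_antipode_square: "t (S (S x)) = t x"
proof -
  obtain v w where vw: "v * w = 1" "w * v = 1" "\<And>x. S (S x) = v * x * w"
    by (rule antipode_square_inner) blast
  have "t (v * x * w) = t (w * v * x)" by (metis t_commute mult.assoc)
  then show ?thesis using vw by simp
qed

lemma t_Lam: "t Lam = 1"
proof -
  have "t Lam = (\<Sum>b\<in>B. coord b (s (\<epsilon> b) Lam))" by (simp add: t_def tr_def Lam_mult)
  also have "\<dots> = \<epsilon> Lam"
    using functional_expand[OF functional_counit, of Lam]
    by (simp add: functional_scale[OF functional_coord] mult.commute)
  finally show ?thesis by (simp add: counit_Lam)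
qed

text \<open>With \<open>f = t / n\<close>, convolution by \<open>f\<close> is an idempotent commuting with \<open>S\<^sup>2\<close>, and the trace of
  \<open>S\<^sup>2\<close> is \<open>n\<close> times the trace of \<open>S\<^sup>2\<close> on its range. As \<open>S\<^sup>4 = id\<close>, both traces are
  integers; the first is nonzero and bounded by \<open>n\<close>, which forces it to be \<open>n\<close>.\<close>

theorem antipode_involution: "S (S x) = x"
proof -
  define n where "n = card B"
  have n: "n > 0"
    using B_span B_finite by (metis UNIV_I card_gt_0_iff empty_iff insert_iff n_def span_empty zero_neq_one)
  define f where "f x = t x / of_nat n" for x
  have f: "functional f"
    using functional_t by (simp add: functional_def f_def add_divide_distrib)
  have ff: "sw a (\<lambda>p q. f p * f q) = f a" for a
  proof -
    have e: "f p * f q = inverse (of_nat n * of_nat n) * (t p * t q)" for p q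
      by (simp add: f_def field_simps)
    show ?thesis
      unfolding e sw_times t_convolution using n by (simp add: f_def n_def field_simps)
  qed
  let ?P = "hit f" and ?\<sigma> = "\<lambda>x. S (S x)"
  have op\<sigma>: "operator ?\<sigma>" by (intro fn_intros)
  have PP: "?P (?P a) = ?P a" for a
  proof (rule functional_separate)
    fix g assume g: "functional g"
    have "g (?P (?P a)) = sw a (\<lambda>p q. f p * sw q (\<lambda>u v. f u * g v))"
      by (simp add: functional_hit[OF g] functional_hit[OF functional_sw])
    also have "\<dots> = sw a (\<lambda>m v. sw m (\<lambda>p u. f p * (f u * g v)))"
      unfolding sw_coassoc by (simp add: sw_times)
    also have "\<dots> = sw a (\<lambda>m v. sw m (\<lambda>p u. f p * f u) * g v)"
      by (simp add: sw_times_right[symmetric] mult.assoc)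
    finally show "g (?P (?P a)) = g (?P a)" by (simp add: ff functional_hit[OF g])
  qed
  have P\<sigma>: "?P (?\<sigma> a) = ?\<sigma> (?P a)" for a
  proof (rule functional_separate)
    fix g assume g: "functional g"
    note fi = fn_intros functional_comp[OF f] functional_comp[OF g]
    have "g (?P (?\<sigma> a)) = sw a (\<lambda>p q. f (S (S p)) * g (S (S q)))"
      unfolding functional_hit[OF g]
      by (subst sw_antipode, (intro bifunctionalI fi)[1], subst sw_antipode, (intro bifunctionalI fi)[1]) (rule refl)
    also have "\<dots> = g (?\<sigma> (?P a))"
      using functional_hit[OF functional_comp[OF g op\<sigma>], of f a] by (simp add: f_def t_antipode_square)
    finally show "g (?P (?\<sigma> a)) = g (?\<sigma> (?P a))" .
  qed
  have main: "of_nat n * tr (\<lambda>a. ?\<sigma> (?P a)) = tr ?\<sigma>"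
    using tr_hit_antipode_square[OF f] n by (simp add: f_def t_Lam lam_1)
  \<comment> \<open>The square of \<open>S\<close> is an involution by now. \<open>Q\<close>
    projects onto its fixed vectors, and through the ranks \<open>q\<close>, \<open>q'\<close>,
    \<open>r\<close> and \<open>r'\<close> all traces become integers.\<close>
  define Q where "Q a = s (1/2) (a + ?\<sigma> a)" for a
  have opQ: "operator Q"
    unfolding operator_def Q_def using op\<sigma>
    by (auto simp: antipode_add antipode_scale algebra_simps)
  have half: "s (1/2) (x + x) = x" for x
  proof -
    have "s (1/2) (x + x) = s (1/2 + 1/2) x" by (simp only: scale_right_distrib scale_left_distrib)
    also have "(1/2 + 1/2 :: 'k) = 1" by simp
    finally show ?thesis by simp
  qed
  have QQ: "Q (Q a) = Q a" for a
  proof -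
    have "?\<sigma> (Q a) = Q a"
      by (simp add: Q_def antipode_add antipode_scale antipode_4_id add.commute)
    then have "Q (Q a) = s (1/2) (Q a + Q a)" by (simp add: Q_def)
    then show ?thesis by (simp add: half)
  qed
  have \<sigma>Q: "?\<sigma> a = s 2 (Q a) - a" for a by (simp add: Q_def)
  have PQ: "?P (Q a) = Q (?P a)" for a
    using operator_add[OF operator_hit] operator_scale[OF operator_hit] P\<sigma> by (simp add: Q_def)
  define q where "q = dim (range Q)"
  define q' where "q' = dim (range (\<lambda>a. a - Q a))"
  define r where "r = dim (range ?P)"
  define r' where "r' = dim (range (\<lambda>a. Q (?P a)))"
  have q: "tr Q = of_nat q" unfolding q_def by (rule tr_idempotent[OF opQ QQ])
  have opQ': "operator (\<lambda>a. a - Q a)"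
    using opQ by (auto simp: operator_def algebra_simps)
  have q': "tr (\<lambda>a. a - Q a) = of_nat q'"
    unfolding q'_def by (rule tr_idempotent[OF opQ']) (simp add: operator_diff[OF opQ] QQ)
  have r: "tr ?P = of_nat r" unfolding r_def by (rule tr_idempotent[OF operator_hit PP])
  have r': "tr (\<lambda>a. Q (?P a)) = of_nat r'"
    unfolding r'_def
    by (rule tr_idempotent[OF operator_comp[OF opQ operator_hit, unfolded comp_def]])
      (simp add: PQ PP QQ)
  have "tr (\<lambda>a. a - Q a) = of_nat n - of_nat q" by (simp add: tr_diff tr_id q n_def)
  then have "(of_nat (q + q') :: 'k) = of_nat n" using q' by (simp add: algebra_simps)
  then have qq: "q + q' = n" using of_nat_eq_iff by blast
  have tr\<sigma>: "tr ?\<sigma> = of_int (2 * int q - int n)"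
    unfolding \<sigma>Q by (simp add: tr_diff tr_scale q tr_id n_def)
  have "tr (\<lambda>a. ?\<sigma> (?P a)) = of_int (2 * int r' - int r)"
    unfolding \<sigma>Q by (simp add: tr_diff tr_scale r' r)
  then have "of_int (int n * (2 * int r' - int r)) = (of_int (2 * int q - int n) :: 'k)"
    using main tr\<sigma> by simp
  \<comment> \<open>So the trace \<open>2 q - n\<close> is a nonzero multiple of \<open>n\<close>,
    while \<open>0 \<le> q \<le> n\<close>: only \<open>q = 0\<close> and \<open>q = n\<close>
    remain, and \<open>1\<close> is fixed.\<close>
  then have eq: "int n * (2 * int r' - int r) = 2 * int q - int n" using of_int_eq_iff by blast
  have nz: "2 * int q - int n \<noteq> 0"
  proof
    assume z: "2 * int q - int n = 0"
    have "tr ?\<sigma> = 0" unfolding tr\<sigma> z by simp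
    then show False using lam_1_nonzero by (simp add: lam_1)
  qed
  have "2 * int r' - int r \<noteq> 0" using eq nz by auto
  then have "int n * 1 \<le> int n * \<bar>2 * int r' - int r\<bar>" by (intro mult_left_mono) auto
  then have "int n \<le> \<bar>2 * int q - int n\<bar>" unfolding eq[symmetric] abs_mult by simp
  then have "q = n \<or> q = 0" using qq by auto
  moreover have "q \<noteq> 0"
  proof
    assume "q = 0"
    then have "Q 1 = 0" using tr_idempotent_eq_0[OF opQ QQ] q by simp
    then show False using half[of 1] by (simp add: Q_def antipode_one)
  qed
  ultimately have "q' = 0" using qq by simp
  then have "x - Q x = 0"
    using tr_idempotent_eq_0[OF opQ', of x] q' by (simp add: operator_diff[OF opQ] QQ)
  then have "S (S x) = s 2 x - x" using \<sigma>Q[of x] by simp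
  then show ?thesis by (simp add: scale_left_distrib[of 1 1 x, simplified])
qed

end

section \<open>Matrix coalgebras\<close>

context ss_hopf
begin

lemma lam_commute: "lam (x * y) = lam (y * x)"
  using lam_nakayama[of x y] by (simp add: antipode_involution)

lemma sw_antipode_flip_left:
  "functional h \<Longrightarrow> sw x (\<lambda>a b. h (S b * a)) = \<epsilon> x * h 1"
  using sw_antipode_3_left[of h x] by (simp add: antipode_involution)

lemma card_B_pos: "card B > 0"
  using B_span B_finite by (metis UNIV_I card_gt_0_iff empty_iff insert_iff span_empty zero_neq_one)

text \<open>With \<open>S\<close> an involution, the dual bases in \<open>tr_lam\<close> cancel by
  the antipode axiom with exchanged legs.\<close>

lemma t_eq_lam: "t x = lam x"
proof -
  have "t x = sw Lam (\<lambda>a b. lam (x * S b * a))"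
    unfolding t_def by (rule tr_lam) (intro fn_intros)
  also have "\<dots> = sw Lam (\<lambda>a b. (\<lambda>z. lam (x * z)) (S b * a))"
    by (simp add: mult.assoc)
  also have "\<dots> = lam x"
    by (subst sw_antipode_flip_left) (intro fnl, simp add: counit_Lam)
  finally show ?thesis .
qed

definition haar :: "'h \<Rightarrow> 'k" where "haar x = lam x / of_nat (card B)"

lemma functional_haar: "functional haar"
  using functional_lam by (simp add: functional_def haar_def add_divide_distrib)

lemma tr_L: "tr (\<lambda>a. x * a) = of_nat (card B) * haar x"
  using t_eq_lam[of x] card_B_pos by (simp add: t_def haar_def)

lemma haar_1: "haar 1 = 1"
  using tr_L[of 1] tr_id card_B_pos by simp

lemma haar_commute: "haar (x * y) = haar (y * x)"
  by (simp add: haar_def lam_commute)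

lemma haar_antipode: "haar (S x) = haar x"
  using lam_antipode[of x] by (simp add: haar_def gd_eq_1)

lemma haar_integral:
  assumes "functional f"
  shows "sw x (\<lambda>a b. haar a * f b) = haar x * f 1"
  using lam_integral[OF assms, of x] sw_times[of x "inverse (of_nat (card B))" "\<lambda>a b. lam a * f b"]
  by (simp add: haar_def field_simps)

definition conv :: "('h \<Rightarrow> 'k) \<Rightarrow> ('h \<Rightarrow> 'k) \<Rightarrow> 'h \<Rightarrow> 'k" where
  "conv f g x = sw x (\<lambda>a b. f a * g b)"

lemma functional_conv: "functional (conv f g)"
  unfolding conv_def by (rule functional_sw)

lemma conv_assoc: "conv (conv f g) h = conv f (conv g h)"
proof
  fix x
  have "conv (conv f g) h x = sw x (\<lambda>a b. sw a (\<lambda>p q. f p * (g q * h b)))"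
    by (simp add: conv_def sw_times_right[symmetric] mult.assoc)
  also have "\<dots> = sw x (\<lambda>a b. sw b (\<lambda>p q. f a * (g p * h q)))"
    by (rule sw_coassoc)
  finally show "conv (conv f g) h x = conv f (conv g h) x" by (simp add: conv_def sw_times)
qed

lemma counit_hit: "functional f \<Longrightarrow> \<epsilon> (hit f a) = f a"
  by (simp add: functional_hit[OF functional_counit] sw_counit_right)

lemma hit_counit: "hit \<epsilon> a = a"
  by (rule functional_separate) (simp add: functional_hit sw_counit_left)

lemma hit_hit: "hit f (hit g a) = hit (conv g f) a"
proof (rule functional_separate)
  fix h assume h: "functional h"
  have "h (hit f (hit g a)) = conv g (conv f h) a"
    by (simp add: functional_hit[OF h] functional_hit[OF functional_sw] conv_def)
  then show "h (hit f (hit g a)) = h (hit (conv g f) a)"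
    by (simp add: functional_hit[OF h] conv_assoc[symmetric] conv_def)
qed

lemma tr_hit: "functional f \<Longrightarrow> tr (hit f) = of_nat (card B) * f Lam"
  using tr_hit_antipode_square[of f] tr_L[of 1] tr_id card_B_pos
  by (simp add: antipode_involution haar_def)

text \<open>Cyclicity of the trace, since convolution is composition of the operators
  \<open>hit\<close>; it says that \<open>Lam\<close> is cocommutative.\<close>

lemma conv_Lam_commute:
  assumes "functional f" "functional g"
  shows "conv f g Lam = conv g f Lam"
proof -
  have "tr (hit (conv f g)) = tr (hit (conv g f))"
    using tr_commute[OF operator_hit operator_hit, of f g] unfolding hit_hit by simp
  then show ?thesis using card_B_pos by (simp add: tr_hit functional_conv)
qed

text \<open>This is the dual algebra acting by \<open>hit\<close>. Up to the factor
  \<open>card B\<close> its trace form is convolution evaluated at \<open>Lam\<close>, nondegenerate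
  by \<open>Lam_injective\<close>.\<close>

lemma hit_op_algebra: "op_algebra s B {hit f | f. functional f}"
proof unfold_locales
  fix F G c
  assume "F \<in> {hit f | f. functional f}"
  then obtain f where f: "functional f" "F = hit f" by blast
  show "operator F" using f operator_hit by simp
  have "(\<lambda>v. s c (hit f v)) = hit (\<lambda>x. c * f x)"
    by (intro ext functional_separate) (simp add: functional_hit functional_scale sw_times mult.assoc)
  then show "(\<lambda>v. s c (F v)) \<in> {hit f | f. functional f}"
    using f functional_times by blast
  show "F = (\<lambda>x. 0)" if 0: "\<And>G. G \<in> {hit f | f. functional f} \<Longrightarrow> tr (\<lambda>x. F (G x)) = 0"
  proof -
    have "sw Lam (\<lambda>a b. f a * g b) = 0" if g: "functional g" for g
    proof -
      have "tr (\<lambda>x. hit f (hit g x)) = 0" using 0[of "hit g"] f g by blast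
      then have "tr (hit (conv g f)) = 0" by (simp add: hit_hit tr_def)
      then show ?thesis
        using card_B_pos conv_Lam_commute[OF f(1) g] by (simp add: tr_hit functional_conv conv_def)
    qed
    then have f0: "f x = 0" for x using Lam_injective[OF f(1)] by blast
    show ?thesis
      unfolding f(2)
      by (intro ext functional_separate) (simp add: functional_hit functional_0 f0, simp add: sw_def)
  qed
  assume "G \<in> {hit f | f. functional f}"
  then obtain g where g: "functional g" "G = hit g" by blast
  have "(\<lambda>v. F v + G v) = hit (\<lambda>x. f x + g x)"
    by (intro ext functional_separate)
      (simp add: f g functional_hit functional_add distrib_right sw_plus)
  then show "(\<lambda>v. F v + G v) \<in> {hit f | f. functional f}"
    using f g functional_plus by blast
  have "(\<lambda>v. F (G v)) = hit (conv g f)" by (simp add: f g hit_hit fun_eq_iff)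
  then show "(\<lambda>v. F (G v)) \<in> {hit f | f. functional f}" using functional_conv by blast
next
  have "(\<lambda>x. x) = hit \<epsilon>" by (simp add: hit_counit fun_eq_iff)
  then show "(\<lambda>x. x) \<in> {hit f | f. functional f}" using functional_counit by blast
qed

end

text \<open>A basis \<open>c\<close> consisting of matrix coefficients; \<open>f\<close> is the dual basis, a system of matrix units
  of the dual algebra. The classes of \<open>cl\<close> are the simple subcoalgebras.\<close>

locale matrix_basis = ss_hopf s \<Delta> \<epsilon> S B
  for s :: "'k::{alg_closed_field,field_char_0} \<Rightarrow> 'h::ring_1 \<Rightarrow> 'h" and \<Delta> \<epsilon> S B +
  fixes I :: "'i set" and cl :: "'i \<Rightarrow> 'j" and f :: "'i \<Rightarrow> 'i \<Rightarrow> 'h \<Rightarrow> 'k" and c :: "'i \<Rightarrow> 'i \<Rightarrow> 'h"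
  assumes I_finite: "finite I"
    and f_functional: "i \<in> I \<Longrightarrow> j \<in> I \<Longrightarrow> functional (f i j)"
    and f_conv: "i \<in> I \<Longrightarrow> j \<in> I \<Longrightarrow> k \<in> I \<Longrightarrow> l \<in> I \<Longrightarrow> cl i = cl j \<Longrightarrow> cl k = cl l \<Longrightarrow>
      conv (f i j) (f k l) x = (if j = k then f i l x else 0)"
    and f_unit: "(\<Sum>i\<in>I. f i i x) = \<epsilon> x"
    and f_c: "i \<in> I \<Longrightarrow> j \<in> I \<Longrightarrow> k \<in> I \<Longrightarrow> l \<in> I \<Longrightarrow> cl i = cl j \<Longrightarrow> cl k = cl l \<Longrightarrow>
      f i j (c k l) = (if i = k \<and> j = l then 1 else 0)"
    and c_expand: "x = (\<Sum>i\<in>I. \<Sum>j\<in>{j\<in>I. cl j = cl i}. s (f i j x) (c i j))"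

text \<open>The matrix units of the dual algebra have a dual basis with respect to the form
  \<open>conv f g Lam\<close>; up to a scalar, \<open>c i j\<close> is
  \<open>hit (f j i) Lam\<close>.\<close>

theorem (in ss_hopf) matrix_basis_exists:
  "\<exists>(I :: ('h \<Rightarrow> 'h) set) (cl :: ('h \<Rightarrow> 'h) \<Rightarrow> ('h \<Rightarrow> 'h)) f c. matrix_basis s \<Delta> \<epsilon> S B I cl f c"
proof -
  interpret O: op_algebra s B "{hit f | f. functional f}" by (rule hit_op_algebra)
  obtain E where E: "O.decomposition E" "\<And>e F. e \<in> E \<Longrightarrow> F \<in> {hit f | f. functional f} \<Longrightarrow>
      \<exists>c. \<forall>x. e (F (e x)) = s c (e x)"
    by (rule O.primitive_decomposition) (rule that)
  interpret P: primitive_op_algebra s B "{hit f | f. functional f}" E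
    by unfold_locales (fact E)+
  obtain cl u where "P.matrix_unit_system cl u" using P.matrix_units by blast
  note u = P.matrix_unit_systemD[OF this]
  \<comment> \<open>The indices are exchanged because \<open>hit\<close> reverses products.\<close>
  define f where "f i j x = \<epsilon> (u j i x)" for i j x
  have u_f: "u j i = hit (f i j)" and ff: "functional (f i j)" if ij: "i \<in> E" "j \<in> E" for i j
  proof -
    obtain g where g: "functional g" "u j i = hit g" using u(1)[OF ij(2,1)] by blast
    then have "f i j = g" by (simp add: f_def counit_hit fun_eq_iff)
    then show "u j i = hit (f i j)" "functional (f i j)" using g by auto
  qed
  have conv_f: "conv (f i j) (f k l) x = (if j = k then f i l x else 0)"
    if "i \<in> E" "j \<in> E" "k \<in> E" "l \<in> E" "cl i = cl j" "cl k = cl l" for i j k l x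
  proof -
    have "conv (f i j) (f k l) x = \<epsilon> (u l k (u j i x))"
      using that by (simp add: u_f hit_hit counit_hit functional_conv)
    also have "\<dots> = (if j = k then f i l x else 0)"
      using u(3)[of l k j i x] that functional_0[OF functional_counit] by (auto simp: f_def)
    finally show ?thesis .
  qed
  have unit: "(\<Sum>i\<in>E. f i i x) = \<epsilon> x" for x
    using P.E_sum[of x] u(2) by (simp add: f_def functional_sum[OF functional_counit, symmetric])
  have tr0: "tr i \<noteq> 0" if i: "i \<in> E" for i
    using P.E_nonzero[OF i] tr_idempotent_eq_0[OF P.E_op[OF i] P.E_idem[OF i]] by auto
  \<comment> \<open>The scalar makes \<open>f i j (c i j) = 1\<close>, since
    \<open>card B * f j j Lam\<close> is the trace of the idempotent \<open>j\<close>.\<close>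
  define c where "c i j = s (of_nat (card B) / tr j) (hit (f j i) Lam)" for i j
  have g_c: "g (c i j) = of_nat (card B) / tr j * conv (f j i) g Lam" if "functional g" for g i j
    using that by (simp add: c_def functional_scale functional_hit conv_def)
  have f_Lam: "of_nat (card B) * f i j Lam = (if i = j then tr j else 0)"
    if "i \<in> E" "j \<in> E" "cl i = cl j" for i j
  proof (cases "i = j")
    case True
    then show ?thesis using tr_hit[OF ff[OF that(2,2)]] u_f[OF that(2,2)] u(2)[OF that(2)] by simp
  next
    case False
    have "f i j Lam = conv (f i i) (f i j) Lam" using conv_f[of i i i j Lam] that by simp
    also have "\<dots> = conv (f i j) (f i i) Lam" using that ff by (intro conv_Lam_commute) auto
    also have "\<dots> = 0" using conv_f[of i j i i Lam] that False by simp
    finally show ?thesis using False by simp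
  qed
  have f_c: "f i j (c k l) = (if i = k \<and> j = l then 1 else 0)"
    if "i \<in> E" "j \<in> E" "k \<in> E" "l \<in> E" "cl i = cl j" "cl k = cl l" for i j k l
  proof -
    have "f i j (c k l) = of_nat (card B) / tr l * (if k = i then f l j Lam else 0)"
      unfolding g_c[OF ff[OF that(1,2)]]
      using conv_f[OF that(4,3,1,2) that(6)[symmetric] that(5), of Lam] by simp
    moreover have "of_nat (card B) * f l j Lam = (if l = j then tr j else 0)" if "k = i"
      using f_Lam[OF \<open>l \<in> E\<close> \<open>j \<in> E\<close>] \<open>cl i = cl j\<close> \<open>cl k = cl l\<close> that by simp
    ultimately show ?thesis using tr0[OF that(4)] by (cases "k = i") auto
  qed
  have expand: "x = (\<Sum>i\<in>E. \<Sum>j\<in>{j\<in>E. cl j = cl i}. s (f i j x) (c i j))" for x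
  proof (rule functional_separate)
    fix g assume g: "functional g"
    \<comment> \<open>Cutting \<open>g\<close> by two idempotents leaves a multiple of
      \<open>f i j\<close>, and evaluation at \<open>c i j\<close> identifies the factor as
      \<open>g (c i j)\<close>.\<close>
    have ij: "conv (conv (f i i) g) (f j j) x = (if cl j = cl i then g (c i j) * f i j x else 0)"
      if ij: "i \<in> E" "j \<in> E" for i j x
    proof -
      have ei: "i y = hit (f i i) y" and ej: "j y = hit (f j j) y" for y
        using u_f[OF ij(1,1)] u_f[OF ij(2,2)] u(2)[OF ij(1)] u(2)[OF ij(2)] by metis+
      show ?thesis
    proof (cases "cl j = cl i")
      case True
      obtain r where r: "\<And>x. j (hit g (i x)) = s r (u j i x)"
        using u(4)[OF ij(2,1) _ True, of "hit g"] g by blast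
      have conv_r: "conv (conv (f i i) g) (f j j) x = r * f i j x" for x
      proof -
        have "j (hit g (i x)) = hit (conv (conv (f i i) g) (f j j)) x"
          by (simp only: ei ej hit_hit)
        then have "\<epsilon> (s r (u j i x)) = conv (conv (f i i) g) (f j j) x"
          using r[of x] by (simp add: counit_hit functional_conv)
        then show ?thesis by (simp add: counit_scale f_def)
      qed
      have "f i j (c i j) = 1" using f_c[OF ij ij True[symmetric] True[symmetric]] by simp
      then have "r = r * f i j (c i j)" by (simp only: mult_1_right)
      also have "\<dots> = conv (conv (f i i) g) (f j j) (c i j)" by (simp add: conv_r)
      also have "\<dots> = of_nat (card B) / tr j * conv (f j i) (conv (conv (f i i) g) (f j j)) Lam"
        by (rule g_c[OF functional_conv])
      also have "conv (f j i) (conv (conv (f i i) g) (f j j)) = conv (conv (conv (f j i) (f i i)) g) (f j j)"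
        by (simp add: conv_assoc)
      also have "conv (f j i) (f i i) = f j i"
        using conv_f[OF ij(2,1,1,1) True refl] by (intro ext) simp
      also have "conv (conv (f j i) g) (f j j) Lam = conv (conv (f j j) (f j i)) g Lam"
        using conv_Lam_commute[OF functional_conv ff[OF ij(2,2)]] by (simp add: conv_assoc)
      also have "conv (f j j) (f j i) = f j i"
        using conv_f[OF ij(2,2,2,1) refl True] by (intro ext) simp
      also have "of_nat (card B) / tr j * conv (f j i) g Lam = g (c i j)" using g_c[OF g] by simp
      finally show ?thesis using conv_r True by simp
    next
      case False
      have "j (hit g (i x)) = 0" using u(5)[OF ij(2,1) _ False, of "hit g"] g by blast
      moreover have "j (hit g (i x)) = hit (conv (conv (f i i) g) (f j j)) x"
        by (simp only: ei ej hit_hit)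
      ultimately have "conv (conv (f i i) g) (f j j) x = 0"
        using counit_hit[OF functional_conv] functional_0[OF functional_counit] by metis
      then show ?thesis using False by simp
    qed
    qed
    have "g x = conv (conv \<epsilon> g) \<epsilon> x"
      using g by (simp add: conv_def sw_counit_left sw_counit_right functional_sw)
    also have "\<dots> = (\<Sum>i\<in>E. \<Sum>j\<in>E. conv (conv (f i i) g) (f j j) x)"
      unfolding unit[symmetric] conv_def
      by (simp add: sum_distrib_left sum_distrib_right sw_sum) (rule sum.swap)
    also have "\<dots> = (\<Sum>i\<in>E. \<Sum>j\<in>E. if cl j = cl i then g (c i j) * f i j x else 0)"
      by (intro sum.cong refl ij)
    also have "\<dots> = (\<Sum>i\<in>E. \<Sum>j\<in>{j\<in>E. cl j = cl i}. g (c i j) * f i j x)"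
      by (rule sum.cong[OF refl], rule sum.inter_filter[OF P.E_finite, symmetric])
    finally show "g x = g (\<Sum>i\<in>E. \<Sum>j\<in>{j\<in>E. cl j = cl i}. s (f i j x) (c i j))"
      by (simp add: functional_sum[OF g] functional_scale[OF g] mult.commute)
  qed
  have "matrix_basis s \<Delta> \<epsilon> S B E cl f c"
    by unfold_locales (use P.E_finite ff conv_f unit f_c expand in blast)+
  then show ?thesis by blast
qed

text \<open>\<open>p\<close> acts as an idempotent on the functions supported on \<open>X\<close>,
  so its trace is a rank.\<close>

lemma idempotent_matrix_trace:
  fixes p :: "'y \<Rightarrow> 'y \<Rightarrow> 'k::field_char_0"
  assumes X: "finite X" and p: "\<And>i j. i \<in> X \<Longrightarrow> j \<in> X \<Longrightarrow> (\<Sum>l\<in>X. p i l * p l j) = p i j"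
  obtains n :: nat where "(\<Sum>i\<in>X. p i i) = of_nat n"
    "\<And>i j. n = 0 \<Longrightarrow> i \<in> X \<Longrightarrow> j \<in> X \<Longrightarrow> p i j = 0"
proof -
  interpret F: vspace "fscale :: 'k \<Rightarrow> ('y \<Rightarrow> 'k) \<Rightarrow> _"
    by (simp add: vspace_def vector_space_fscale)
  define W where "W = {v :: 'y \<Rightarrow> 'k. \<forall>i. i \<notin> X \<longrightarrow> v i = 0}"
  define P where "P v = (\<lambda>i. if i \<in> X then \<Sum>j\<in>X. p i j * v j else 0)" for v
  define e where "e i = (\<lambda>j. if j = i then 1 else 0 :: 'k)" for i :: 'y
  have W: "F.subspace W" by (auto simp: F.subspace_def W_def fscale_def)
  have sum_apply: "(\<Sum>i\<in>A. g i) j = (\<Sum>i\<in>A. g i j)" for g :: "'y \<Rightarrow> 'y \<Rightarrow> 'k" and A j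
    by (induction A rule: infinite_finite_induct) auto
  have ds: "F.dual_system W X (\<lambda>i v. v i) e"
    unfolding F.dual_system_def
  proof (intro conjI ballI)
    fix v assume v: "v \<in> W"
    show "v = (\<Sum>i\<in>X. fscale (v i) (e i))"
      using v X by (auto simp: fun_eq_iff sum_apply fscale_def e_def W_def if_distrib cong: if_cong)
  qed (auto simp: X F.functional_def fscale_def e_def W_def)
  have opP: "F.operator P"
    by (auto simp: F.operator_def P_def fscale_def fun_eq_iff distrib_left sum.distrib
        sum_distrib_left mult.left_commute)
  have PW: "P ` W \<subseteq> W" by (auto simp: P_def W_def)
  have PP: "P (P v) = P v" for v
  proof
    fix i
    show "P (P v) i = P v i"
    proof (cases "i \<in> X")
      case True
      have "P (P v) i = (\<Sum>l\<in>X. \<Sum>j\<in>X. p i l * p l j * v j)"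
        using True by (simp add: P_def sum_distrib_left mult.assoc)
      also have "\<dots> = (\<Sum>j\<in>X. (\<Sum>l\<in>X. p i l * p l j) * v j)"
        by (subst sum.swap) (simp add: sum_distrib_right)
      also have "\<dots> = P v i" using True p by (simp add: P_def)
      finally show ?thesis .
    qed (simp add: P_def)
  qed
  have Pe: "P (e j) i = p i j" if "i \<in> X" "j \<in> X" for i j
    using that X by (simp add: P_def e_def if_distrib cong: if_cong)
  have tr: "(\<Sum>i\<in>X. p i i) = of_nat (F.dim (P ` W))"
    using F.dtrace_idempotent[OF W ds opP PW PP] by (simp add: F.dtrace_def Pe)
  have "p i j = 0" if 0: "F.dim (P ` W) = 0" and ij: "i \<in> X" "j \<in> X" for i j
  proof -
    have "finite (e ` X)" "P ` W \<subseteq> F.span (e ` X)"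
      using X PW F.dual_system_subspace_span[OF ds] by auto
    from this(2,1) obtain C where C: "F.independent C" "finite C" "F.span C = P ` W"
      "card C = F.dim (P ` W)"
      by (rule F.subspace_basis[OF F.subspace_image_operator[OF opP W]])
    have "e j \<in> W" using ij by (auto simp: e_def W_def)
    then have "P (e j) \<in> F.span {}" using C 0 by auto
    then have "P (e j) = 0" by simp
    then show ?thesis using Pe[OF ij] by simp
  qed
  then show ?thesis using that tr by blast
qed

section \<open>Matrix coefficients and Schur orthogonality\<close>

context matrix_basis
begin

definition cs :: "'j \<Rightarrow> 'i set" where "cs D = {i \<in> I. cl i = D}"

definition Cl :: "'j set" where "Cl = cl ` I"

definition deg :: "'j \<Rightarrow> nat" where "deg D = card (cs D)"

lemma cs_finite: "finite (cs D)" and Cl_finite: "finite Cl"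
  using I_finite by (auto simp: cs_def Cl_def)

lemma cs_I: "i \<in> cs D \<Longrightarrow> i \<in> I" "i \<in> cs D \<Longrightarrow> cl i = D"
  by (auto simp: cs_def)

lemma cl_Cl: "i \<in> I \<Longrightarrow> cl i \<in> Cl" "i \<in> I \<Longrightarrow> i \<in> cs (cl i)"
  by (auto simp: cs_def Cl_def)

lemma deg_pos: "D \<in> Cl \<Longrightarrow> deg D > 0"
  using cs_finite by (auto simp: deg_def Cl_def cs_def card_gt_0_iff)

lemma sum_I: "(\<Sum>i\<in>I. g i) = (\<Sum>D\<in>Cl. \<Sum>i\<in>cs D. g i)"
  unfolding Cl_def cs_def by (rule sum.image_gen[OF I_finite])

lemma c_expand': "x = (\<Sum>D\<in>Cl. \<Sum>i\<in>cs D. \<Sum>j\<in>cs D. s (f i j x) (c i j))"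
proof -
  have "(\<Sum>i\<in>I. \<Sum>j\<in>{j\<in>I. cl j = cl i}. s (f i j x) (c i j)) =
      (\<Sum>D\<in>Cl. \<Sum>i\<in>cs D. \<Sum>j\<in>{j\<in>I. cl j = cl i}. s (f i j x) (c i j))"
    by (rule sum_I)
  also have "\<dots> = (\<Sum>D\<in>Cl. \<Sum>i\<in>cs D. \<Sum>j\<in>cs D. s (f i j x) (c i j))"
    by (intro sum.cong refl) (auto simp: cs_def)
  finally show ?thesis using c_expand[of x] by simp
qed

lemma f_eqI:
  assumes "\<And>i j. i \<in> I \<Longrightarrow> j \<in> I \<Longrightarrow> cl i = cl j \<Longrightarrow> f i j x = f i j y"
  shows "x = y"
proof -
  have "(\<Sum>i\<in>I. \<Sum>j\<in>{j\<in>I. cl j = cl i}. s (f i j x) (c i j)) =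
      (\<Sum>i\<in>I. \<Sum>j\<in>{j\<in>I. cl j = cl i}. s (f i j y) (c i j))"
    using assms by (intro sum.cong refl) auto
  then show ?thesis using c_expand[of x] c_expand[of y] by simp
qed

lemma f_sum_c:
  assumes "i \<in> I" "j \<in> I" "cl i = cl j" "finite A"
    and "\<And>a. a \<in> A \<Longrightarrow> k a \<in> I \<and> l a \<in> I \<and> cl (k a) = cl (l a)"
  shows "f i j (\<Sum>a\<in>A. s (r a) (c (k a) (l a))) = (\<Sum>a\<in>A. if i = k a \<and> j = l a then r a else 0)"
  using assms
  by (simp add: functional_sum[OF f_functional] functional_scale[OF f_functional] f_c if_distrib
      cong: if_cong)

lemma counit_c: "i \<in> I \<Longrightarrow> j \<in> I \<Longrightarrow> cl i = cl j \<Longrightarrow> \<epsilon> (c i j) = (if i = j then 1 else 0)"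
proof -
  assume ij: "i \<in> I" "j \<in> I" "cl i = cl j"
  have "\<epsilon> (c i j) = (\<Sum>k\<in>I. if k = i then if i = j then 1 else 0 else 0)"
    unfolding f_unit[symmetric] using ij by (intro sum.cong refl) (auto simp: f_c)
  then show ?thesis using ij I_finite by simp
qed

lemma conv_f_right:
  assumes g: "functional g" and i: "i \<in> I" "j \<in> I" "cl i = cl j" "p \<in> I" "q \<in> I" "cl p = cl q"
  shows "conv g (f p q) (c i j) = (if q = j then g (c i p) else 0)"
proof -
  define y where "y = swv (c i j) (\<lambda>a b. s (f p q b) a)"
  have fy: "h y = conv h (f p q) (c i j)" if "functional h" for h
    using that by (simp add: y_def conv_def functional_swv functional_scale mult.commute)
  have "y = (if q = j then c i p else 0)"
  proof (rule f_eqI)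
    fix k l assume kl: "k \<in> I" "l \<in> I" "cl k = cl l"
    have 1: "f k l y = (if l = p then f k q (c i j) else 0)"
      using fy[OF f_functional[OF kl(1,2)]] f_conv[OF kl(1,2) i(4,5) kl(3) i(6)] by simp
    show "f k l y = f k l (if q = j then c i p else 0)"
    proof (cases "q = j")
      case True
      then have "cl i = cl p" using i by simp
      then show ?thesis
        using 1 True f_c[OF kl(1) i(5) i(1,2) _ i(3)] f_c[OF kl(1,2) i(1,4) kl(3)] kl i by auto
    next
      case False
      have "f k q (c i j) = 0" if "l = p" using f_c[OF kl(1) i(5) i(1,2) _ i(3)] kl i that False by auto
      then show ?thesis using 1 False functional_0[OF f_functional[OF kl(1,2)]] by simp
    qed
  qed
  then show ?thesis using fy[OF g] functional_0[OF g] by (simp split: if_splits)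
qed

text \<open>The functionals \<open>f\<close> determine vectors, and on them the coproduct is dual to
  convolution, where matrix units multiply (\<open>conv_f_right\<close>). General \<open>F\<close>
  reduce to products of coordinate functions.\<close>

lemma sw_c:
  assumes F: "bifunctional F" and i: "i \<in> cs D" "j \<in> cs D"
  shows "sw (c i j) F = (\<Sum>l\<in>cs D. F (c i l) (c l j))"
proof -
  have i': "i \<in> I" "j \<in> I" "cl i = D" "cl j = D" using i by (auto simp: cs_def)
  have pure: "sw (c i j) (\<lambda>a b. g a * h b) = (\<Sum>l\<in>cs D. g (c i l) * h (c l j))"
    if g: "functional g" and h: "functional h" for g h
  proof -
    have "hit g (c i j) = (\<Sum>l\<in>cs D. s (g (c i l)) (c l j))"
    proof (rule f_eqI)
      fix p q assume pq: "p \<in> I" "q \<in> I" "cl p = cl q"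
      have "f p q (hit g (c i j)) = (if q = j then g (c i p) else 0)"
        using conv_f_right[OF g i'(1,2) _ pq] i'
        by (simp add: functional_hit[OF f_functional[OF pq(1,2)]] conv_def)
      also have "\<dots> = (\<Sum>l\<in>cs D. if p = l \<and> q = j then g (c i l) else 0)"
      proof (cases "q = j")
        case True
        then have "p \<in> cs D" using pq i' by (simp add: cs_def)
        then show ?thesis using True cs_finite by simp
      qed simp
      also have "\<dots> = f p q (\<Sum>l\<in>cs D. s (g (c i l)) (c l j))"
        using i' by (intro f_sum_c[OF pq cs_finite, symmetric]) (auto simp: cs_def)
      finally show "f p q (hit g (c i j)) = f p q (\<Sum>l\<in>cs D. s (g (c i l)) (c l j))" .
    qed
    then show ?thesis
      using functional_hit[OF h, of g "c i j"] by (simp add: functional_sum[OF h] functional_scale[OF h])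
  qed
  have "sw (c i j) F = (\<Sum>p\<in>B. \<Sum>q\<in>B. (\<Sum>l\<in>cs D. coord p (c i l) * coord q (c l j)) * F p q)"
    by (subst sw_def) (simp add: delta_sw pure[OF functional_coord functional_coord])
  also have "\<dots> = (\<Sum>l\<in>cs D. \<Sum>p\<in>B. \<Sum>q\<in>B. coord p (c i l) * coord q (c l j) * F p q)"
    by (simp add: sum_distrib_right) (subst sum.swap, subst (2) sum.swap, rule refl)
  also have "\<dots> = (\<Sum>l\<in>cs D. F (c i l) (c l j))"
    by (simp add: bifunctional_expand[OF F, symmetric])
  finally show ?thesis .
qed

text \<open>By invariance of \<open>haar\<close> (\<open>inv\<close>), averaging produces an
  intertwiner between two matrix coalgebras. Independence of the coefficients makes it zero or
  scalar, and summing over \<open>j\<close> with the antipode axiom fixes the scalar.\<close>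

lemma haar_orthogonal:
  assumes i: "i \<in> cs D" "p \<in> cs D" and m: "m \<in> cs E" "l \<in> cs E"
  shows "haar (c i p * S (c m l)) = (if p = m \<and> i = l then 1 / of_nat (deg D) else 0)"
proof -
  note fh = fn_intros functional_comp[OF functional_haar]
  have inv: "(\<Sum>a\<in>cs D. \<Sum>b\<in>cs E. s (haar (c i a * S (c b l))) (c a j * S (c k b))) =
      s (haar (c i j * S (c k l))) 1" if j: "j \<in> cs D" and k: "k \<in> cs E" for j k
  proof (rule functional_separate)
    fix g assume g: "functional g"
    note fi = fh functional_comp[OF g]
    have "haar (c i j * S (c k l)) * g 1 = sw (c i j * S (c k l)) (\<lambda>a b. haar a * g b)"
      by (rule haar_integral[OF g, symmetric])
    also have "\<dots> = sw (c i j) (\<lambda>p q. sw (S (c k l)) (\<lambda>u v. haar (p * u) * g (q * v)))"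
      by (rule sw_mult) (intro bifunctionalI fi)
    also have "\<dots> = sw (c i j) (\<lambda>p q. sw (c k l) (\<lambda>u v. haar (p * S v) * g (q * S u)))"
      by (subst sw_antipode) (intro bifunctionalI fi, simp)
    also have "\<dots> = (\<Sum>a\<in>cs D. \<Sum>b\<in>cs E. haar (c i a * S (c b l)) * g (c a j * S (c k b)))"
      by (subst sw_c[OF _ i(1) j], (intro bifunctionalI fi)[1], subst sw_c[OF _ k m(2)],
          (intro bifunctionalI fi)[1]) (rule refl)
    finally show "g (\<Sum>a\<in>cs D. \<Sum>b\<in>cs E. s (haar (c i a * S (c b l))) (c a j * S (c k b))) =
      g (s (haar (c i j * S (c k l))) 1)"
      by (simp add: functional_sum[OF g] functional_scale[OF g])
  qed
  \<comment> \<open>The antipode axiom with exchanged legs, valid because \<open>S\<close> is an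
    involution; it cancels the second matrix in \<open>inv\<close>.\<close>
  have flip: "(\<Sum>k\<in>cs E. S (c k b) * c m k) = (if m = b then 1 else 0)" if b: "b \<in> cs E" for b
  proof (rule functional_separate)
    fix g assume g: "functional g"
    note fi = fn_intros functional_comp[OF g]
    have "(\<Sum>k\<in>cs E. g (S (c k b) * c m k)) = sw (c m b) (\<lambda>p q. g (S q * p))"
      by (rule sw_c[OF _ m(1) b, symmetric]) (intro bifunctionalI fi)
    also have "\<dots> = \<epsilon> (c m b) * g 1" by (rule sw_antipode_flip_left[OF g])
    finally show "g (\<Sum>k\<in>cs E. S (c k b) * c m k) = g (if m = b then 1 else 0)"
      using b m by (simp add: functional_sum[OF g] functional_0[OF g] counit_c cs_def)
  qed
  \<comment> \<open>Comparison of the coefficients at \<open>c p j\<close> on both sides of the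
    intertwining relation.\<close>
  have key: "haar (c i p * S (c m l)) = (if p = m then haar (c i j * S (c j l)) else 0)"
    if p: "p \<in> cs D" and j: "j \<in> cs D" for p j
  proof -
    have "(\<Sum>a\<in>cs D. s (haar (c i a * S (c m l))) (c a j)) =
        (\<Sum>k\<in>cs E. s (haar (c i j * S (c k l))) (c m k))"
    proof -
      have "(\<Sum>k\<in>cs E. s (haar (c i j * S (c k l))) (c m k)) =
          (\<Sum>k\<in>cs E. (\<Sum>a\<in>cs D. \<Sum>b\<in>cs E. s (haar (c i a * S (c b l))) (c a j * S (c k b))) * c m k)"
        using inv[OF j] by (intro sum.cong refl) (simp add: scale_mult_left)
      also have "\<dots> = (\<Sum>k\<in>cs E. \<Sum>a\<in>cs D. \<Sum>b\<in>cs E. s (haar (c i a * S (c b l))) (c a j * (S (c k b) * c m k)))"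
        by (simp add: sum_distrib_right scale_mult_left mult.assoc)
      also have "\<dots> = (\<Sum>a\<in>cs D. \<Sum>b\<in>cs E. \<Sum>k\<in>cs E. s (haar (c i a * S (c b l))) (c a j * (S (c k b) * c m k)))"
        by (subst sum.swap) (intro sum.cong refl sum.swap)
      also have "\<dots> = (\<Sum>a\<in>cs D. \<Sum>b\<in>cs E. s (haar (c i a * S (c b l))) (c a j * (\<Sum>k\<in>cs E. S (c k b) * c m k)))"
        by (simp add: sum_distrib_left scale_sum_right)
      also have "\<dots> = (\<Sum>a\<in>cs D. \<Sum>b\<in>cs E. if m = b then s (haar (c i a * S (c b l))) (c a j) else 0)"
        by (intro sum.cong refl) (simp add: flip)
      also have "\<dots> = (\<Sum>a\<in>cs D. s (haar (c i a * S (c m l))) (c a j))"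
        using m cs_finite by simp
      finally show ?thesis by simp
    qed
    then have "f p j (\<Sum>a\<in>cs D. s (haar (c i a * S (c m l))) (c a j)) =
        f p j (\<Sum>k\<in>cs E. s (haar (c i j * S (c k l))) (c m k))" by simp
    moreover have "f p j (\<Sum>a\<in>cs D. s (haar (c i a * S (c m l))) (c a j)) = haar (c i p * S (c m l))"
    proof -
      have "f p j (\<Sum>a\<in>cs D. s (haar (c i a * S (c m l))) (c a j)) =
          (\<Sum>a\<in>cs D. if p = a \<and> j = j then haar (c i a * S (c m l)) else 0)"
        by (rule f_sum_c[OF _ _ _ cs_finite]) (use p j in \<open>auto simp: cs_def\<close>)
      then show ?thesis using p cs_finite by simp
    qed
    moreover have "f p j (\<Sum>k\<in>cs E. s (haar (c i j * S (c k l))) (c m k)) =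
        (if p = m then haar (c i j * S (c j l)) else 0)"
    proof -
      have "f p j (\<Sum>k\<in>cs E. s (haar (c i j * S (c k l))) (c m k)) =
          (\<Sum>k\<in>cs E. if p = m \<and> j = k then haar (c i j * S (c k l)) else 0)"
        by (rule f_sum_c[OF _ _ _ cs_finite]) (use p j m in \<open>auto simp: cs_def\<close>)
      also have "\<dots> = (if p = m then haar (c i j * S (c j l)) else 0)"
        using p j m cs_finite by (auto simp: cs_def)
      finally show ?thesis .
    qed
    ultimately show ?thesis by simp
  qed
  show ?thesis
  proof (cases "p = m")
    case True
    then have DE: "D = E" using i m by (simp add: cs_def)
    have eq: "haar (c i j * S (c j l)) = haar (c i p * S (c m l))" if "j \<in> cs D" for j
      using key[OF i(2) that] True by simp
    have "of_nat (deg D) * haar (c i p * S (c m l)) = (\<Sum>j\<in>cs D. haar (c i j * S (c j l)))"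
      by (simp add: eq deg_def)
    also have "\<dots> = sw (c i l) (\<lambda>a b. haar (a * S b))"
      using m DE by (intro sw_c[OF _ i(1), symmetric] bifunctionalI fh) auto
    also have "\<dots> = (if i = l then 1 else 0)"
      using i m DE sw_antipode_right[OF functional_haar, of "c i l"]
      by (simp add: haar_1 counit_c cs_def)
    finally show ?thesis
      using True deg_pos[of D] cl_Cl(1)[of i] i by (auto simp: cs_def field_simps split: if_splits)
  next
    case False
    then show ?thesis using key[OF i(2) i(2)] by simp
  qed
qed

section \<open>Characters\<close>

definition chi :: "'j \<Rightarrow> 'h" where "chi D = (\<Sum>i\<in>cs D. c i i)"

lemma f_chi:
  assumes "i \<in> cs D" "j \<in> cs D"
  shows "f i j (chi E) = (if E = D \<and> i = j then 1 else 0)"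
proof -
  have ij: "i \<in> I" "j \<in> I" "cl i = cl j" "cl i = D" using assms by (auto simp: cs_def)
  have "f i j (c k k) = (if k = i then if i = j then 1 else 0 else 0)" if "k \<in> cs E" for k
    using that f_c[OF ij(1,2) _ _ ij(3) refl, of k] by (auto simp: cs_def)
  then have "f i j (chi E) = (\<Sum>k\<in>cs E. if k = i then if i = j then 1 else 0 else 0)"
    unfolding chi_def functional_sum[OF f_functional[OF ij(1,2)]] by (intro sum.cong refl)
  also have "\<dots> = (if E = D \<and> i = j then 1 else 0)" using cs_finite ij by (auto simp: cs_def)
  finally show ?thesis .
qed

lemma counit_chi: "\<epsilon> (chi D) = of_nat (deg D)"
proof -
  have "\<epsilon> (chi D) = (\<Sum>i\<in>cs D. 1)"
    unfolding chi_def functional_sum[OF functional_counit]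
    by (intro sum.cong refl) (auto simp: counit_c cs_def)
  then show ?thesis by (simp add: deg_def)
qed

lemma haar_chi: "D \<in> Cl \<Longrightarrow> haar (chi D * S (chi E)) = (if D = E then 1 else 0)"
proof -
  assume D: "D \<in> Cl"
  have "haar (chi D * S (chi E)) = (\<Sum>i\<in>cs D. \<Sum>j\<in>cs E. haar (c i i * S (c j j)))"
    by (simp add: chi_def operator_sum[OF operator_antipode] sum_product functional_sum[OF functional_haar])
  also have "\<dots> = (\<Sum>i\<in>cs D. \<Sum>j\<in>cs E. if i = j then 1 / of_nat (deg D) else 0)"
    by (intro sum.cong refl) (simp add: haar_orthogonal)
  also have "\<dots> = (\<Sum>i\<in>cs D. if i \<in> cs E then 1 / of_nat (deg D) else 0)"
    using cs_finite by (simp add: sum.delta')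
  also have "\<dots> = (if D = E then 1 else 0)"
  proof (cases "D = E")
    case True
    then show ?thesis using deg_pos[OF D] by (simp add: deg_def)
  next
    case False
    then show ?thesis by (auto simp: cs_def intro!: sum.neutral)
  qed
  finally show ?thesis .
qed

text \<open>By orthogonality of characters this is the coefficient of \<open>chi D\<close>.\<close>

definition cf :: "'j \<Rightarrow> 'h \<Rightarrow> 'k" where "cf D x = haar (x * S (chi D))"

lemma functional_cf: "functional (cf D)"
  unfolding cf_def by (intro fn_intros functional_comp[OF functional_haar])

lemma cf_chi_sum: "D \<in> Cl \<Longrightarrow> cf D (\<Sum>E\<in>Cl. s (r E) (chi E)) = r D"
  using Cl_finite
  by (simp add: functional_sum[OF functional_cf] functional_scale[OF functional_cf])
    (simp add: cf_def haar_chi if_distrib cong: if_cong)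

text \<open>Characters of comodules are sums of irreducible ones: the multiplicity of \<open>D\<close> is the trace of
  the idempotent by which \<open>f a a\<close> acts.\<close>

lemma corepresentation_character:
  fixes x :: "'y \<Rightarrow> 'y \<Rightarrow> 'h"
  assumes X: "finite X"
    and x: "\<And>F i j. bifunctional F \<Longrightarrow> i \<in> X \<Longrightarrow> j \<in> X \<Longrightarrow> sw (x i j) F = (\<Sum>l\<in>X. F (x i l) (x l j))"
  defines "\<tau> \<equiv> \<Sum>i\<in>X. x i i"
  shows "\<tau> = (\<Sum>D\<in>Cl. s (cf D \<tau>) (chi D))"
    and "D \<in> Cl \<Longrightarrow> \<exists>n::nat. cf D \<tau> = of_nat n"
    and "a \<in> cs D \<Longrightarrow> b \<in> cs D \<Longrightarrow> i \<in> X \<Longrightarrow> j \<in> X \<Longrightarrow> f a b (x i j) \<noteq> 0 \<Longrightarrow> cf D \<tau> \<noteq> 0"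
proof -
  have conv_x: "conv g h (x i j) = (\<Sum>l\<in>X. g (x i l) * h (x l j))"
    if "functional g" "functional h" "i \<in> X" "j \<in> X" for g h i j
    unfolding conv_def
    by (rule x) (use that in \<open>auto intro!: bifunctionalI fn_intros simp: functional_comp\<close>)
  \<comment> \<open>The trace of a comodule matrix is cocommutative; convolving it with matrix units
    shows that its coefficients form a scalar matrix on every class (\<open>off\<close> and
    \<open>diag\<close>).\<close>
  have conv_\<tau>: "conv g h \<tau> = conv h g \<tau>" if gh: "functional g" "functional h" for g h
  proof -
    have *: "conv g h \<tau> = (\<Sum>i\<in>X. \<Sum>l\<in>X. g (x i l) * h (x l i))" if "functional g" "functional h" for g h
      using conv_x[OF that] by (simp add: \<tau>_def functional_sum[OF functional_conv])
    show ?thesis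
      unfolding *[OF gh] *[OF gh(2,1)] by (subst sum.swap) (simp add: mult.commute)
  qed
  have off: "f a b \<tau> = 0" if ab: "a \<in> I" "b \<in> I" "cl a = cl b" "a \<noteq> b" for a b
  proof -
    have "f a b \<tau> = conv (f a a) (f a b) \<tau>"
      using f_conv[OF ab(1,1,1,2) refl ab(3)] by simp
    also have "\<dots> = conv (f a b) (f a a) \<tau>" using ab by (intro conv_\<tau> f_functional)
    also have "\<dots> = 0" using f_conv[OF ab(1,2,1,1) ab(3) refl] ab(4) by simp
    finally show ?thesis .
  qed
  have diag: "f a a \<tau> = f b b \<tau>" if ab: "a \<in> I" "b \<in> I" "cl a = cl b" for a b
  proof -
    have "f a a \<tau> = conv (f a b) (f b a) \<tau>"
      using f_conv[OF ab(1,2,2,1) ab(3) ab(3)[symmetric]] by simp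
    also have "\<dots> = conv (f b a) (f a b) \<tau>" using ab by (intro conv_\<tau> f_functional)
    also have "\<dots> = f b b \<tau>"
      using f_conv[OF ab(2,1,1,2) ab(3)[symmetric] ab(3)] by simp
    finally show ?thesis .
  qed
  define r where "r D = f (SOME a. a \<in> cs D) (SOME a. a \<in> cs D) \<tau>" for D
  have r: "f a a \<tau> = r D" if "a \<in> cs D" for a D
    unfolding r_def using someI[of "\<lambda>a. a \<in> cs D" a] that by (intro diag) (auto simp: cs_def)
  have \<tau>: "\<tau> = (\<Sum>D\<in>Cl. s (r D) (chi D))"
  proof -
    have "\<tau> = (\<Sum>D\<in>Cl. \<Sum>a\<in>cs D. \<Sum>b\<in>cs D. s (f a b \<tau>) (c a b))" by (rule c_expand')
    also have "\<dots> = (\<Sum>D\<in>Cl. \<Sum>a\<in>cs D. \<Sum>b\<in>cs D. if a = b then s (r D) (c a a) else 0)"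
    proof (intro sum.cong refl)
      fix D a b assume "a \<in> cs D" "b \<in> cs D"
      then show "s (f a b \<tau>) (c a b) = (if a = b then s (r D) (c a a) else 0)"
        using off[of a b] r[of a D] by (auto simp: cs_def)
    qed
    also have "\<dots> = (\<Sum>D\<in>Cl. s (r D) (chi D))"
      using cs_finite by (simp add: chi_def scale_sum_right)
    finally show ?thesis .
  qed
  have cf_r: "cf D \<tau> = r D" if "D \<in> Cl" for D
    by (subst \<tau>) (rule cf_chi_sum[OF that])
  show "\<tau> = (\<Sum>D\<in>Cl. s (cf D \<tau>) (chi D))"
    using \<tau> cf_r by simp
  have faa: "f a a (x i j) = (\<Sum>l\<in>X. f a a (x i l) * f a a (x l j))"
    if "a \<in> I" "i \<in> X" "j \<in> X" for a i j
    using conv_x[OF f_functional f_functional, of a a a a i j]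
      f_conv[OF that(1,1,1,1) refl refl, of "x i j"] that by simp
  have \<tau>_faa: "f a a \<tau> = (\<Sum>i\<in>X. f a a (x i i))" if "a \<in> I" for a
    by (simp add: \<tau>_def functional_sum[OF f_functional[OF that that]])
  show "\<exists>n::nat. cf D \<tau> = of_nat n" if D: "D \<in> Cl"
  proof -
    obtain a where a: "a \<in> cs D" using D by (auto simp: Cl_def cs_def)
    then have aI: "a \<in> I" by (simp add: cs_def)
    obtain n :: nat where "(\<Sum>i\<in>X. f a a (x i i)) = of_nat n"
      using idempotent_matrix_trace[OF X faa[OF aI, symmetric]] by blast
    then have "cf D \<tau> = of_nat n" using cf_r[OF D] r[OF a] \<tau>_faa[OF aI] by simp
    then show ?thesis by blast
  qed
  \<comment> \<open>Multiplicity zero makes \<open>f a a\<close> vanish on the whole matrix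
    \<open>x\<close>, hence also \<open>f a b\<close>, which is \<open>f a a\<close> convolved with
    \<open>f a b\<close>.\<close>
  show "cf D \<tau> \<noteq> 0" if ab: "a \<in> cs D" "b \<in> cs D" and ij: "i \<in> X" "j \<in> X" and nz: "f a b (x i j) \<noteq> 0"
  proof
    assume 0: "cf D \<tau> = 0"
    have aI: "a \<in> I" "b \<in> I" "cl a = cl b" using ab by (auto simp: cs_def)
    have D: "D \<in> Cl" using ab by (auto simp: cs_def Cl_def)
    obtain n :: nat where n: "(\<Sum>i\<in>X. f a a (x i i)) = of_nat n"
      "\<And>i j. n = 0 \<Longrightarrow> i \<in> X \<Longrightarrow> j \<in> X \<Longrightarrow> f a a (x i j) = 0"
      using idempotent_matrix_trace[OF X faa[OF aI(1), symmetric]] by blast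
    have "n = 0" using n(1) 0 cf_r[OF D] r[OF ab(1)] \<tau>_faa[OF aI(1)] by simp
    then have "conv (f a a) (f a b) (x i j) = 0"
      using conv_x[OF f_functional f_functional, of a a a b i j] aI ij n(2) by simp
    then show False using nz f_conv[OF aI(1,1,1,2) refl aI(3), of "x i j"] by simp
  qed
qed

end

text \<open>A rational-linear functional turns an eigenvector over the field into a rational one.\<close>

lemma integer_matrix_rational_eigenvalue:
  fixes v :: "'x \<Rightarrow> 'k::field_char_0" and M :: "'x \<Rightarrow> 'x \<Rightarrow> int"
  assumes X: "finite X" and v: "x0 \<in> X" "v x0 \<noteq> 0"
    and M: "\<And>i. i \<in> X \<Longrightarrow> (\<Sum>j\<in>X. of_int (M i j) * v j) = of_rat r * v i"
  shows "r \<in> \<int>"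
proof -
  define sc where "sc q x = of_rat q * x" for q and x :: 'k
  have vs: "vector_space sc"
    by unfold_locales (auto simp: sc_def algebra_simps of_rat_add of_rat_mult)
  obtain \<phi> where \<phi>: "Vector_Spaces.linear sc (*) \<phi>" "\<phi> (v x0) \<noteq> \<phi> 0"
    using functionals_separate[OF vs, of "v x0" 0] v(2) by blast
  have add: "\<phi> (x + y) = \<phi> x + \<phi> y" and scale: "\<phi> (of_rat q * x) = q * \<phi> x" for x y q
    using \<phi>(1) by (auto simp: Vector_Spaces.linear_iff sc_def)
  have zero: "\<phi> 0 = 0" using scale[of 0 0] by simp
  have sum: "\<phi> (\<Sum>j\<in>A. g j) = (\<Sum>j\<in>A. \<phi> (g j))" for g :: "'x \<Rightarrow> 'k" and A
    by (induction A rule: infinite_finite_induct) (auto simp: add zero)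
  define w where "w i = \<phi> (v i)" for i
  have w0: "w x0 \<noteq> 0" using \<phi>(2) zero by (simp add: w_def)
  have Mw: "(\<Sum>j\<in>X. of_int (M i j) * w j) = r * w i" if "i \<in> X" for i
  proof -
    have "(\<Sum>j\<in>X. of_int (M i j) * w j) = \<phi> (\<Sum>j\<in>X. of_rat (of_int (M i j)) * v j)"
      unfolding sum scale w_def ..
    then show ?thesis using M[OF that] scale by (simp add: w_def)
  qed
  define den where "den i = snd (quotient_of (w i))" for i
  define num where "num i = fst (quotient_of (w i))" for i
  have q: "w i = of_int (num i) / of_int (den i)" "den i > 0" for i
    using quotient_of_div[of "w i" "num i" "den i"] quotient_of_denom_pos[of "w i" "num i" "den i"]
    by (auto simp: num_def den_def)
  \<comment> \<open>Clearing denominators gives the integer vector \<open>y\<close>, division by its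
    gcd the primitive vector \<open>z\<close>. With \<open>r = a / b\<close> in lowest terms,
    \<open>b\<close> divides every \<open>a * z i\<close>, hence every \<open>z i\<close>, hence
    \<open>1\<close>.\<close>
  define d where "d = (\<Prod>i\<in>X. den i)"
  have d: "d > 0" unfolding d_def by (rule prod_pos) (use q in auto)
  define y where "y i = num i * (\<Prod>j\<in>X - {i}. den j)" for i
  have y: "of_int (y i) = of_int d * w i" if i: "i \<in> X" for i
  proof -
    have "d = den i * (\<Prod>j\<in>X - {i}. den j)" unfolding d_def using X i by (rule prod.remove)
    then show ?thesis using q[of i] by (simp add: y_def)
  qed
  obtain a b where ab: "quotient_of r = (a, b)" by fastforce
  have r: "r = of_int a / of_int b" "b > 0" "coprime a b"
    using quotient_of_div[OF ab] quotient_of_denom_pos[OF ab] quotient_of_coprime[OF ab] by auto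
  define g where "g = Gcd (y ` X)"
  have "y x0 \<noteq> 0" using y[OF v(1)] w0 d by auto
  then have g0: "g \<noteq> 0" using v(1) by (auto simp: g_def)
  define z where "z i = y i div g" for i
  have yz: "y i = g * z i" if "i \<in> X" for i
    using that by (simp add: z_def g_def)
  have Gz: "Gcd (z ` X) = 1"
  proof -
    have "Gcd (z ` X) * g dvd y i" if "i \<in> X" for i
      using yz[OF that] that by (simp add: mult.commute)
    then have "Gcd (z ` X) * g dvd g" unfolding g_def by (intro Gcd_greatest) auto
    then have "is_unit (Gcd (z ` X))" using g0 by simp
    then show ?thesis by (metis normalize_Gcd is_unit_normalize)
  qed
  have "b dvd z i" if i: "i \<in> X" for i
  proof -
    have "of_int (b * (\<Sum>j\<in>X. M i j * y j)) = of_int b * (\<Sum>j\<in>X. of_int (M i j) * (of_int d * w j))"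
      by (simp add: y)
    also have "\<dots> = of_int b * of_int d * (\<Sum>j\<in>X. of_int (M i j) * w j)"
      by (simp add: sum_distrib_left mult.left_commute mult.assoc)
    also have "\<dots> = (of_int (a * y i) :: rat)"
      using Mw[OF i] y[OF i] r by (simp add: field_simps)
    finally have "b * (\<Sum>j\<in>X. M i j * y j) = a * y i" by (simp only: of_int_eq_iff)
    then have "g * (b * (\<Sum>j\<in>X. M i j * z j)) = g * (a * z i)"
      using i by (simp add: yz sum_distrib_left mult.left_commute)
    then have "b dvd a * z i" using g0 by (metis dvd_triv_left mult_cancel_left)
    then show ?thesis using r(3) by (simp add: coprime_commute coprime_dvd_mult_right_iff)
  qed
  then have "b dvd Gcd (z ` X)" by (intro Gcd_greatest) auto
  then have "b = 1" using Gz r(2) by simp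
  then show ?thesis using r(1) by simp
qed

context matrix_basis
begin

definition character :: "'h \<Rightarrow> bool" where
  "character X \<longleftrightarrow> X = (\<Sum>D\<in>Cl. s (cf D X) (chi D)) \<and> (\<forall>D\<in>Cl. \<exists>n::nat. cf D X = of_nat n)"

text \<open>Products of coefficients are the matrix of a tensor product of comodules. The second
  part shows that every class met by such a product occurs in \<open>chi D * chi E\<close>, so
  characters alone decide whether a span of coefficients is closed under multiplication.\<close>

lemma product_corepresentation:
  assumes "D \<in> Cl" "E \<in> Cl"
  shows "character (chi D * chi E)"
    and "i \<in> cs D \<Longrightarrow> j \<in> cs D \<Longrightarrow> k \<in> cs E \<Longrightarrow> l \<in> cs E \<Longrightarrow> a \<in> cs F \<Longrightarrow> b \<in> cs F \<Longrightarrow>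
      f a b (c i j * c k l) \<noteq> 0 \<Longrightarrow> cf F (chi D * chi E) \<noteq> 0"
proof -
  let ?X = "cs D \<times> cs E"
  let ?x = "\<lambda>p q. c (fst p) (fst q) * c (snd p) (snd q)"
  have fin: "finite ?X" using cs_finite by simp
  have sw: "sw (?x p q) F = (\<Sum>r\<in>?X. F (?x p r) (?x r q))"
    if F: "bifunctional F" and pq: "p \<in> ?X" "q \<in> ?X" for F p q
  proof -
    note fi = fn_intros functional_bif_left[OF F] functional_bif_right[OF F]
    have p: "fst p \<in> cs D" "fst q \<in> cs D" "snd p \<in> cs E" "snd q \<in> cs E" using pq by auto
    have "sw (?x p q) F = sw (c (fst p) (fst q)) (\<lambda>a b. sw (c (snd p) (snd q)) (\<lambda>u v. F (a * u) (b * v)))"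
      by (rule sw_mult[OF F])
    also have "\<dots> = (\<Sum>i\<in>cs D. \<Sum>k\<in>cs E. F (c (fst p) i * c (snd p) k) (c i (fst q) * c k (snd q)))"
      by (subst sw_c[OF _ p(1,2)], (intro bifunctionalI fi)[1], subst sw_c[OF _ p(3,4)],
          (intro bifunctionalI fi)[1]) (rule refl)
    finally show ?thesis by (simp add: sum.cartesian_product case_prod_unfold)
  qed
  have tr: "(\<Sum>p\<in>?X. ?x p p) = chi D * chi E"
    by (simp add: chi_def sum_product sum.cartesian_product case_prod_unfold)
  note cor = corepresentation_character[of ?X ?x, OF fin sw, unfolded tr]
  show "character (chi D * chi E)"
    using cor(1,2) by (simp add: character_def)
  show "cf F (chi D * chi E) \<noteq> 0"
    if "i \<in> cs D" "j \<in> cs D" "k \<in> cs E" "l \<in> cs E" "a \<in> cs F" "b \<in> cs F" "f a b (c i j * c k l) \<noteq> 0"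
    using cor(3)[of a F b "(i, k)" "(j, l)"] that by simp
qed

text \<open>\<open>S\<close> reverses the comultiplication, so the comodule matrix is transposed:
  its entry at \<open>i\<close>, \<open>j\<close> is \<open>S (c j i)\<close>.\<close>

lemma antipode_corepresentation:
  shows "character (S (chi D))"
    and "i \<in> cs D \<Longrightarrow> j \<in> cs D \<Longrightarrow> a \<in> cs F \<Longrightarrow> b \<in> cs F \<Longrightarrow> f a b (S (c j i)) \<noteq> 0 \<Longrightarrow>
      cf F (S (chi D)) \<noteq> 0"
proof -
  have sw: "sw (S (c j i)) F = (\<Sum>l\<in>cs D. F (S (c l i)) (S (c j l)))"
    if F: "bifunctional F" and ij: "i \<in> cs D" "j \<in> cs D" for F i j
  proof -
    note fi = fn_intros functional_bif_left[OF F] functional_bif_right[OF F]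
    have "sw (S (c j i)) F = sw (c j i) (\<lambda>a b. F (S b) (S a))" by (rule sw_antipode[OF F])
    also have "\<dots> = (\<Sum>l\<in>cs D. F (S (c l i)) (S (c j l)))"
      by (rule sw_c[OF _ ij(2,1)]) (intro bifunctionalI fi)
    finally show ?thesis .
  qed
  have tr: "(\<Sum>i\<in>cs D. S (c i i)) = S (chi D)"
    by (simp add: chi_def operator_sum[OF operator_antipode])
  note cor = corepresentation_character[of "cs D" "\<lambda>i j. S (c j i)", OF cs_finite sw, unfolded tr]
  show "character (S (chi D))"
    using cor(1,2) by (simp add: character_def)
  show "cf F (S (chi D)) \<noteq> 0"
    if "i \<in> cs D" "j \<in> cs D" "a \<in> cs F" "b \<in> cs F" "f a b (S (c j i)) \<noteq> 0"
    using cor(3)[of a F b i j] that by simp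
qed

text \<open>By orthogonality the norm is the sum of the squared multiplicities; a sum of squares of
  naturals equal to \<open>1\<close> has a single nonzero term.\<close>

lemma character_irreducible:
  assumes X: "character X" and norm: "haar (X * S X) = 1"
  shows "\<exists>D\<in>Cl. X = chi D"
proof -
  have e: "X = (\<Sum>D\<in>Cl. s (cf D X) (chi D))" using X by (simp add: character_def)
  have "\<forall>D\<in>Cl. \<exists>n::nat. cf D X = of_nat n" using X by (simp add: character_def)
  then obtain n :: "'j \<Rightarrow> nat" where n: "\<And>D. D \<in> Cl \<Longrightarrow> cf D X = of_nat (n D)" by metis
  have "haar (X * S X) = haar (X * S (\<Sum>D\<in>Cl. s (cf D X) (chi D)))" using e by simp
  also have "\<dots> = (\<Sum>D\<in>Cl. cf D X * cf D X)"
    by (simp add: operator_sum[OF operator_antipode] antipode_scale sum_distrib_left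
        functional_sum[OF functional_haar] scale_mult_right functional_scale[OF functional_haar] cf_def)
  also have "\<dots> = of_nat (\<Sum>D\<in>Cl. n D * n D)" by (simp add: n)
  finally have "(of_nat (\<Sum>D\<in>Cl. n D * n D) :: 'k) = of_nat 1" using norm by simp
  then have sum1: "(\<Sum>D\<in>Cl. n D * n D) = 1" using of_nat_eq_iff by blast
  have "\<exists>D\<in>Cl. n D * n D \<noteq> 0"
  proof (rule ccontr)
    assume "\<not> ?thesis"
    then have "(\<Sum>D\<in>Cl. n D * n D) = 0" by (intro sum.neutral) blast
    then show False using sum1 by simp
  qed
  then obtain D where D: "D \<in> Cl" "n D * n D \<noteq> 0" by blast
  have split: "n D * n D + (\<Sum>E\<in>Cl - {D}. n E * n E) = 1"
    using sum.remove[OF Cl_finite D(1), of "\<lambda>E. n E * n E"] sum1 by (rule trans[OF sym])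
  have D1: "n D * n D = 1" and D0: "(\<Sum>E\<in>Cl - {D}. n E * n E) = 0"
    using split D(2) by linarith+
  have nD: "n D = 1" using D1 by (rule iffD1[OF nat_mult_eq_1_iff, THEN conjunct1])
  have nE: "n E = 0" if E: "E \<in> Cl - {D}" for E
  proof -
    have "n E * n E = 0" using D0 E Cl_finite by (subst (asm) sum_eq_0_iff) auto
    then show ?thesis by simp
  qed
  have "X = s (cf D X) (chi D) + (\<Sum>E\<in>Cl - {D}. s (cf E X) (chi E))"
    by (subst e) (rule sum.remove[OF Cl_finite D(1)])
  also have "(\<Sum>E\<in>Cl - {D}. s (cf E X) (chi E)) = 0"
    using n nE by (intro sum.neutral) auto
  finally show ?thesis using n[OF D(1)] nD D(1) by auto
qed

lemma haar_antipode_chi: "D \<in> Cl \<Longrightarrow> haar (S (chi D) * S (S (chi D))) = 1"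
  using haar_chi[of D D] by (simp add: antipode_involution haar_commute)

lemma antipode_chi: "D \<in> Cl \<Longrightarrow> \<exists>E\<in>Cl. S (chi D) = chi E"
  by (rule character_irreducible[OF antipode_corepresentation(1) haar_antipode_chi])

definition star :: "'j \<Rightarrow> 'j" where "star D = (SOME E. E \<in> Cl \<and> S (chi D) = chi E)"

lemma star: "D \<in> Cl \<Longrightarrow> star D \<in> Cl" "D \<in> Cl \<Longrightarrow> S (chi D) = chi (star D)"
proof -
  assume "D \<in> Cl"
  then have "star D \<in> Cl \<and> S (chi D) = chi (star D)"
    unfolding star_def using antipode_chi by (intro someI_ex[of "\<lambda>E. E \<in> Cl \<and> S (chi D) = chi E"]) auto
  then show "star D \<in> Cl" "S (chi D) = chi (star D)" by auto
qed

lemma unit_class: "\<exists>D\<in>Cl. 1 = chi D"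
proof (rule character_irreducible)
  note cor = corepresentation_character[of "{()}" "\<lambda>_ _. 1"]
  show "character 1"
    using cor(1,2) by (simp add: character_def sw_one)
  show "haar (1 * S 1) = 1" by (simp add: antipode_one haar_1)
qed

definition one_class :: 'j where "one_class = (SOME D. D \<in> Cl \<and> chi D = 1)"

lemma one_class: "one_class \<in> Cl" "chi one_class = 1" "deg one_class = 1"
proof -
  have "one_class \<in> Cl \<and> chi one_class = 1"
    unfolding one_class_def using unit_class by (intro someI_ex[of "\<lambda>D. D \<in> Cl \<and> chi D = 1"]) auto
  then show "one_class \<in> Cl" and 1: "chi one_class = 1" by auto
  have "(of_nat (deg one_class) :: 'k) = of_nat 1"
    using counit_chi[of one_class] 1 by (simp add: counit_one)
  then show "deg one_class = 1" using of_nat_eq_iff by blast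
qed

lemma cf_one_class: "cf one_class x = haar x"
  by (simp add: cf_def one_class antipode_one)

lemma cf_chi: "D \<in> Cl \<Longrightarrow> cf E (chi D) = (if D = E then 1 else 0)"
  by (simp add: cf_def haar_chi)

lemma cf_one_chi_star: "D \<in> Cl \<Longrightarrow> cf one_class (chi D * chi (star D)) = 1"
  using haar_chi[of D D] by (simp add: cf_one_class star(2)[symmetric])

section \<open>The class equation\<close>

text \<open>Closed sets of classes correspond to Hopf subalgebras \<open>span_c J\<close>.\<close>

definition closed :: "'j set \<Rightarrow> bool" where
  "closed J \<longleftrightarrow> J \<subseteq> Cl \<and> one_class \<in> J \<and> (\<forall>D\<in>J. star D \<in> J) \<and>
     (\<forall>D\<in>J. \<forall>E\<in>J. \<forall>F\<in>Cl. cf F (chi D * chi E) \<noteq> 0 \<longrightarrow> F \<in> J)"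

text \<open>Described by vanishing coordinates instead of as a span, so that membership is checked
  with the functionals \<open>f\<close>.\<close>

definition span_c :: "'j set \<Rightarrow> 'h set" where
  "span_c J = {x. \<forall>i\<in>I. \<forall>j\<in>I. cl i = cl j \<longrightarrow> cl i \<notin> J \<longrightarrow> f i j x = 0}"

lemma subspace_span_c: "subspace (span_c J)"
  by (auto simp: subspace_def span_c_def functional_0[OF f_functional] functional_add[OF f_functional]
      functional_scale[OF f_functional])

lemma c_span_c: "D \<in> J \<Longrightarrow> i \<in> cs D \<Longrightarrow> j \<in> cs D \<Longrightarrow> c i j \<in> span_c J"
  by (auto simp: span_c_def cs_def f_c)

lemma chi_span_c: "D \<in> J \<Longrightarrow> chi D \<in> span_c J"
  unfolding chi_def by (intro subspace_sum[OF subspace_span_c] c_span_c)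

lemma span_c_expand:
  assumes x: "x \<in> span_c J" and J: "J \<subseteq> Cl"
  shows "x = (\<Sum>D\<in>J. \<Sum>i\<in>cs D. \<Sum>j\<in>cs D. s (f i j x) (c i j))"
proof -
  have "x = (\<Sum>D\<in>Cl. \<Sum>i\<in>cs D. \<Sum>j\<in>cs D. s (f i j x) (c i j))" by (rule c_expand')
  also have "\<dots> = (\<Sum>D\<in>J. \<Sum>i\<in>cs D. \<Sum>j\<in>cs D. s (f i j x) (c i j))"
    using x by (intro sum.mono_neutral_right Cl_finite J ballI sum.neutral) (auto simp: span_c_def cs_def)
  finally show ?thesis .
qed

lemma span_c_dual_system:
  assumes J: "J \<subseteq> Cl"
  shows "dual_system (span_c J) (SIGMA D:J. cs D \<times> cs D) (\<lambda>(D, i, j). f i j) (\<lambda>(D, i, j). c i j)"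
    and "(\<Sum>(D, i, j)\<in>(SIGMA D:J. cs D \<times> cs D). g i j) = (\<Sum>D\<in>J. \<Sum>i\<in>cs D. \<Sum>j\<in>cs D. g i j)"
proof -
  let ?X = "SIGMA D:J. cs D \<times> cs D"
  have finJ: "finite J" using J Cl_finite finite_subset by blast
  have sum: "(\<Sum>(D, i, j)\<in>?X. g i j) = (\<Sum>D\<in>J. \<Sum>i\<in>cs D. \<Sum>j\<in>cs D. g i j)" for g :: "'i \<Rightarrow> 'i \<Rightarrow> 'z::comm_monoid_add"
    using finJ cs_finite by (simp add: sum.Sigma sum.cartesian_product)
  then show "(\<Sum>(D, i, j)\<in>?X. g i j) = (\<Sum>D\<in>J. \<Sum>i\<in>cs D. \<Sum>j\<in>cs D. g i j)" .
  show "dual_system (span_c J) ?X (\<lambda>(D, i, j). f i j) (\<lambda>(D, i, j). c i j)"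
    unfolding dual_system_def
  proof (intro conjI ballI)
    show "finite ?X" using finJ cs_finite by auto
    fix x assume "x \<in> ?X"
    then obtain D i j where x: "x = (D, i, j)" "D \<in> J" "i \<in> cs D" "j \<in> cs D" by auto
    show "functional ((\<lambda>(D, i, j). f i j) x)" using x f_functional cs_I by auto
    show "(\<lambda>(D, i, j). c i j) x \<in> span_c J" using c_span_c[OF x(2,3,4)] x(1) by simp
  next
    fix x assume "x \<in> span_c J"
    from span_c_expand[OF this J]
    show "x = (\<Sum>i\<in>?X. s ((\<lambda>(D, i, j). f i j) i x) ((\<lambda>(D, i, j). c i j) i))"
      unfolding sum[symmetric] by (simp add: case_prod_unfold)
  qed
qed

lemma span_c_induct:
  assumes "x \<in> span_c J" "J \<subseteq> Cl" "subspace W"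
    and "\<And>D i j. D \<in> J \<Longrightarrow> i \<in> cs D \<Longrightarrow> j \<in> cs D \<Longrightarrow> c i j \<in> W"
  shows "x \<in> W"
  by (subst span_c_expand[OF assms(1,2)]) (intro subspace_sum[OF assms(3)] subspace_scale[OF assms(3)] assms(4))

lemma closedD:
  assumes "closed J"
  shows "J \<subseteq> Cl" "one_class \<in> J" "D \<in> J \<Longrightarrow> star D \<in> J"
    and "D \<in> J \<Longrightarrow> E \<in> J \<Longrightarrow> F \<in> Cl \<Longrightarrow> cf F (chi D * chi E) \<noteq> 0 \<Longrightarrow> F \<in> J"
proof -
  note J = assms[unfolded closed_def]
  show "J \<subseteq> Cl" using J by (rule conjunct1)
  show "one_class \<in> J" using J by (elim conjE)
  show "star D \<in> J" if "D \<in> J" using J that by (elim conjE bspec)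
  show "F \<in> J" if "D \<in> J" "E \<in> J" "F \<in> Cl" "cf F (chi D * chi E) \<noteq> 0"
  proof -
    have "\<forall>D\<in>J. \<forall>E\<in>J. \<forall>F\<in>Cl. cf F (chi D * chi E) \<noteq> 0 \<longrightarrow> F \<in> J" using J by (elim conjE)
    from bspec[OF bspec[OF bspec[OF this that(1)] that(2)] that(3)] show ?thesis using that(4) by (rule mp)
  qed
qed

context
  fixes J
  assumes J: "closed J"
begin

lemma J_Cl: "D \<in> J \<Longrightarrow> D \<in> Cl" "J \<subseteq> Cl" and J_finite: "finite J"
  using closedD(1)[OF J] Cl_finite finite_subset by auto

lemma one_span_c: "1 \<in> span_c J"
  using chi_span_c[OF closedD(2)[OF J]] by (simp add: one_class)

lemma span_c_mult: assumes "x \<in> span_c J" "y \<in> span_c J" shows "x * y \<in> span_c J"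
proof (rule span_c_induct[OF assms(1) J_Cl(2), of "{x. x * y \<in> span_c J}", simplified])
  show "subspace {x. x * y \<in> span_c J}"
    using subspace_span_c[of J] by (auto simp: subspace_def distrib_right scale_mult_left)
  fix D i j assume ij: "D \<in> J" "i \<in> cs D" "j \<in> cs D"
  show "c i j * y \<in> span_c J"
  proof (rule span_c_induct[OF assms(2) J_Cl(2), of "{y. c i j * y \<in> span_c J}", simplified])
    show "subspace {y. c i j * y \<in> span_c J}"
      using subspace_span_c[of J] by (auto simp: subspace_def distrib_left scale_mult_right)
    fix E k l assume kl: "E \<in> J" "k \<in> cs E" "l \<in> cs E"
    show "c i j * c k l \<in> span_c J"
      unfolding span_c_def
    proof (intro CollectI ballI impI)
      fix a b assume ab: "a \<in> I" "b \<in> I" "cl a = cl b" "cl a \<notin> J"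
      show "f a b (c i j * c k l) = 0"
      proof (rule ccontr)
        assume "f a b (c i j * c k l) \<noteq> 0"
        then have "cf (cl a) (chi D * chi E) \<noteq> 0"
          using product_corepresentation(2)[OF J_Cl(1)[OF ij(1)] J_Cl(1)[OF kl(1)] ij(2,3) kl(2,3), of a "cl a" b]
            ab by (simp add: cs_def)
        then have "cl a \<in> J" by (rule closedD(4)[OF J ij(1) kl(1) cl_Cl(1)[OF ab(1)]])
        then show False using ab(4) by contradiction
      qed
    qed
  qed
qed

lemma span_c_antipode: assumes "x \<in> span_c J" shows "S x \<in> span_c J"
proof (rule span_c_induct[OF assms J_Cl(2), of "{x. S x \<in> span_c J}", simplified])
  show "subspace {x. S x \<in> span_c J}"
    using subspace_span_c[of J] operator_0[OF operator_antipode]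
    by (auto simp: subspace_def antipode_add antipode_scale)
  fix D i j assume ij: "D \<in> J" "i \<in> cs D" "j \<in> cs D"
  show "S (c i j) \<in> span_c J"
    unfolding span_c_def
  proof (intro CollectI ballI impI)
    fix a b assume ab: "a \<in> I" "b \<in> I" "cl a = cl b" "cl a \<notin> J"
    show "f a b (S (c i j)) = 0"
    proof (rule ccontr)
      assume "f a b (S (c i j)) \<noteq> 0"
      then have "cf (cl a) (S (chi D)) \<noteq> 0"
        using antipode_corepresentation(2)[OF ij(3,2), of a "cl a" b] ab by (simp add: cs_def)
      then have "cl a = star D"
        using star[OF J_Cl(1)[OF ij(1)]] by (simp add: cf_chi split: if_splits)
      then show False using closedD(3)[OF J ij(1)] ab(4) by simp
    qed
  qed
qed

text \<open>The dimension of \<open>span_c J\<close>.\<close>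

definition size_J :: nat where "size_J = (\<Sum>D\<in>J. deg D * deg D)"

text \<open>Orthogonality leaves a single term, so pairing with \<open>S (c p i)\<close> reads off a
  coordinate.\<close>

lemma f_haar:
  assumes x: "x \<in> span_c J" and D: "D \<in> J" "i \<in> cs D" "p \<in> cs D"
  shows "haar (x * S (c p i)) = f i p x / of_nat (deg D)"
proof -
  have "haar (x * S (c p i)) = (\<Sum>E\<in>J. \<Sum>k\<in>cs E. \<Sum>l\<in>cs E. f k l x * haar (c k l * S (c p i)))"
    by (subst span_c_expand[OF x J_Cl(2)])
      (simp add: sum_distrib_right scale_mult_left functional_sum[OF functional_haar]
        functional_scale[OF functional_haar])
  also have "\<dots> = (\<Sum>E\<in>J. \<Sum>k\<in>cs E. \<Sum>l\<in>cs E. if l = p then if k = i then f i p x / of_nat (deg D) else 0 else 0)"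
  proof (intro sum.cong refl)
    fix E k l assume "E \<in> J" and kl: "k \<in> cs E" "l \<in> cs E"
    then show "f k l x * haar (c k l * S (c p i)) =
        (if l = p then if k = i then f i p x / of_nat (deg D) else 0 else 0)"
      using haar_orthogonal[OF kl D(3,2)] D by (auto simp: cs_def)
  qed
  also have "\<dots> = (\<Sum>E\<in>J. if E = D then f i p x / of_nat (deg D) else 0)"
  proof (intro sum.cong refl)
    fix E
    have "(\<Sum>k\<in>cs E. \<Sum>l\<in>cs E. if l = p then if k = i then f i p x / of_nat (deg D) else 0 else 0) =
       (\<Sum>k\<in>cs E. if k = i then if p \<in> cs E then f i p x / of_nat (deg D) else 0 else 0)"
      using cs_finite by (intro sum.cong refl) (simp add: sum.delta')
    also have "\<dots> = (if E = D then f i p x / of_nat (deg D) else 0)"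
      using cs_finite D by (auto simp: sum.delta' cs_def)
    finally show "(\<Sum>k\<in>cs E. \<Sum>l\<in>cs E. if l = p then if k = i then f i p x / of_nat (deg D) else 0 else 0) =
      (if E = D then f i p x / of_nat (deg D) else 0)" .
  qed
  also have "\<dots> = f i p x / of_nat (deg D)" using J_finite D(1) by simp
  finally show ?thesis .
qed

lemma span_c_eqI:
  assumes x: "x \<in> span_c J" and 0: "\<And>y. y \<in> span_c J \<Longrightarrow> haar (x * y) = 0"
  shows "x = 0"
proof -
  have "f i p x = 0" if D: "D \<in> J" "i \<in> cs D" "p \<in> cs D" for D i p
    using f_haar[OF x D] 0[OF span_c_antipode[OF c_span_c[OF D(1,3,2)]]] deg_pos[OF J_Cl(1)[OF D(1)]]
    by simp
  then show ?thesis by (subst span_c_expand[OF x J_Cl(2)]) (intro sum.neutral ballI, simp)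
qed

text \<open>The Haar integral of the Hopf subalgebra \<open>span_c J\<close>: its regular character
  divided by its dimension.\<close>

definition Lam_J :: 'h where "Lam_J = s (1 / of_nat size_J) (\<Sum>D\<in>J. s (of_nat (deg D)) (chi D))"

lemma Lam_J_span_c: "Lam_J \<in> span_c J"
  unfolding Lam_J_def
  by (intro subspace_scale[OF subspace_span_c] subspace_sum[OF subspace_span_c] chi_span_c)

lemma size_J_pos: "size_J > 0"
proof -
  have "deg one_class * deg one_class \<le> size_J"
    unfolding size_J_def using closedD(2)[OF J] J_finite by (intro member_le_sum) simp_all
  then show ?thesis by (simp add: one_class)
qed

lemma counit_Lam_J: "\<epsilon> Lam_J = 1"
proof -
  have "\<epsilon> Lam_J = 1 / of_nat size_J * (\<Sum>D\<in>J. of_nat (deg D) * of_nat (deg D))"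
    by (simp add: Lam_J_def counit_scale functional_sum[OF functional_counit] counit_chi)
  also have "(\<Sum>D\<in>J. of_nat (deg D) * of_nat (deg D)) = (of_nat size_J :: 'k)"
    by (simp add: size_J_def)
  finally show ?thesis using size_J_pos by simp
qed

lemma haar_Lam_J: assumes "y \<in> span_c J" shows "haar (Lam_J * y) = \<epsilon> y / of_nat size_J"
proof -
  have *: "haar (Lam_J * S z) = \<epsilon> z / of_nat size_J" if "z \<in> span_c J" for z
  proof (rule span_c_induct[OF that J_Cl(2), of "{z. haar (Lam_J * S z) = \<epsilon> z / of_nat size_J}", simplified])
    show "subspace {z. haar (Lam_J * S z) = \<epsilon> z / of_nat size_J}"
      using operator_0[OF operator_antipode] functional_0[OF functional_haar] functional_0[OF functional_counit]
      by (auto simp: subspace_def antipode_add antipode_scale distrib_left scale_mult_right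
        functional_add[OF functional_haar] functional_scale[OF functional_haar] counit_add counit_scale
        add_divide_distrib)
    fix D p i assume D: "D \<in> J" "p \<in> cs D" "i \<in> cs D"
    have "f i p Lam_J = (if i = p then of_nat (deg D) / of_nat size_J else 0)"
    proof -
      note f_chi[OF D(3,2)]
      then have "f i p Lam_J = (\<Sum>E\<in>J. if E = D then (if i = p then of_nat (deg D) / of_nat size_J else 0) else 0)"
        unfolding Lam_J_def using D
        by (simp add: functional_scale[OF f_functional] functional_sum[OF f_functional] cs_def
            sum_divide_distrib) (intro impI sum.cong, auto)
      then show ?thesis using D J_finite by simp
    qed
    then show "haar (Lam_J * S (c p i)) = \<epsilon> (c p i) / of_nat size_J"
      using f_haar[OF Lam_J_span_c D(1,3,2)] deg_pos[OF J_Cl(1)[OF D(1)]] D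
      by (auto simp: counit_c cs_def)
  qed
  show ?thesis using *[OF span_c_antipode[OF assms]] by (simp add: antipode_involution counit_antipode)
qed

text \<open>With respect to the form \<open>haar (x * y)\<close>, nondegenerate on
  \<open>span_c J\<close>, the element \<open>Lam_J\<close> represents a multiple of the counit;
  multiplicativity of the counit gives both equations.\<close>

lemma Lam_J_integral:
  assumes x: "x \<in> span_c J"
  shows "x * Lam_J = s (\<epsilon> x) Lam_J" "Lam_J * x = s (\<epsilon> x) Lam_J"
proof -
  have d: "z - s (\<epsilon> x) Lam_J \<in> span_c J" if "z \<in> span_c J" for z
    by (intro subspace_diff[OF subspace_span_c] subspace_scale[OF subspace_span_c] that Lam_J_span_c)
  have "x * Lam_J - s (\<epsilon> x) Lam_J = 0"
  proof (rule span_c_eqI[OF d[OF span_c_mult[OF x Lam_J_span_c]]])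
    fix y assume y: "y \<in> span_c J"
    have "haar (x * Lam_J * y) = haar (Lam_J * (y * x))" by (metis haar_commute mult.assoc)
    then show "haar ((x * Lam_J - s (\<epsilon> x) Lam_J) * y) = 0"
      using haar_Lam_J[OF span_c_mult[OF y x]] haar_Lam_J[OF y]
      by (simp add: left_diff_distrib functional_diff[OF functional_haar] scale_mult_left
          functional_scale[OF functional_haar] counit_mult)
  qed
  then show "x * Lam_J = s (\<epsilon> x) Lam_J" by simp
  have "Lam_J * x - s (\<epsilon> x) Lam_J = 0"
  proof (rule span_c_eqI[OF d[OF span_c_mult[OF Lam_J_span_c x]]])
    fix y assume y: "y \<in> span_c J"
    show "haar ((Lam_J * x - s (\<epsilon> x) Lam_J) * y) = 0"
      using haar_Lam_J[OF span_c_mult[OF x y]] haar_Lam_J[OF y]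
      by (simp add: left_diff_distrib functional_diff[OF functional_haar] scale_mult_left
          functional_scale[OF functional_haar] counit_mult mult.assoc)
  qed
  then show "Lam_J * x = s (\<epsilon> x) Lam_J" by simp
qed

end

end

section \<open>The character ring of a Hopf subalgebra\<close>

context matrix_basis
begin

definition class_functions :: "'j set \<Rightarrow> 'h set" where
  "class_functions J = {x. x = (\<Sum>D\<in>J. s (cf D x) (chi D))}"

context
  fixes J
  assumes J: "closed J"
begin

lemma class_functions_expand: "x \<in> class_functions J \<Longrightarrow> x = (\<Sum>D\<in>J. s (cf D x) (chi D))"
  unfolding class_functions_def by (rule CollectD)

lemma subspace_class_functions: "subspace (class_functions J)"
  unfolding subspace_def class_functions_def
  by (simp add: functional_0[OF functional_cf] functional_add[OF functional_cf]
      functional_scale[OF functional_cf] scale_left_distrib sum.distrib scale_scale[symmetric] scale_sum_right[symmetric]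
      del: scale_scale)

lemma chi_class_functions: "D \<in> J \<Longrightarrow> chi D \<in> class_functions J"
proof -
  assume D: "D \<in> J"
  then have "(\<Sum>E\<in>J. s (cf E (chi D)) (chi E)) = (\<Sum>E\<in>J. if E = D then chi E else 0)"
    by (intro sum.cong refl) (simp add: cf_chi[OF J_Cl(1)[OF J]])
  then show ?thesis using D J_finite[OF J] by (simp add: class_functions_def)
qed

lemma class_functions_induct:
  assumes "x \<in> class_functions J" "subspace W" "\<And>D. D \<in> J \<Longrightarrow> chi D \<in> W"
  shows "x \<in> W"
  by (subst class_functions_expand[OF assms(1)])
    (intro subspace_sum[OF assms(2)] subspace_scale[OF assms(2)] assms(3))

lemma class_functions_span_c: "x \<in> class_functions J \<Longrightarrow> x \<in> span_c J"
  by (erule class_functions_induct[OF _ subspace_span_c]) (rule chi_span_c)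

lemma one_class_functions: "1 \<in> class_functions J"
  using chi_class_functions[OF closedD(2)[OF J]] by (simp add: one_class)

lemma chi_mult_chi:
  assumes "D \<in> J" "E \<in> J"
  shows "chi D * chi E \<in> class_functions J"
proof -
  have DE: "D \<in> Cl" "E \<in> Cl" using assms J_Cl(1)[OF J] by auto
  have "chi D * chi E = (\<Sum>F\<in>Cl. s (cf F (chi D * chi E)) (chi F))"
    using product_corepresentation(1)[OF DE] unfolding character_def by (rule conjunct1)
  also have "\<dots> = (\<Sum>F\<in>J. s (cf F (chi D * chi E)) (chi F))"
    by (intro sum.mono_neutral_right Cl_finite J_Cl(2)[OF J])
      (use closedD(4)[OF J assms] in auto)
  finally show ?thesis unfolding class_functions_def by (rule CollectI)
qed

lemma class_functions_mult:
  assumes x: "x \<in> class_functions J" and y: "y \<in> class_functions J"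
  shows "x * y \<in> class_functions J"
proof (rule class_functions_induct[OF x, of "{x. x * y \<in> class_functions J}", simplified])
  show "subspace {x. x * y \<in> class_functions J}"
    using subspace_class_functions unfolding subspace_def
    by (simp add: distrib_right scale_mult_left)
  fix D assume D: "D \<in> J"
  show "chi D * y \<in> class_functions J"
  proof (rule class_functions_induct[OF y, of "{y. chi D * y \<in> class_functions J}", simplified])
    show "subspace {y. chi D * y \<in> class_functions J}"
      using subspace_class_functions unfolding subspace_def
      by (simp add: distrib_left scale_mult_right)
  qed (rule chi_mult_chi[OF D])
qed

lemma class_functions_antipode: "x \<in> class_functions J \<Longrightarrow> S x \<in> class_functions J"
proof (erule class_functions_induct[of _ "{x. S x \<in> class_functions J}", simplified])
  show "subspace {x. S x \<in> class_functions J}"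
    using subspace_class_functions operator_0[OF operator_antipode] unfolding subspace_def
    by (simp add: antipode_add antipode_scale)
  show "S (chi D) \<in> class_functions J" if "D \<in> J" for D
    using chi_class_functions[OF closedD(3)[OF J that]] star(2)[OF J_Cl(1)[OF J that]] by simp
qed

text \<open>By \<open>haar_chi\<close> the \<open>chi D\<close> and the \<open>S (chi D)\<close> are
  dual bases for \<open>haar\<close>; the expansion of \<open>S x\<close> is transported back by
  \<open>S\<close>.\<close>

lemma class_functions_dual:
  assumes x: "x \<in> class_functions J"
  shows "x = (\<Sum>D\<in>J. s (haar (x * chi D)) (S (chi D)))"
proof -
  have "x = S (S x)" by (simp add: antipode_involution)
  also have "S x = (\<Sum>D\<in>J. s (cf D (S x)) (chi D))"
    by (rule class_functions_expand[OF class_functions_antipode[OF x]])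
  also have "S \<dots> = (\<Sum>D\<in>J. s (cf D (S x)) (S (chi D)))"
    by (simp add: operator_sum[OF operator_antipode] antipode_scale)
  also have "\<dots> = (\<Sum>D\<in>J. s (haar (x * chi D)) (S (chi D)))"
  proof (intro sum.cong refl)
    fix D
    have "cf D (S x) = haar (S (chi D * x))" by (simp add: cf_def antipode_mult)
    then show "s (cf D (S x)) (S (chi D)) = s (haar (x * chi D)) (S (chi D))"
      by (simp add: haar_antipode haar_commute)
  qed
  finally show ?thesis .
qed

text \<open>The trace form of left multiplications is \<open>card B * haar\<close>. It is
  nondegenerate on class functions because \<open>cf D\<close> is the pairing with
  \<open>S (chi D)\<close>, so \<open>primitive_decomposition\<close> applies.\<close>

lemma class_functions_decomposition:
  obtains E where "finite E" "E \<subseteq> class_functions J" "(\<Sum>e\<in>E. e) = 1"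
    "\<And>e. e \<in> E \<Longrightarrow> e \<noteq> 0" "\<And>e. e \<in> E \<Longrightarrow> e * e = e"
    "\<And>e x. e \<in> E \<Longrightarrow> x \<in> class_functions J \<Longrightarrow> \<exists>a. e * x * e = s a e"
proof -
  let ?L = "\<lambda>x a. x * a :: 'h"
  interpret O: op_algebra s B "?L ` class_functions J"
  proof (rule L_op_algebra[OF one_class_functions subspace_class_functions class_functions_mult])
    fix x assume x: "x \<in> class_functions J" and 0: "\<And>y. y \<in> class_functions J \<Longrightarrow> t (x * y) = 0"
    have "cf D x = 0" if "D \<in> J" for D
      using 0[OF class_functions_antipode[OF chi_class_functions[OF that]]] card_B_pos
      by (simp add: t_def tr_L cf_def)
    then show "x = 0" by (subst class_functions_expand[OF x]) simp
  qed
  obtain E where dec: "O.decomposition E"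
    and prim: "\<And>e F. e \<in> E \<Longrightarrow> F \<in> ?L ` class_functions J \<Longrightarrow> \<exists>c. \<forall>x. e (F (e x)) = s c (e x)"
    by (rule O.primitive_decomposition) (rule that)
  interpret P: primitive_op_algebra s B "?L ` class_functions J" E
    by unfold_locales (use dec prim in auto)
  have e1: "e x = e 1 * x" "e 1 \<in> class_functions J" if e: "e \<in> E" for e x
  proof -
    obtain y where "y \<in> class_functions J" "e = ?L y" using P.E_mem[OF e] by blast
    then show "e x = e 1 * x" "e 1 \<in> class_functions J" by auto
  qed
  have inj: "inj_on (\<lambda>e. e 1) E"
  proof (rule inj_onI)
    fix e f assume ef: "e \<in> E" "f \<in> E" "e 1 = f 1"
    show "e = f"
    proof (rule ext)
      fix x show "e x = f x" using ef(3) e1(1)[OF ef(1), of x] e1(1)[OF ef(2), of x] by simp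
    qed
  qed
  show ?thesis
  proof (rule that[of "(\<lambda>e. e 1) ` E"])
    show "finite ((\<lambda>e. e 1) ` E)" using P.E_finite by simp
    show "(\<lambda>e. e 1) ` E \<subseteq> class_functions J" using e1(2) by auto
    show "(\<Sum>e\<in>(\<lambda>e. e 1) ` E. e) = 1" by (simp add: sum.reindex[OF inj] P.E_sum)
    fix x assume "x \<in> (\<lambda>e. e 1) ` E"
    then obtain e where e: "e \<in> E" "x = e 1" by blast
    show "x \<noteq> 0"
    proof
      assume "x = 0"
      then have e0: "e 1 = 0" using e(2) by simp
      have "e = (\<lambda>x. 0)"
      proof (rule ext)
        show "e x = 0" for x by (subst e1(1)[OF e(1)], subst e0) simp
      qed
      then show False using P.E_nonzero[OF e(1)] by contradiction
    qed
    show "x * x = x" unfolding e(2) using trans[OF e1(1)[OF e(1), of "e 1", symmetric] P.E_idem[OF e(1)]] .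
    show "\<exists>a. x * y * x = s a x" if y: "y \<in> class_functions J" for y
    proof -
      obtain c where "\<And>x. e (y * e x) = s c (e x)" using prim[OF e(1) imageI[OF y]] by blast
      then have "e (y * e 1) = s c (e 1)" .
      then have "e 1 * (y * e 1) = s c (e 1)" by (rule trans[OF e1(1)[OF e(1), symmetric]])
      then show ?thesis unfolding e(2) mult.assoc by (rule exI)
    qed
  qed
qed

context
  fixes e
  assumes e: "e \<in> class_functions J" "e \<noteq> 0" "e * e = e"
    and e_prim: "\<And>x. x \<in> class_functions J \<Longrightarrow> \<exists>a. e * x * e = s a e"
begin

text \<open>The right ideal is taken in the whole algebra and not in \<open>span_c J\<close>: its
  dimension is to be compared with \<open>card B\<close>.\<close>

definition mult_e :: nat where "mult_e = dim (range (\<lambda>a. e * a))"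

lemma mult_e: "of_nat mult_e = of_nat (card B) * haar e" "mult_e > 0"
proof -
  have ee: "e * (e * a) = e * a" for a by (simp add: mult.assoc[symmetric] e(3))
  show "of_nat mult_e = of_nat (card B) * haar e"
    using tr_idempotent[OF operator_L ee] by (simp add: tr_L mult_e_def)
  show "mult_e > 0"
    unfolding mult_e_def
    by (rule dim_pos[OF _ _ e(2)]) (use subspace_image_operator[OF operator_L subspace_UNIV] e(3) in
        \<open>auto intro: range_eqI[of _ _ e]\<close>)
qed

lemma haar_e: "haar e \<noteq> 0"
  using mult_e by auto

lemma e_sandwich:
  assumes x: "x \<in> class_functions J"
  shows "e * x * e = s (haar (x * e) / haar e) e"
proof -
  obtain a where a: "e * x * e = s a e" using e_prim[OF x] by blast
  have "haar (e * x * e) = haar (x * (e * e))" using haar_commute[of e "x * e"] by (simp add: mult.assoc)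
  then have "haar (x * e) = a * haar e" using a e(3) functional_scale[OF functional_haar] by simp
  then show ?thesis using a haar_e by simp
qed

text \<open>The sum of \<open>chi H \<otimes> S (chi H)\<close> is a Casimir element:
  \<open>class_functions_dual\<close> carries a class function across the tensor sign, and
  \<open>e_sandwich\<close> evaluates the rest. The outcome is that it multiplies
  \<open>e \<otimes> e\<close> by \<open>1 / haar e\<close>, read off at the pair \<open>F\<close>,
  \<open>G\<close>.\<close>

lemma eigenvalue_identity:
  assumes F: "F \<in> J"
  shows "(\<Sum>H\<in>J. cf F (chi H * e) * cf G (S (chi H) * e)) = cf F e * cf G e / haar e"
proof -
  note SF = class_functions_antipode[OF chi_class_functions[OF F]]
  have "(\<Sum>H\<in>J. cf F (chi H * e) * cf G (S (chi H) * e)) =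
      (\<Sum>H\<in>J. cf G (s (haar (e * S (chi F) * chi H)) (S (chi H)) * e))"
  proof (intro sum.cong refl)
    fix H
    have "cf F (chi H * e) = haar (e * S (chi F) * chi H)"
      by (simp add: cf_def mult.assoc haar_commute[of "chi H"])
    then show "cf F (chi H * e) * cf G (S (chi H) * e) =
        cf G (s (haar (e * S (chi F) * chi H)) (S (chi H)) * e)"
      by (simp add: scale_mult_left functional_scale[OF functional_cf])
  qed
  also have "\<dots> = cf G ((\<Sum>H\<in>J. s (haar (e * S (chi F) * chi H)) (S (chi H))) * e)"
    by (simp add: sum_distrib_right functional_sum[OF functional_cf])
  also have "(\<Sum>H\<in>J. s (haar (e * S (chi F) * chi H)) (S (chi H))) = e * S (chi F)"
    by (rule class_functions_dual[symmetric, OF class_functions_mult[OF e(1) SF]])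
  also have "e * S (chi F) * e = s (cf F e / haar e) e"
    using e_sandwich[OF SF] by (simp add: cf_def haar_commute)
  finally show ?thesis by (simp add: functional_scale[OF functional_cf])
qed

text \<open>The rational number \<open>card B / mult_e\<close> equals \<open>1 / haar e\<close>. It
  is an eigenvalue of the integer matrix of the Casimir element from
  \<open>eigenvalue_identity\<close>, hence an integer.\<close>

lemma mult_e_dvd: "mult_e dvd card B"
proof -
  define m :: "'j \<Rightarrow> 'j \<Rightarrow> 'j \<Rightarrow> nat" where "m F D E = (SOME n. cf F (chi D * chi E) = of_nat n)" for F D E
  have m: "cf F (chi D * chi E) = of_nat (m F D E)" if "D \<in> J" "E \<in> J" "F \<in> J" for D E F
  proof -
    have "\<forall>F\<in>Cl. \<exists>n::nat. cf F (chi D * chi E) = of_nat n"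
      using product_corepresentation(1)[OF J_Cl(1)[OF J that(1)] J_Cl(1)[OF J that(2)]]
      unfolding character_def by (rule conjunct2)
    then have "\<exists>n::nat. cf F (chi D * chi E) = of_nat n" using J_Cl(1)[OF J that(3)] by blast
    then show ?thesis unfolding m_def by (rule someI_ex)
  qed
  have cfe: "(\<Sum>E\<in>J. of_nat (m F D E) * cf E e) = cf F (chi D * e)" if D: "D \<in> J" "F \<in> J" for F D
  proof -
    have "cf F (chi D * e) = cf F (chi D * (\<Sum>E\<in>J. s (cf E e) (chi E)))"
      by (rule arg_cong[where f = "\<lambda>z. cf F (chi D * z)", OF class_functions_expand[OF e(1)]])
    also have "\<dots> = (\<Sum>E\<in>J. cf E e * cf F (chi D * chi E))"
      by (simp add: sum_distrib_left scale_mult_right functional_sum[OF functional_cf]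
          functional_scale[OF functional_cf])
    also have "\<dots> = (\<Sum>E\<in>J. of_nat (m F D E) * cf E e)"
      by (intro sum.cong refl) (simp add: m[OF D(1) _ D(2)])
    finally show ?thesis by simp
  qed
  \<comment> \<open>\<open>v\<close> holds the coordinates of \<open>e \<otimes> e\<close>, and
    \<open>M\<close> is the Casimir element in terms of fusion multiplicities; \<open>star H\<close>
    enters because \<open>S (chi H)\<close> is \<open>chi (star H)\<close>.\<close>
  define v where "v x = cf (fst x) e * cf (snd x) e" for x
  define M where "M x y = (\<Sum>H\<in>J. int (m (fst x) H (fst y) * m (snd x) (star H) (snd y)))" for x y
  define r :: rat where "r = of_nat (card B) / of_nat mult_e"
  have r: "(of_rat r :: 'k) = 1 / haar e"
    using mult_e card_B_pos by (simp add: r_def of_rat_divide)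
  have "\<exists>D\<in>J. cf D e \<noteq> 0"
  proof (rule ccontr)
    assume "\<not> ?thesis"
    then have "(\<Sum>D\<in>J. s (cf D e) (chi D)) = 0" by (intro sum.neutral) auto
    then show False using class_functions_expand[OF e(1)] e(2) by simp
  qed
  then obtain D where D: "D \<in> J" "cf D e \<noteq> 0" by blast
  have fin: "finite (J \<times> J)" using J_finite[OF J] by simp
  have "r \<in> \<int>"
  proof (rule integer_matrix_rational_eigenvalue[OF fin, of "(D, D)" v M])
    show "(D, D) \<in> J \<times> J" "v (D, D) \<noteq> 0" using D by (auto simp: v_def)
    fix x assume "x \<in> J \<times> J"
    then obtain F G where x: "x = (F, G)" "F \<in> J" "G \<in> J" by auto
    have "(\<Sum>y\<in>J \<times> J. of_int (M x y) * v y) =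
      (\<Sum>y\<in>J \<times> J. \<Sum>H\<in>J. (of_nat (m F H (fst y)) * cf (fst y) e) * (of_nat (m G (star H) (snd y)) * cf (snd y) e))"
      unfolding M_def v_def x(1)
      by (intro sum.cong refl) (simp add: sum_distrib_left sum_distrib_right mult_ac)
    also have "\<dots> = (\<Sum>H\<in>J. \<Sum>y\<in>J \<times> J. (of_nat (m F H (fst y)) * cf (fst y) e) * (of_nat (m G (star H) (snd y)) * cf (snd y) e))"
      by (rule sum.swap)
    also have "\<dots> = (\<Sum>H\<in>J. (\<Sum>y\<in>J. of_nat (m F H y) * cf y e) * (\<Sum>y\<in>J. of_nat (m G (star H) y) * cf y e))"
      by (simp add: sum_product sum.cartesian_product case_prod_unfold)
    also have "\<dots> = (\<Sum>H\<in>J. cf F (chi H * e) * cf G (S (chi H) * e))"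
    proof (intro sum.cong refl)
      fix H assume H: "H \<in> J"
      show "(\<Sum>y\<in>J. of_nat (m F H y) * cf y e) * (\<Sum>y\<in>J. of_nat (m G (star H) y) * cf y e) =
          cf F (chi H * e) * cf G (S (chi H) * e)"
        unfolding cfe[OF H x(2)] cfe[OF closedD(3)[OF J H] x(3)] star(2)[OF J_Cl(1)[OF J H]] ..
    qed
    also have "\<dots> = cf F e * cf G e / haar e" by (rule eigenvalue_identity[OF x(2)])
    finally show "(\<Sum>y\<in>J \<times> J. of_int (M x y) * v y) = of_rat r * v x"
      by (simp add: r v_def x(1))
  qed
  then obtain z where "r = of_int z" by (rule Ints_cases)
  then have "of_nat (card B) = (of_int (z * int mult_e) :: rat)"
    using mult_e(2) by (simp add: r_def field_simps)
  then have "int (card B) = z * int mult_e" by (metis of_int_eq_iff of_int_of_nat_eq)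
  then have "int mult_e dvd int (card B)" by simp
  then show ?thesis by simp
qed

text \<open>Cyclicity of \<open>haar\<close> brings \<open>S (c j i)\<close> next to
  \<open>c i j\<close>, where the sum over \<open>i\<close> is the antipode axiom.\<close>

lemma trace_right_e:
  "(\<Sum>D\<in>J. \<Sum>i\<in>cs D. \<Sum>j\<in>cs D. f i j (c i j * e)) = of_nat (size_J J) * haar e"
proof -
  have *: "(\<Sum>i\<in>cs D. \<Sum>j\<in>cs D. f i j (c i j * e)) = of_nat (deg D * deg D) * haar e" if D: "D \<in> J" for D
  proof -
    have d0: "(of_nat (deg D) :: 'k) \<noteq> 0" using deg_pos[OF J_Cl(1)[OF J D]] by simp
    have "(\<Sum>i\<in>cs D. \<Sum>j\<in>cs D. f i j (c i j * e)) =
        (\<Sum>i\<in>cs D. \<Sum>j\<in>cs D. of_nat (deg D) * haar (e * (S (c j i) * c i j)))"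
    proof (intro sum.cong refl)
      fix i j assume ij: "i \<in> cs D" "j \<in> cs D"
      have "haar (c i j * e * S (c j i)) = f i j (c i j * e) / of_nat (deg D)"
        by (rule f_haar[OF J span_c_mult[OF J c_span_c[OF D ij] class_functions_span_c[OF e(1)]] D ij])
      moreover have "haar (c i j * e * S (c j i)) = haar (e * (S (c j i) * c i j))"
        using haar_commute[of "c i j" "e * S (c j i)"] by (simp add: mult.assoc)
      ultimately show "f i j (c i j * e) = of_nat (deg D) * haar (e * (S (c j i) * c i j))"
        using d0 by (simp add: field_simps)
    qed
    also have "\<dots> = (\<Sum>j\<in>cs D. of_nat (deg D) * (\<Sum>i\<in>cs D. haar (e * (S (c j i) * c i j))))"
      by (subst sum.swap) (simp add: sum_distrib_left)
    also have "\<dots> = (\<Sum>j\<in>cs D. of_nat (deg D) * haar e)"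
    proof (intro sum.cong refl)
      fix j assume j: "j \<in> cs D"
      note fi = fn_intros functional_comp[OF functional_haar]
      have fe: "functional (\<lambda>a. haar (e * a))" by (intro fi)
      have "(\<Sum>i\<in>cs D. haar (e * (S (c j i) * c i j))) = sw (c j j) (\<lambda>a b. haar (e * (S a * b)))"
        by (rule sw_c[OF _ j j, symmetric]) (intro bifunctionalI fi)
      also have "\<dots> = \<epsilon> (c j j) * haar (e * 1)" by (rule sw_antipode_left[OF fe])
      finally have "(\<Sum>i\<in>cs D. haar (e * (S (c j i) * c i j))) = haar e"
        using j by (simp add: counit_c cs_def)
      then show "of_nat (deg D) * (\<Sum>i\<in>cs D. haar (e * (S (c j i) * c i j))) = of_nat (deg D) * haar e"
        by simp
    qed
    also have "\<dots> = of_nat (deg D * deg D) * haar e" by (simp add: deg_def)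
    finally show ?thesis .
  qed
  have "(\<Sum>D\<in>J. \<Sum>i\<in>cs D. \<Sum>j\<in>cs D. f i j (c i j * e)) = (\<Sum>D\<in>J. of_nat (deg D * deg D) * haar e)"
    by (intro sum.cong refl *)
  also have "\<dots> = of_nat (\<Sum>D\<in>J. deg D * deg D) * haar e"
    by (simp add: sum_distrib_right)
  finally show ?thesis by (simp add: size_J_def[OF J])
qed

lemma right_ideal_e: "of_nat (dim ((\<lambda>x. x * e) ` span_c J)) = of_nat (size_J J) * haar e"
proof -
  let ?X = "SIGMA D:J. cs D \<times> cs D"
  let ?\<phi> = "\<lambda>(D, i, j). f i j" and ?a = "\<lambda>(D, i, j). c i j"
  note ds = span_c_dual_system(1)[OF J_Cl(2)[OF J]]
  have op: "operator (\<lambda>x. x * e)" by (intro fn_intros)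
  have "dtrace ?X ?\<phi> ?a (\<lambda>x. x * e) = of_nat (dim ((\<lambda>x. x * e) ` span_c J))"
  proof (rule dtrace_idempotent[OF subspace_span_c ds op])
    show "(\<lambda>x. x * e) ` span_c J \<subseteq> span_c J"
      using span_c_mult[OF J _ class_functions_span_c[OF e(1)]] by auto
  qed (simp add: mult.assoc e(3))
  also have "dtrace ?X ?\<phi> ?a (\<lambda>x. x * e) = (\<Sum>D\<in>J. \<Sum>i\<in>cs D. \<Sum>j\<in>cs D. f i j (c i j * e))"
    unfolding span_c_dual_system(2)[OF J_Cl(2)[OF J], symmetric] dtrace_def by (simp add: case_prod_unfold)
  finally show ?thesis by (simp add: trace_right_e)
qed

text \<open>The left ideal of \<open>span_c J\<close> generated by \<open>e\<close> has dimension
  \<open>size_J J * haar e\<close>, that is \<open>size_J J * mult_e / card B\<close>, and the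
  assumption bounds this by \<open>1\<close>.\<close>

lemma one_dimensional_e:
  assumes le: "size_J J * mult_e \<le> card B"
  shows "of_nat (size_J J) * haar e = 1"
    and "x \<in> span_c J \<Longrightarrow> x * e = s (haar (x * e) / haar e) e"
proof -
  let ?W = "(\<lambda>x. x * e) ` span_c J"
  have op: "operator (\<lambda>x. x * e)" by (intro fn_intros)
  have sub: "subspace ?W" by (rule subspace_image_operator[OF op subspace_span_c])
  have eW: "e \<in> ?W" using class_functions_span_c[OF e(1)] e(3) by (intro image_eqI[of _ _ e]) auto
  have pos: "dim ?W > 0" by (rule dim_pos[OF sub eW e(2)])
  have "of_nat (card B * dim ?W) = (of_nat (size_J J * mult_e) :: 'k)"
    by (simp add: right_ideal_e mult_e(1))
  then have "card B * dim ?W = size_J J * mult_e" by (simp only: of_nat_eq_iff)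
  then have "card B * dim ?W \<le> card B * 1" using le by simp
  then have d1: "dim ?W = 1" using pos card_B_pos by simp
  then show "of_nat (size_J J) * haar e = 1" using right_ideal_e by simp
  show "x * e = s (haar (x * e) / haar e) e" if x: "x \<in> span_c J"
  proof -
    obtain b where b: "?W = span {b}"
    proof -
      obtain C where C: "independent C" "finite C" "span C = ?W" "card C = dim ?W"
        using subspace_basis[OF sub _ B_finite] B_span by (metis top_greatest)
      then obtain b where "C = {b}" using d1 card_1_singletonE by metis
      then show ?thesis using C(3) that by blast
    qed
    have "e \<in> span {b}" "x * e \<in> span {b}" using eW x b by auto
    then obtain u v where u: "e = s u b" and v: "x * e = s v b" by (auto simp: span_singleton)
    have "u \<noteq> 0" using u e(2) by auto
    then have xe: "x * e = s (v / u) e" using u v by simp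
    then have "haar (x * e) = v / u * haar e" using functional_scale[OF functional_haar] by simp
    then show ?thesis using xe haar_e by simp
  qed
qed

end

end

end

text \<open>The term at \<open>l\<close> is \<open>p ^ b\<close> with \<open>k = a + b\<close>. If
  all other terms were larger, they would be divisible by \<open>p ^ (b + 1)\<close>, as is the sum
  because \<open>a \<ge> 1\<close>; then so would \<open>p ^ b\<close> itself.\<close>

lemma prime_power_summand:
  fixes m :: "'x \<Rightarrow> nat"
  assumes p: "prime p" and E: "finite E" "l \<in> E" and dvd: "\<And>e. e \<in> E \<Longrightarrow> m e dvd p ^ k"
    and sum: "(\<Sum>e\<in>E. m e) = p ^ k" and l: "p ^ a * m l = p ^ k" and a: "a \<ge> 1"
  shows "\<exists>e\<in>E. e \<noteq> l \<and> p ^ a * m e \<le> p ^ k"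
proof (rule ccontr)
  assume neg: "\<not> ?thesis"
  have p0: "p > 0" "p > 1" using p prime_gt_0_nat prime_gt_1_nat by auto
  obtain b where b: "m l = p ^ b" using dvd[OF E(2)] p by (auto simp: divides_primepow_nat)
  have "p ^ (a + b) = p ^ k" using l b by (simp add: power_add)
  then have k: "k = a + b" using p0(2) by (metis power_inject_exp)
  have "p ^ Suc b dvd m e" if e: "e \<in> E - {l}" for e
  proof -
    obtain j where j: "m e = p ^ j" using dvd[of e] e p by (auto simp: divides_primepow_nat)
    have "p ^ a * p ^ j > p ^ k" using neg e j by auto
    then have "p ^ (a + b) < p ^ (a + j)" by (simp add: k power_add)
    then have "b < j" using p0(2) by (simp add: power_strict_increasing_iff)
    then show ?thesis unfolding j by (intro le_imp_power_dvd) simp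
  qed
  then have 1: "p ^ Suc b dvd (\<Sum>e\<in>E - {l}. m e)" by (rule dvd_sum)
  have 2: "p ^ Suc b dvd p ^ k" using a k by (intro le_imp_power_dvd) simp
  have "p ^ k = m l + (\<Sum>e\<in>E - {l}. m e)" using sum sum.remove[OF E, of m] by simp
  then have "p ^ Suc b dvd p ^ b" using 1 2 b by (metis dvd_add_left_iff)
  then have "p ^ Suc b \<le> p ^ b" using p0 by (intro dvd_imp_le) auto
  then show False using p0 by simp
qed

context matrix_basis
begin

section \<open>Gradings of the fusion ring\<close>

text \<open>A grading of the fusion ring of \<open>J\<close> by the multiplicative group of the
  field.\<close>

definition fusion :: "'j set \<Rightarrow> ('j \<Rightarrow> 'k) \<Rightarrow> bool" where
  "fusion J \<omega> \<longleftrightarrow> \<omega> one_class = 1 \<and>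
     (\<forall>D\<in>J. \<forall>E\<in>J. \<forall>F\<in>J. cf F (chi D * chi E) \<noteq> 0 \<longrightarrow> \<omega> F = \<omega> D * \<omega> E)"

lemma fusionD:
  assumes "fusion J \<omega>"
  shows "\<omega> one_class = 1"
    and "D \<in> J \<Longrightarrow> E \<in> J \<Longrightarrow> F \<in> J \<Longrightarrow> cf F (chi D * chi E) \<noteq> 0 \<Longrightarrow> \<omega> F = \<omega> D * \<omega> E"
proof -
  note * = assms[unfolded fusion_def]
  show "\<omega> one_class = 1" using * by (rule conjunct1)
  show "\<omega> F = \<omega> D * \<omega> E" if "D \<in> J" "E \<in> J" "F \<in> J" "cf F (chi D * chi E) \<noteq> 0"
    using bspec[OF bspec[OF bspec[OF conjunct2[OF *] that(1)] that(2)] that(3)] that(4) by (rule mp)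
qed

context
  fixes J
  assumes J: "closed J"
begin

lemma f_class_function:
  assumes x: "x \<in> class_functions J" and ij: "i \<in> cs D" "j \<in> cs D" and D: "D \<in> J"
  shows "f i j x = (if i = j then cf D x else 0)"
proof -
  have I: "i \<in> I" "j \<in> I" using ij by (auto simp: cs_def)
  have "f i j x = f i j (\<Sum>E\<in>J. s (cf E x) (chi E))"
    by (rule arg_cong[OF class_functions_expand[OF J x]])
  also have "\<dots> = (\<Sum>E\<in>J. if E = D then (if i = j then cf D x else 0) else 0)"
    unfolding functional_sum[OF f_functional[OF I]] functional_scale[OF f_functional[OF I]] f_chi[OF ij]
    by (intro sum.cong) auto
  also have "\<dots> = (if i = j then cf D x else 0)" using D J_finite[OF J] by simp
  finally show ?thesis .
qed

lemma Lam_J_class_functions: "Lam_J J \<in> class_functions J"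
  unfolding Lam_J_def[OF J]
  by (intro subspace_scale[OF subspace_class_functions[OF J]] subspace_sum[OF subspace_class_functions[OF J]]
      chi_class_functions[OF J])

text \<open>Among the primitive idempotents of the character ring only \<open>Lam_J J\<close> is
  seen by the counit, and its ideal has dimension \<open>p ^ (k - a)\<close>. The remaining ones
  include, by \<open>prime_power_summand\<close>, one that meets the bound of
  \<open>one_dimensional_e\<close>.\<close>

lemma one_dimensional_idempotent:
  assumes p: "prime p" "card B = p ^ k" "size_J J = p ^ a" "a \<ge> 1"
  obtains e where "e \<in> class_functions J" "e \<noteq> 0" "Lam_J J * e = 0" "of_nat (size_J J) * haar e = 1"
    "\<And>x. x \<in> span_c J \<Longrightarrow> x * e = s (haar (x * e) / haar e) e"
proof -
  obtain E where E: "finite E" "E \<subseteq> class_functions J" "(\<Sum>e\<in>E. e) = 1"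
    and nz: "\<And>e. e \<in> E \<Longrightarrow> e \<noteq> 0" and idem: "\<And>e. e \<in> E \<Longrightarrow> e * e = e"
    and prim: "\<And>e x. e \<in> E \<Longrightarrow> x \<in> class_functions J \<Longrightarrow> \<exists>a. e * x * e = s a e"
    by (rule class_functions_decomposition[OF J]) (rule that)
  let ?l = "Lam_J J"
  have mem: "e \<in> class_functions J" if "e \<in> E" for e using that E(2) by (rule rev_subsetD)
  have l0: "?l \<noteq> 0"
  proof
    assume "?l = 0"
    then have "\<epsilon> ?l = 0" using functional_0[OF functional_counit] by simp
    then show False using counit_Lam_J[OF J] by simp
  qed
  have eps: "e = ?l" if e: "e \<in> E" "\<epsilon> e \<noteq> 0" for e
  proof -
    note sp = class_functions_span_c[OF J mem[OF e(1)]]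
    obtain b where b: "e * ?l * e = s b e" using prim[OF e(1) Lam_J_class_functions] by blast
    have "e * ?l * e = s (\<epsilon> e * \<epsilon> e) ?l"
      unfolding Lam_J_integral(1)[OF J sp] scale_mult_left Lam_J_integral(2)[OF J sp] scale_scale ..
    then have eq: "s (\<epsilon> e * \<epsilon> e) ?l = s b e" using b by simp
    then have "\<epsilon> (s (\<epsilon> e * \<epsilon> e) ?l) = \<epsilon> (s b e)" by simp
    then have "b = \<epsilon> e" using e(2) by (simp add: counit_scale counit_Lam_J[OF J])
    moreover have "\<epsilon> e * \<epsilon> e = \<epsilon> e" using idem[OF e(1)] counit_mult[of e e] by simp
    then have "\<epsilon> e = 1" using e(2) by simp
    ultimately show ?thesis using eq by simp
  qed
  have lE: "?l \<in> E"
  proof -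
    have "\<exists>e\<in>E. \<epsilon> e \<noteq> 0"
    proof (rule ccontr)
      assume "\<not> ?thesis"
      then have "(\<Sum>e\<in>E. \<epsilon> e) = 0" by (intro sum.neutral) blast
      moreover have "(\<Sum>e\<in>E. \<epsilon> e) = 1"
        using functional_sum[OF functional_counit, of "\<lambda>e. e" E] E(3) by (simp add: counit_one)
      ultimately show False by simp
    qed
    then obtain e where "e \<in> E" "\<epsilon> e \<noteq> 0" by blast
    then show ?thesis using eps[of e] by simp
  qed
  note me = mult_e[OF J mem nz idem prim] and dvd = mult_e_dvd[OF J mem nz idem prim]
  have sum: "(\<Sum>e\<in>E. mult_e e) = p ^ k"
  proof -
    have "(of_nat (\<Sum>e\<in>E. mult_e e) :: 'k) = (\<Sum>e\<in>E. of_nat (card B) * haar e)"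
      unfolding of_nat_sum by (intro sum.cong refl me(1))
    also have "\<dots> = of_nat (card B) * haar (\<Sum>e\<in>E. e)"
      by (simp add: functional_sum[OF functional_haar] sum_distrib_left)
    also have "\<dots> = of_nat (p ^ k)" unfolding E(3) haar_1 p(2) by simp
    finally show ?thesis by (simp only: of_nat_eq_iff)
  qed
  have l: "p ^ a * mult_e ?l = p ^ k"
  proof -
    have "haar ?l = 1 / of_nat (size_J J)"
      using haar_Lam_J[OF J one_span_c[OF J]] by (simp add: counit_one)
    then have "of_nat (size_J J * mult_e ?l) = (of_nat (card B) :: 'k)"
      using me(1)[OF lE lE lE lE] size_J_pos[OF J] by simp
    then show ?thesis by (simp only: of_nat_eq_iff p)
  qed
  have "\<exists>e\<in>E. e \<noteq> ?l \<and> p ^ a * mult_e e \<le> p ^ k"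
    using dvd p(2) by (intro prime_power_summand[OF p(1) E(1) lE _ sum l p(4)]) metis
  then obtain e where e: "e \<in> E" "e \<noteq> ?l" "size_J J * mult_e e \<le> card B" using p by auto
  have "?l * e = s (\<epsilon> e) ?l" by (rule Lam_J_integral(2)[OF J class_functions_span_c[OF J mem[OF e(1)]]])
  also have "\<epsilon> e = 0" using eps[OF e(1)] e(2) by blast
  finally have le: "?l * e = 0" by simp
  note od = one_dimensional_e[OF J mem[OF e(1)] nz[OF e(1)] idem[OF e(1)] prim[OF e(1)] e(3)]
  show ?thesis by (rule that[OF mem[OF e(1)] nz[OF e(1)] le od])
qed

text \<open>On \<open>span_c J\<close> the equation \<open>x * e = s (h x) e\<close> defines an
  algebra map \<open>h\<close>. As \<open>e\<close> is a class function, \<open>h\<close> is a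
  scalar matrix on every class; these scalars \<open>\<omega>\<close> are not all \<open>1\<close>
  because \<open>Lam_J J * e = 0\<close>.\<close>

lemma fusion_character:
  assumes p: "prime p" "card B = p ^ k" "size_J J = p ^ a" "a \<ge> 1"
  obtains \<omega> D where "fusion J \<omega>" "D \<in> J" "\<omega> D \<noteq> 1"
proof -
  obtain e where e: "e \<in> class_functions J" "e \<noteq> 0" "Lam_J J * e = 0" "of_nat (size_J J) * haar e = 1"
    and xe: "\<And>x. x \<in> span_c J \<Longrightarrow> x * e = s (haar (x * e) / haar e) e"
    by (rule one_dimensional_idempotent[OF p]) (rule that)
  define N :: 'k where "N = of_nat (size_J J)"
  define h where "h x = N * haar (x * e)" for x
  define \<omega> where "\<omega> D = N * cf D (S e) / of_nat (deg D)" for D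
  have fh: "functional h" unfolding h_def by (intro fn_intros functional_comp[OF functional_haar])
  have N: "N * haar e = 1" using e(4) by (simp add: N_def)
  have xh: "x * e = s (h x) e" if "x \<in> span_c J" for x
  proof -
    have "N \<noteq> 0" using N by auto
    then have "haar e = 1 / N" using N by (simp add: field_simps)
    then have "haar (x * e) / haar e = h x" by (simp add: h_def)
    then show ?thesis using xe[OF that] by simp
  qed
  have h_mult: "h (x * y) = h x * h y" if xy: "x \<in> span_c J" "y \<in> span_c J" for x y
  proof -
    have "s (h (x * y)) e = x * (y * e)" using xh[OF span_c_mult[OF J xy]] by (simp add: mult.assoc)
    also have "\<dots> = s (h y) (x * e)" unfolding xh[OF xy(2)] scale_mult_right ..
    also have "\<dots> = s (h x * h y) e" unfolding xh[OF xy(1)] by (simp add: mult.commute)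
    finally show ?thesis using e(2) by simp
  qed
  have h_c: "h (c i j) = (if i = j then \<omega> D else 0)" if D: "D \<in> J" "i \<in> cs D" "j \<in> cs D" for D i j
  proof -
    note Se = class_functions_antipode[OF J e(1)]
    have "haar (c i j * e) = haar (S e * S (c i j))" using haar_antipode[of "c i j * e"] by (simp add: antipode_mult)
    also have "\<dots> = f j i (S e) / of_nat (deg D)"
      by (rule f_haar[OF J class_functions_span_c[OF J Se] D(1,3,2)])
    also have "f j i (S e) = (if j = i then cf D (S e) else 0)" by (rule f_class_function[OF Se D(3,2,1)])
    finally show ?thesis by (simp add: h_def \<omega>_def)
  qed
  have h_chi: "h (chi D) = of_nat (deg D) * \<omega> D" if D: "D \<in> J" for D
  proof -
    have "h (chi D) = (\<Sum>i\<in>cs D. \<omega> D)"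
      unfolding chi_def functional_sum[OF fh] by (intro sum.cong refl) (simp add: h_c[OF D])
    then show ?thesis by (simp add: deg_def)
  qed
  have one: "\<omega> one_class = 1"
    using h_chi[OF closedD(2)[OF J]] N by (simp add: one_class h_def)
  \<comment> \<open>\<open>G F\<close> is \<open>h\<close> convolved with \<open>cf F\<close>. It
    acts on coefficients of \<open>D\<close> through \<open>\<omega> D\<close> and on products
    through \<open>\<omega> D * \<omega> E\<close>; evaluating both ways at
    \<open>chi D * chi E\<close> yields multiplicativity along constituents.\<close>
  define G where "G F x = sw x (\<lambda>u v. h u * cf F v)" for F x
  note fi = fn_intros functional_comp[OF fh] functional_comp[OF functional_cf]
  have fG: "functional (G F)" for F unfolding G_def by (rule functional_sw)
  have bif: "bifunctional (\<lambda>u v. h u * cf F v)" for F by (intro bifunctionalI fi)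
  have G_c: "G F (c i j) = \<omega> D * cf F (c i j)" if D: "D \<in> J" "i \<in> cs D" "j \<in> cs D" for D i j F
  proof -
    have "G F (c i j) = (\<Sum>l\<in>cs D. h (c i l) * cf F (c l j))"
      unfolding G_def by (rule sw_c[OF bif D(2,3)])
    also have "\<dots> = (\<Sum>l\<in>cs D. if l = i then \<omega> D * cf F (c i j) else 0)"
      by (intro sum.cong refl) (simp add: h_c[OF D(1,2)])
    also have "\<dots> = \<omega> D * cf F (c i j)" using D(2) cs_finite by simp
    finally show ?thesis .
  qed
  have G_chi: "G F (chi D) = \<omega> D * cf F (chi D)" if D: "D \<in> J" for D F
    unfolding chi_def functional_sum[OF fG] functional_sum[OF functional_cf] sum_distrib_left
    by (intro sum.cong refl G_c[OF D])
  have G_cc: "G F (c i j * c k l) = \<omega> D * \<omega> E * cf F (c i j * c k l)"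
    if D: "D \<in> J" "i \<in> cs D" "j \<in> cs D" and E: "E \<in> J" "k \<in> cs E" "l \<in> cs E" for D E i j k l F
  proof -
    have "G F (c i j * c k l) = sw (c i j) (\<lambda>a b. sw (c k l) (\<lambda>u v. h (a * u) * cf F (b * v)))"
      unfolding G_def by (rule sw_mult[OF bif])
    also have "\<dots> = (\<Sum>m\<in>cs D. sw (c k l) (\<lambda>u v. h (c i m * u) * cf F (c m j * v)))"
      by (rule sw_c[OF _ D(2,3)]) (intro bifunctionalI fi)
    also have "\<dots> = (\<Sum>m\<in>cs D. \<Sum>n\<in>cs E. h (c i m * c k n) * cf F (c m j * c n l))"
      by (intro sum.cong refl sw_c[OF _ E(2,3)] bifunctionalI fi)
    also have "\<dots> = (\<Sum>m\<in>cs D. \<Sum>n\<in>cs E. if n = k then if m = i then \<omega> D * \<omega> E * cf F (c i j * c k l) else 0 else 0)"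
    proof (intro sum.cong refl)
      fix m n assume mn: "m \<in> cs D" "n \<in> cs E"
      show "h (c i m * c k n) * cf F (c m j * c n l) =
        (if n = k then if m = i then \<omega> D * \<omega> E * cf F (c i j * c k l) else 0 else 0)"
        using h_mult[OF c_span_c[OF D(1,2) mn(1)] c_span_c[OF E(1,2) mn(2)]]
        by (simp add: h_c[OF D(1,2) mn(1)] h_c[OF E(1,2) mn(2)])
    qed
    also have "\<dots> = \<omega> D * \<omega> E * cf F (c i j * c k l)" using D(2) E(2) cs_finite by simp
    finally show ?thesis .
  qed
  have G_chi_chi: "G F (chi D * chi E) = \<omega> D * \<omega> E * cf F (chi D * chi E)" if D: "D \<in> J" "E \<in> J" for D E F
  proof -
    have *: "chi D * chi E = (\<Sum>i\<in>cs D. \<Sum>k\<in>cs E. c i i * c k k)" by (simp add: chi_def sum_product)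
    show ?thesis
      unfolding * functional_sum[OF fG] functional_sum[OF functional_cf] sum_distrib_left
      by (intro sum.cong refl G_cc[OF D(1) _ _ D(2)])
  qed
  have fus: "fusion J \<omega>"
    unfolding fusion_def
  proof (intro conjI one ballI impI)
    fix D E F assume DEF: "D \<in> J" "E \<in> J" "F \<in> J" and nz: "cf F (chi D * chi E) \<noteq> 0"
    let ?x = "chi D * chi E"
    have "G F ?x = G F (\<Sum>H\<in>J. s (cf H ?x) (chi H))"
      by (rule arg_cong[OF class_functions_expand[OF J chi_mult_chi[OF J DEF(1,2)]]])
    also have "\<dots> = (\<Sum>H\<in>J. cf H ?x * (\<omega> H * cf F (chi H)))"
      unfolding functional_sum[OF fG] functional_scale[OF fG] by (intro sum.cong refl) (simp add: G_chi)
    also have "\<dots> = (\<Sum>H\<in>J. if H = F then cf F ?x * \<omega> F else 0)"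
      by (intro sum.cong refl) (simp add: cf_chi[OF J_Cl(1)[OF J]])
    also have "\<dots> = cf F ?x * \<omega> F" using DEF(3) J_finite[OF J] by simp
    finally have "cf F ?x * \<omega> F = \<omega> D * \<omega> E * cf F ?x" using G_chi_chi[OF DEF(1,2), of F] by (simp only:)
    then show "\<omega> F = \<omega> D * \<omega> E" using nz by simp
  qed
  have "\<exists>D\<in>J. \<omega> D \<noteq> 1"
  proof (rule ccontr)
    assume "\<not> ?thesis"
    then have w1: "\<omega> D = 1" if "D \<in> J" for D using that by blast
    have "h (Lam_J J) = 1 / N * (\<Sum>D\<in>J. of_nat (deg D) * h (chi D))"
      unfolding Lam_J_def[OF J] functional_scale[OF fh] functional_sum[OF fh] N_def ..
    also have "(\<Sum>D\<in>J. of_nat (deg D) * h (chi D)) = (\<Sum>D\<in>J. of_nat (deg D * deg D))"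
      by (intro sum.cong refl) (simp add: h_chi w1)
    also have "\<dots> = N" by (simp add: N_def size_J_def[OF J])
    finally have "h (Lam_J J) = 1" using N by (cases "N = 0") auto
    moreover have "h (Lam_J J) = 0" using e(3) functional_0[OF functional_haar] by (simp add: h_def)
    ultimately show False by simp
  qed
  then obtain D where "D \<in> J" "\<omega> D \<noteq> 1" by blast
  then show ?thesis by (rule that[OF fus])
qed

end

end

section \<open>Components of a grading and their degrees\<close>

lemma card_roots_of_unity:
  assumes "d > 0"
  shows "finite {x :: 'k::idom. x ^ d = 1}" "card {x :: 'k. x ^ d = 1} \<le> d"
proof -
  let ?q = "monom 1 d - 1 :: 'k poly"
  have "coeff ?q d = 1" using assms by (simp add: coeff_1)
  then have q: "?q \<noteq> 0" by (metis coeff_0 zero_neq_one)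
  have "{x. poly ?q x = 0} = {x. x ^ d = 1}" by (auto simp: poly_monom)
  moreover have "degree ?q \<le> d" by (rule degree_diff_le) (auto simp: degree_monom_le)
  ultimately show "finite {x :: 'k. x ^ d = 1}" "card {x :: 'k. x ^ d = 1} \<le> d"
    using poly_roots_finite[OF q] card_poly_roots_bound[OF q] by auto
qed

text \<open>Multiplication by \<open>w\<close> permutes \<open>W\<close>, so the product of all
  members acquires the factor \<open>w ^ card W\<close>.\<close>

lemma finite_group_power_card:
  fixes W :: "'k::field set"
  assumes W: "finite W" "0 \<notin> W" "\<And>v w. v \<in> W \<Longrightarrow> w \<in> W \<Longrightarrow> v * w \<in> W" and w: "w \<in> W"
  shows "w ^ card W = 1"
proof -
  have w0: "w \<noteq> 0" using w W(2) by auto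
  then have inj: "inj_on ((*) w) W" by (auto simp: inj_on_def)
  have "(*) w ` W = W"
    by (rule card_subset_eq) (use W w inj in \<open>auto simp: card_image\<close>)
  then have "prod id W = (\<Prod>x\<in>W. w * x)" using prod.reindex[OF inj, of id] by (simp add: comp_def)
  also have "\<dots> = w ^ card W * prod id W" by (simp add: prod.distrib)
  finally have "(w ^ card W - 1) * prod id W = 0" by (simp add: algebra_simps)
  moreover have "prod id W \<noteq> 0" using W(1,2) by auto
  ultimately show ?thesis by simp
qed

context matrix_basis
begin

lemma deg_one:
  assumes "deg F = 1"
  shows "\<And>G. bifunctional G \<Longrightarrow> sw (chi F) G = G (chi F) (chi F)" "\<epsilon> (chi F) = 1"
    "chi F * S (chi F) = 1" "S (chi F) * chi F = 1"
proof -
  obtain i where i: "cs F = {i}" using assms card_1_singletonE unfolding deg_def by metis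
  then have chi: "chi F = c i i" by (simp add: chi_def)
  show sw: "sw (chi F) G = G (chi F) (chi F)" if "bifunctional G" for G
    using sw_c[OF that, of i F i] i chi by simp
  show eps: "\<epsilon> (chi F) = 1" using assms by (simp add: counit_chi)
  show "chi F * S (chi F) = 1"
  proof (rule functional_separate)
    fix g assume g: "functional g"
    note fi = fn_intros functional_comp[OF g]
    have "g (chi F * S (chi F)) = sw (chi F) (\<lambda>a b. g (a * S b))"
      by (rule sw[symmetric]) (intro bifunctionalI fi)
    then show "g (chi F * S (chi F)) = g 1" using sw_antipode_right[OF g, of "chi F"] eps by simp
  qed
  show "S (chi F) * chi F = 1"
  proof (rule functional_separate)
    fix g assume g: "functional g"
    note fi = fn_intros functional_comp[OF g]
    have "g (S (chi F) * chi F) = sw (chi F) (\<lambda>a b. g (S a * b))"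
      by (rule sw[symmetric]) (intro bifunctionalI fi)
    then show "g (S (chi F) * chi F) = g 1" using sw_antipode_left[OF g, of "chi F"] eps by simp
  qed
qed

text \<open>Multiplication by a group-like element preserves the norm of a character, so
  \<open>character_irreducible\<close> applies to the product.\<close>

lemma deg_one_mult:
  assumes F: "F \<in> Cl" "deg F = 1" and D: "D \<in> Cl"
  obtains E where "E \<in> Cl" "chi F * chi D = chi E" "deg E = deg D"
proof -
  have "S (chi F) * (chi F * x) = x" for x using deg_one(4)[OF F(2)] by (simp add: mult.assoc[symmetric])
  then have "haar (chi F * chi D * S (chi F * chi D)) = haar (chi D * S (chi D))"
    using haar_commute[of "chi F" "chi D * (S (chi D) * S (chi F))"]
    by (simp add: antipode_mult mult.assoc deg_one(4)[OF F(2)])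
  then have "\<exists>E\<in>Cl. chi F * chi D = chi E"
    using D by (intro character_irreducible product_corepresentation F D) (simp add: haar_chi)
  then obtain E where E: "E \<in> Cl" "chi F * chi D = chi E" by blast
  have "of_nat (deg E) = (of_nat (deg D) :: 'k)"
    using arg_cong[OF E(2), of \<epsilon>] by (simp add: counit_mult counit_chi F(2))
  then have "deg E = deg D" by (simp only: of_nat_eq_iff)
  then show ?thesis by (rule that[OF E])
qed

context
  fixes J
  assumes J: "closed J"
begin

lemma product_constituent:
  assumes "D \<in> J" "E \<in> J"
  obtains F where "F \<in> J" "cf F (chi D * chi E) \<noteq> 0"
proof -
  have "\<exists>F\<in>J. cf F (chi D * chi E) \<noteq> 0"
  proof (rule ccontr)
    assume "\<not> ?thesis"
    then have "(\<Sum>F\<in>J. s (cf F (chi D * chi E)) (chi F)) = 0" by (intro sum.neutral) auto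
    then have "chi D * chi E = 0" using class_functions_expand[OF J chi_mult_chi[OF J assms]] by simp
    then have "\<epsilon> (chi D * chi E) = 0" using functional_0[OF functional_counit] by simp
    then show False
      using deg_pos[OF J_Cl(1)[OF J assms(1)]] deg_pos[OF J_Cl(1)[OF J assms(2)]]
      by (simp add: counit_mult counit_chi)
  qed
  then show ?thesis using that by blast
qed

lemma cf_Lam_J: "F \<in> J \<Longrightarrow> cf F (Lam_J J) = of_nat (deg F) / of_nat (size_J J)"
proof -
  assume F: "F \<in> J"
  have "cf F (Lam_J J) = 1 / of_nat (size_J J) * (\<Sum>D\<in>J. of_nat (deg D) * cf F (chi D))"
    unfolding Lam_J_def[OF J] by (simp add: functional_scale[OF functional_cf] functional_sum[OF functional_cf])
  also have "(\<Sum>D\<in>J. of_nat (deg D) * cf F (chi D)) = (\<Sum>D\<in>J. if D = F then of_nat (deg F) else 0)"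
    by (intro sum.cong refl) (simp add: cf_chi[OF J_Cl(1)[OF J]])
  finally show ?thesis using F J_finite[OF J] by simp
qed

text \<open>Obtained by comparing the coefficients of \<open>chi F\<close> in the integral property
  of \<open>Lam_J J\<close> at \<open>chi E\<close>.\<close>

lemma degree_multiplicity:
  assumes "E \<in> J" "F \<in> J"
  shows "(\<Sum>D\<in>J. of_nat (deg D) * cf F (chi D * chi E)) = of_nat (deg E * deg F)"
proof -
  have N: "(of_nat (size_J J) :: 'k) \<noteq> 0" using size_J_pos[OF J] by simp
  have "(\<Sum>D\<in>J. of_nat (deg D) * cf F (chi D * chi E)) =
      of_nat (size_J J) * cf F (Lam_J J * chi E)"
    using N unfolding Lam_J_def[OF J]
    by (simp add: scale_mult_left sum_distrib_right functional_scale[OF functional_cf] functional_sum[OF functional_cf])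
  also have "Lam_J J * chi E = s (of_nat (deg E)) (Lam_J J)"
    using Lam_J_integral(2)[OF J chi_span_c[OF assms(1)]] by (simp add: counit_chi)
  finally show ?thesis using N by (simp add: functional_scale[OF functional_cf] cf_Lam_J[OF assms(2)])
qed

context
  fixes \<omega>
  assumes fusion: "fusion J \<omega>"
begin

lemma fusion_inverse: "D \<in> J \<Longrightarrow> \<omega> D * \<omega> (star D) = 1"
  using fusionD(2)[OF fusion _ closedD(3)[OF J] closedD(2)[OF J], of D D]
    cf_one_chi_star[OF J_Cl(1)[OF J]] fusionD(1)[OF fusion] by simp

text \<open>Translation invariance of the weight given by squared degrees:
  \<open>degree_multiplicity\<close> writes \<open>deg E * deg F\<close> as a sum over
  \<open>D\<close>, and wherever the multiplicity is nonzero the grading replaces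
  \<open>\<omega> F\<close> by \<open>\<omega> D * \<omega> E\<close>.\<close>

lemma fusion_shift:
  assumes E: "E \<in> J"
  shows "(\<Sum>F\<in>J. of_nat (deg F * deg F) * h (\<omega> F)) = (\<Sum>D\<in>J. of_nat (deg D * deg D) * (h (\<omega> D * \<omega> E) :: 'k))"
proof -
  have dE: "(of_nat (deg E) :: 'k) \<noteq> 0" using deg_pos[OF J_Cl(1)[OF J E]] by simp
  have "of_nat (deg E) * (\<Sum>F\<in>J. of_nat (deg F * deg F) * h (\<omega> F)) =
      (\<Sum>F\<in>J. of_nat (deg E * deg F) * (of_nat (deg F) * h (\<omega> F)))"
    by (simp add: sum_distrib_left mult_ac)
  also have "\<dots> = (\<Sum>F\<in>J. \<Sum>D\<in>J. of_nat (deg D) * cf F (chi D * chi E) * (of_nat (deg F) * h (\<omega> F)))"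
    by (intro sum.cong refl) (simp only: degree_multiplicity[OF E, symmetric] sum_distrib_right)
  also have "\<dots> = (\<Sum>D\<in>J. \<Sum>F\<in>J. of_nat (deg D) * cf F (chi D * chi E) * (of_nat (deg F) * h (\<omega> F)))"
    by (rule sum.swap)
  also have "\<dots> = (\<Sum>D\<in>J. \<Sum>F\<in>J. of_nat (deg D) * h (\<omega> D * \<omega> E) * (cf F (chi D * chi E) * of_nat (deg F)))"
  proof (intro sum.cong refl)
    fix D F assume DF: "D \<in> J" "F \<in> J"
    show "of_nat (deg D) * cf F (chi D * chi E) * (of_nat (deg F) * h (\<omega> F)) =
      of_nat (deg D) * h (\<omega> D * \<omega> E) * (cf F (chi D * chi E) * of_nat (deg F))"
      using fusionD(2)[OF fusion DF(1) E DF(2)] by (cases "cf F (chi D * chi E) = 0") simp_all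
  qed
  also have "\<dots> = (\<Sum>D\<in>J. of_nat (deg D) * h (\<omega> D * \<omega> E) * (of_nat (deg D) * of_nat (deg E)))"
  proof (intro sum.cong refl)
    fix D assume D: "D \<in> J"
    have "of_nat (deg D) * of_nat (deg E) = \<epsilon> (chi D * chi E)" by (simp add: counit_mult counit_chi)
    also have "\<dots> = \<epsilon> (\<Sum>F\<in>J. s (cf F (chi D * chi E)) (chi F))"
      by (rule arg_cong[OF class_functions_expand[OF J chi_mult_chi[OF J D E]]])
    also have "\<dots> = (\<Sum>F\<in>J. cf F (chi D * chi E) * of_nat (deg F))"
      by (simp add: functional_sum[OF functional_counit] counit_scale counit_chi)
    finally show "(\<Sum>F\<in>J. of_nat (deg D) * h (\<omega> D * \<omega> E) * (cf F (chi D * chi E) * of_nat (deg F))) =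
       of_nat (deg D) * h (\<omega> D * \<omega> E) * (of_nat (deg D) * of_nat (deg E))"
      by (simp add: sum_distrib_left)
  qed
  also have "\<dots> = of_nat (deg E) * (\<Sum>D\<in>J. of_nat (deg D * deg D) * h (\<omega> D * \<omega> E))"
    by (simp add: sum_distrib_left mult_ac)
  finally show ?thesis using dE by simp
qed

definition kernel :: "'j set" where "kernel = {D \<in> J. \<omega> D = 1}"

lemma closed_kernel: "closed kernel"
  unfolding closed_def
proof (intro conjI ballI impI)
  show "kernel \<subseteq> Cl" using closedD(1)[OF J] by (auto simp: kernel_def)
  show "one_class \<in> kernel" using closedD(2)[OF J] fusionD(1)[OF fusion] by (simp add: kernel_def)
  show "star D \<in> kernel" if "D \<in> kernel" for D
    using that closedD(3)[OF J, of D] fusion_inverse[of D] by (simp add: kernel_def)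
  fix D E F assume a: "D \<in> kernel" "E \<in> kernel" "F \<in> Cl" "cf F (chi D * chi E) \<noteq> 0"
  then have DE: "D \<in> J" "E \<in> J" "\<omega> D = 1" "\<omega> E = 1" by (auto simp: kernel_def)
  have "F \<in> J" by (rule closedD(4)[OF J DE(1,2) a(3,4)])
  then show "F \<in> kernel" using fusionD(2)[OF fusion DE(1,2) _ a(4)] DE by (simp add: kernel_def)
qed

text \<open>This is \<open>fusion_shift\<close> for the indicator function of
  \<open>\<omega> E\<close>.\<close>

lemma fibre_size:
  assumes E: "E \<in> J"
  shows "(\<Sum>D\<in>{D \<in> J. \<omega> D = \<omega> E}. deg D * deg D) = size_J kernel"
proof -
  have w0: "\<omega> E \<noteq> 0" using fusion_inverse[OF E] by auto
  have sum: "(\<Sum>D\<in>J. of_nat (deg D * deg D) * (if P D then 1 else 0 :: 'k)) = of_nat (\<Sum>D\<in>{D \<in> J. P D}. deg D * deg D)"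
    for P
    unfolding of_nat_sum by (rule sum.mono_neutral_cong_right) (use J_finite[OF J] in auto)
  have "(of_nat (\<Sum>D\<in>{D \<in> J. \<omega> D = \<omega> E}. deg D * deg D) :: 'k) =
      (\<Sum>D\<in>J. of_nat (deg D * deg D) * (if \<omega> D = \<omega> E then 1 else 0))"
    by (rule sum[symmetric])
  also have "\<dots> = (\<Sum>D\<in>J. of_nat (deg D * deg D) * (if \<omega> D * \<omega> E = \<omega> E then 1 else 0))"
    by (rule fusion_shift[OF E, of "\<lambda>x. if x = \<omega> E then 1 else 0"])
  also have "\<dots> = of_nat (\<Sum>D\<in>{D \<in> J. \<omega> D * \<omega> E = \<omega> E}. deg D * deg D)"
    by (rule sum)
  also have "{D \<in> J. \<omega> D * \<omega> E = \<omega> E} = kernel" using w0 by (auto simp: kernel_def)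
  finally show ?thesis unfolding size_J_def[OF closed_kernel] by (simp only: of_nat_eq_iff)
qed

lemma size_kernel: "size_J J = card (\<omega> ` J) * size_J kernel"
proof -
  have "size_J J = (\<Sum>w\<in>\<omega> ` J. \<Sum>D\<in>{D \<in> J. \<omega> D = w}. deg D * deg D)"
    unfolding size_J_def[OF J] by (rule sum.image_gen[OF J_finite[OF J]])
  also have "\<dots> = (\<Sum>w\<in>\<omega> ` J. size_J kernel)"
    by (intro sum.cong refl) (auto simp: fibre_size)
  finally show ?thesis by simp
qed

lemma fusion_values:
  "finite (\<omega> ` J)" "0 \<notin> \<omega> ` J" "1 \<in> \<omega> ` J"
  "v \<in> \<omega> ` J \<Longrightarrow> w \<in> \<omega> ` J \<Longrightarrow> v * w \<in> \<omega> ` J"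
proof -
  show "finite (\<omega> ` J)" using J_finite[OF J] by simp
  show "0 \<notin> \<omega> ` J"
  proof
    assume "0 \<in> \<omega> ` J"
    then obtain D where "D \<in> J" "\<omega> D = 0" by auto
    then show False using fusion_inverse[of D] by simp
  qed
  show "1 \<in> \<omega> ` J" using closedD(2)[OF J] fusionD(1)[OF fusion] by (intro image_eqI[of _ _ one_class]) auto
  show "v * w \<in> \<omega> ` J" if vw: "v \<in> \<omega> ` J" "w \<in> \<omega> ` J"
  proof -
    obtain D E where DE: "D \<in> J" "E \<in> J" "v = \<omega> D" "w = \<omega> E" using vw by blast
    obtain F where F: "F \<in> J" "cf F (chi D * chi E) \<noteq> 0" by (rule product_constituent[OF DE(1,2)])
    show ?thesis using fusionD(2)[OF fusion DE(1,2) F] F(1) DE(3,4) by (intro image_eqI[of _ _ F]) auto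
  qed
qed

lemma fusion_power: "fusion J (\<lambda>D. \<omega> D ^ m)"
  unfolding fusion_def
proof (intro conjI ballI impI)
  show "\<omega> one_class ^ m = 1" by (simp add: fusionD(1)[OF fusion])
  show "\<omega> F ^ m = \<omega> D ^ m * \<omega> E ^ m"
    if "D \<in> J" "E \<in> J" "F \<in> J" "cf F (chi D * chi E) \<noteq> 0" for D E F
    unfolding fusionD(2)[OF fusion that] by (rule power_mult_distrib)
qed

text \<open>\<open>chi D * chi (star E)\<close> has a constituent \<open>F\<close> in the kernel,
  which is group-like by assumption; then \<open>chi E\<close> is the inverse of
  \<open>chi F\<close> times \<open>chi D\<close>.\<close>

lemma degree_constant_on_fibres:
  assumes 1: "\<And>F. F \<in> kernel \<Longrightarrow> deg F = 1"
    and DE: "D \<in> J" "E \<in> J" "\<omega> D = \<omega> E"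
  shows "deg D = deg E"
proof -
  have E': "star E \<in> J" by (rule closedD(3)[OF J DE(2)])
  obtain F where F: "F \<in> J" "cf F (chi D * chi (star E)) \<noteq> 0" by (rule product_constituent[OF DE(1) E'])
  have "\<omega> F = 1" using fusionD(2)[OF fusion DE(1) E' F] fusion_inverse[OF DE(2)] DE(3) by simp
  then have F1: "deg F = 1" using F(1) by (intro 1) (simp add: kernel_def)
  have Cl: "D \<in> Cl" "E \<in> Cl" "F \<in> Cl" using J_Cl(1)[OF J] DE F by auto
  have d: "deg (star F) = 1"
  proof -
    have "(of_nat (deg (star F)) :: 'k) = \<epsilon> (S (chi F))" by (simp add: star(2)[OF Cl(3)] counit_chi)
    also have "\<dots> = of_nat 1" by (simp add: counit_antipode counit_chi F1)
    finally show ?thesis by (simp only: of_nat_eq_iff)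
  qed
  obtain E1 where E1: "E1 \<in> Cl" "chi (star F) * chi D = chi E1" "deg E1 = deg D"
    by (rule deg_one_mult[OF star(1)[OF Cl(3)] d Cl(1)])
  have "cf F (chi D * chi (star E)) = haar (S (chi F) * (chi D * S (chi E)))"
    unfolding cf_def star(2)[OF Cl(2), symmetric] by (rule haar_commute)
  also have "\<dots> = cf E (chi E1)"
    unfolding cf_def star(2)[OF Cl(3)] E1(2)[symmetric] by (simp add: mult.assoc)
  finally have "E1 = E" using F(2) by (simp add: cf_chi[OF E1(1)] split: if_splits)
  then show ?thesis using E1(3) by simp
qed

end

end

end

section \<open>Hopf algebras of dimension \<open>p ^ 3\<close>\<close>

lemma tensor_space_eqI:
  assumes "vector_space s" "vector_space t" "z \<in> tensor_space s t" "z' \<in> tensor_space s t"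
    and eq: "\<And>F. bilinear_map s t (*) F \<Longrightarrow> z F = z' F"
  shows "z = z'"
proof (rule ext)
  fix F
  obtain xs where xs: "z = (\<Sum>(v, w)\<leftarrow>xs. v \<otimes>[s,t] w)" by (rule tensor_space_sum_list[OF assms(1-3)])
  obtain ys where ys: "z' = (\<Sum>(v, w)\<leftarrow>ys. v \<otimes>[s,t] w)" by (rule tensor_space_sum_list[OF assms(1,2,4)])
  show "z F = z' F"
  proof (cases "bilinear_map s t (*) F")
    case False
    then have "(\<Sum>(v, w)\<leftarrow>zs. v \<otimes>[s,t] w) F = 0" for zs
      by (induction zs) (auto simp: tens_def)
    then show ?thesis unfolding xs ys by simp
  qed (rule eq)
qed

lemma square_dvd_prime_power:
  fixes d :: nat
  assumes "prime p" "d * d dvd p ^ b" "b \<le> 2"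
  shows "d = 1 \<or> d = p"
proof -
  have "d dvd p ^ b" using assms(2) by (rule dvd_mult_left)
  then obtain j where j: "d = p ^ j" using assms(1) by (auto simp: divides_primepow_nat)
  have "p ^ (j + j) dvd p ^ b" using assms(2) j by (simp add: power_add)
  then have "j + j \<le> b" using prime_gt_1_nat[OF assms(1)] by (metis power_dvd_imp_le)
  then have "j = 0 \<or> j = 1" using assms(3) by auto
  then show ?thesis using j by auto
qed

context matrix_basis
begin

lemma closed_Cl: "closed Cl"
  unfolding closed_def using one_class(1) star(1) by blast

lemma size_Cl: "size_J Cl = card B"
proof -
  let ?X = "SIGMA D:Cl. cs D \<times> cs D"
  let ?\<phi> = "\<lambda>(D, i, j). f i j" and ?a = "\<lambda>(D, i, j). c i j"
  have "span_c Cl = UNIV" using cl_Cl(1) by (auto simp: span_c_def)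
  then have ds: "dual_system UNIV ?X ?\<phi> ?a" using span_c_dual_system(1)[OF order_refl] by simp
  have "of_nat (card B) = (\<Sum>i\<in>?X. ?\<phi> i (?a i))"
    using tr_dual_system[OF ds operator_id] by (simp add: tr_id)
  also have "\<dots> = (\<Sum>D\<in>Cl. \<Sum>i\<in>cs D. \<Sum>j\<in>cs D. f i j (c i j))"
    unfolding span_c_dual_system(2)[OF order_refl, symmetric] by (simp add: case_prod_unfold)
  also have "\<dots> = (\<Sum>D\<in>Cl. \<Sum>i\<in>cs D. \<Sum>j\<in>cs D. 1)"
    by (intro sum.cong refl) (auto simp: cs_def f_c)
  also have "\<dots> = of_nat (size_J Cl)" by (simp add: size_J_def[OF closed_Cl] deg_def)
  finally show ?thesis by (simp only: of_nat_eq_iff)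
qed

text \<open>A nontrivial grading has a group of values of order \<open>p ^ Suc j\<close>. Its
  \<open>p ^ j\<close>-th power takes values in the \<open>p\<close>-th roots of unity and is still
  nontrivial, because at most \<open>p ^ j\<close> elements have trivial \<open>p ^ j\<close>-th
  power; hence it has exactly \<open>p\<close> values.\<close>

lemma prime_grading:
  assumes J: "closed J" and p: "prime p" "card B = p ^ k" "size_J J = p ^ Suc a"
  obtains \<omega> where "fusion J \<omega>" "\<And>D. D \<in> J \<Longrightarrow> \<omega> D ^ p = 1" "\<exists>D\<in>J. \<omega> D \<noteq> 1" "size_J (kernel J \<omega>) = p ^ a"
proof -
  obtain \<omega> D where \<omega>: "fusion J \<omega>" "D \<in> J" "\<omega> D \<noteq> 1"
    by (rule fusion_character[OF J p]) (simp, rule that)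
  let ?W = "\<omega> ` J"
  note W = fusion_values[OF J \<omega>(1)]
  have p1: "p > 1" using p(1) by (rule prime_gt_1_nat)
  have dvd: "\<exists>j. card (\<tau> ` J) = p ^ Suc j" if \<tau>: "fusion J \<tau>" "E \<in> J" "\<tau> E \<noteq> 1" for \<tau> E
  proof -
    have "card (\<tau> ` J) dvd p ^ Suc a" using size_kernel[OF J \<tau>(1)] p(3) by (metis dvd_triv_left)
    then obtain j where j: "card (\<tau> ` J) = p ^ j" using divides_primepow_nat[OF p(1)] by blast
    have "j \<noteq> 0"
    proof
      assume "j = 0"
      then have "card (\<tau> ` J) = 1" using j by simp
      then obtain w where w: "\<tau> ` J = {w}" by (rule card_1_singletonE)
      have "\<tau> E \<in> {w}" "1 \<in> {w}" using fusion_values(3)[OF J \<tau>(1)] \<tau>(2) w by auto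
      then show False using \<tau>(3) by simp
    qed
    then show ?thesis using j by (metis not0_implies_Suc)
  qed
  obtain j where j: "card ?W = p ^ Suc j" using dvd[OF \<omega>] by blast
  define \<tau> where "\<tau> D = \<omega> D ^ (p ^ j)" for D
  have \<tau>: "fusion J \<tau>" unfolding \<tau>_def by (rule fusion_power[OF J \<omega>(1)])
  have \<tau>p: "\<tau> D ^ p = 1" if "D \<in> J" for D
  proof -
    have "\<omega> D ^ card ?W = 1"
      by (rule finite_group_power_card[OF W(1,2,4)]) (use that in auto)
    then show ?thesis unfolding \<tau>_def j by (simp add: power_mult[symmetric] mult.commute)
  qed
  have ex: "\<exists>D\<in>J. \<tau> D \<noteq> 1"
  proof (rule ccontr)
    assume neg: "\<not> ?thesis"
    have pj: "p ^ j > 0" using p1 by simp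
    have "?W \<subseteq> {x. x ^ (p ^ j) = 1}" using neg by (auto simp: \<tau>_def)
    then have "card ?W \<le> card {x :: 'k. x ^ (p ^ j) = 1}" by (rule card_mono[OF card_roots_of_unity(1)[OF pj]])
    also have "\<dots> \<le> p ^ j" by (rule card_roots_of_unity(2)[OF pj])
    finally have "p * p ^ j \<le> 1 * p ^ j" using j by simp
    then show False using pj p1 by (simp only: mult_le_cancel2) simp
  qed
  then obtain E where E: "E \<in> J" "\<tau> E \<noteq> 1" by blast
  obtain i where i: "card (\<tau> ` J) = p ^ Suc i" using dvd[OF \<tau> E] by blast
  have p0: "p > 0" using p1 by simp
  have "\<tau> ` J \<subseteq> {x. x ^ p = 1}" using \<tau>p by auto
  then have "card (\<tau> ` J) \<le> card {x :: 'k. x ^ p = 1}" by (rule card_mono[OF card_roots_of_unity(1)[OF p0]])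
  also have "\<dots> \<le> p" by (rule card_roots_of_unity(2)[OF p0])
  finally have "p ^ Suc i \<le> p ^ 1" using i by simp
  then have "i = 0" using p1 by (simp only: power_increasing_iff)
  then have "p * size_J (kernel J \<tau>) = p * p ^ a" using size_kernel[OF J \<tau>] i p(3) by (metis power_Suc power_0 mult_1_right)
  then have sk: "size_J (kernel J \<tau>) = p ^ a" using p0 by simp
  show ?thesis by (rule that[of \<tau>]) (fact \<tau> \<tau>p ex sk)+
qed

text \<open>By \<open>degree_constant_on_fibres\<close> the component of \<open>D\<close> consists
  of classes of equal degree, and by \<open>fibre_size\<close> it is as large as the kernel.\<close>

lemma fibre_degree:
  assumes J: "closed J" and \<omega>: "fusion J \<omega>" and k: "\<And>F. F \<in> kernel J \<omega> \<Longrightarrow> deg F = 1" and D: "D \<in> J"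
  shows "deg D * deg D dvd size_J (kernel J \<omega>)"
proof -
  have "size_J (kernel J \<omega>) = (\<Sum>E\<in>{E \<in> J. \<omega> E = \<omega> D}. deg D * deg D)"
    unfolding fibre_size[OF J \<omega> D, symmetric]
    by (intro sum.cong refl) (use degree_constant_on_fibres[OF J \<omega> k _ D] in auto)
  then show ?thesis by simp
qed

text \<open>The components of a grading cut dimension \<open>p\<close> into pieces of size
  \<open>1\<close>.\<close>

lemma degree_one_p:
  assumes J: "closed J" and p: "prime p" "card B = p ^ k" "size_J J = p" and D: "D \<in> J"
  shows "deg D = 1"
proof -
  have Suc: "size_J J = p ^ Suc 0" using p by simp
  obtain \<omega> where \<omega>: "fusion J \<omega>" "size_J (kernel J \<omega>) = p ^ 0"
    by (rule prime_grading[OF J p(1,2) Suc]) (rule that)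
  have "deg D * deg D \<le> (\<Sum>E\<in>{E \<in> J. \<omega> E = \<omega> D}. deg E * deg E)"
    using D J_finite[OF J] by (intro member_le_sum) auto
  then have "deg D * deg D \<le> 1" using fibre_size[OF J \<omega>(1) D] \<omega>(2) by simp
  moreover have "deg D > 0" by (rule deg_pos[OF J_Cl(1)[OF J D]])
  ultimately show ?thesis by (cases "deg D") auto
qed

text \<open>The trivial component has size \<open>p\<close>, hence only degree one by
  \<open>degree_one_p\<close>; so the square of \<open>deg D\<close> divides
  \<open>p\<close>.\<close>

lemma degree_one_p2:
  assumes J: "closed J" and p: "prime p" "card B = p ^ k" "size_J J = p ^ 2" and D: "D \<in> J"
  shows "deg D = 1"
proof -
  have Suc: "size_J J = p ^ Suc 1" using p by (simp add: power2_eq_square)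
  obtain \<omega> where \<omega>: "fusion J \<omega>" "size_J (kernel J \<omega>) = p ^ 1"
    by (rule prime_grading[OF J p(1,2) Suc]) (rule that)
  have k: "deg F = 1" if "F \<in> kernel J \<omega>" for F
    by (rule degree_one_p[OF closed_kernel[OF J \<omega>(1)] p(1,2) _ that]) (simp add: \<omega>(2))
  have dvd: "deg D * deg D dvd p ^ 1" using fibre_degree[OF J \<omega>(1) k D] \<omega>(2) by simp
  then have "deg D \<noteq> p" using prime_gt_1_nat[OF p(1)] by auto
  then show ?thesis using square_dvd_prime_power[OF p(1) dvd] by simp
qed

text \<open>Classes of degree one have a single coefficient, which is group-like, and the
  coefficients span.\<close>

lemma cocommutativeI:
  assumes "\<And>D. D \<in> Cl \<Longrightarrow> deg D = 1"
  shows "cocommutative s \<Delta>"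
  unfolding cocommutative_def
proof
  fix x
  have sym: "sw x F = sw x (\<lambda>a b. F b a)" if F: "bifunctional F" for x F
  proof -
    have F': "bifunctional (\<lambda>a b. F b a)" using F unfolding bifunctional_iff by simp
    have c: "sw (c i j) F = sw (c i j) (\<lambda>a b. F b a)" if D: "D \<in> Cl" "i \<in> cs D" "j \<in> cs D" for D i j
    proof -
      obtain l where l: "cs D = {l}" using assms[OF D(1)] card_1_singletonE unfolding deg_def by metis
      then show ?thesis using sw_c[OF F D(2,3)] sw_c[OF F' D(2,3)] D by simp
    qed
    have "sw x G = (\<Sum>D\<in>Cl. \<Sum>i\<in>cs D. \<Sum>j\<in>cs D. f i j x * sw (c i j) G)" for G
    proof -
      have "sw x G = sw (\<Sum>D\<in>Cl. \<Sum>i\<in>cs D. \<Sum>j\<in>cs D. s (f i j x) (c i j)) G"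
        by (rule arg_cong[OF c_expand'])
      then show ?thesis
        by (simp only: functional_sum[OF functional_sw] sw_scale)
    qed
    then show ?thesis by (simp add: c cong: sum.cong)
  qed
  note vs = vs
  let ?y = "sweedler s s (\<Delta> x) (\<lambda>x1 x2. x2 \<otimes>[s,s] x1)"
  have bt: "bilinear_map s s fscale (\<lambda>x1 x2. x2 \<otimes>[s,s] x1)"
    using bilinear_map_tens[OF vs vs] unfolding bilinear_map_def by simp
  obtain xs where xs: "\<Delta> x = (\<Sum>(v, w)\<leftarrow>xs. v \<otimes>[s,s] w)"
    by (rule tensor_space_sum_list[OF vs vs comult_in])
  show "?y = \<Delta> x"
  proof (rule tensor_space_eqI[OF vs vs _ comult_in])
    interpret T: vector_space "fscale :: 'k \<Rightarrow> ('k, 'h, 'h) tensor \<Rightarrow> _" by (rule vector_space_fscale)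
    have "?y = (\<Sum>(v, w)\<leftarrow>xs. w \<otimes>[s,s] v)" unfolding xs by (rule sweedler_sum_list[OF bt])
    also have "\<dots> \<in> tensor_space s s"
    proof (induction xs)
      case Nil
      show ?case unfolding tensor_sub_def list.map sum_list.Nil by (rule T.span_zero)
    next
      case (Cons a xs)
      have "(\<Sum>(v, w)\<leftarrow>a # xs. w \<otimes>[s,s] v) = snd a \<otimes>[s,s] fst a + (\<Sum>(v, w)\<leftarrow>xs. w \<otimes>[s,s] v)"
        by (simp only: list.map sum_list.Cons case_prod_unfold)
      then show ?case
        using T.span_add[OF tens_in_tensor_space[of "snd a" s s "fst a", unfolded tensor_sub_def]
            Cons.IH[unfolded tensor_sub_def]]
        unfolding tensor_sub_def by (simp only:)
    qed
    finally show "?y \<in> tensor_space s s" .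
    fix F assume F: "bilinear_map s s (*) F"
    then have F': "bifunctional F" .
    then have F'': "bifunctional (\<lambda>a b. F b a)" unfolding bifunctional_iff by simp
    have "?y F = sweedler s s (\<Delta> x) (\<lambda>a b. (b \<otimes>[s,s] a) F)"
      by (rule sweedler_push[OF bt linear_eval comult_in])
    also have "(\<lambda>a b. (b \<otimes>[s,s] a) F) = (\<lambda>a b. F b a)" using F by (simp add: tens_def)
    also have "sweedler s s (\<Delta> x) (\<lambda>a b. F b a) = sw x F"
      using sw_sweedler[OF F''] sym[OF F'] by simp
    also have "\<dots> = \<Delta> x F" by (rule sw_eval[OF F'])
    finally show "?y F = \<Delta> x F" .
  qed
qed

text \<open>The kernel of a grading has size \<open>p ^ 2\<close> and only degree one, so every
  degree is \<open>1\<close> or \<open>p\<close>. A group-like class outside the kernel would have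
  powers in all components, and every degree would be one.\<close>

theorem prime_cube_structure:
  assumes p: "prime p" "card B = p ^ 3" and nc: "\<not> cocommutative s \<Delta>"
  obtains J where "closed J" "size_J J = p ^ 2" "\<And>D. D \<in> J \<Longrightarrow> deg D = 1" "\<And>D. D \<in> Cl - J \<Longrightarrow> deg D = p"
proof -
  have Suc: "size_J Cl = p ^ Suc 2" using p by (simp add: size_Cl eval_nat_numeral)
  obtain \<omega> where \<omega>: "fusion Cl \<omega>" "\<And>D. D \<in> Cl \<Longrightarrow> \<omega> D ^ p = 1" "size_J (kernel Cl \<omega>) = p ^ 2"
    by (rule prime_grading[OF closed_Cl p Suc]) (rule that)
  let ?J = "kernel Cl \<omega>"
  note J = closed_kernel[OF closed_Cl \<omega>(1)]
  have k: "deg F = 1" if "F \<in> ?J" for F by (rule degree_one_p2[OF J p \<omega>(3) that])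
  have d: "deg D = 1 \<or> deg D = p" if D: "D \<in> Cl" for D
    using fibre_degree[OF closed_Cl \<omega>(1) k D] \<omega>(3)
    by (intro square_dvd_prime_power[OF p(1), of _ 2]) simp_all
  have "deg D \<noteq> 1" if D: "D \<in> Cl - ?J" for D
  proof
    assume d1: "deg D = 1"
    have DC: "D \<in> Cl" and D1: "\<omega> D \<noteq> 1" using D by (auto simp: kernel_def[OF closed_Cl \<omega>(1)])
    have pw: "\<exists>F\<in>Cl. deg F = 1 \<and> \<omega> F = \<omega> D ^ i" for i
    proof (induction i)
      case 0
      show ?case using one_class(1,3) fusionD(1)[OF \<omega>(1)] by (intro bexI[of _ one_class]) auto
    next
      case (Suc i)
      then obtain F where F: "F \<in> Cl" "deg F = 1" "\<omega> F = \<omega> D ^ i" by blast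
      obtain E where E: "E \<in> Cl" "chi D * chi F = chi E" "deg E = deg F"
        by (rule deg_one_mult[OF DC d1 F(1)])
      have "cf E (chi D * chi F) \<noteq> 0" using E by (simp add: cf_chi)
      then have "\<omega> E = \<omega> D * \<omega> F" by (rule fusionD(2)[OF \<omega>(1) DC F(1) E(1)])
      then show ?case using E F by (intro bexI[of _ E]) auto
    qed
    have p0: "p > 0" using p(1) by (rule prime_gt_0_nat)
    have w0: "\<omega> D \<noteq> 0" using \<omega>(2)[OF DC] p0 by (auto simp: zero_power)
    \<comment> \<open>As \<open>p\<close> is prime, Bezout turns a trivial power with exponent
      strictly between \<open>0\<close> and \<open>p\<close> into
      \<open>\<omega> D = 1\<close>.\<close>
    have step: "\<omega> D ^ i \<noteq> \<omega> D ^ j" if ij: "i < j" "j < p" for i j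
    proof
      assume "\<omega> D ^ i = \<omega> D ^ j"
      also have "\<omega> D ^ j = \<omega> D ^ i * \<omega> D ^ (j - i)" using ij by (simp add: power_add[symmetric])
      finally have 1: "\<omega> D ^ (j - i) = 1" using w0 by simp
      have "\<not> p dvd j - i" using ij by (auto dest: dvd_imp_le)
      then have cop: "gcd (j - i) p = 1"
        using prime_imp_coprime[OF p(1)] unfolding coprime_iff_gcd_eq_1 gcd.commute[of "j - i"] by blast
      have "j - i \<noteq> 0" using ij by simp
      from bezout_nat[OF this, of p] obtain u v where "(j - i) * u = p * v + 1"
        unfolding cop by blast
      then have "\<omega> D ^ ((j - i) * u) = \<omega> D ^ (p * v + 1)" by simp
      then show False using 1 \<omega>(2)[OF DC] D1 by (simp add: power_mult power_add)
    qed
    have inj: "inj_on (\<lambda>i. \<omega> D ^ i) {..<p}"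
    proof (rule inj_onI)
      fix i j assume "i \<in> {..<p}" "j \<in> {..<p}" "\<omega> D ^ i = \<omega> D ^ j"
      then show "i = j" using step[of i j] step[of j i] by (metis lessThan_iff nat_neq_iff)
    qed
    have all: "{x :: 'k. x ^ p = 1} = (\<lambda>i. \<omega> D ^ i) ` {..<p}"
    proof (rule card_seteq[OF card_roots_of_unity(1)[OF p0], symmetric])
      show "(\<lambda>i. \<omega> D ^ i) ` {..<p} \<subseteq> {x. x ^ p = 1}"
        using \<omega>(2)[OF DC] by (auto simp: power_mult[symmetric] mult.commute[of _ p]) (simp add: power_mult)
      show "card {x :: 'k. x ^ p = 1} \<le> card ((\<lambda>i. \<omega> D ^ i) ` {..<p})"
        using card_roots_of_unity(2)[OF p0] by (simp add: card_image[OF inj])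
    qed
    have "deg E = 1" if E: "E \<in> Cl" for E
    proof -
      have "\<omega> E \<in> (\<lambda>i. \<omega> D ^ i) ` {..<p}" using \<omega>(2)[OF E] all by blast
      then obtain i where "\<omega> E = \<omega> D ^ i" by blast
      then obtain F where F: "F \<in> Cl" "deg F = 1" "\<omega> F = \<omega> E" using pw[of i] by auto
      show ?thesis using degree_constant_on_fibres[OF closed_Cl \<omega>(1) k F(1) E F(3)] F(2) by simp
    qed
    then show False using cocommutativeI nc by blast
  qed
  then show ?thesis using d by (intro that[OF J \<omega>(3) k]) auto
qed

text \<open>A group-like element is a comodule matrix with one entry, and its norm as a character is
  \<open>1\<close>.\<close>

lemma group_likes_chi: "g \<in> group_likes s \<Delta> \<Longrightarrow> \<exists>D\<in>Cl. deg D = 1 \<and> g = chi D"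
proof -
  assume g: "g \<in> group_likes s \<Delta>"
  then have g0: "g \<noteq> 0" and dg: "\<Delta> g = g \<otimes>[s,s] g" by (auto simp: group_likes_def)
  have sw: "sw g F = F g g" if F: "bifunctional F" for F
    using sw_eval[OF F, of g] F dg by (simp add: tens_def)
  have eps: "\<epsilon> g = 1"
  proof -
    obtain h where h: "functional h" "h g \<noteq> h 0" using functional_separate[of g 0] g0 by blast
    have "h g = \<epsilon> g * h g"
    proof -
      note fi = fn_intros functional_comp[OF h(1)]
      have "sw g (\<lambda>a b. \<epsilon> a * h b) = \<epsilon> g * h g" by (rule sw) (intro bifunctionalI fi)
      then show ?thesis using sw_counit_left[OF h(1), of g] by simp
    qed
    then show ?thesis using h functional_0[OF h(1)] by simp
  qed
  have gr: "grp g" unfolding grp_def using sw eps by blast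
  have "character g"
    using corepresentation_character(1,2)[of "{()}" "\<lambda>_ _. g"] sw by (simp add: character_def)
  then obtain D where D: "D \<in> Cl" "g = chi D"
    using character_irreducible[of g] grp_antipode(2)[OF gr] haar_1 by auto
  then have "of_nat (deg D) = (of_nat 1 :: 'k)" using eps by (simp add: counit_chi)
  then have "deg D = 1" by (simp only: of_nat_eq_iff)
  then show ?thesis using D by blast
qed

end

section \<open>Hopf algebras with a total integral\<close>

context hopf_vspace
begin

text \<open>Stands in for antimultiplicativity of \<open>S\<close>, which
  \<open>antipode_mult\<close> provides only over a finite basis. The expression
  \<open>S (h1 x1) h2 x2 S x3\<close> is collapsed in two ways.\<close>

lemma antipode_cancel:
  assumes f: "functional f"
  shows "\<Delta> h (\<lambda>u v. f (S (u * x) * v)) = \<epsilon> h * f (S x)"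
proof -
  note fi = functional_comp[OF f] fnh
  note bb = bifunctionalI functional_comult functional_comult_body
  have "\<epsilon> h * f (S x) = \<epsilon> h * \<Delta> x (\<lambda>x' z. \<epsilon> x' * f (S z))"
    by (subst counit_eval(1)) (intro fi refl)+
  also have "\<dots> = \<Delta> x (\<lambda>x' z. \<epsilon> h * (\<epsilon> x' * f (S z)))"
    by (rule comult_scale(1)[symmetric]) (intro bb fi)
  also have "\<dots> = \<Delta> x (\<lambda>x' z. \<Delta> (h * x') (\<lambda>p q. f (S p * q * S z)))"
  proof (rule comult_cong)
    fix x' z
    have "functional (\<lambda>y. f (y * S z))" by (intro fi)
    from antipode_eval(1)[OF this, of "h * x'"]
    show "\<epsilon> h * (\<epsilon> x' * f (S z)) = \<Delta> (h * x') (\<lambda>p q. f (S p * q * S z))"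
      by (simp add: counit_mult)
  qed
  also have "\<dots> = \<Delta> x (\<lambda>x' z. \<Delta> h (\<lambda>u v. \<Delta> x' (\<lambda>a y. f (S (u * a) * (v * y) * S z))))"
    by (intro comult_cong comult_mult_eval bb fi)
  also have "\<dots> = \<Delta> x (\<lambda>x' z. \<Delta> x' (\<lambda>a y. \<Delta> h (\<lambda>u v. f (S (u * a) * (v * y) * S z))))"
    by (intro comult_cong comult_swap fi)
  also have "\<dots> = \<Delta> x (\<lambda>a w. \<Delta> w (\<lambda>y z. \<Delta> h (\<lambda>u v. f (S (u * a) * (v * y) * S z))))"
    by (rule comult_coassoc[of "\<lambda>a y z. \<Delta> h (\<lambda>u v. f (S (u * a) * (v * y) * S z))"]) (intro bb fi)+
  also have "\<dots> = \<Delta> x (\<lambda>a w. \<Delta> h (\<lambda>u v. \<Delta> w (\<lambda>y z. f (S (u * a) * (v * y) * S z))))"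
    by (intro comult_cong comult_swap fi)
  also have "\<dots> = \<Delta> x (\<lambda>a w. \<Delta> h (\<lambda>u v. \<epsilon> w * f (S (u * a) * v)))"
  proof (intro comult_cong)
    fix a w u v
    have "functional (\<lambda>y. f (S (u * a) * v * y))" by (intro fi)
    from antipode_eval(2)[OF this, of w]
    show "\<Delta> w (\<lambda>y z. f (S (u * a) * (v * y) * S z)) = \<epsilon> w * f (S (u * a) * v)"
      by (simp add: mult.assoc)
  qed
  also have "\<dots> = \<Delta> h (\<lambda>u v. \<Delta> x (\<lambda>a w. \<epsilon> w * f (S (u * a) * v)))"
    by (rule comult_swap) (intro fi functional_counit)+
  also have "\<dots> = \<Delta> h (\<lambda>u v. f (S (u * x) * v))"
    by (intro comult_cong counit_eval(2) fi)
  finally show ?thesis by simp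
qed

context
  fixes t
  assumes t: "\<epsilon> t = 1" "\<And>h. h * t = s (\<epsilon> h) t"
begin

text \<open>\<open>t\<^sub>1 \<otimes> S t\<^sub>2\<close> is a separability idempotent.\<close>

lemma integral_separability:
  assumes f: "functional f" and g: "functional g"
  shows "\<Delta> t (\<lambda>a b. g a * f (S b * h)) = \<Delta> t (\<lambda>a b. g (h * a) * f (S b))"
proof -
  note fi = functional_comp[OF f] functional_comp[OF g] f g fnh
  note bb = bifunctionalI functional_comult functional_comult_body
  have "\<Delta> t (\<lambda>a b. g a * f (S b * h)) = \<Delta> h (\<lambda>u v. \<epsilon> u * \<Delta> t (\<lambda>a b. g a * f (S b * v)))"
    by (rule counit_eval(1)[symmetric]) (intro bb fi)
  also have "\<dots> = \<Delta> h (\<lambda>u v. \<Delta> (u * t) (\<lambda>a b. g a * f (S b * v)))"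
    by (intro comult_cong) (simp add: t(2) functional_scale[OF functional_comult])
  also have "\<dots> = \<Delta> h (\<lambda>h' w. \<Delta> h' (\<lambda>u v. \<Delta> t (\<lambda>a b. g (u * a) * f (S (v * b) * w))))"
    by (intro comult_cong comult_mult_eval bb fi)
  also have "\<dots> = \<Delta> h (\<lambda>u h'. \<Delta> h' (\<lambda>v w. \<Delta> t (\<lambda>a b. g (u * a) * f (S (v * b) * w))))"
    by (rule comult_coassoc[of "\<lambda>u v w. \<Delta> t (\<lambda>a b. g (u * a) * f (S (v * b) * w))"]) (intro bb fi)+
  also have "\<dots> = \<Delta> h (\<lambda>u h'. \<Delta> t (\<lambda>a b. \<Delta> h' (\<lambda>v w. g (u * a) * f (S (v * b) * w))))"
    by (intro comult_cong comult_swap fi)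
  also have "\<dots> = \<Delta> h (\<lambda>u h'. \<Delta> t (\<lambda>a b. \<epsilon> h' * (g (u * a) * f (S b))))"
  proof (intro comult_cong)
    fix u h' a b
    have "\<Delta> h' (\<lambda>v w. g (u * a) * f (S (v * b) * w)) = g (u * a) * (\<epsilon> h' * f (S b))"
      unfolding antipode_cancel[OF f, symmetric] by (rule comult_scale(1)) (intro bb fi)
    then show "\<Delta> h' (\<lambda>v w. g (u * a) * f (S (v * b) * w)) = \<epsilon> h' * (g (u * a) * f (S b))" by simp
  qed
  also have "\<dots> = \<Delta> h (\<lambda>u h'. \<epsilon> h' * \<Delta> t (\<lambda>a b. g (u * a) * f (S b)))"
    by (intro comult_cong comult_scale(1) bb fi)
  also have "\<dots> = \<Delta> t (\<lambda>a b. g (h * a) * f (S b))"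
    by (rule counit_eval(2)) (intro bb fi)
  finally show ?thesis .
qed

text \<open>In \<open>h = t1 S t2 h\<close> the factor \<open>S t2 h\<close> is expanded in a basis.
  By \<open>integral_separability\<close> (\<open>key\<close>) the factor \<open>h\<close> can be
  moved away from \<open>S t2\<close>, so only the finitely many basis vectors occurring in the
  elements \<open>S t2\<close> contribute.\<close>

theorem total_integral_finite_dimensional:
  obtains C where "finite C" "independent C" "span C = UNIV"
proof -
  obtain Q where Q: "independent Q" "UNIV \<subseteq> span Q" by (rule maximal_independent_subset[of UNIV])
  have spQ: "span Q = UNIV" using Q(2) by blast
  define f where "f j x = representation Q x j" for j x
  have ff: "functional (f j)" for j
    using linear_representation[OF Q(1) spQ, of j] unfolding f_def functional_iff by simp
  have fin: "finite {j. f j x \<noteq> 0}" for x unfolding f_def by (rule finite_representation)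
  have rep: "x = (\<Sum>j\<in>A. s (f j x) j)" if A: "finite A" "{j. f j x \<noteq> 0} \<subseteq> A" for x A
  proof -
    have "x = (\<Sum>j | f j x \<noteq> 0. s (f j x) j)"
      unfolding f_def using sum_nonzero_representation_eq[OF Q(1), of x] spQ by simp
    also have "\<dots> = (\<Sum>j\<in>A. s (f j x) j)" by (rule sum.mono_neutral_left) (use A in auto)
    finally show ?thesis .
  qed
  obtain xs where xs: "\<And>F. bifunctional F \<Longrightarrow> \<Delta> t F = (\<Sum>(v, w)\<leftarrow>xs. F v w)" by (rule comult_eval_list[of t]) (rule that)
  have sl: "functional g \<Longrightarrow> g (\<Sum>x\<leftarrow>ys. k x) = (\<Sum>x\<leftarrow>ys. g (k x))" for g k and ys :: "('h \<times> 'h) list"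
    by (induction ys) (simp_all add: functional_0 functional_add)
  have key: "(\<Sum>(a, b)\<leftarrow>xs. s (f j (S b * h)) a) = h * (\<Sum>(a, b)\<leftarrow>xs. s (f j (S b)) a)" for j h
  proof (rule functional_separate)
    fix g assume g: "functional g"
    note fi = functional_comp[OF ff] functional_comp[OF g] ff g fnh
    have e: "bifunctional (\<lambda>a b. g a * f j (S b * h))" "bifunctional (\<lambda>a b. g (h * a) * f j (S b))" by (intro bifunctionalI fi)+
    have gh: "functional (\<lambda>x. g (h * x))" by (intro fi)
    show "g (\<Sum>(a, b)\<leftarrow>xs. s (f j (S b * h)) a) = g (h * (\<Sum>(a, b)\<leftarrow>xs. s (f j (S b)) a))"
      using integral_separability[OF ff g, of j h] unfolding xs[OF e(1)] xs[OF e(2)] sl[OF g] sl[OF gh]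
      by (simp add: case_prod_unfold functional_scale[OF g] scale_mult_right mult.commute)
  qed
  have one: "(\<Sum>(a, b)\<leftarrow>xs. a * S b) = 1"
  proof (rule functional_separate)
    fix g assume g: "functional g"
    have e: "bifunctional (\<lambda>a b. g (a * S b))" by (intro bifunctionalI functional_comp[OF g] fnh)
    show "g (\<Sum>(a, b)\<leftarrow>xs. a * S b) = g 1"
      using antipode_eval(2)[OF g, of t] unfolding xs[OF e] sl[OF g] by (simp add: case_prod_unfold t(1))
  qed
  define J where "J = (\<Union>(a, b)\<in>set xs. {j. f j (S b) \<noteq> 0})"
  have J: "finite J" unfolding J_def by (intro finite_UN_I) (auto simp: fin)
  define Y where "Y = (\<lambda>(a, j). a * j) ` (fst ` set xs \<times> J)"
  have Y: "finite Y" using J by (simp add: Y_def)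
  have "h \<in> span Y" for h
  proof -
    define A where "A = J \<union> (\<Union>(a, b)\<in>set xs. {j. f j (S b * h) \<noteq> 0})"
    have A: "finite A" unfolding A_def using J by (intro finite_UnI finite_UN_I) (auto simp: fin)
    have fs: "(\<Sum>x\<leftarrow>ys. \<Sum>j\<in>A. G x j) = (\<Sum>j\<in>A. \<Sum>x\<leftarrow>ys. G x j)" for G :: "'h \<times> 'h \<Rightarrow> 'h \<Rightarrow> 'h" and ys
      by (induction ys) (simp_all add: sum.distrib)
    have "h = (\<Sum>(a, b)\<leftarrow>xs. a * S b) * h" by (simp add: one)
    also have "\<dots> = (\<Sum>x\<leftarrow>xs. fst x * (S (snd x) * h))"
      by (simp add: case_prod_unfold sum_list_mult_const[symmetric] mult.assoc)
    also have "\<dots> = (\<Sum>x\<leftarrow>xs. \<Sum>j\<in>A. s (f j (S (snd x) * h)) (fst x) * j)"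
    proof (intro arg_cong[of _ _ sum_list] map_cong refl)
      fix x assume x: "x \<in> set xs"
      have "S (snd x) * h = (\<Sum>j\<in>A. s (f j (S (snd x) * h)) j)"
        by (rule rep[OF A]) (use x in \<open>force simp: A_def\<close>)
      then have "fst x * (S (snd x) * h) = fst x * (\<Sum>j\<in>A. s (f j (S (snd x) * h)) j)" by simp
      then show "fst x * (S (snd x) * h) = (\<Sum>j\<in>A. s (f j (S (snd x) * h)) (fst x) * j)"
        by (simp add: sum_distrib_left scale_mult_left scale_mult_right)
    qed
    also have "\<dots> = (\<Sum>j\<in>A. \<Sum>x\<leftarrow>xs. s (f j (S (snd x) * h)) (fst x) * j)" by (rule fs)
    also have "\<dots> \<in> span Y"
    proof (rule span_sum)
      fix j assume "j \<in> A"
      show "(\<Sum>x\<leftarrow>xs. s (f j (S (snd x) * h)) (fst x) * j) \<in> span Y"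
      proof (cases "j \<in> J")
        case True
        have "(\<Sum>x\<leftarrow>ys. s (f j (S (snd x) * h)) (fst x) * j) \<in> span Y" if "set ys \<subseteq> set xs" for ys
          using that
        proof (induction ys)
          case (Cons y ys)
          have "fst y * j \<in> Y" using Cons.prems True by (force simp: Y_def)
          then have "s (f j (S (snd y) * h)) (fst y) * j \<in> span Y"
            unfolding scale_mult_left by (intro span_scale span_base)
          then show ?case using Cons by (simp add: span_add)
        qed (simp add: span_zero)
        then show ?thesis by simp
      next
        case False
        have "f j (S (snd x)) = 0" if "x \<in> set xs" for x using False that by (force simp: J_def)
        then have "map (\<lambda>x. s (f j (S (snd x))) (fst x)) xs = map (\<lambda>x. 0) xs"
          by (intro map_cong refl) simp
        then have 0: "(\<Sum>x\<leftarrow>xs. s (f j (S (snd x))) (fst x)) = 0" by (simp only: sum_list_0)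
        have "(\<Sum>x\<leftarrow>xs. s (f j (S (snd x) * h)) (fst x) * j) = (\<Sum>x\<leftarrow>xs. s (f j (S (snd x) * h)) (fst x)) * j"
          by (simp add: sum_list_mult_const)
        also have "\<dots> = 0" using key[of j h] 0 by (simp add: case_prod_unfold)
        finally show ?thesis by (simp only: span_zero)
      qed
    qed
    finally show ?thesis .
  qed
  then have sY: "span Y = UNIV" by blast
  obtain C where C: "C \<subseteq> Y" "independent C" "Y \<subseteq> span C" by (rule maximal_independent_subset[of Y])
  have "span C = UNIV" using span_mono[OF C(3)] sY by (simp add: span_span top.extremum_unique)
  then show ?thesis using C finite_subset[OF C(1) Y] by (intro that)
qed

end

end

section \<open>Finite-dimensional subbialgebras are Hopf subalgebras\<close>

text \<open>Reduction to pure tensors; the stability of subspaces under Sweedler expressions rests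
  on this below.\<close>

lemma sweedler_mem:
  fixes s :: "'k::field \<Rightarrow> 'v::ab_group_add \<Rightarrow> 'v" and t :: "'k \<Rightarrow> 'w::ab_group_add \<Rightarrow> 'w"
  assumes z: "z \<in> tensor_sub s t V W" and f: "bilinear_map s t u f"
    and U: "module.subspace u U" "\<And>v w. v \<in> V \<Longrightarrow> w \<in> W \<Longrightarrow> f v w \<in> U"
  shows "sweedler s t z f \<in> U"
proof -
  interpret F: vector_space "fscale :: 'k \<Rightarrow> ('k, 'v, 'w) tensor \<Rightarrow> _" by (rule vector_space_fscale)
  interpret u: vector_space u using bilinear_mapD(7)[OF f] .
  have sub: "tensor_sub s t V W \<subseteq> tensor_space s t"
    unfolding tensor_sub_def by (intro F.span_mono) auto
  have "z \<in> tensor_space s t \<and> sweedler s t z f \<in> U"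
    using z[unfolded tensor_sub_def]
  proof (induction rule: F.span_induct_alt)
    case base
    have 0: "(0 :: ('k, 'v, 'w) tensor) \<in> tensor_space s t" unfolding tensor_sub_def by (rule F.span_zero)
    have "sweedler s t (fscale 0 0) f = u 0 (sweedler s t 0 f)" by (rule tensor_universal_property(3)[OF f 0])
    then have "sweedler s t 0 f = 0" by (simp only: F.scale_zero_right u.scale_zero_left)
    then show ?case by (intro conjI 0) (simp only: u.subspace_0[OF U(1)])
  next
    case (step c x y)
    then obtain v w where x: "x = v \<otimes>[s,t] w" "v \<in> V" "w \<in> W" by auto
    have xt: "x \<in> tensor_space s t" unfolding x(1) by (rule tens_in_tensor_space)
    have cx: "fscale c x \<in> tensor_space s t"
      using xt unfolding tensor_sub_def by (rule F.span_scale)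
    have "fscale c x + y \<in> tensor_space s t"
      using cx conjunct1[OF step(2)] unfolding tensor_sub_def by (rule F.span_add)
    moreover have "sweedler s t (fscale c x + y) f = u c (f v w) + sweedler s t y f"
      unfolding tensor_universal_property(2)[OF f cx conjunct1[OF step(2)]]
        tensor_universal_property(3)[OF f xt] unfolding x(1) tensor_universal_property(1)[OF f] ..
    moreover have "u c (f v w) + sweedler s t y f \<in> U"
      using step(2) U(2)[OF x(2,3)] by (intro u.subspace_add[OF U(1)] u.subspace_scale[OF U(1)]) auto
    ultimately show ?case by (simp only:)
  qed
  then show ?thesis by blast
qed

text \<open>Elimination: a function not vanishing at \<open>x\<close> serves as pivot, and a
  relation among the reduced functions \<open>g'\<close> on the smaller set lifts.\<close>

lemma finite_family_relation:
  fixes g :: "nat \<Rightarrow> 'x \<Rightarrow> 'k::field"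
  assumes "finite X"
  shows "\<exists>N a. (\<exists>n\<le>N. a n \<noteq> 0) \<and> (\<forall>x\<in>X. (\<Sum>n\<le>N. a n * g n x) = 0)"
  using assms
proof (induction X arbitrary: g)
  case empty
  show ?case by (intro exI[of _ 0] exI[of _ "\<lambda>_. 1"]) auto
next
  case (insert x X)
  show ?case
  proof (cases "\<exists>m. g m x \<noteq> 0")
    case False
    then show ?thesis using insert.IH[of g] by auto
  next
    case True
    then obtain m where m: "g m x \<noteq> 0" by blast
    define g' where "g' n y = g (n + Suc m) y - g (n + Suc m) x / g m x * g m y" for n y
    obtain N a' where a': "\<exists>n\<le>N. a' n \<noteq> 0" "\<And>y. y \<in> X \<Longrightarrow> (\<Sum>n\<le>N. a' n * g' n y) = 0"
      using insert.IH[of g'] by blast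
    \<comment> \<open>The coefficient of the pivot collects the multiples that were subtracted; the
      other coefficients are shifted past it by \<open>Suc m\<close>.\<close>
    define r where "r = (\<Sum>n\<le>N. a' n * (g (n + Suc m) x / g m x))"
    define a where "a k = (if k = m then - r else if k > m then a' (k - Suc m) else 0)" for k
    have sum: "(\<Sum>k\<le>N + Suc m. a k * g k y) = (\<Sum>n\<le>N. a' n * g' n y)" for y
    proof -
      have "(\<Sum>k\<le>N + Suc m. a k * g k y) = (\<Sum>k\<in>insert m {0 + Suc m..N + Suc m}. a k * g k y)"
        by (rule sum.mono_neutral_right) (auto simp: a_def)
      also have "\<dots> = - r * g m y + (\<Sum>k=0 + Suc m..N + Suc m. a k * g k y)"
        by (subst sum.insert) (auto simp: a_def)
      also have "(\<Sum>k=0 + Suc m..N + Suc m. a k * g k y) = (\<Sum>n=0..N. a (n + Suc m) * g (n + Suc m) y)"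
        by (rule sum.shift_bounds_cl_nat_ivl)
      also have "\<dots> = (\<Sum>n\<le>N. a' n * g (n + Suc m) y)"
        by (intro sum.cong) (auto simp: a_def atLeast0AtMost)
      finally show ?thesis
        by (simp add: g'_def r_def right_diff_distrib sum_subtractf sum_distrib_right mult.assoc)
    qed
    show ?thesis
    proof (rule exI[of _ "N + Suc m"], rule exI[of _ a], intro conjI ballI)
      obtain n where "n \<le> N" "a' n \<noteq> 0" using a'(1) by blast
      then show "\<exists>n\<le>N + Suc m. a n \<noteq> 0" by (intro exI[of _ "n + Suc m"]) (auto simp: a_def)
      fix y assume "y \<in> insert x X"
      then show "(\<Sum>n\<le>N + Suc m. a n * g n y) = 0"
        unfolding sum using a'(2) m by (auto simp: g'_def)
    qed
  qed
qed

context fd_hopf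
begin

primrec idpow :: "nat \<Rightarrow> 'h \<Rightarrow> 'h" where
  "idpow 0 x = s (\<epsilon> x) 1"
| "idpow (Suc n) x = sweedler s s (\<Delta> x) (\<lambda>a b. idpow n a * b)"

lemma idpow:
  shows operator_idpow: "operator (idpow n)"
    and bilinear_idpow: "bilinear_map s s s (\<lambda>a b. idpow n a * b)"
proof -
  have b: "bilinear_map s s s (\<lambda>a b. idpow n a * b)" if "operator (idpow n)" for n
    using operator_add[OF that] operator_scale[OF that]
    by (auto intro!: bilinear_mapI vs simp: distrib_left distrib_right scale_mult_left scale_mult_right)
  show op: "operator (idpow n)"
  proof (induction n)
    case 0
    show ?case
      by (simp add: operator_def counit_add counit_scale scale_left_distrib)
  next
    case (Suc n)
    show ?case using sweedler_linear[OF comult_linear comult_in b[OF Suc]] by (simp add: operator_iff)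
  qed
  show "bilinear_map s s s (\<lambda>a b. idpow n a * b)" by (rule b[OF op])
qed

lemma idpow_Suc:
  assumes f: "functional f"
  shows "f (idpow (Suc n) x) = sw x (\<lambda>a b. f (idpow n a * b))"
proof -
  have "f (idpow (Suc n) x) = sweedler s s (\<Delta> x) (\<lambda>a b. f (idpow n a * b))"
    using sweedler_push[OF bilinear_idpow linear_functional[OF f] comult_in] by simp
  also have "\<dots> = sw x (\<lambda>a b. f (idpow n a * b))"
    by (rule sw_sweedler) (intro bifunctionalI functional_comp[OF f] operator_mult_left operator_mult_right operator_id operator_idpow)
  finally show ?thesis .
qed

lemma idpow_antipode:
  assumes f: "functional f"
  shows "sw x (\<lambda>u v. f (idpow (Suc n) u * S v)) = f (idpow n x)"
    and "sw x (\<lambda>u v. f (idpow 0 u * S v)) = f (S x)"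
proof -
  have fS: "functional (\<lambda>y. f (y * S v))" for v by (intro functional_comp[OF f] fn_intros)
  have "sw x (\<lambda>u v. f (idpow (Suc n) u * S v)) = sw x (\<lambda>u v. sw u (\<lambda>p q. f (idpow n p * q * S v)))"
    unfolding idpow_Suc[OF fS] ..
  also have "\<dots> = sw x (\<lambda>p w. sw w (\<lambda>q v. f (idpow n p * q * S v)))"
    by (rule sw_coassoc)
  also have "\<dots> = sw x (\<lambda>p w. f (idpow n p) * \<epsilon> w)"
  proof -
    have "functional (\<lambda>y. f (idpow n p * y))" for p by (intro functional_comp[OF f] fn_intros)
    from sw_antipode_right[OF this] show ?thesis by (simp add: mult.assoc mult.commute)
  qed
  also have "\<dots> = f (idpow n x)"
    by (rule sw_counit_right) (intro functional_comp[OF f] operator_idpow)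
  finally show "sw x (\<lambda>u v. f (idpow (Suc n) u * S v)) = f (idpow n x)" .
  have fS': "functional (\<lambda>v. f (S v))" by (intro functional_comp[OF f] fn_intros)
  show "sw x (\<lambda>u v. f (idpow 0 u * S v)) = f (S x)"
    using sw_counit_left[OF fS', of x] by (simp add: scale_mult_left functional_scale[OF f])
qed

text \<open>The antipode is the convolution inverse of the identity, hence a polynomial in it.\<close>

lemma antipode_idpow:
  obtains N a where "\<And>x. S x = (\<Sum>n<N. s (a n) (idpow n x))"
proof -
  obtain N a where a: "\<exists>n\<le>N. a n \<noteq> (0 :: 'k)"
    "\<forall>x\<in>B \<times> B. (\<Sum>n\<le>N. a n * coord (snd x) (idpow n (fst x))) = 0"
    using finite_family_relation[of "B \<times> B" "\<lambda>n x. coord (snd x) (idpow n (fst x))"] B_finite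
    by (auto simp del: idpow.simps)
  \<comment> \<open>Convolving a relation among the powers with \<open>S\<close> lowers all
    exponents. After \<open>m\<close> rounds the first nonzero term has exponent zero, and one more
    round makes it a multiple of \<open>S\<close>.\<close>
  define m where "m = (LEAST n. a n \<noteq> 0)"
  have am: "a m \<noteq> 0" unfolding m_def by (rule LeastI_ex) (use a(1) in blast)
  have alt: "a n = 0" if "n < m" for n using not_less_Least[of n "\<lambda>n. a n \<noteq> 0"] that unfolding m_def by blast
  have mN: "m \<le> N" using a(1) unfolding m_def by (meson Least_le le_trans)
  have rel: "f (\<Sum>n\<in>{j..N}. s (a n) (idpow (n - j) x)) = 0" if j: "j \<le> m" and f: "functional f" for j x f
    using j f
  proof (induction j arbitrary: x f)
    case 0
    note f = 0(2)
    have "(\<Sum>n\<le>N. s (a n) (idpow n b)) = 0" if b: "b \<in> B" for b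
    proof -
      have "coord c (\<Sum>n\<le>N. s (a n) (idpow n b)) = 0" if "c \<in> B" for c
        using a(2) b that by (simp add: functional_sum[OF functional_coord] functional_scale[OF functional_coord])
      then show ?thesis using sum_coord[of "\<Sum>n\<le>N. s (a n) (idpow n b)"] by simp
    qed
    moreover have op: "operator (\<lambda>x. \<Sum>n\<le>N. s (a n) (idpow n x))"
      by (simp add: operator_def operator_add[OF operator_idpow] operator_scale[OF operator_idpow]
          scale_right_distrib sum.distrib scale_sum_right mult.commute)
    ultimately have "(\<Sum>n\<le>N. s (a n) (idpow n x)) = 0"
      using operator_expand[OF op, of x] by simp
    then show ?case using functional_0[OF f] by (simp add: atLeast0AtMost)
  next
    case (Suc j)
    note f = Suc.prems(2)
    have 0: "sw x (\<lambda>u v. f ((\<Sum>n\<in>{j..N}. s (a n) (idpow (n - j) u)) * S v)) = 0"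
    proof -
      have fS: "functional (\<lambda>y. f (y * S v))" for v by (intro functional_comp[OF f] fn_intros)
      show ?thesis using Suc.IH[OF _ fS] Suc.prems(1) by (simp add: sw_def)
    qed
    have jN: "{j..N} = insert j {Suc j..N}" using Suc.prems(1) mN by auto
    have "sw x (\<lambda>u v. f ((\<Sum>n\<in>{j..N}. s (a n) (idpow (n - j) u)) * S v)) =
        (\<Sum>n\<in>{j..N}. a n * sw x (\<lambda>u v. f (idpow (n - j) u * S v)))"
      by (simp add: sum_distrib_right functional_sum[OF f] scale_mult_left functional_scale[OF f] sw_sum sw_times)
    also have "\<dots> = (\<Sum>n\<in>{Suc j..N}. a n * sw x (\<lambda>u v. f (idpow (n - j) u * S v)))"
      unfolding jN using alt[of j] Suc.prems(1) by (simp del: idpow.simps)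
    also have "\<dots> = (\<Sum>n\<in>{Suc j..N}. a n * f (idpow (n - Suc j) x))"
    proof (intro sum.cong refl)
      fix n assume "n \<in> {Suc j..N}"
      then have "n - j = Suc (n - Suc j)" by auto
      then show "a n * sw x (\<lambda>u v. f (idpow (n - j) u * S v)) = a n * f (idpow (n - Suc j) x)"
        by (simp only: idpow_antipode(1)[OF f])
    qed
    finally show ?case using 0 by (simp add: functional_sum[OF f] functional_scale[OF f])
  qed
  define r where "r n = - a (n + Suc m) / a m" for n
  have S: "S x = (\<Sum>n<N - m. s (r n) (idpow n x))" for x
  proof (rule functional_separate)
    fix f assume f: "functional f"
    have fS: "functional (\<lambda>y. f (y * S v))" for v by (intro functional_comp[OF f] fn_intros)
    have mN': "{m..N} = insert m {Suc m..N}" using mN by auto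
    have "0 = sw x (\<lambda>u v. f ((\<Sum>n\<in>{m..N}. s (a n) (idpow (n - m) u)) * S v))"
      using rel[OF le_refl fS] by (simp add: sw_def)
    also have "\<dots> = (\<Sum>n\<in>{m..N}. a n * sw x (\<lambda>u v. f (idpow (n - m) u * S v)))"
      by (simp add: sum_distrib_right functional_sum[OF f] scale_mult_left functional_scale[OF f] sw_sum sw_times)
    also have "\<dots> = a m * f (S x) + (\<Sum>n\<in>{Suc m..N}. a n * sw x (\<lambda>u v. f (idpow (n - m) u * S v)))"
      unfolding mN' using idpow_antipode(2)[OF f, of x] by (simp del: idpow.simps)
    also have "(\<Sum>n\<in>{Suc m..N}. a n * sw x (\<lambda>u v. f (idpow (n - m) u * S v))) =
        (\<Sum>n\<in>{Suc m..N}. a n * f (idpow (n - Suc m) x))"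
    proof (intro sum.cong refl)
      fix n assume "n \<in> {Suc m..N}"
      then have "n - m = Suc (n - Suc m)" by auto
      then show "a n * sw x (\<lambda>u v. f (idpow (n - m) u * S v)) = a n * f (idpow (n - Suc m) x)"
        by (simp only: idpow_antipode(1)[OF f])
    qed
    also have "\<dots> = (\<Sum>n<N - m. a (n + Suc m) * f (idpow n x))"
      by (rule sum.reindex_bij_witness[of _ "\<lambda>n. n + Suc m" "\<lambda>n. n - Suc m"]) auto
    finally have "a m * f (S x) = - (\<Sum>n<N - m. a (n + Suc m) * f (idpow n x))"
      by (simp add: eq_neg_iff_add_eq_0)
    then have "f (S x) = - (\<Sum>n<N - m. a (n + Suc m) * f (idpow n x)) / a m"
      using am by (simp add: field_simps)
    also have "\<dots> = (\<Sum>n<N - m. r n * f (idpow n x))"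
      by (simp add: r_def sum_negf[symmetric] sum_divide_distrib)
    finally show "f (S x) = f (\<Sum>n<N - m. s (r n) (idpow n x))"
      by (simp add: functional_sum[OF f] functional_scale[OF f])
  qed
  show ?thesis by (rule that[OF S])
qed

text \<open>By \<open>antipode_idpow\<close> the antipode is expressed through multiplication and
  comultiplication, under which \<open>K\<close> is stable.\<close>

theorem subbialgebra_hopf_subalgebra:
  assumes K: "subalgebra s K" "\<And>x. x \<in> K \<Longrightarrow> \<Delta> x \<in> tensor_sub s s K K"
  shows "hopf_subalgebra s \<Delta> S K"
proof -
  have sub: "subspace K" and one: "1 \<in> K" and mult: "\<And>x y. x \<in> K \<Longrightarrow> y \<in> K \<Longrightarrow> x * y \<in> K"
    using K(1) by (auto simp: subalgebra_def)
  have pow: "idpow n x \<in> K" if "x \<in> K" for n x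
    using that
  proof (induction n arbitrary: x)
    case 0
    show ?case by (simp add: subspace_scale[OF sub one])
  next
    case (Suc n)
    show ?case
      unfolding idpow.simps
      by (rule sweedler_mem[OF K(2)[OF Suc.prems] bilinear_idpow sub]) (intro mult Suc.IH)
  qed
  obtain N a where S: "\<And>x. S x = (\<Sum>n<N. s (a n) (idpow n x))" by (rule antipode_idpow) (rule that)
  have "S x \<in> K" if "x \<in> K" for x
    unfolding S by (intro subspace_sum[OF sub] subspace_scale[OF sub] pow that)
  then show ?thesis using K by (simp add: hopf_subalgebra_def)
qed

end

section \<open>Biproducts\<close>

lemma bilinear_map_comp:
  assumes "bilinear_map s t u f" "Vector_Spaces.linear u w g"
  shows "bilinear_map s t w (\<lambda>x y. g (f x y))"
  using assms by (auto simp: bilinear_map_def Vector_Spaces.linear_iff)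

locale fd_biproduct =
  biproduct sA \<Delta>A \<epsilon>A SA sR act \<rho> \<Delta>R \<epsilon>R SR sH \<Delta>H \<epsilon>H SH smash +
  A: ss_hopf sA \<Delta>A \<epsilon>A SA B + RV: vspace sR + HV: hopf_vspace sH \<Delta>H \<epsilon>H SH
  for sA :: "'k::{alg_closed_field,field_char_0} \<Rightarrow> 'a::ring_1 \<Rightarrow> 'a" and \<Delta>A \<epsilon>A SA
    and sR :: "'k \<Rightarrow> 'r::ring_1 \<Rightarrow> 'r" and act (infixr \<open>\<cdot>\<close> 80) and \<rho> \<Delta>R \<epsilon>R SR
    and sH :: "'k \<Rightarrow> 'h::ring_1 \<Rightarrow> 'h" and \<Delta>H \<epsilon>H SH
    and smash :: "'r \<Rightarrow> 'a \<Rightarrow> 'h" (infix \<open>\<sharp>\<close> 70) and B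
begin

lemma vA: "vector_space sA" and vR: "vector_space sR" and vH: "vector_space sH"
  by unfold_locales

lemma act_simps:
  "h \<cdot> (x + y) = h \<cdot> x + h \<cdot> y" "(h + h') \<cdot> x = h \<cdot> x + h' \<cdot> x"
  "h \<cdot> sR c x = sR c (h \<cdot> x)" "sA c h \<cdot> x = sR c (h \<cdot> x)"
  using bilinear_mapD[OF act_bilinear] by auto

lemma smash_simps:
  "r \<sharp> (a + b) = r \<sharp> a + r \<sharp> b" "(r + r') \<sharp> a = r \<sharp> a + r' \<sharp> a"
  "r \<sharp> sA c a = sH c (r \<sharp> a)" "sR c r \<sharp> a = sH c (r \<sharp> a)"
  using bilinear_mapD[OF smash_bilinear] by auto

lemma counitR_simps: "\<epsilon>R (x + y) = \<epsilon>R x + \<epsilon>R y" "\<epsilon>R (sR c x) = c * \<epsilon>R x"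
  using R.counit_linear by (auto simp: Vector_Spaces.linear_iff)

lemma functional_counitR: "RV.functional \<epsilon>R"
  by (simp add: RV.functional_def counitR_simps)

lemma functional_RV: "RV.functional \<phi> \<Longrightarrow> Vector_Spaces.linear sR (*) \<phi>"
  by (simp add: RV.functional_iff)

text \<open>The universal property of the tensor product, carried over to \<open>H\<close> along
  \<open>smash_bij\<close>; linear maps out of \<open>H\<close> are built with it.\<close>

lemma smash_lift:
  assumes F: "bilinear_map sR sA sX F"
  obtains \<Theta> where "Vector_Spaces.linear sH sX \<Theta>" "\<And>r a. \<Theta> (r \<sharp> a) = F r a"
proof -
  interpret T: vector_space "fscale :: 'k \<Rightarrow> ('k, 'r, 'a) tensor \<Rightarrow> _" by (rule vector_space_fscale)
  let ?T = "tensor_space sR sA"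
  let ?\<sigma> = "\<lambda>t. sweedler sR sA t smash"
  let ?i = "inv_into ?T ?\<sigma>"
  let ?\<Theta> = "\<lambda>h. sweedler sR sA (?i h) F"
  have sub: "T.subspace ?T" unfolding tensor_sub_def by (rule T.subspace_span)
  have iT: "?i h \<in> ?T" for h
    using smash_bij inv_into_into[of h ?\<sigma> ?T] unfolding bij_betw_def by blast
  have \<sigma>i: "?\<sigma> (?i h) = h" for h
    using smash_bij f_inv_into_f[of h ?\<sigma> ?T] unfolding bij_betw_def by blast
  have i\<sigma>: "?i h = z" if "z \<in> ?T" "?\<sigma> z = h" for z h
    using smash_bij inv_into_f_f[of ?\<sigma> ?T z] that unfolding bij_betw_def by blast
  have add: "?i (x + y) = ?i x + ?i y" for x y
    by (rule i\<sigma>[OF T.subspace_add[OF sub iT iT]])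
      (simp only: tensor_universal_property(2)[OF smash_bilinear iT iT] \<sigma>i)
  have scale: "?i (sH c x) = fscale c (?i x)" for c x
    by (rule i\<sigma>[OF T.subspace_scale[OF sub iT]])
      (simp only: tensor_universal_property(3)[OF smash_bilinear iT] \<sigma>i)
  have "Vector_Spaces.linear sH sX ?\<Theta>"
    unfolding Vector_Spaces.linear_iff
    using vH bilinear_mapD(7)[OF F] tensor_universal_property(2,3)[OF F iT] iT
    by (simp only: add scale) simp
  moreover have "?\<Theta> (r \<sharp> a) = F r a" for r a
  proof -
    have "?i (r \<sharp> a) = r \<otimes>[sR,sA] a"
      by (rule i\<sigma>[OF tens_in_tensor_space tensor_universal_property(1)[OF smash_bilinear]])
    then show ?thesis by (simp only: tensor_universal_property(1)[OF F])
  qed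
  ultimately show ?thesis by (rule that)
qed

lemma smash_spans: "h \<in> H.span {r \<sharp> a | r a. True}"
proof -
  obtain z where z: "z \<in> tensor_space sR sA" "h = sweedler sR sA z smash"
    using smash_bij unfolding bij_betw_def by (metis UNIV_I imageE)
  show ?thesis unfolding z(2)
    by (rule sweedler_mem[OF z(1) smash_bilinear H.subspace_span]) (intro H.span_base, blast)
qed

definition proj :: "'h \<Rightarrow> 'r" where
  "proj = (SOME \<Theta>. Vector_Spaces.linear sH sR \<Theta> \<and> (\<forall>r a. \<Theta> (r \<sharp> a) = sR (\<epsilon>A a) r))"

lemma linear_proj: "Vector_Spaces.linear sH sR proj"
  and proj_smash: "proj (r \<sharp> a) = sR (\<epsilon>A a) r"
proof -
  have b: "bilinear_map sR sA sR (\<lambda>r a. sR (\<epsilon>A a) r)"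
    by (intro bilinear_mapI vA vR)
      (auto simp: A.counit_add A.counit_scale R.scale_left_distrib R.scale_right_distrib mult.commute)
  have "\<exists>\<Theta>. Vector_Spaces.linear sH sR \<Theta> \<and> (\<forall>r a. \<Theta> (r \<sharp> a) = sR (\<epsilon>A a) r)"
    by (rule smash_lift[OF b]) blast
  from someI_ex[OF this] show "Vector_Spaces.linear sH sR proj" "proj (r \<sharp> a) = sR (\<epsilon>A a) r"
    unfolding proj_def by blast+
qed

lemma proj_smash_1: "proj (r \<sharp> 1) = r"
  by (simp add: proj_smash A.counit_one)

lemma smash_1_inj: "r \<sharp> 1 = r' \<sharp> 1 \<Longrightarrow> r = r'"
  by (metis proj_smash_1)

lemma comult_smash_1:
  assumes \<beta>: "bilinear_map sH sH (*) \<beta>"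
  shows "\<Delta>H (r \<sharp> 1) \<beta> = sweedler sR sR (\<Delta>R r) (\<lambda>x y. sweedler sA sR (\<rho> y) (\<lambda>m n. \<beta> (x \<sharp> m) (n \<sharp> 1)))"
proof -
  note tt = bilinear_mapD[OF bilinear_map_tens[OF vH vH]]
  have b1: "bilinear_map sA sR fscale (\<lambda>m n. (x \<sharp> (m * g1)) \<otimes>[sH,sH] (n \<sharp> g2))" for x g1 g2
    by (intro bilinear_mapI vA vR vector_space_fscale)
      (simp_all add: smash_simps tt distrib_right A.scale_mult_left)
  have b2: "bilinear_map sA sA fscale (\<lambda>g1 g2. sweedler sA sR (\<rho> y) (\<lambda>m n. (x \<sharp> (m * g1)) \<otimes>[sH,sH] (n \<sharp> g2)))" for x y
    unfolding bilinear_map_def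
    by (intro conjI allI sweedler_linear_parameter[OF coact_in b1])
      (auto simp: Vector_Spaces.linear_iff vA vector_space_fscale smash_simps tt distrib_left A.scale_mult_right)
  have b3: "bilinear_map sR sR fscale (\<lambda>x y. sweedler sA sR (\<rho> y) (\<lambda>m n. (x \<sharp> (m * 1)) \<otimes>[sH,sH] (n \<sharp> 1)))"
    unfolding bilinear_map_def
    by (intro conjI allI sweedler_linear_parameter[OF coact_in b1] sweedler_linear[OF coact_linear coact_in b1])
      (auto simp: Vector_Spaces.linear_iff vR vector_space_fscale smash_simps tt)
  have "\<Delta>H (r \<sharp> 1) = sweedler sR sR (\<Delta>R r) (\<lambda>x y. sweedler sA sR (\<rho> y) (\<lambda>m n. (x \<sharp> (m * 1)) \<otimes>[sH,sH] (n \<sharp> 1)))"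
    unfolding smash_comult A.comult_one tensor_universal_property(1)[OF b2] ..
  then have "\<Delta>H (r \<sharp> 1) \<beta> =
      sweedler sR sR (\<Delta>R r) (\<lambda>x y. sweedler sA sR (\<rho> y) (\<lambda>m n. ((x \<sharp> (m * 1)) \<otimes>[sH,sH] (n \<sharp> 1)) \<beta>))"
    unfolding sweedler_push[OF b1 linear_eval coact_in, symmetric]
    by (simp only: sweedler_push[OF b3 linear_eval R.comult_in])
  also have "\<dots> = sweedler sR sR (\<Delta>R r) (\<lambda>x y. sweedler sA sR (\<rho> y) (\<lambda>m n. \<beta> (x \<sharp> m) (n \<sharp> 1)))"
    using \<beta> by (simp add: tens_def)
  finally show ?thesis .
qed

text \<open>The coaction seen as an action of the dual algebra of \<open>A\<close>.\<close>

definition coev :: "('a \<Rightarrow> 'k) \<Rightarrow> 'r \<Rightarrow> 'r" where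
  "coev g r = sweedler sA sR (\<rho> r) (\<lambda>m n. sR (g m) n)"

lemma coev_bilinear:
  assumes g: "A.functional g"
  shows "bilinear_map sA sR sR (\<lambda>m n. sR (g m) n)"
  by (intro bilinear_mapI vA vR)
    (simp_all add: A.functional_add[OF g] A.functional_scale[OF g] R.scale_left_distrib R.scale_right_distrib mult.commute)

lemma operator_coev: "A.functional g \<Longrightarrow> RV.operator (coev g)"
  unfolding RV.operator_iff coev_def by (rule sweedler_linear[OF coact_linear coact_in coev_bilinear])

lemma functional_pair_bilinear:
  assumes "A.functional g" "RV.functional \<phi>"
  shows "bilinear_map sA sR (*) (\<lambda>m n. g m * \<phi> n)"
  by (intro bilinear_mapI vA vR vector_space_mult)
    (simp_all add: A.functional_add[OF assms(1)] A.functional_scale[OF assms(1)]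
      RV.functional_add[OF assms(2)] RV.functional_scale[OF assms(2)] algebra_simps)

lemma functional_coev:
  assumes g: "A.functional g" and \<phi>: "RV.functional \<phi>"
  shows "\<phi> (coev g r) = sweedler sA sR (\<rho> r) (\<lambda>m n. g m * \<phi> n)"
  unfolding coev_def sweedler_push[OF coev_bilinear[OF g] functional_RV[OF \<phi>] coact_in]
  by (simp add: RV.functional_scale[OF \<phi>])

text \<open>Coassociativity of the coaction tested against \<open>h\<close>, \<open>g\<close> and
  \<open>\<phi>\<close>; the order is reversed as for \<open>hit\<close>.\<close>

lemma coev_coev:
  assumes g: "A.functional g" and h: "A.functional h"
  shows "coev g (coev h r) = coev (A.conv h g) r"
proof (rule RV.functional_separate)
  fix \<phi> assume \<phi>: "RV.functional \<phi>"
  let ?\<gamma> = "\<lambda>m n. g m * \<phi> n"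
  note bg = functional_pair_bilinear[OF g \<phi>]
  let ?ev = "\<lambda>z :: ('k, 'a, ('k, 'a, 'r) tensor) tensor. z (\<lambda>y t. h y * t ?\<gamma>)"
  have lh: "Vector_Spaces.linear sA (*) h" using h by (simp add: A.functional_iff)
  have pure: "?ev (y \<otimes>[sA,fscale] t) = h y * t ?\<gamma>" for y t
    using bilinear_eval_inner[OF lh, of ?\<gamma>] by (simp add: tens_def)
  have pure2: "?ev (y \<otimes>[sA,fscale] (z \<otimes>[sA,sR] n)) = h y * g z * \<phi> n" for y z n
    unfolding pure using bg by (simp add: tens_def)
  note tt = bilinear_mapD[OF bilinear_map_tens[OF vA vR]]
  note tf = bilinear_mapD[OF bilinear_map_tens[OF vA vector_space_fscale]]
  have b1: "bilinear_map sA sA fscale (\<lambda>m1 m2. m1 \<otimes>[sA,fscale] (m2 \<otimes>[sA,sR] n))" for n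
    by (intro bilinear_mapI vA vector_space_fscale) (simp_all add: tt tf)
  have b2: "bilinear_map sA sR fscale
      (\<lambda>m n. sweedler sA sA (\<Delta>A m) (\<lambda>m1 m2. m1 \<otimes>[sA,fscale] (m2 \<otimes>[sA,sR] n)))"
    unfolding bilinear_map_def
    by (intro conjI allI sweedler_linear_parameter[OF A.comult_in b1]
        sweedler_linear[OF A.comult_linear A.comult_in b1])
      (auto simp: Vector_Spaces.linear_iff vR vector_space_fscale tt tf)
  have b3: "bilinear_map sA sR fscale (\<lambda>m n. m \<otimes>[sA,fscale] \<rho> n)"
    using coact_linear
    by (intro bilinear_mapI vA vR vector_space_fscale) (auto simp: Vector_Spaces.linear_iff tf)
  have b4: "bilinear_map sA sR sR (\<lambda>m n. sR (h m) n)" by (rule coev_bilinear[OF h])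
  have lin: "Vector_Spaces.linear sR (*) (\<lambda>x. \<phi> (coev g x))"
    using RV.functional_comp[OF \<phi> operator_coev[OF g]] by (simp add: RV.functional_iff)
  have "\<phi> (coev g (coev h r)) = sweedler sA sR (\<rho> r) (\<lambda>m n. \<phi> (coev g (sR (h m) n)))"
    unfolding coev_def[of h] by (rule sweedler_push[OF b4 lin coact_in])
  also have "\<dots> = sweedler sA sR (\<rho> r) (\<lambda>m n. h m * \<rho> n ?\<gamma>)"
    using lin by (simp add: Vector_Spaces.linear_iff functional_coev[OF g \<phi>] sweedler_eval[OF bg coact_in])
  also have "\<dots> = ?ev (sweedler sA sR (\<rho> r) (\<lambda>m n. m \<otimes>[sA,fscale] \<rho> n))"
    unfolding sweedler_push[OF b3 linear_eval coact_in] pure ..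
  also have "\<dots> = ?ev (sweedler sA sR (\<rho> r) (\<lambda>m n. sweedler sA sA (\<Delta>A m)
         (\<lambda>m1 m2. m1 \<otimes>[sA,fscale] (m2 \<otimes>[sA,sR] n))))"
    unfolding coact_coassoc ..
  also have "\<dots> = sweedler sA sR (\<rho> r) (\<lambda>m n. sweedler sA sA (\<Delta>A m) (\<lambda>m1 m2. h m1 * g m2 * \<phi> n))"
    unfolding sweedler_push[OF b2 linear_eval coact_in] sweedler_push[OF b1 linear_eval A.comult_in] pure2 ..
  also have "\<dots> = sweedler sA sR (\<rho> r) (\<lambda>m n. A.conv h g m * \<phi> n)"
  proof -
    have "A.bifunctional (\<lambda>m1 m2. h m1 * g m2 * c)" for c
      by (intro A.bifunctionalI A.functional_times A.functional_times_right g h)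
    then show ?thesis by (simp add: A.sw_sweedler A.conv_def A.sw_times_right)
  qed
  also have "\<dots> = \<phi> (coev (A.conv h g) r)" by (rule functional_coev[OF A.functional_conv \<phi>, symmetric])
  finally show "\<phi> (coev g (coev h r)) = \<phi> (coev (A.conv h g) r)" .
qed

lemma counitR_coev:
  assumes g: "A.functional g"
  shows "\<epsilon>R (coev g r) = g 1 * \<epsilon>R r"
proof -
  have lg: "Vector_Spaces.linear sA (*) g" using g by (simp add: A.functional_iff)
  have b: "bilinear_map sA sR sA (\<lambda>m n. sA (\<epsilon>R n) m)"
    by (intro bilinear_mapI vA vR)
      (simp_all add: counitR_simps A.scale_left_distrib A.scale_right_distrib mult.commute)
  have "g (sA (\<epsilon>R r) 1) = sweedler sA sR (\<rho> r) (\<lambda>m n. g (sA (\<epsilon>R n) m))"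
    unfolding counit_coact[symmetric] by (rule sweedler_push[OF b lg coact_in])
  then show ?thesis
    by (simp add: functional_coev[OF g functional_counitR] A.functional_scale[OF g] mult.commute)
qed

context
  fixes V
  assumes V: "left_coideal sH \<Delta>H ((\<lambda>r. r \<sharp> 1) ` V)"
begin

lemma coideal_subspace: "R.subspace V"
proof -
  have sub: "H.subspace ((\<lambda>r. r \<sharp> 1) ` V)" using V by (simp add: left_coideal_def)
  have mem: "r \<in> V" if "r \<sharp> 1 \<in> (\<lambda>r. r \<sharp> 1) ` V" for r using that smash_1_inj by blast
  show ?thesis
    unfolding R.subspace_def
  proof (intro conjI ballI allI)
    have "0 \<sharp> 1 = (0 :: 'h)" using smash_simps(4)[of 0 0 1] by simp
    then show "0 \<in> V" using H.subspace_0[OF sub] by (intro mem) simp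
    show "x + y \<in> V" if "x \<in> V" "y \<in> V" for x y
      by (intro mem) (use that in \<open>auto simp: smash_simps intro!: H.subspace_add[OF sub]\<close>)
    show "sR c x \<in> V" if "x \<in> V" for c x
      by (intro mem) (use that in \<open>auto simp: smash_simps intro!: H.subspace_scale[OF sub]\<close>)
  qed
qed

text \<open>\<open>coev g\<close> arises from the coproduct of \<open>H\<close> by applying to the
  left leg the functional \<open>\<gamma>\<close>, the counit of \<open>R\<close> times
  \<open>g\<close>, and \<open>proj\<close> to the right leg, which stays in
  \<open>V\<close>.\<close>

lemma coideal_coev:
  assumes g: "A.functional g" and v: "v \<in> V"
  shows "coev g v \<in> V"
proof -
  have bg: "bilinear_map sR sA (*) (\<lambda>r a. \<epsilon>R r * g a)"
    by (intro bilinear_mapI vA vR vector_space_mult)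
      (simp_all add: counitR_simps A.functional_add[OF g] A.functional_scale[OF g] algebra_simps)
  obtain \<gamma> where \<gamma>: "Vector_Spaces.linear sH (*) \<gamma>" "\<And>r a. \<gamma> (r \<sharp> a) = \<epsilon>R r * g a"
    by (rule smash_lift[OF bg]) (rule that)
  let ?\<Phi> = "\<lambda>x y. sR (\<gamma> x) (proj y)"
  have b\<Phi>: "bilinear_map sH sH sR ?\<Phi>"
    using \<gamma>(1) linear_proj
    by (intro bilinear_mapI vH vR)
      (auto simp: Vector_Spaces.linear_iff R.scale_left_distrib R.scale_right_distrib mult.commute)
  have \<Delta>v: "\<Delta>H (v \<sharp> 1) \<in> tensor_sub sH sH UNIV ((\<lambda>r. r \<sharp> 1) ` V)"
    using V v by (auto simp: left_coideal_def)
  have "sweedler sH sH (\<Delta>H (v \<sharp> 1)) ?\<Phi> \<in> V"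
    by (rule sweedler_mem[OF \<Delta>v b\<Phi> coideal_subspace])
      (auto simp: proj_smash_1 intro: R.subspace_scale[OF coideal_subspace])
  also have "sweedler sH sH (\<Delta>H (v \<sharp> 1)) ?\<Phi> = coev g v"
  proof (rule RV.functional_separate)
    fix \<psi> assume \<psi>: "RV.functional \<psi>"
    have b: "bilinear_map sH sH (*) (\<lambda>x y. \<psi> (?\<Phi> x y))"
      by (rule bilinear_map_comp[OF b\<Phi> functional_RV[OF \<psi>]])
    have bc: "bilinear_map sR sR sR (\<lambda>x y. sR (\<epsilon>R x) y)"
      by (intro bilinear_mapI vR)
        (simp_all add: counitR_simps R.scale_left_distrib R.scale_right_distrib mult.commute)
    have lc: "Vector_Spaces.linear sR (*) (\<lambda>x. \<psi> (coev g x))"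
      using RV.functional_comp[OF \<psi> operator_coev[OF g]] by (simp add: RV.functional_iff)
    have bs: "bilinear_map sA sR (*) (\<lambda>m n. c * (g m * \<psi> n))" for c
      using bilinear_mapD[OF functional_pair_bilinear[OF g \<psi>]]
      by (intro bilinear_mapI vA vR vector_space_mult) (auto simp: algebra_simps)
    have "\<psi> (sweedler sH sH (\<Delta>H (v \<sharp> 1)) ?\<Phi>) = sweedler sH sH (\<Delta>H (v \<sharp> 1)) (\<lambda>x y. \<psi> (?\<Phi> x y))"
      by (rule sweedler_push[OF b\<Phi> functional_RV[OF \<psi>] H.comult_in])
    also have "\<dots> = \<Delta>H (v \<sharp> 1) (\<lambda>x y. \<psi> (?\<Phi> x y))"
      by (rule sweedler_eval[OF b H.comult_in])
    also have "\<dots> = sweedler sR sR (\<Delta>R v) (\<lambda>x y. sweedler sA sR (\<rho> y) (\<lambda>m n. \<epsilon>R x * (g m * \<psi> n)))"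
      unfolding comult_smash_1[OF b] \<gamma>(2) proj_smash_1 by (simp add: RV.functional_scale[OF \<psi>] mult.assoc)
    also have "\<dots> = sweedler sR sR (\<Delta>R v) (\<lambda>x y. \<psi> (coev g (sR (\<epsilon>R x) y)))"
    proof -
      have "sweedler sA sR (\<rho> y) (\<lambda>m n. c * (g m * \<psi> n)) = \<psi> (coev g (sR c y))" for c y
      proof -
        have "Vector_Spaces.linear (*) (*) (\<lambda>x :: 'k. c * x)"
          by (auto simp: Vector_Spaces.linear_iff vector_space_mult algebra_simps)
        from sweedler_push[OF functional_pair_bilinear[OF g \<psi>] this coact_in, of y]
        show ?thesis
          using lc by (simp add: Vector_Spaces.linear_iff functional_coev[OF g \<psi>])
      qed
      then show ?thesis by simp
    qed
    also have "\<dots> = \<psi> (coev g v)"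
      using sweedler_push[OF bc lc R.comult_in, of v] by (simp add: R.counit_left)
    finally show "\<psi> (sweedler sH sH (\<Delta>H (v \<sharp> 1)) ?\<Phi>) = \<psi> (coev g v)" .
  qed
  finally show ?thesis .
qed

text \<open>The counit axiom is applied to the leg of the coproduct that lies in
  \<open>V\<close>.\<close>

lemma coideal_counit:
  assumes "\<And>v. v \<in> V \<Longrightarrow> \<epsilon>R v = 0" and v: "v \<in> V"
  shows "v = 0"
proof -
  have b: "bilinear_map sH sH sH (\<lambda>x y. sH (\<epsilon>H y) x)"
    using HV.functional_add[OF HV.functional_counit] HV.functional_scale[OF HV.functional_counit]
    by (intro bilinear_mapI vH) (auto simp: H.scale_left_distrib H.scale_right_distrib mult.commute)
  have \<Delta>v: "\<Delta>H (v \<sharp> 1) \<in> tensor_sub sH sH UNIV ((\<lambda>r. r \<sharp> 1) ` V)"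
    using V v by (auto simp: left_coideal_def)
  have "sweedler sH sH (\<Delta>H (v \<sharp> 1)) (\<lambda>x y. sH (\<epsilon>H y) x) \<in> {0}"
    by (rule sweedler_mem[OF \<Delta>v b H.subspace_single_0]) (auto simp: smash_counit assms(1))
  then have "v \<sharp> 1 = 0" by (simp add: H.counit_right)
  also have "(0 :: 'h) = 0 \<sharp> 1" using smash_simps(4)[of 0 0 1] by simp
  finally show ?thesis by (rule smash_1_inj)
qed

end

text \<open>\<open>x * (h \<cdot> y)\<close> is \<open>h2 \<cdot> ((S h1 \<cdot> x) * y)\<close>,
  because \<open>h2 * S h1\<close> cancels when \<open>S\<close> is an involution; the inner product
  is a multiple of \<open>y\<close>.\<close>

lemma act_invariant_integral:
  assumes y: "\<And>x. x * y = sR (\<epsilon>R x) y"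
  shows "x * (h \<cdot> y) = sR (\<epsilon>R x) (h \<cdot> y)"
proof (rule RV.functional_separate)
  fix \<phi> assume \<phi>: "RV.functional \<phi>"
  have fx: "A.functional (\<lambda>h. \<phi> (z * ((G h \<cdot> u) * w)))" if "A.operator G" for z u w G
    using that by (simp add: A.functional_def A.operator_def RV.functional_add[OF \<phi>] RV.functional_scale[OF \<phi>]
        act_simps distrib_left distrib_right R.scale_mult_left R.scale_mult_right)
  have f1: "A.functional (\<lambda>h. \<phi> ((G h \<cdot> u) * w))" "A.functional (\<lambda>h. \<phi> (w * (G h \<cdot> u)))"
    "A.functional (\<lambda>h. \<phi> (G h \<cdot> u))" if "A.operator G" for u w G
    using that by (simp_all add: A.functional_def A.operator_def RV.functional_add[OF \<phi>] RV.functional_scale[OF \<phi>]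
        act_simps distrib_left distrib_right R.scale_mult_left R.scale_mult_right)
  have f2: "A.functional (\<lambda>a. \<phi> (b \<cdot> ((SA a \<cdot> x) * y)))" for b
    by (simp add: A.functional_def RV.functional_add[OF \<phi>] RV.functional_scale[OF \<phi>]
        act_simps distrib_right R.scale_mult_left A.antipode_add A.antipode_scale)
  have dist: "\<phi> (b \<cdot> (u * w)) = A.sw b (\<lambda>p q. \<phi> ((p \<cdot> u) * (q \<cdot> w)))" for b u w
  proof -
    have bb: "bilinear_map sA sA sR (\<lambda>p q. (p \<cdot> u) * (q \<cdot> w))"
      by (intro bilinear_mapI vA vR)
        (simp_all add: act_simps distrib_left distrib_right R.scale_mult_left R.scale_mult_right)
    have "\<phi> (b \<cdot> (u * w)) = sweedler sA sA (\<Delta>A b) (\<lambda>p q. \<phi> ((p \<cdot> u) * (q \<cdot> w)))"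
      unfolding act_mult_distrib by (rule sweedler_push[OF bb functional_RV[OF \<phi>] A.comult_in])
    also have "\<dots> = A.sw b (\<lambda>p q. \<phi> ((p \<cdot> u) * (q \<cdot> w)))"
      by (rule A.sw_sweedler) (intro A.bifunctionalI f1 A.operator_id)
    finally show ?thesis .
  qed
  have flip: "A.sw b (\<lambda>a p. f (p * SA a)) = \<epsilon>A b * f 1" if f: "A.functional f" for f b
  proof -
    have "A.sw (SA b) (\<lambda>a c. f (SA a * c)) = A.sw b (\<lambda>a c. f (SA (SA c) * SA a))"
      by (rule A.sw_antipode) (intro A.bifunctionalI A.functional_comp[OF f] A.fn_intros)
    then show ?thesis
      using A.sw_antipode_left[OF f, of "SA b"] by (simp add: A.antipode_involution A.counit_antipode)
  qed
  have "A.sw h (\<lambda>a b. \<phi> (b \<cdot> ((SA a \<cdot> x) * y))) = A.sw h (\<lambda>a b. A.sw b (\<lambda>p q. \<phi> (((p * SA a) \<cdot> x) * (q \<cdot> y))))"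
    unfolding dist act_mult ..
  also have "\<dots> = A.sw h (\<lambda>c q. A.sw c (\<lambda>a p. \<phi> (((p * SA a) \<cdot> x) * (q \<cdot> y))))"
    by (rule A.sw_coassoc[symmetric])
  also have "\<dots> = A.sw h (\<lambda>c q. \<epsilon>A c * \<phi> (x * (q \<cdot> y)))"
    using flip[OF f1(1)[OF A.operator_id]] by (simp add: act_one)
  also have "\<dots> = \<phi> (x * (h \<cdot> y))"
    by (rule A.sw_counit_left) (intro f1 A.operator_id)
  finally have "\<phi> (x * (h \<cdot> y)) = A.sw h (\<lambda>a b. \<phi> (b \<cdot> ((SA a \<cdot> x) * y)))" by simp
  also have "\<dots> = A.sw h (\<lambda>a b. \<epsilon>R x * (\<epsilon>A a * \<phi> (b \<cdot> y)))"
    by (simp add: y counit_act A.counit_antipode act_simps RV.functional_scale[OF \<phi>] mult_ac)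
  also have "\<dots> = \<epsilon>R x * \<phi> (h \<cdot> y)"
    unfolding A.sw_times by (subst A.sw_counit_left) (intro f1 A.operator_id refl)+
  finally show "\<phi> (x * (h \<cdot> y)) = \<phi> (sR (\<epsilon>R x) (h \<cdot> y))" by (simp add: RV.functional_scale[OF \<phi>])
qed

text \<open>Acting with the integral of \<open>A\<close> on an integral of \<open>R\<close> gives an
  \<open>A\<close>-invariant one, \<open>m\<close>. Invariance makes \<open>m \<sharp> A.Lam\<close>
  an integral of \<open>H\<close> of counit \<open>1\<close>, and
  \<open>total_integral_finite_dimensional\<close> applies.\<close>

theorem finite_dimensional:
  assumes "semisimple_algebra sR"
  obtains C where "finite C" "H.independent C" "H.span C = UNIV"
proof -
  obtain l where l: "\<epsilon>R l = 1" "\<And>x. x * l = sR (\<epsilon>R x) l"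
  proof -
    have "k_algebra sR" by unfold_locales
    from semisimple_left_integral[OF this assms R.counit_linear counit_mult counit_unit]
    show ?thesis using that by blast
  qed
  define m where "m = A.Lam \<cdot> l"
  have em: "\<epsilon>R m = 1" by (simp add: m_def counit_act A.counit_Lam l(1))
  have xm: "x * m = sR (\<epsilon>R x) m" for x unfolding m_def by (rule act_invariant_integral[OF l(2)])
  have hm: "h \<cdot> m = sR (\<epsilon>A h) m" for h
    by (simp add: m_def act_mult[symmetric] A.mult_Lam act_simps)
  define t where "t = m \<sharp> A.Lam"
  have et: "\<epsilon>H t = 1" by (simp add: t_def smash_counit em A.counit_Lam)
  have gen: "(r \<sharp> a) * t = sH (\<epsilon>H (r \<sharp> a)) t" for r a
  proof -
    have b: "bilinear_map sA sA sA (\<lambda>a b. sA (\<epsilon>A a) b)"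
      by (intro bilinear_mapI vA)
        (simp_all add: A.counit_add A.counit_scale A.scale_left_distrib A.scale_right_distrib mult.commute)
    have lin: "Vector_Spaces.linear sA sH (\<lambda>b. (r * m) \<sharp> (b * A.Lam))"
      by (simp add: Vector_Spaces.linear_iff vA vH distrib_right A.scale_mult_left smash_simps)
    have "(r \<sharp> a) * t = sweedler sA sA (\<Delta>A a) (\<lambda>g1 g2. (r * m) \<sharp> (sA (\<epsilon>A g1) g2 * A.Lam))"
      unfolding t_def smash_mult
      by (simp add: hm R.scale_mult_right A.scale_mult_left smash_simps)
    also have "\<dots> = (r * m) \<sharp> (a * A.Lam)"
      using sweedler_push[OF b lin A.comult_in, of a] by (simp add: A.counit_left)
    finally show ?thesis by (simp add: t_def xm A.mult_Lam smash_simps smash_counit)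
  qed
  have ht: "h * t = sH (\<epsilon>H h) t" for h
    using smash_spans[of h]
  proof (induction rule: H.span_induct)
    case base
    show ?case
      using HV.functional_add[OF HV.functional_counit] HV.functional_scale[OF HV.functional_counit]
        HV.functional_0[OF HV.functional_counit]
      by (auto simp: H.subspace_def distrib_right H.scale_left_distrib H.scale_mult_left)
  next
    case (step x)
    then show ?case using gen by auto
  qed
  show ?thesis by (rule HV.total_integral_finite_dimensional[OF et ht]) (rule that)
qed

end

section \<open>The coaction on the coideal and the Hopf subalgebra\<close>

lemma sum_apply:
  fixes G :: "'i \<Rightarrow> 'x \<Rightarrow> 'y::comm_monoid_add"
  shows "(\<Sum>i\<in>X. G i) x = (\<Sum>i\<in>X. G i x)"
  by (induction X rule: infinite_finite_induct) auto

lemma (in vspace) dual_family_independent: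
  assumes X: "finite X"
    and dual: "\<And>i. i \<in> X \<Longrightarrow> \<exists>\<theta>. functional \<theta> \<and> (\<forall>j\<in>X. \<theta> (v j) = (if i = j then 1 else 0))"
  shows "inj_on v X" "independent (v ` X)"
proof -
  show inj: "inj_on v X"
  proof (rule inj_onI)
    fix i j assume ij: "i \<in> X" "j \<in> X" "v i = v j"
    obtain \<theta> where \<theta>: "\<forall>j\<in>X. \<theta> (v j) = (if i = j then 1 else (0 :: 'a))" using dual[OF ij(1)] by blast
    have "\<theta> (v i) = 1" using bspec[OF \<theta> ij(1)] by simp
    moreover have "\<theta> (v j) = (if i = j then 1 else 0)" by (rule bspec[OF \<theta> ij(2)])
    ultimately have "(if i = j then 1 else 0) = (1 :: 'a)" unfolding ij(3) by (simp only:)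
    then show "i = j" by (cases "i = j") simp_all
  qed
  show "independent (v ` X)"
  proof
    assume "dependent (v ` X)"
    then obtain u where u: "\<exists>x\<in>v ` X. u x \<noteq> 0" "(\<Sum>x\<in>v ` X. scale (u x) x) = 0"
      using X by (auto simp: dependent_finite)
    then obtain i where i: "i \<in> X" "u (v i) \<noteq> 0" by blast
    obtain \<theta> where \<theta>: "functional \<theta>" "\<And>j. j \<in> X \<Longrightarrow> \<theta> (v j) = (if i = j then 1 else 0)"
      using dual[OF i(1)] by blast
    have "0 = \<theta> (\<Sum>j\<in>X. scale (u (v j)) (v j))"
      using u(2) functional_0[OF \<theta>(1)] by (simp add: sum.reindex[OF inj])
    also have "\<dots> = (\<Sum>j\<in>X. if j = i then u (v i) else 0)"
      unfolding functional_sum[OF \<theta>(1)] functional_scale[OF \<theta>(1)] by (intro sum.cong) (auto simp: \<theta>(2))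
    also have "\<dots> = u (v i)" using X i(1) by simp
    finally show False using i(2) by simp
  qed
qed

lemma (in vector_space) linear_image_span:
  assumes G: "Vector_Spaces.linear t scale G" and x: "x \<in> module.span t X" and Y: "G ` X \<subseteq> span Y"
  shows "G x \<in> span Y"
proof -
  interpret t: vector_space t using G by (simp add: Vector_Spaces.linear_iff)
  have "G 0 = 0" using module_hom.zero[OF module_hom_linearI[OF G]] .
  then have sub: "t.subspace {x. G x \<in> span Y}"
    using G by (auto simp: t.subspace_def Vector_Spaces.linear_iff span_zero span_add span_scale)
  show ?thesis using x by (rule t.span_induct[OF _ sub]) (use Y in auto)
qed

context matrix_basis
begin

lemma comult_c:
  assumes ij: "i \<in> cs D" "j \<in> cs D"
  shows "\<Delta> (c i j) = (\<Sum>l\<in>cs D. c i l \<otimes>[s,s] c l j)"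
proof (rule tensor_space_eqI[OF vs vs comult_in])
  interpret T: vector_space "fscale :: 'k \<Rightarrow> ('k, 'h, 'h) tensor \<Rightarrow> _" by (rule vector_space_fscale)
  show "(\<Sum>l\<in>cs D. c i l \<otimes>[s,s] c l j) \<in> tensor_space s s"
    by (intro T.subspace_sum[OF subspace_tensor_sub] tens_in_tensor_space)
  fix F assume F: "bilinear_map s s (*) F"
  then have F': "bifunctional F" .
  show "\<Delta> (c i j) F = (\<Sum>l\<in>cs D. c i l \<otimes>[s,s] c l j) F"
    using sw_eval[OF F', of "c i j"] sw_c[OF F' ij] F unfolding sum_apply by (simp add: tens_def)
qed

lemma comult_span_c:
  assumes J: "J \<subseteq> Cl" and x: "x \<in> span_c J"
  shows "\<Delta> x \<in> tensor_sub s s (span_c J) (span_c J)"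
proof (rule span_c_induct[OF x J, of "{x. \<Delta> x \<in> tensor_sub s s (span_c J) (span_c J)}", simplified])
  interpret T: vector_space "fscale :: 'k \<Rightarrow> ('k, 'h, 'h) tensor \<Rightarrow> _" by (rule vector_space_fscale)
  note sub = subspace_tensor_sub[of s s "span_c J" "span_c J"]
  have \<Delta>0: "\<Delta> 0 = 0" using module_hom.zero[OF module_hom_linearI[OF comult_linear]] .
  have \<Delta>: "\<Delta> (x + y) = \<Delta> x + \<Delta> y" "\<Delta> (s a x) = fscale a (\<Delta> x)" for x y a
    using comult_linear by (auto simp: Vector_Spaces.linear_iff)
  show "subspace {x. \<Delta> x \<in> tensor_sub s s (span_c J) (span_c J)}"
    unfolding subspace_def
  proof (intro conjI ballI allI)
    show "0 \<in> {x. \<Delta> x \<in> tensor_sub s s (span_c J) (span_c J)}"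
      unfolding mem_Collect_eq \<Delta>0 by (rule T.subspace_0[OF sub])
    show "x + y \<in> {x. \<Delta> x \<in> tensor_sub s s (span_c J) (span_c J)}"
      if "x \<in> {x. \<Delta> x \<in> tensor_sub s s (span_c J) (span_c J)}"
        "y \<in> {x. \<Delta> x \<in> tensor_sub s s (span_c J) (span_c J)}" for x y
      unfolding mem_Collect_eq \<Delta> using that by (intro T.subspace_add[OF sub]) blast+
    show "s a x \<in> {x. \<Delta> x \<in> tensor_sub s s (span_c J) (span_c J)}"
      if "x \<in> {x. \<Delta> x \<in> tensor_sub s s (span_c J) (span_c J)}" for x a
      unfolding mem_Collect_eq \<Delta> using that by (intro T.subspace_scale[OF sub]) blast
  qed
  show "\<Delta> (c i j) \<in> tensor_sub s s (span_c J) (span_c J)" if "D \<in> J" "i \<in> cs D" "j \<in> cs D" for D i j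
    unfolding comult_c[OF that(2,3)]
    by (intro T.subspace_sum[OF sub] tens_in_tensor_sub c_span_c[OF that(1)] that(2,3))
qed

lemma degree_one_basis:
  assumes J: "closed J" and 1: "\<And>D. D \<in> J \<Longrightarrow> deg D = 1"
  shows "inj_on chi J" "independent (chi ` J)" "span (chi ` J) = span_c J" "card J = size_J J"
proof -
  have dual: "\<exists>\<theta>. functional \<theta> \<and> (\<forall>E\<in>J. \<theta> (chi E) = (if D = E then 1 else 0))" for D
    by (intro exI[of _ "cf D"]) (use functional_cf J_Cl(1)[OF J] in \<open>auto simp: cf_chi\<close>)
  show "inj_on chi J" "independent (chi ` J)" by (rule dual_family_independent[OF J_finite[OF J] dual])+
  show "card J = size_J J" using 1 by (simp add: size_J_def[OF J])
  show "span (chi ` J) = span_c J"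
  proof
    show "span (chi ` J) \<subseteq> span_c J"
      by (rule span_minimal[OF _ subspace_span_c]) (auto intro: chi_span_c)
    show "span_c J \<subseteq> span (chi ` J)"
    proof
      fix x assume "x \<in> span_c J"
      then show "x \<in> span (chi ` J)"
      proof (rule span_c_induct[OF _ J_Cl(2)[OF J] subspace_span])
        fix D i j assume D: "D \<in> J" "i \<in> cs D" "j \<in> cs D"
        obtain l where "cs D = {l}" using 1[OF D(1)] card_1_singletonE unfolding deg_def by metis
        then have "c i j = chi D" using D by (simp add: chi_def)
        then show "c i j \<in> span (chi ` J)" using D(1) by (simp add: span_base)
      qed
    qed
  qed
qed

end

locale biproduct_matrix_basis =
  fd_biproduct sA \<Delta>A \<epsilon>A SA sR act \<rho> \<Delta>R \<epsilon>R SR sH \<Delta>H \<epsilon>H SH smash B +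
  A: matrix_basis sA \<Delta>A \<epsilon>A SA B I cl f c
  for sA :: "'k::{alg_closed_field,field_char_0} \<Rightarrow> 'a::ring_1 \<Rightarrow> 'a" and \<Delta>A \<epsilon>A SA
    and sR :: "'k \<Rightarrow> 'r::ring_1 \<Rightarrow> 'r" and act (infixr \<open>\<cdot>\<close> 80) and \<rho> \<Delta>R \<epsilon>R SR
    and sH :: "'k \<Rightarrow> 'h::ring_1 \<Rightarrow> 'h" and \<Delta>H \<epsilon>H SH
    and smash :: "'r \<Rightarrow> 'a \<Rightarrow> 'h" (infix \<open>\<sharp>\<close> 70) and B
    and I :: "'i set" and cl :: "'i \<Rightarrow> 'j" and f c
begin

text \<open>The components of the coaction in the matrix basis are the operators
  \<open>coev (f i j)\<close>, which compose like matrix units by \<open>coev_f\<close>.\<close>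

lemma coact_expand: "\<rho> r = (\<Sum>i\<in>I. \<Sum>j\<in>{j\<in>I. cl j = cl i}. c i j \<otimes>[sA,sR] coev (f i j) r)"
proof (rule tensor_space_eqI[OF vA vR coact_in])
  interpret T: vector_space "fscale :: 'k \<Rightarrow> ('k, 'a, 'r) tensor \<Rightarrow> _" by (rule vector_space_fscale)
  show "(\<Sum>i\<in>I. \<Sum>j\<in>{j\<in>I. cl j = cl i}. c i j \<otimes>[sA,sR] coev (f i j) r) \<in> tensor_space sA sR"
    by (intro T.subspace_sum[OF subspace_tensor_sub] tens_in_tensor_space)
  fix F assume F: "bilinear_map sA sR (*) F"
  note FD = bilinear_mapD[OF F]
  have fl: "A.functional (\<lambda>m. F m n)" for n using FD by (simp add: A.functional_def)
  have fr: "RV.functional (F m)" for m using FD by (simp add: RV.functional_def)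
  obtain xs where xs: "\<rho> r = (\<Sum>(v, w)\<leftarrow>xs. v \<otimes>[sA,sR] w)"
    by (rule tensor_space_sum_list[OF vA vR coact_in])
  have ev: "sweedler sA sR (\<rho> r) G = (\<Sum>(v, w)\<leftarrow>xs. G v w)" if "bilinear_map sA sR (*) G" for G
    unfolding xs by (rule sweedler_sum_list[OF that])
  have "\<rho> r F = sweedler sA sR (\<rho> r) F" by (rule sweedler_eval[OF F coact_in, symmetric])
  also have "\<dots> = (\<Sum>(m, n)\<leftarrow>xs. F m n)" by (rule ev[OF F])
  also have "\<dots> = (\<Sum>(m, n)\<leftarrow>xs. \<Sum>i\<in>I. \<Sum>j\<in>{j\<in>I. cl j = cl i}. f i j m * F (c i j) n)"
  proof (intro arg_cong[of _ _ sum_list] map_cong refl)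
    have *: "F m n = (\<Sum>i\<in>I. \<Sum>j\<in>{j\<in>I. cl j = cl i}. f i j m * F (c i j) n)" for m n
    proof -
      have "F m n = F (\<Sum>i\<in>I. \<Sum>j\<in>{j\<in>I. cl j = cl i}. sA (f i j m) (c i j)) n"
        by (rule arg_cong[where f = "\<lambda>z. F z n", OF A.c_expand])
      then show ?thesis by (simp only: A.functional_sum[OF fl] FD(3))
    qed
    show "(case x of (m, n) \<Rightarrow> F m n) =
        (case x of (m, n) \<Rightarrow> \<Sum>i\<in>I. \<Sum>j\<in>{j\<in>I. cl j = cl i}. f i j m * F (c i j) n)" for x
      unfolding case_prod_unfold by (rule *)
  qed
  also have "\<dots> = (\<Sum>i\<in>I. \<Sum>j\<in>{j\<in>I. cl j = cl i}. \<Sum>(m, n)\<leftarrow>xs. f i j m * F (c i j) n)"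
  proof -
    have "(\<Sum>x\<leftarrow>xs. \<Sum>i\<in>X. G x i) = (\<Sum>i\<in>X. \<Sum>x\<leftarrow>xs. G x i)" for G :: "'a \<times> 'r \<Rightarrow> 'i \<Rightarrow> 'k" and X
      by (induction xs) (simp_all add: sum.distrib)
    then show ?thesis by (simp add: case_prod_unfold)
  qed
  also have "\<dots> = (\<Sum>i\<in>I. \<Sum>j\<in>{j\<in>I. cl j = cl i}. F (c i j) (coev (f i j) r))"
  proof (intro sum.cong refl)
    fix i j assume "i \<in> I" "j \<in> {j\<in>I. cl j = cl i}"
    then have ff: "A.functional (f i j)" by (auto intro: A.f_functional)
    show "(\<Sum>(m, n)\<leftarrow>xs. f i j m * F (c i j) n) = F (c i j) (coev (f i j) r)"
      unfolding functional_coev[OF ff fr] by (rule ev[OF functional_pair_bilinear[OF ff fr], symmetric])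
  qed
  also have "\<dots> = (\<Sum>i\<in>I. \<Sum>j\<in>{j\<in>I. cl j = cl i}. c i j \<otimes>[sA,sR] coev (f i j) r) F"
    unfolding sum_apply using F by (simp add: tens_def)
  finally show "\<rho> r F = (\<Sum>i\<in>I. \<Sum>j\<in>{j\<in>I. cl j = cl i}. c i j \<otimes>[sA,sR] coev (f i j) r) F" .
qed

lemma coev_zero: "coev (\<lambda>x. 0) r = 0"
proof -
  have "A.functional (\<lambda>x. 0)" by (simp add: A.functional_def)
  from sweedler_mem[OF coact_in coev_bilinear[OF this] R.subspace_single_0, of r]
  show ?thesis by (simp add: coev_def)
qed

lemma coev_f:
  assumes "i \<in> I" "j \<in> I" "k \<in> I" "l \<in> I" "cl i = cl j" "cl k = cl l"
  shows "coev (f k l) (coev (f i j) r) = (if j = k then coev (f i l) r else 0)"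
proof -
  have "A.conv (f i j) (f k l) = (if j = k then f i l else (\<lambda>x. 0))"
    by (rule ext) (simp add: A.f_conv[OF assms])
  then show ?thesis
    unfolding coev_coev[OF A.f_functional[OF assms(3,4)] A.f_functional[OF assms(1,2)]]
    by (simp add: coev_zero)
qed

text \<open>A nonzero component of \<open>V\<close> of degree \<open>p\<close> would place \<open>p\<close> independent vectors in the
  proper subspace of \<open>V\<close> where the counit vanishes.\<close>

lemma coideal_component_zero:
  assumes V: "left_coideal sH \<Delta>H ((\<lambda>r. r \<sharp> 1) ` V)" and dim: "R.dim V = p" "p > 0"
    and i: "i \<in> I" "cl i \<noteq> A.one_class" "A.deg (cl i) = p" and v: "v \<in> V"
  shows "coev (f i i) v = 0"
proof (rule ccontr)
  let ?u = "coev (f i i) v" and ?D = "A.cs (cl i)" and ?w = "\<lambda>j. coev (f i j) v"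
  assume u: "?u \<noteq> 0"
  have D: "j \<in> I" "cl j = cl i" if "j \<in> ?D" for j using that by (auto simp: A.cs_def)
  obtain \<phi> where \<phi>: "RV.functional \<phi>" "\<phi> ?u \<noteq> \<phi> 0" using RV.functional_separate[of ?u 0] u by blast
  have \<phi>u: "\<phi> ?u \<noteq> 0" using \<phi>(2) unfolding RV.functional_0[OF \<phi>(1)] .
  \<comment> \<open>Applying \<open>f k i\<close> to the row entry \<open>?w j\<close> returns
    \<open>?u\<close> if \<open>j = k\<close> and zero otherwise; a functional nonzero at
    \<open>?u\<close>, rescaled, is therefore dual to the row.\<close>
  have dual: "\<exists>\<theta>. RV.functional \<theta> \<and> (\<forall>j\<in>?D. \<theta> (?w j) = (if k = j then 1 else 0))" if k: "k \<in> ?D" for k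
  proof (intro exI[of _ "\<lambda>x. \<phi> (coev (f k i) x) / \<phi> ?u"] conjI ballI)
    have "RV.functional (\<lambda>x. \<phi> (coev (f k i) x))"
      by (intro RV.functional_comp[OF \<phi>(1)] operator_coev A.f_functional D(1)[OF k] i(1))
    then show "RV.functional (\<lambda>x. \<phi> (coev (f k i) x) / \<phi> ?u)"
      by (simp add: RV.functional_def add_divide_distrib)
    fix j assume j: "j \<in> ?D"
    show "\<phi> (coev (f k i) (?w j)) / \<phi> ?u = (if k = j then 1 else 0)"
      unfolding coev_f[OF i(1) D(1)[OF j] D(1)[OF k] i(1) D(2)[OF j, symmetric] D(2)[OF k]]
      using \<phi>u RV.functional_0[OF \<phi>(1)] by auto
  qed
  note ind = RV.dual_family_independent[OF A.cs_finite dual]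
  have card: "card (?w ` ?D) = p" using card_image[OF ind(1)] i(3) by (simp add: A.deg_def)
  have wV: "?w ` ?D \<subseteq> V"
    using coideal_coev[OF V A.f_functional[OF i(1)] v] D(1) by auto
  \<comment> \<open>\<open>coev (f i j)\<close> multiplies the counit by \<open>f i j 1\<close>,
    which is zero because \<open>1\<close> is the character of a different class.\<close>
  have w0: "\<epsilon>R x = 0" if x: "x \<in> ?w ` ?D" for x
  proof -
    obtain j where j: "j \<in> ?D" "x = ?w j" using x by blast
    have "f i j (A.chi A.one_class) = 0"
      using A.f_chi[OF A.cl_Cl(2)[OF i(1)] j(1), of A.one_class] i(2) by auto
    then show ?thesis
      unfolding j(2) by (simp add: counitR_coev[OF A.f_functional[OF i(1) D(1)[OF j(1)]]] A.one_class)
  qed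
  obtain C where C: "C \<subseteq> V" "R.independent C" "V \<subseteq> R.span C" "card C = p"
    using R.basis_exists[of V] dim(1) by metis
  have finC: "finite C" using C(4) dim(2) by (metis card.infinite less_irrefl)
  \<comment> \<open>The \<open>p\<close> independent row entries already span \<open>V\<close>, so
    the counit would vanish on all of \<open>V\<close>, against
    \<open>coideal_counit\<close>.\<close>
  have "V \<subseteq> R.span (?w ` ?D)"
  proof (rule ccontr)
    assume "\<not> ?thesis"
    then obtain x where x: "x \<in> V" "x \<notin> R.span (?w ` ?D)" by blast
    have "R.independent (insert x (?w ` ?D))" using ind(2) x(2) by (rule R.independent_insertI[rotated])
    moreover have "insert x (?w ` ?D) \<subseteq> R.span C" using wV x(1) C(3) by blast
    ultimately have "card (insert x (?w ` ?D)) \<le> card C" using R.independent_span_bound[OF finC] by blast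
    moreover have "x \<notin> ?w ` ?D"
    proof
      assume "x \<in> ?w ` ?D"
      then have "x \<in> R.span (?w ` ?D)" by (rule R.span_base)
      with x(2) show False by contradiction
    qed
    then have "card (insert x (?w ` ?D)) = Suc p"
      using card_insert_disjoint[OF finite_imageI[OF A.cs_finite, of ?w], of x "cl i"] unfolding card by blast
    ultimately show False unfolding C(4) by simp
  qed
  then have ker: "\<epsilon>R x = 0" if "x \<in> V" for x
  proof -
    have sub: "R.subspace {x. \<epsilon>R x = 0}"
      using RV.functional_0[OF functional_counitR] by (auto simp: R.subspace_def counitR_simps)
    have "?w ` ?D \<subseteq> {x. \<epsilon>R x = 0}" using w0 by blast
    then have "R.span (?w ` ?D) \<subseteq> {x. \<epsilon>R x = 0}" using sub by (rule R.span_minimal)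
    then show ?thesis using \<open>V \<subseteq> R.span (?w ` ?D)\<close> that by blast
  qed
  have "?u \<in> V" by (rule coideal_coev[OF V A.f_functional[OF i(1,1)] v])
  then show False using coideal_counit[OF V ker] u by blast
qed

context
  fixes J
  assumes J: "A.closed J"
begin

text \<open>Every component factors as \<open>coev (f i j)\<close> after
  \<open>coev (f i i)\<close>, so the vanishing of diagonal components suffices.\<close>

lemma coact_in_J:
  assumes "\<And>i. i \<in> I \<Longrightarrow> cl i \<notin> J \<Longrightarrow> coev (f i i) r = 0"
  shows "\<rho> r \<in> tensor_sub sA sR (A.span_c J) UNIV"
proof -
  interpret T: vector_space "fscale :: 'k \<Rightarrow> ('k, 'a, 'r) tensor \<Rightarrow> _" by (rule vector_space_fscale)
  note sub = subspace_tensor_sub[of sA sR "A.span_c J" UNIV]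
  have "c i j \<otimes>[sA,sR] coev (f i j) r \<in> tensor_sub sA sR (A.span_c J) UNIV"
    if ij: "i \<in> I" "j \<in> {j \<in> I. cl j = cl i}" for i j
  proof (cases "cl i \<in> J")
    case True
    then show ?thesis
      by (intro tens_in_tensor_sub A.c_span_c[OF True]) (use ij in \<open>auto simp: A.cs_def\<close>)
  next
    case False
    have j: "j \<in> I" "cl i = cl j" using ij(2) by auto
    have "coev (f i j) r = coev (f i j) (coev (f i i) r)"
      using coev_f[OF ij(1,1,1) j(1) refl j(2)] by simp
    also have "\<dots> = 0"
      using RV.operator_0[OF operator_coev[OF A.f_functional[OF ij(1) j(1)]]] assms[OF ij(1) False] by simp
    finally have "c i j \<otimes>[sA,sR] coev (f i j) r = c i j \<otimes>[sA,sR] sR 0 0" by simp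
    also have "\<dots> = fscale 0 (c i j \<otimes>[sA,sR] 0)"
      by (rule bilinear_mapD(4)[OF bilinear_map_tens[OF vA vR]])
    also have "\<dots> \<in> tensor_sub sA sR (A.span_c J) UNIV"
      unfolding T.scale_zero_left by (rule T.subspace_0[OF sub])
    finally show ?thesis .
  qed
  then show ?thesis by (subst coact_expand) (intro T.subspace_sum[OF sub])
qed

lemmas span_J = A.span_c_mult[OF J] A.one_span_c[OF J] A.span_c_antipode[OF J] A.comult_span_c[OF A.J_Cl(2)[OF J]]

lemma coact_J_subalgebra: "subalgebra sR {r. \<rho> r \<in> tensor_sub sA sR (A.span_c J) UNIV}"
proof -
  interpret T: vector_space "fscale :: 'k \<Rightarrow> ('k, 'a, 'r) tensor \<Rightarrow> _" by (rule vector_space_fscale)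
  let ?T = "tensor_sub sA sR (A.span_c J) UNIV"
  note sub = subspace_tensor_sub[of sA sR "A.span_c J" UNIV]
  note tt = bilinear_mapD[OF bilinear_map_tens[OF vA vR]]
  have \<rho>0: "\<rho> 0 = 0" using module_hom.zero[OF module_hom_linearI[OF coact_linear]] .
  have \<rho>: "\<rho> (x + y) = \<rho> x + \<rho> y" "\<rho> (sR a x) = fscale a (\<rho> x)" for x y a
    using coact_linear by (auto simp: Vector_Spaces.linear_iff)
  have b1: "bilinear_map sA sR fscale (\<lambda>n y0. (m * n) \<otimes>[sA,sR] (x0 * y0))" for m x0
    by (intro bilinear_mapI vA vR vector_space_fscale)
      (simp_all add: tt distrib_left A.scale_mult_right R.scale_mult_right)
  have b2: "bilinear_map sA sR fscale (\<lambda>m x0. sweedler sA sR (\<rho> y) (\<lambda>n y0. (m * n) \<otimes>[sA,sR] (x0 * y0)))" for y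
    unfolding bilinear_map_def
    by (intro conjI allI sweedler_linear_parameter[OF coact_in b1])
      (auto simp: Vector_Spaces.linear_iff vA vR vector_space_fscale tt distrib_right A.scale_mult_left R.scale_mult_left)
  show ?thesis
    unfolding subalgebra_def R.subspace_def mem_Collect_eq
  proof (intro conjI ballI allI)
    show "\<rho> 0 \<in> ?T" unfolding \<rho>0 by (rule T.subspace_0[OF sub])
    show "\<rho> (x + y) \<in> ?T" if "x \<in> {r. \<rho> r \<in> ?T}" "y \<in> {r. \<rho> r \<in> ?T}" for x y
      unfolding \<rho> using that by (intro T.subspace_add[OF sub]) blast+
    show "\<rho> (sR a x) \<in> ?T" if "x \<in> {r. \<rho> r \<in> ?T}" for a x
      unfolding \<rho> using that by (intro T.subspace_scale[OF sub]) blast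
    show "\<rho> 1 \<in> ?T" unfolding coact_unit by (intro tens_in_tensor_sub span_J UNIV_I)
    show "\<rho> (x * y) \<in> ?T" if x: "x \<in> {r. \<rho> r \<in> ?T}" and y: "y \<in> {r. \<rho> r \<in> ?T}" for x y
      unfolding coact_mult
      by (rule sweedler_mem[OF _ b2 sub], (use x in blast)[1], rule sweedler_mem[OF _ b1 sub], (use y in blast)[1])
        (intro tens_in_tensor_sub span_J UNIV_I)
  qed
qed

text \<open>The Yetter-Drinfeld condition replaces \<open>m\<close> by
  \<open>h1 * m * SA h3\<close>, which stays in the Hopf subalgebra \<open>span_c J\<close>.\<close>

lemma coact_J_act:
  assumes h: "h \<in> A.span_c J" and r: "\<rho> r \<in> tensor_sub sA sR (A.span_c J) UNIV"
  shows "\<rho> (h \<cdot> r) \<in> tensor_sub sA sR (A.span_c J) UNIV"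
proof -
  note sub = subspace_tensor_sub[of sA sR "A.span_c J" UNIV]
  note tt = bilinear_mapD[OF bilinear_map_tens[OF vA vR]]
  note simps = tt distrib_left distrib_right A.scale_mult_left A.scale_mult_right act_simps
    A.antipode_add A.antipode_scale
  have b1: "bilinear_map sA sR fscale (\<lambda>m n. (h1 * m * SA h3) \<otimes>[sA,sR] (h2 \<cdot> n))" for h1 h2 h3
    by (intro bilinear_mapI vA vR vector_space_fscale) (simp_all add: simps)
  have b2: "bilinear_map sA sA fscale (\<lambda>h2 h3. sweedler sA sR (\<rho> r) (\<lambda>m n. (h1 * m * SA h3) \<otimes>[sA,sR] (h2 \<cdot> n)))" for h1
    unfolding bilinear_map_def
    by (intro conjI allI sweedler_linear_parameter[OF coact_in b1])
      (auto simp: Vector_Spaces.linear_iff vA vector_space_fscale simps)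
  have b3: "bilinear_map sA sA fscale (\<lambda>h1 h'. sweedler sA sA (\<Delta>A h') (\<lambda>h2 h3.
      sweedler sA sR (\<rho> r) (\<lambda>m n. (h1 * m * SA h3) \<otimes>[sA,sR] (h2 \<cdot> n))))"
    unfolding bilinear_map_def
    by (intro conjI allI sweedler_linear_parameter[OF A.comult_in b2] sweedler_linear_parameter[OF coact_in b1]
        sweedler_linear[OF A.comult_linear A.comult_in b2])
      (auto simp: Vector_Spaces.linear_iff vA vector_space_fscale simps)
  show ?thesis
    unfolding coact_act
    by (rule sweedler_mem[OF span_J(4)[OF h] b3 sub], rule sweedler_mem[OF span_J(4) b2 sub], assumption,
        rule sweedler_mem[OF r b1 sub]) (intro tens_in_tensor_sub span_J(1-3) UNIV_I)
qed

definition subK :: "'h set" where "subK = H.span {r \<sharp> g | r g. g \<in> A.span_c J}"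

lemma smash_subK: "g \<in> A.span_c J \<Longrightarrow> r \<sharp> g \<in> subK"
  unfolding subK_def by (intro H.span_base) blast

lemma subspace_subK: "H.subspace subK"
  unfolding subK_def by (rule H.subspace_span)

lemma subK_induct:
  assumes "x \<in> subK" "H.subspace W" "\<And>r g. g \<in> A.span_c J \<Longrightarrow> r \<sharp> g \<in> W"
  shows "x \<in> W"
  using assms(1) unfolding subK_def by (rule H.span_induct[of _ _ "\<lambda>x. x \<in> W", simplified]) (use assms(2,3) in auto)

lemma subK_subalgebra: "subalgebra sH subK"
  unfolding subalgebra_def
proof (intro conjI ballI subspace_subK)
  show "1 \<in> subK" unfolding smash_one by (intro smash_subK span_J)
  fix x y assume x: "x \<in> subK" and y: "y \<in> subK"
  have "x \<in> {x. x * y \<in> subK}"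
  proof (rule subK_induct[OF x])
    show "H.subspace {x. x * y \<in> subK}"
      using subspace_subK by (simp add: H.subspace_def distrib_right H.scale_mult_left)
    fix r g assume g: "g \<in> A.span_c J"
    have "y \<in> {y. (r \<sharp> g) * y \<in> subK}"
    proof (rule subK_induct[OF y])
      show "H.subspace {y. (r \<sharp> g) * y \<in> subK}"
        using subspace_subK by (simp add: H.subspace_def distrib_left H.scale_mult_right)
      fix b h assume h: "h \<in> A.span_c J"
      have bl: "bilinear_map sA sA sH (\<lambda>g1 g2. (r * (g1 \<cdot> b)) \<sharp> (g2 * h))"
        by (intro bilinear_mapI vA vH)
          (simp_all add: smash_simps act_simps distrib_left distrib_right A.scale_mult_left R.scale_mult_right)
      have "(r \<sharp> g) * (b \<sharp> h) \<in> subK"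
        unfolding smash_mult
        by (rule sweedler_mem[OF span_J(4)[OF g] bl subspace_subK]) (intro smash_subK span_J(1) h)
      then show "b \<sharp> h \<in> {y. (r \<sharp> g) * y \<in> subK}" by simp
    qed
    then show "r \<sharp> g \<in> {x. x * y \<in> subK}" by simp
  qed
  then show "x * y \<in> subK" by simp
qed

text \<open>The left leg of the coproduct is multiplied by the \<open>A\<close>-part of the
  coaction; \<open>coact\<close> is what keeps that leg in \<open>subK\<close>.\<close>

lemma subK_comult:
  assumes coact: "\<And>r. \<rho> r \<in> tensor_sub sA sR (A.span_c J) UNIV" and x: "x \<in> subK"
  shows "\<Delta>H x \<in> tensor_sub sH sH subK subK"
proof -
  interpret T: vector_space "fscale :: 'k \<Rightarrow> ('k, 'h, 'h) tensor \<Rightarrow> _" by (rule vector_space_fscale)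
  let ?T = "tensor_sub sH sH subK subK"
  note sub = subspace_tensor_sub[of sH sH subK subK]
  note tt = bilinear_mapD[OF bilinear_map_tens[OF vH vH]]
  note simps = tt smash_simps distrib_left distrib_right A.scale_mult_left A.scale_mult_right
  have \<Delta>0: "\<Delta>H 0 = 0" using module_hom.zero[OF module_hom_linearI[OF H.comult_linear]] .
  have \<Delta>: "\<Delta>H (x + y) = \<Delta>H x + \<Delta>H y" "\<Delta>H (sH a x) = fscale a (\<Delta>H x)" for x y a
    using H.comult_linear by (auto simp: Vector_Spaces.linear_iff)
  have b1: "bilinear_map sA sR fscale (\<lambda>m n. (a1 \<sharp> (m * g1)) \<otimes>[sH,sH] (n \<sharp> g2))" for a1 g1 g2
    by (intro bilinear_mapI vA vR vector_space_fscale) (simp_all add: simps)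
  have b2: "bilinear_map sA sA fscale (\<lambda>g1 g2. sweedler sA sR (\<rho> a2) (\<lambda>m n. (a1 \<sharp> (m * g1)) \<otimes>[sH,sH] (n \<sharp> g2)))" for a1 a2
    unfolding bilinear_map_def
    by (intro conjI allI sweedler_linear_parameter[OF coact_in b1])
      (auto simp: Vector_Spaces.linear_iff vA vector_space_fscale simps)
  have b3: "bilinear_map sR sR fscale (\<lambda>a1 a2. sweedler sA sA (\<Delta>A g) (\<lambda>g1 g2.
      sweedler sA sR (\<rho> a2) (\<lambda>m n. (a1 \<sharp> (m * g1)) \<otimes>[sH,sH] (n \<sharp> g2))))" for g
    unfolding bilinear_map_def
    by (intro conjI allI sweedler_linear_parameter[OF A.comult_in b2] sweedler_linear_parameter[OF coact_in b1]
        sweedler_linear[OF coact_linear coact_in b1])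
      (auto simp: Vector_Spaces.linear_iff vR vector_space_fscale simps)
  have "x \<in> {x. \<Delta>H x \<in> ?T}"
  proof (rule subK_induct[OF x])
    show "H.subspace {x. \<Delta>H x \<in> ?T}"
      unfolding H.subspace_def mem_Collect_eq
    proof (intro conjI ballI allI)
      show "\<Delta>H 0 \<in> ?T" unfolding \<Delta>0 by (rule T.subspace_0[OF sub])
      show "\<Delta>H (x + y) \<in> ?T" if "x \<in> {x. \<Delta>H x \<in> ?T}" "y \<in> {x. \<Delta>H x \<in> ?T}" for x y
        unfolding \<Delta> using that by (intro T.subspace_add[OF sub]) blast+
      show "\<Delta>H (sH a x) \<in> ?T" if "x \<in> {x. \<Delta>H x \<in> ?T}" for a x
        unfolding \<Delta> using that by (intro T.subspace_scale[OF sub]) blast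
    qed
    fix r g assume g: "g \<in> A.span_c J"
    have "\<Delta>H (r \<sharp> g) \<in> ?T"
      unfolding smash_comult
      by (rule sweedler_mem[OF R.comult_in b3 sub], rule sweedler_mem[OF span_J(4)[OF g] b2 sub],
          rule sweedler_mem[OF coact b1 sub]) (intro tens_in_tensor_sub smash_subK span_J(1))
    then show "r \<sharp> g \<in> {x. \<Delta>H x \<in> ?T}" by simp
  qed
  then show ?thesis by simp
qed

end

text \<open>Products of coordinate functionals extend to \<open>H\<close> by
  \<open>smash_lift\<close> and are dual to the products of basis vectors.\<close>

lemma smash_independent:
  assumes X: "finite X" "R.independent X" and Y: "finite Y" "A.independent Y"
  shows "inj_on (\<lambda>(x, y). x \<sharp> y) (X \<times> Y)" "H.independent ((\<lambda>(x, y). x \<sharp> y) ` (X \<times> Y))"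
proof -
  note dX = RV.dual_system_basis[OF X(2,1)] and dY = A.dual_system_basis[OF Y(2,1)]
  have dual: "\<exists>\<theta>. HV.functional \<theta> \<and> (\<forall>w\<in>X \<times> Y. \<theta> ((\<lambda>(x, y). x \<sharp> y) w) = (if z = w then 1 else 0))"
    if z: "z \<in> X \<times> Y" for z
  proof -
    obtain x0 y0 where z: "z = (x0, y0)" "x0 \<in> X" "y0 \<in> Y" using z by auto
    define \<phi> where "\<phi> r = R.representation (R.extend_basis X) r x0" for r
    define \<psi> where "\<psi> a = A.representation (A.extend_basis Y) a y0" for a
    have \<phi>: "RV.functional \<phi>" "\<And>x. x \<in> X \<Longrightarrow> \<phi> x = (if x0 = x then 1 else 0)"
      using dX z(2) unfolding RV.dual_system_def \<phi>_def by auto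
    have \<psi>: "A.functional \<psi>" "\<And>y. y \<in> Y \<Longrightarrow> \<psi> y = (if y0 = y then 1 else 0)"
      using dY z(3) unfolding A.dual_system_def \<psi>_def by auto
    have b: "bilinear_map sR sA (*) (\<lambda>r a. \<phi> r * \<psi> a)"
      by (intro bilinear_mapI vA vR vector_space_mult)
        (simp_all add: A.functional_add[OF \<psi>(1)] A.functional_scale[OF \<psi>(1)]
          RV.functional_add[OF \<phi>(1)] RV.functional_scale[OF \<phi>(1)] algebra_simps)
    obtain \<theta> where \<theta>: "Vector_Spaces.linear sH (*) \<theta>" "\<And>r a. \<theta> (r \<sharp> a) = \<phi> r * \<psi> a"
      by (rule smash_lift[OF b]) (rule that)
    show ?thesis
      by (intro exI[of _ \<theta>] conjI ballI)
        (use \<theta> z in \<open>auto simp: HV.functional_iff \<phi>(2) \<psi>(2) split: if_splits\<close>)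
  qed
  show "inj_on (\<lambda>(x, y). x \<sharp> y) (X \<times> Y)" "H.independent ((\<lambda>(x, y). x \<sharp> y) ` (X \<times> Y))"
    by (rule HV.dual_family_independent[OF _ dual]; use X Y in simp)+
qed

lemma smash_in_span:
  assumes r: "r \<in> R.span X" and a: "a \<in> A.span Y"
  shows "r \<sharp> a \<in> H.span ((\<lambda>(x, y). x \<sharp> y) ` (X \<times> Y))"
proof (rule H.linear_image_span[OF _ r])
  show "Vector_Spaces.linear sR sH (\<lambda>r. r \<sharp> a)"
    by (simp add: Vector_Spaces.linear_iff vR vH smash_simps)
  show "(\<lambda>r. r \<sharp> a) ` X \<subseteq> H.span ((\<lambda>(x, y). x \<sharp> y) ` (X \<times> Y))"
  proof (intro image_subsetI)
    fix x assume x: "x \<in> X"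
    show "x \<sharp> a \<in> H.span ((\<lambda>(x, y). x \<sharp> y) ` (X \<times> Y))"
    proof (rule H.linear_image_span[OF _ a])
      show "Vector_Spaces.linear sA sH (\<lambda>a. x \<sharp> a)"
        by (simp add: Vector_Spaces.linear_iff vA vH smash_simps)
      show "(\<lambda>a. x \<sharp> a) ` Y \<subseteq> H.span ((\<lambda>(x, y). x \<sharp> y) ` (X \<times> Y))"
        using x by (auto intro!: H.span_base)
    qed
  qed
qed

text \<open>Applied to \<open>B\<close> this gives the dimension of \<open>H\<close>, applied to the
  characters of degree one that of \<open>subK\<close>.\<close>

lemma dim_smash:
  assumes X: "finite X" "R.independent X" "R.span X = UNIV" and Y: "finite Y" "A.independent Y"
  shows "H.dim (H.span {r \<sharp> a | r a. a \<in> A.span Y}) = card X * card Y"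
proof -
  note ind = smash_independent[OF X(1,2) Y]
  have "H.span ((\<lambda>(x, y). x \<sharp> y) ` (X \<times> Y)) = H.span (H.span {r \<sharp> a | r a. a \<in> A.span Y})"
    unfolding H.span_span
  proof (rule H.span_eq[THEN iffD2], intro conjI)
    show "(\<lambda>(x, y). x \<sharp> y) ` (X \<times> Y) \<subseteq> H.span {r \<sharp> a | r a. a \<in> A.span Y}"
      by (auto intro!: H.span_base) (use A.span_base in blast)
    show "{r \<sharp> a | r a. a \<in> A.span Y} \<subseteq> H.span ((\<lambda>(x, y). x \<sharp> y) ` (X \<times> Y))"
      using smash_in_span[of _ X _ Y] X(3) by auto
  qed
  from H.dim_eq_card[OF this ind(2)] show ?thesis
    by (simp add: card_image[OF ind(1)] card_cartesian_product)
qed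

theorem hopf_subalgebra_index:
  assumes p: "prime p" "card B = p ^ 3" and nc: "\<not> cocommutative sA \<Delta>A" and ss: "semisimple_algebra sR"
    and V: "left_coideal sH \<Delta>H ((\<lambda>r. r \<sharp> 1) ` V)" "R.dim V = p"
    and gen: "generates_algebra sR (R.span (\<Union>g\<in>group_likes sA \<Delta>A. act g ` V))"
  shows "\<exists>K. hopf_subalgebra sH \<Delta>H SH K \<and> hopf_index sH K = of_nat p"
proof -
  obtain J where J: "A.closed J" "A.size_J J = p ^ 2"
    and d1: "\<And>D. D \<in> J \<Longrightarrow> A.deg D = 1" and dp: "\<And>D. D \<in> A.Cl - J \<Longrightarrow> A.deg D = p"
    by (rule A.prime_cube_structure[OF p nc]) (rule that)
  have p1: "p > 1" using p(1) by (rule prime_gt_1_nat)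
  let ?R = "{r. \<rho> r \<in> tensor_sub sA sR (A.span_c J) UNIV}"
  have "V \<subseteq> ?R"
  proof
    fix v assume v: "v \<in> V"
    have "coev (f i i) v = 0" if i: "i \<in> I" "cl i \<notin> J" for i
      by (rule coideal_component_zero[OF V _ i(1) _ _ v])
        (use i p1 dp A.cl_Cl(1)[OF i(1)] A.closedD(2)[OF J(1)] in auto)
    then show "v \<in> ?R" using coact_in_J[OF J(1), of v] by blast
  qed
  \<comment> \<open>Outside \<open>J\<close> the degree is \<open>p > 1\<close>, so the classes of
    group-like elements belong to \<open>J\<close>.\<close>
  moreover have "g \<in> A.span_c J" if g: "g \<in> group_likes sA \<Delta>A" for g
  proof -
    obtain D where D: "D \<in> A.Cl" "A.deg D = 1" "g = A.chi D" using A.group_likes_chi[OF g] by blast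
    have "D \<in> J" using dp[of D] D p1 by fastforce
    then show ?thesis unfolding D(3) by (rule A.chi_span_c)
  qed
  ultimately have "(\<Union>g\<in>group_likes sA \<Delta>A. act g ` V) \<subseteq> ?R"
    using coact_J_act[OF J(1)] by blast
  then have "R.span (\<Union>g\<in>group_likes sA \<Delta>A. act g ` V) \<subseteq> ?R"
    by (rule R.span_minimal) (use coact_J_subalgebra[OF J(1)] in \<open>simp add: subalgebra_def\<close>)
  then have "subalgebra sR hull (R.span (\<Union>g\<in>group_likes sA \<Delta>A. act g ` V)) \<subseteq> ?R"
    by (rule hull_minimal) (rule coact_J_subalgebra[OF J(1)])
  then have coact: "\<rho> r \<in> tensor_sub sA sR (A.span_c J) UNIV" for r
    using gen unfolding generates_algebra_def by blast
  let ?K = "subK J"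
  obtain C where C: "finite C" "H.independent C" "H.span C = UNIV"
    by (rule finite_dimensional[OF ss]) (rule that)
  interpret HF: fd_hopf sH \<Delta>H \<epsilon>H SH C
    by unfold_locales (use C in auto)
  have K: "hopf_subalgebra sH \<Delta>H SH ?K"
    by (rule HF.subbialgebra_hopf_subalgebra[OF subK_subalgebra[OF J(1)] subK_comult[OF J(1) coact]])
  obtain X where X: "R.independent X" "UNIV \<subseteq> R.span X" by (rule R.maximal_independent_subset[of UNIV])
  have spX: "R.span X = UNIV" using X(2) by blast
  \<comment> \<open>\<open>R\<close> is the image of the finite-dimensional \<open>H\<close> under
    \<open>proj\<close>.\<close>
  have finX: "finite X"
  proof -
    have "R.span (proj ` C) = UNIV"
    proof -
      have "proj h \<in> R.span (proj ` C)" for h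
        by (rule R.linear_image_span[OF linear_proj, of h C]) (use C(3) R.span_base in auto)
      then show ?thesis using proj_smash_1 by (metis UNIV_eq_I)
    qed
    then show ?thesis
      using R.independent_span_bound[OF finite_imageI[OF C(1)] X(1), of proj] by simp
  qed
  have X0: "card X > 0"
  proof (rule ccontr)
    assume "\<not> ?thesis"
    then have "X = {}" using finX by simp
    then have "(1 :: 'r) \<in> {0}" using spX by (simp add: R.span_empty)
    then show False by simp
  qed
  have dimH: "H.dim UNIV = card X * p ^ 3"
  proof -
    have "H.span {r \<sharp> a | r a. a \<in> A.span B} = UNIV" using smash_spans by (auto simp: A.B_span)
    then show ?thesis using dim_smash[OF finX X(1) spX A.B_finite A.B_indep] p(2) by simp
  qed
  have dimK: "H.dim ?K = card X * p ^ 2"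
  proof -
    note b = A.degree_one_basis[OF J(1) d1]
    have "finite (A.chi ` J)" using A.J_finite[OF J(1)] by simp
    from dim_smash[OF finX X(1) spX this b(2)] show ?thesis
      by (simp add: subK_def[OF J(1)] b(3) card_image[OF b(1)] b(4) J(2))
  qed
  have "hopf_index sH ?K = of_nat p"
    using X0 p1 by (simp add: hopf_index_def dimH dimK power2_eq_square power3_eq_cube)
  then show ?thesis using K by blast
qed

end

theorem corollary4p3p4:
  fixes p :: nat
    and sA :: "'k::{alg_closed_field, field_char_0} \<Rightarrow> 'a::ring_1 \<Rightarrow> 'a"
    and sR :: "'k \<Rightarrow> 'r::ring_1 \<Rightarrow> 'r"
    and sH :: "'k \<Rightarrow> 'h::ring_1 \<Rightarrow> 'h"
    and smash :: "'r \<Rightarrow> 'a \<Rightarrow> 'h"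
    and V :: "'r set"
  assumes "prime p"
    and "biproduct sA \<Delta>A \<epsilon>A SA sR act \<rho> \<Delta>R \<epsilon>R SR sH \<Delta>H \<epsilon>H SH smash"
    and "\<not> cocommutative sA \<Delta>A"
    and "semisimple_algebra sA"
    and "vector_space.dim sA UNIV = p ^ 3"
    and "semisimple_algebra sR"
    and "irreducible_left_coideal sH \<Delta>H ((\<lambda>r. smash r 1) ` V)"
    and "vector_space.dim sR V = p"
    and "generates_algebra sR (module.span sR (\<Union>g\<in>group_likes sA \<Delta>A. act g ` V))"
  shows "\<exists>K. hopf_subalgebra sH \<Delta>H SH K \<and> hopf_index sH K = of_nat p"
proof -
  interpret biproduct sA \<Delta>A \<epsilon>A SA sR act \<rho> \<Delta>R \<epsilon>R SR sH \<Delta>H \<epsilon>H SH smash by fact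
  obtain B where B: "A.independent B" "UNIV \<subseteq> A.span B" "card B = p ^ 3"
    using A.basis_exists[of UNIV] assms(5) by metis
  \<comment> \<open>\<open>card\<close> is \<open>0\<close> on infinite sets, so the positive value
    \<open>p ^ 3\<close> gives finiteness.\<close>
  have finB: "finite B" using B(3) prime_gt_0_nat[OF assms(1)] by (intro card_ge_0_finite) simp
  interpret A: ss_hopf sA \<Delta>A \<epsilon>A SA B
    by unfold_locales (use B finB assms(4) in auto)
  obtain I :: "('a \<Rightarrow> 'a) set" and cl :: "('a \<Rightarrow> 'a) \<Rightarrow> ('a \<Rightarrow> 'a)" and f c
    where "matrix_basis sA \<Delta>A \<epsilon>A SA B I cl f c"
    using A.matrix_basis_exists by blast
  then interpret A: matrix_basis sA \<Delta>A \<epsilon>A SA B I cl f c .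
  interpret biproduct_matrix_basis sA \<Delta>A \<epsilon>A SA sR act \<rho> \<Delta>R \<epsilon>R SR sH \<Delta>H \<epsilon>H SH smash B I cl f c
    by unfold_locales
  have "left_coideal sH \<Delta>H ((\<lambda>r. smash r 1) ` V)"
    using assms(7) by (simp add: irreducible_left_coideal_def)
  from hopf_subalgebra_index[OF assms(1) B(3) assms(3,6) this assms(8,9)] show ?thesis .
qed

end
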